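(* Let $p(\cdot):G\to[1,\infty)$ be a measurable function with $1<p_-\le p_+<\infty$. Then the following statements are equivalent: (i) $p(\cdot)\in\mathcal{A}(G)$; (ii) there is a constant $C$, depending only on $p(\cdot)$, such that for every $f\in L^{p(\cdot)}(G)$ the partial sums $S_nf$ of the Vilenkin-Fourier series of $f$ satisfy $$\sup_{n\in\mathbb{N}}\|S_nf\|_{p(\cdot)}\le C\|f\|_{p(\cdot)};$$ (iii) for every $f\in L^{p(\cdot)}(G)$, the partial sums $S_nf$ of the Vilenkin-Fourier series of $f$ converge to $f$ in $L^{p(\cdot)}(G)$, i.e. $\lim_{n\to\infty}\|S_nf-f\|_{p(\cdot)}=0$.
   Context: Group. Let $\{p_i\}_{i\ge0}$ be a sequence of integers with $p_i\ge2$ (no boundedness is assumed), $G=\prod_{i=0}^\infty\mathbb{Z}_{p_i}$ the direct product of cyclic groups of order $p_i$, and $\mu$ the Haar measure on $G$ normalized by $\mu(G)=1$. Elements of $G$ are sequences $x=\{x_i\}$ with $0\le x_i<p_i$; addition is coordinatewise modulo $p_i$. Put $m_0=1$, $m_k=\prod_{i=0}^{k-1}p_i$. Vilenkin system. $\phi_k(x)=\exp(2\pi i x_k/p_k)$ for $k\ge0$. Each integer $n\ge0$ is written uniquely as a finite sum $n=\sum_{k\ge0}\alpha_km_k$ with $0\le\alpha_k<p_k$, and $\psi_n=\prod_{k\ge0}\phi_k^{\alpha_k}$. The $\psi_n$ are the characters of $G$ and form a complete orthonormal system. For $f\in L^1(G)$, $S_nf=\sum_{j=0}^{n-1}\left(\int_Gf\,\overline{\psi_j}\,d\mu\right)\psi_j$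 is the $n$th partial sum of the Vilenkin-Fourier series of $f$. Generalized intervals. $\mathcal{F}$ is the collection of all sets of the form $x+\{y\in G: y_i=0 \text{ for } i<k,\ 0\le y_k<j\}$ with $x\in G$, $k\ge0$, $1\le j\le p_k$. Variable Lebesgue space. For measurable $p(\cdot):G\to[1,\infty)$, $L^{p(\cdot)}(G)$ is the set of measurable $f$ such that $\int_G(|f(x)|/\lambda)^{p(x)}d\mu<\infty$ for some $\lambda>0$, with norm $\|f\|_{p(\cdot)}=\inf\{\lambda>0:\int_G(|f(x)|/\lambda)^{p(x)}d\mu\le1\}$ (and $L^{p(\cdot)}(G)\subset L^1(G)$). Write $p_-=\operatorname{ess\,inf}_{x\in G}p(x)$, $p_+=\operatorname{ess\,sup}_{x\in G}p(x)$, and let $p'(\cdot)$ be the conjugate exponent, $1/p(x)+1/p'(x)=1$. Condition $\mathcal{A}(G)$. An exponent $p(\cdot)$ with $1<p_-\le p_+<\infty$ satisfies $p(\cdot)\in\mathcal{A}(G)$ if there is a constant $C$ such that for every $I\in\mathcal{F}$, $\frac{1}{\mu(I)}\|\chi_I\|_{p(\cdot)}\|\chi_I\|_{p'(\cdot)}\le C$, where $\chi_I$ is the characteristic function of $I$. *)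

theory Defs
  imports "HOL-Probability.Probability"
begin

section \<open>The group and its Haar measure\<close>

text \<open>
  An element of G is a sequence x with x i < p i. The library has no Haar measure; the product of
  the uniform probability measures on the factors is the normalized Haar measure, since its
  sigma-algebra is the Borel sigma-algebra of the countable product of finite discrete spaces
  and it is a translation invariant probability measure (proved below).
\<close>

definition vilenkin_measure :: "(nat \<Rightarrow> nat) \<Rightarrow> (nat \<Rightarrow> nat) measure" where
  "vilenkin_measure p = PiM UNIV (\<lambda>i. uniform_count_measure {..<p i})"

abbreviation vilenkin_group :: "(nat \<Rightarrow> nat) \<Rightarrow> (nat \<Rightarrow> nat) set" where
  "vilenkin_group p \<equiv> space (vilenkin_measure p)"

definition vilenkin_add :: "(nat \<Rightarrow> nat) \<Rightarrow> (nat \<Rightarrow> nat) \<Rightarrow> (nat \<Rightarrow> nat) \<Rightarrow> nat \<Rightarrow> nat" where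
  "vilenkin_add p x y = (\<lambda>i. (x i + y i) mod p i)"

lemma mem_vilenkin_group_iff: "x \<in> vilenkin_group p \<longleftrightarrow> (\<forall>i. x i < p i)"
  by (auto simp: vilenkin_measure_def space_PiM space_uniform_count_measure PiE_iff)

lemma prob_space_uniform_component:
  assumes "p i \<ge> (2::nat)"
  shows "prob_space (uniform_count_measure {..<p i})"
  using assms by (intro prob_space_uniform_count_measure) (auto simp: lessThan_empty_iff)

lemma prob_space_vilenkin_measure:
  assumes "\<And>i. p i \<ge> 2"
  shows "prob_space (vilenkin_measure p)"
  unfolding vilenkin_measure_def by (intro prob_space_PiM prob_space_uniform_component assms)

lemma bij_betw_add_mod:
  assumes "a < (n::nat)"
  shows "bij_betw (\<lambda>b. (a + b) mod n) {..<n} {..<n}"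
proof -
  let ?f = "\<lambda>b. (a + b) mod n"
  have "c \<in> ?f ` {..<n}" if "c < n" for c
  proof (rule image_eqI)
    have "(a + (c + (n - a)) mod n) mod n = (a + (c + (n - a))) mod n"
      by (rule mod_add_right_eq)
    also have "a + (c + (n - a)) = c + n" using assms by linarith
    also have "(c + n) mod n = c" using that by simp
    finally show "c = ?f ((c + (n - a)) mod n)" by (rule sym)
  qed (use assms in simp)
  moreover have "?f ` {..<n} \<subseteq> {..<n}" using assms by auto
  ultimately have "?f ` {..<n} = {..<n}" by blast
  moreover from this have "inj_on ?f {..<n}" by (intro eq_card_imp_inj_on) simp_all
  ultimately show ?thesis by (simp add: bij_betw_def)
qed

lemma vilenkin_measure_translation_invariant:
  assumes p: "\<And>i. p i \<ge> 2" and x: "x \<in> vilenkin_group p"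
  shows "distr (vilenkin_measure p) (vilenkin_measure p) (vilenkin_add p x) = vilenkin_measure p"
proof -
  let ?U = "\<lambda>i. uniform_count_measure {..<p i}"
  let ?T = "vilenkin_add p x"
  have pos: "p i > 0" for i using p[of i] by simp
  interpret product_prob_space ?U UNIV
    by (intro product_prob_spaceI prob_space_uniform_component p)
  have T: "?T \<in> PiM UNIV ?U \<rightarrow>\<^sub>M PiM UNIV ?U"
    unfolding vilenkin_add_def
  proof (rule measurable_PiM_single')
    fix i
    have "(\<lambda>b. (x i + b) mod p i) \<in> ?U i \<rightarrow>\<^sub>M ?U i"
      using pos by (auto simp: measurable_def space_uniform_count_measure sets_uniform_count_measure)
    from measurable_compose[OF measurable_component_singleton[of i UNIV ?U] this]
    show "(\<lambda>y. (x i + y i) mod p i) \<in> PiM UNIV ?U \<rightarrow>\<^sub>M ?U i" by simp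
  qed (use pos in \<open>auto simp: space_PiM space_uniform_count_measure PiE_iff\<close>)
  have "distr (PiM UNIV ?U) (PiM UNIV ?U) ?T = PiM UNIV ?U"
  proof (rule PiM_eq)
    fix J and F :: "nat \<Rightarrow> nat set"
    assume J: "finite J" "J \<subseteq> UNIV" and F: "\<And>j. j \<in> J \<Longrightarrow> F j \<in> sets (?U j)"
    let ?F = "\<lambda>j. {b \<in> {..<p j}. (x j + b) mod p j \<in> F j}"
    have "emeasure (distr (PiM UNIV ?U) (PiM UNIV ?U) ?T) (prod_emb UNIV ?U J (Pi\<^sub>E J F))
        = emeasure (PiM UNIV ?U) (?T -` prod_emb UNIV ?U J (Pi\<^sub>E J F) \<inter> space (PiM UNIV ?U))"
      using J F by (intro emeasure_distr T sets_PiM_I) auto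
    also have "?T -` prod_emb UNIV ?U J (Pi\<^sub>E J F) \<inter> space (PiM UNIV ?U)
        = prod_emb UNIV ?U J (Pi\<^sub>E J ?F)"
      using pos by (auto simp: prod_emb_def space_PiM space_uniform_count_measure PiE_iff
        vilenkin_add_def)
    also have "emeasure (PiM UNIV ?U) \<dots> = (\<Prod>j\<in>J. emeasure (?U j) (?F j))"
      using J by (intro emeasure_PiM_emb) (auto simp: sets_uniform_count_measure)
    also have "\<dots> = (\<Prod>j\<in>J. emeasure (?U j) (F j))"
    proof (intro prod.cong refl)
      fix j assume j: "j \<in> J"
      have Fj: "F j \<subseteq> {..<p j}" using F[OF j] by (simp add: sets_uniform_count_measure)
      have xj: "x j < p j" using x by (simp add: mem_vilenkin_group_iff)
      note b = bij_betw_add_mod[OF xj]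
      have img: "(\<lambda>b. (x j + b) mod p j) ` ?F j = F j"
      proof (intro equalityI subsetI)
        fix c assume c: "c \<in> F j"
        with Fj have "c \<in> (\<lambda>b. (x j + b) mod p j) ` {..<p j}"
          using b by (auto simp: bij_betw_def)
        with c show "c \<in> (\<lambda>b. (x j + b) mod p j) ` ?F j" by blast
      qed auto
      have "inj_on (\<lambda>b. (x j + b) mod p j) (?F j)"
        using b unfolding bij_betw_def by (rule inj_on_subset[OF conjunct1]) auto
      from card_image[OF this] have "card (F j) = card (?F j)" unfolding img .
      then show "emeasure (?U j) (?F j) = emeasure (?U j) (F j)"
        using Fj by (subst (1 2) emeasure_uniform_count_measure) auto
    qed
    finally show "emeasure (distr (PiM UNIV ?U) (PiM UNIV ?U) ?T) (prod_emb UNIV ?U J (Pi\<^sub>E J F))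
        = (\<Prod>j\<in>J. emeasure (?U j) (F j))" .
  qed simp
  then show ?thesis by (simp add: vilenkin_measure_def)
qed


section \<open>The Vilenkin system and partial sums\<close>

definition vilenkin_m :: "(nat \<Rightarrow> nat) \<Rightarrow> nat \<Rightarrow> nat" where
  "vilenkin_m p k = (\<Prod>i<k. p i)"

definition vilenkin_phi :: "(nat \<Rightarrow> nat) \<Rightarrow> nat \<Rightarrow> (nat \<Rightarrow> nat) \<Rightarrow> complex" where
  "vilenkin_phi p k x = exp (2 * of_real pi * \<i> * of_nat (x k) / of_nat (p k))"

text \<open>
  The coefficients of the mixed-radix expansion of n. That they are the unique admissible
  ones is \<open>vilenkin_digit_unique\<close> below.
\<close>

definition vilenkin_digit :: "(nat \<Rightarrow> nat) \<Rightarrow> nat \<Rightarrow> nat \<Rightarrow> nat" where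
  "vilenkin_digit p n k = (n div vilenkin_m p k) mod p k"

text \<open>
  The infinite product over k is taken over its finitely many factors with nonzero exponent
  (\<open>finite_vilenkin_digit_support\<close>).
\<close>

definition vilenkin_psi :: "(nat \<Rightarrow> nat) \<Rightarrow> nat \<Rightarrow> (nat \<Rightarrow> nat) \<Rightarrow> complex" where
  "vilenkin_psi p n x =
     (\<Prod>k | vilenkin_digit p n k \<noteq> 0. vilenkin_phi p k x ^ vilenkin_digit p n k)"

lemma vilenkin_digit_less: "p k \<ge> 2 \<Longrightarrow> vilenkin_digit p n k < p k"
  by (simp add: vilenkin_digit_def)

lemma vilenkin_m_gt:
  assumes "\<And>i. p i \<ge> 2"
  shows "k < vilenkin_m p k"
proof (induction k)
  case (Suc k)
  have "Suc k < vilenkin_m p k * 2" using Suc by simp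
  also have "\<dots> \<le> vilenkin_m p (Suc k)" using assms[of k] by (simp add: vilenkin_m_def)
  finally show ?case .
qed (simp add: vilenkin_m_def)

lemma finite_vilenkin_digit_support:
  assumes "\<And>i. p i \<ge> 2"
  shows "finite {k. vilenkin_digit p n k \<noteq> 0}"
proof (rule finite_subset)
  show "{k. vilenkin_digit p n k \<noteq> 0} \<subseteq> {..n}"
  proof (rule subsetI, rule ccontr)
    fix k assume k: "k \<in> {k. vilenkin_digit p n k \<noteq> 0}" "k \<notin> {..n}"
    then have "n < vilenkin_m p k" using vilenkin_m_gt[of p k, OF assms] by simp
    then show False using k by (simp add: vilenkin_digit_def)
  qed
qed simp

lemma vilenkin_digit_expansion_mod:
  assumes "\<And>i. p i \<ge> 2"
  shows "(\<Sum>k<K. vilenkin_digit p n k * vilenkin_m p k) = n mod vilenkin_m p K"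
proof (induction K)
  case (Suc K)
  have m: "vilenkin_m p (Suc K) = vilenkin_m p K * p K" by (simp add: vilenkin_m_def)
  show ?case using Suc unfolding m mod_mult2_eq by (simp add: vilenkin_digit_def mult.commute)
qed (simp add: vilenkin_m_def)

lemma vilenkin_digit_expansion:
  assumes "\<And>i. p i \<ge> 2"
  shows "n = (\<Sum>k | vilenkin_digit p n k \<noteq> 0. vilenkin_digit p n k * vilenkin_m p k)"
proof -
  have z: "vilenkin_digit p n k = 0" if "k \<ge> n" for k
    using vilenkin_m_gt[of p k, OF assms] that by (simp add: vilenkin_digit_def)
  have "n = (\<Sum>k<n. vilenkin_digit p n k * vilenkin_m p k)"
    using vilenkin_m_gt[of p n, OF assms] by (simp add: vilenkin_digit_expansion_mod[OF assms])
  also have "\<dots> = (\<Sum>k | vilenkin_digit p n k \<noteq> 0. vilenkin_digit p n k * vilenkin_m p k)"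
  proof (rule sum.mono_neutral_right)
    show "{k. vilenkin_digit p n k \<noteq> 0} \<subseteq> {..<n}"
      using z by (metis (mono_tags, lifting) lessThan_iff linorder_not_less mem_Collect_eq subsetI)
  qed auto
  finally show ?thesis .
qed

lemma vilenkin_partial_expansion_less:
  assumes "\<And>i. \<alpha> i < p i"
  shows "(\<Sum>k<K. \<alpha> k * vilenkin_m p k) < vilenkin_m p K"
proof (induction K)
  case (Suc K)
  have "(\<Sum>k<Suc K. \<alpha> k * vilenkin_m p k) < vilenkin_m p K + \<alpha> K * vilenkin_m p K"
    using Suc by simp
  also have "\<dots> = Suc (\<alpha> K) * vilenkin_m p K" by simp
  also have "\<dots> \<le> p K * vilenkin_m p K"
    using assms[of K] by (intro mult_right_mono) auto
  finally show ?case by (simp add: vilenkin_m_def mult.commute)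
qed (simp add: vilenkin_m_def)

lemma vilenkin_digit_unique:
  assumes \<alpha>: "\<And>i. \<alpha> i < p i" and fin: "finite {k. \<alpha> k \<noteq> 0}"
    and n: "n = (\<Sum>k | \<alpha> k \<noteq> 0. \<alpha> k * vilenkin_m p k)"
  shows "\<alpha> k = vilenkin_digit p n k"
proof -
  obtain N where N: "{k. \<alpha> k \<noteq> 0} \<subseteq> {..<N}" using finite_nat_iff_bounded fin by blast
  let ?s = "\<lambda>K. \<Sum>k<K. \<alpha> k * vilenkin_m p k"
  have m: "vilenkin_m p (Suc K) = vilenkin_m p K * p K" for K by (simp add: vilenkin_m_def)
  have pos: "vilenkin_m p K > 0" for K
    unfolding vilenkin_m_def by (intro prod_pos ballI order.strict_trans1[OF le0 \<alpha>])
  have *: "?s (K + d) mod vilenkin_m p K = ?s K" for K d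
  proof -
    have "vilenkin_m p K dvd vilenkin_m p (K + e)" for e
      by (induction e) (auto simp: m)
    then have "?s (K + d) mod vilenkin_m p K = ?s K mod vilenkin_m p K"
      by (induction d) (auto simp: mod_simps dvd_imp_mod_0 mod_add_right_eq[symmetric])
    then show ?thesis using vilenkin_partial_expansion_less[of \<alpha> p K, OF \<alpha>] by simp
  qed
  have ns: "n = ?s (Suc k + N)"
    unfolding n by (rule sum.mono_neutral_left) (use N in auto)
  have "vilenkin_digit p n k = (n mod vilenkin_m p (Suc k)) div vilenkin_m p k"
    using pos[of k] by (simp add: vilenkin_digit_def m mod_mult2_eq)
  also have "n mod vilenkin_m p (Suc k) = ?s (Suc k)" unfolding ns by (rule *)
  also have "?s (Suc k) div vilenkin_m p k = \<alpha> k"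
    using pos[of k] vilenkin_partial_expansion_less[of \<alpha> p k, OF \<alpha>] by simp
  finally show ?thesis by simp
qed

definition vilenkin_coeff :: "(nat \<Rightarrow> nat) \<Rightarrow> ((nat \<Rightarrow> nat) \<Rightarrow> complex) \<Rightarrow> nat \<Rightarrow> complex" where
  "vilenkin_coeff p f j = (LINT x|vilenkin_measure p. f x * cnj (vilenkin_psi p j x))"

definition vilenkin_partial_sum ::
    "(nat \<Rightarrow> nat) \<Rightarrow> nat \<Rightarrow> ((nat \<Rightarrow> nat) \<Rightarrow> complex) \<Rightarrow> (nat \<Rightarrow> nat) \<Rightarrow> complex" where
  "vilenkin_partial_sum p n f x = (\<Sum>j<n. vilenkin_coeff p f j * vilenkin_psi p j x)"


section \<open>Variable Lebesgue spaces\<close>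

definition var_modular ::
    "'a measure \<Rightarrow> ('a \<Rightarrow> real) \<Rightarrow> ('a \<Rightarrow> complex) \<Rightarrow> real \<Rightarrow> ennreal" where
  "var_modular M r f l = (\<integral>\<^sup>+x. ennreal ((norm (f x) / l) powr r x) \<partial>M)"

definition var_Lp :: "'a measure \<Rightarrow> ('a \<Rightarrow> real) \<Rightarrow> ('a \<Rightarrow> complex) set" where
  "var_Lp M r = {f \<in> borel_measurable M. \<exists>l>0. var_modular M r f l < \<infinity>}"

text \<open>
  The norm takes values in the extended nonnegative reals, so that the infimum of the empty set
  is infinite rather than an arbitrary real number.
\<close>

definition var_norm :: "'a measure \<Rightarrow> ('a \<Rightarrow> real) \<Rightarrow> ('a \<Rightarrow> complex) \<Rightarrow> ennreal" where
  "var_norm M r f = Inf {ennreal l | l. l > 0 \<and> var_modular M r f l \<le> 1}"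

definition exponent_inf :: "'a measure \<Rightarrow> ('a \<Rightarrow> real) \<Rightarrow> ereal" where
  "exponent_inf M r = - esssup M (\<lambda>x. - ereal (r x))"

definition exponent_sup :: "'a measure \<Rightarrow> ('a \<Rightarrow> real) \<Rightarrow> ereal" where
  "exponent_sup M r = esssup M (\<lambda>x. ereal (r x))"

text \<open>
  Where r x = 1 the conjugate exponent is infinite, and the value below is a dummy.
  This is a null set whenever the essential infimum of r exceeds 1.
\<close>

definition conj_exponent :: "('a \<Rightarrow> real) \<Rightarrow> 'a \<Rightarrow> real" where
  "conj_exponent r x = r x / (r x - 1)"

lemma conj_exponent_eq:
  assumes "r x > 1"
  shows "1 / r x + 1 / conj_exponent r x = 1"
  using assms by (simp add: conj_exponent_def field_simps)


section \<open>Generalized intervals and the Muckenhoupt-type condition\<close>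

definition gen_intervals :: "(nat \<Rightarrow> nat) \<Rightarrow> (nat \<Rightarrow> nat) set set" where
  "gen_intervals p =
     {vilenkin_add p x ` {y \<in> vilenkin_group p. (\<forall>i<k. y i = 0) \<and> y k < j} | x k j.
        x \<in> vilenkin_group p \<and> 1 \<le> j \<and> j \<le> p k}"

definition class_A :: "(nat \<Rightarrow> nat) \<Rightarrow> ((nat \<Rightarrow> nat) \<Rightarrow> real) \<Rightarrow> bool" where
  "class_A p r \<longleftrightarrow>
     (\<exists>C::real. \<forall>I\<in>gen_intervals p.
        1 / emeasure (vilenkin_measure p) I
          * var_norm (vilenkin_measure p) r (indicator I)
          * var_norm (vilenkin_measure p) (conj_exponent r) (indicator I) \<le> ennreal C)"

end

theory Submission
  imports Defs
begin

text \<open>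
  The characters with index below \<open>m N\<close> live on the finite quotient of level \<open>N\<close>. There the partial
  sum operator, conjugated by the character \<open>\<psi> n\<close>, has a kernel which on a generalized interval far
  from the other variable is a combination of the frequencies \<open>1\<close> and \<open>w\<close> in a single coordinate, up
  to an error of Hilbert kernel type. Hence Calderon-Zygmund theory works with constants independent
  of the orders \<open>p i\<close>, once averages are replaced by a reproducing kernel for functions
  \<open>A + B * w ^ u\<close>, and a stopping time recursion bounds the bilinear form of the operator by
  \<open>c * (\<integral> M f * M g)\<close>. Here \<open>M\<close> is the maximal function of two trees of generalized intervals, the
  second one shifted by a third of each factor. The condition is symmetric in the two conjugate
  exponents and makes \<open>M\<close> modularly bounded for both of them, so that duality yields the boundedness
  of the partial sums. Conversely, for an interval with \<open>j\<close> residues at level \<open>k\<close> the partial sum with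
  \<open>n\<close> about \<open>m (Suc k) / (6 * j)\<close> dominates the average over the interval. Boundedness and
  convergence are related by the density of cylinder functions and by uniform boundedness.
\<close>

section \<open>Laminar families and stopping time recursion\<close>

text \<open>The obstacle is that the orders are unbounded. Passing from a coset to the next larger
  one multiplies the measure by \<open>p k\<close>, so the tree of cosets is not doubling; cyclic
  arcs are inserted between consecutive cosets, and a step up then costs at most the factor 8. Two
  points close to a cut of one system of arcs may share no small arc, hence the second system.
  Inside one coordinate the kernel oscillates with the frequency of a digit of \<open>n\<close>,
  which has no bound either, so subtracting a mean gains nothing. What survives is that after
  conjugation only the frequency 0 and one other occur. On the side of the exponents, the condition
  provides one level per interval, the reciprocal norm of the indicator. The maximal theorem needs
  every level that averages of functions in the unit ball can reach. The passage from the one level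
  to these is \<open>dual_mass_le\<close>; it gives the weights \<open>t powr a x\<close> an
  A-infinity property with uniform constants. The form bound is integrated by Young's inequality at
  each point, which is why the maximal function is needed for both exponents.\<close>

definition laminar :: "'a set set \<Rightarrow> bool" where
  "laminar D \<longleftrightarrow> (\<forall>A\<in>D. \<forall>B\<in>D. A \<subseteq> B \<or> B \<subseteq> A \<or> A \<inter> B = {})"

definition maximal_sets :: "'a set set \<Rightarrow> 'a set set" where
  "maximal_sets D = {A \<in> D. \<forall>B\<in>D. A \<subseteq> B \<longrightarrow> A = B}"

lemma maximal_sets_subset: "maximal_sets D \<subseteq> D"
  by (auto simp: maximal_sets_def)

lemma ex_maximal_superset:
  assumes "finite D" "A \<in> D"
  obtains B where "B \<in> maximal_sets D" "A \<subseteq> B"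
proof -
  obtain B where "B \<in> D" "A \<subseteq> B" "\<forall>C\<in>D. B \<subseteq> C \<longrightarrow> B = C"
    using finite_has_maximal2[OF assms] by blast
  then show thesis using that by (auto simp: maximal_sets_def)
qed

lemma Union_maximal_sets:
  assumes "finite D"
  shows "\<Union>(maximal_sets D) = \<Union>D"
proof
  show "\<Union>(maximal_sets D) \<subseteq> \<Union>D" using maximal_sets_subset by blast
  show "\<Union>D \<subseteq> \<Union>(maximal_sets D)"
  proof
    fix x assume "x \<in> \<Union>D"
    then obtain A where A: "A \<in> D" "x \<in> A" by blast
    then obtain B where "B \<in> maximal_sets D" "A \<subseteq> B" using ex_maximal_superset[OF assms] by blast
    then show "x \<in> \<Union>(maximal_sets D)" using A by blast
  qed
qed

lemma laminar_subset: "laminar D \<Longrightarrow> E \<subseteq> D \<Longrightarrow> laminar E"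
  unfolding laminar_def subset_iff by metis

lemma maximal_sets_disjoint:
  assumes "laminar D" "A \<in> maximal_sets D" "B \<in> maximal_sets D" "A \<noteq> B"
  shows "A \<inter> B = {}"
proof -
  have "A \<in> D" "B \<in> D" using assms(2,3) maximal_sets_subset by blast+
  then have "A \<subseteq> B \<or> B \<subseteq> A \<or> A \<inter> B = {}" using assms(1) unfolding laminar_def by metis
  moreover have "\<not> A \<subseteq> B" "\<not> B \<subseteq> A"
    using assms(2-4) \<open>A \<in> D\<close> \<open>B \<in> D\<close> unfolding maximal_sets_def by auto
  ultimately show ?thesis by metis
qed

text \<open>Maximal members of a laminar family are pairwise disjoint and have the same union, so
  they take the place of a covering lemma and lose no constant.\<close>

lemma sum_Union_maximal:
  assumes "finite D" "laminar D" "\<And>A. A \<in> D \<Longrightarrow> finite A"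
  shows "(\<Sum>A\<in>maximal_sets D. sum f A) = sum f (\<Union>D)"
proof -
  have "sum f (\<Union>(maximal_sets D)) = (\<Sum>A\<in>maximal_sets D. sum f A)"
    using assms maximal_sets_subset[of D] maximal_sets_disjoint[OF assms(2)]
    by (subst sum.Union_disjoint) auto
  then show ?thesis using Union_maximal_sets[OF assms(1)] by simp
qed

section \<open>Calderon-Zygmund operators on a finite set with a tree of subsets\<close>

lemma card_superlevel_le:
  fixes h :: "'a \<Rightarrow> real"
  assumes "finite A" "\<And>x. x \<in> A \<Longrightarrow> h x \<ge> 0" "0 \<le> t"
  shows "real (card {x\<in>A. h x > t}) * t \<le> (\<Sum>x\<in>A. h x)"
proof -
  have "real (card {x\<in>A. h x > t}) * t = (\<Sum>x\<in>{x\<in>A. h x > t}. t)" by simp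
  also have "\<dots> \<le> (\<Sum>x\<in>{x\<in>A. h x > t}. h x)" by (rule sum_mono) auto
  also have "\<dots> \<le> (\<Sum>x\<in>A. h x)" using assms by (intro sum_mono2) auto
  finally show ?thesis .
qed

text \<open>The measure is counting measure and the normalization sits in \<open>K\<close>, whence
  the factors \<open>card Q\<close>. Two axioms deviate from the classical ones.
  \<open>kernel_cancellation\<close> asks that the kernel, as a function of its second variable in
  \<open>Q\<close>, be reproduced by \<open>\<rho>\<close> up to an error summable off
  \<open>star Q\<close>; the constant \<open>1 / card Q\<close> in place of \<open>\<rho>\<close>
  would be the usual mean. \<open>far_part_remez\<close> replaces small oscillation of the far part:
  it may oscillate, but a bound on \<open>Q\<close> outside a sixteenth, with a bound for
  \<open>M\<close> at one point, extends to all of \<open>Q\<close>.\<close>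

locale cz_space =
  fixes X :: "'a set" and D :: "'a set set" and star :: "'a set \<Rightarrow> 'a set"
    and K :: "'a \<Rightarrow> 'a \<Rightarrow> complex" and M :: "('a \<Rightarrow> real) \<Rightarrow> 'a \<Rightarrow> real" and c :: real
  assumes finite_X: "finite X" and c_ge_1: "1 \<le> c"
    and D_subset: "\<And>Q. Q \<in> D \<Longrightarrow> Q \<subseteq> X" and D_nonempty: "\<And>Q. Q \<in> D \<Longrightarrow> Q \<noteq> {}"
    and X_in_D: "X \<in> D" and singleton_in_D: "\<And>x. x \<in> X \<Longrightarrow> {x} \<in> D"
    and laminar_D: "laminar D"
    and parent: "\<And>Q. Q \<in> D \<Longrightarrow> Q \<noteq> X \<Longrightarrow> \<exists>R\<in>D. Q \<subset> R \<and> card R \<le> 8 * card Q"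
    and star_superset: "\<And>Q. Q \<in> D \<Longrightarrow> Q \<subseteq> star Q" and star_subset: "\<And>Q. Q \<in> D \<Longrightarrow> star Q \<subseteq> X"
    and card_star: "\<And>Q. Q \<in> D \<Longrightarrow> real (card (star Q)) \<le> c * card Q"
    and star_mono: "\<And>Q R. Q \<in> D \<Longrightarrow> R \<in> D \<Longrightarrow> Q \<subseteq> R \<Longrightarrow> star Q \<subseteq> star R"
    and L2_bound: "\<And>f. (\<Sum>x\<in>X. (norm (\<Sum>y\<in>X. K x y * f y))\<^sup>2) \<le> (\<Sum>y\<in>X. (norm (f y))\<^sup>2)"
    and M_weak: "\<And>f t. (\<And>x. x \<in> X \<Longrightarrow> f x \<ge> 0) \<Longrightarrow> t > 0 \<Longrightarrow>
        real (card {x\<in>X. M f x > t}) * t \<le> c * (\<Sum>x\<in>X. f x)"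
    and M_star: "\<And>f Q x. (\<And>x. x \<in> X \<Longrightarrow> f x \<ge> 0) \<Longrightarrow> Q \<in> D \<Longrightarrow> x \<in> Q \<Longrightarrow>
        (\<Sum>y\<in>star Q. f y) \<le> c * card Q * M f x"
    and M_mono: "\<And>f g x. (\<And>y. y \<in> X \<Longrightarrow> 0 \<le> f y) \<Longrightarrow> (\<And>y. y \<in> X \<Longrightarrow> f y \<le> g y) \<Longrightarrow> x \<in> X \<Longrightarrow>
        M f x \<le> M g x"
    and kernel_size: "\<And>Q x y. Q \<in> D \<Longrightarrow> x \<in> Q \<Longrightarrow> y \<in> X - star Q \<Longrightarrow> norm (K x y) * card Q \<le> c"
    and kernel_cancellation: "\<And>Q. Q \<in> D \<Longrightarrow> \<exists>\<rho>. (\<forall>y\<in>Q. \<forall>z\<in>Q. norm (\<rho> y z) * card Q \<le> c) \<and>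
        (\<forall>y\<in>Q. (\<Sum>x\<in>X - star Q. norm (K x y - (\<Sum>z\<in>Q. K x z * \<rho> y z))) \<le> c)"
    and far_part_remez: "\<And>Q x0 f E t. Q \<in> D \<Longrightarrow> x0 \<in> Q \<Longrightarrow> E \<subseteq> Q \<Longrightarrow> 16 * card (Q - E) \<le> card Q \<Longrightarrow>
        M (\<lambda>x. norm (f x)) x0 \<le> t \<Longrightarrow>
        (\<And>x. x \<in> E \<Longrightarrow> norm (\<Sum>y\<in>X - star Q. K x y * f y) \<le> t) \<Longrightarrow>
        (\<forall>x\<in>Q. norm (\<Sum>y\<in>X - star Q. K x y * f y) \<le> c * t)"
begin

definition T :: "('a \<Rightarrow> complex) \<Rightarrow> 'a \<Rightarrow> complex" where
  "T f x = (\<Sum>y\<in>X. K x y * f y)"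

text \<open>Weak type constant from the decomposition below: \<open>32 * c\<^sup>2\<close> from the
  good part, \<open>c\<close> from the enlarged stopping sets, \<open>2 * c\<close> from the bad
  part, rounded up.\<close>

definition W :: real where "W = 64 * c\<^sup>2 + 3 * c"

lemma finite_D: "finite D"
  using finite_X D_subset by (auto intro: finite_subset[of D "Pow X"])

lemma finite_member: "Q \<in> D \<Longrightarrow> finite Q"
  using finite_X D_subset finite_subset by blast

lemma card_pos_D: "Q \<in> D \<Longrightarrow> card Q > 0"
  using finite_member D_nonempty card_gt_0_iff by blast

text \<open>Calderon-Zygmund decomposition at height \<open>t\<close>. On a stopping set the good
  part is not the mean of \<open>f\<close> but the transpose of \<open>\<rho>\<close> applied to
  \<open>f\<close>; then \<open>T (b Q)\<close> at a point off \<open>star Q\<close> is exactly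
  \<open>f\<close> summed against the error in \<open>kernel_cancellation\<close>.\<close>

lemma weak_type:
  assumes t: "t > 0"
  shows "real (card {x\<in>X. norm (T f x) > t}) * t \<le> W * (\<Sum>x\<in>X. norm (f x))"
proof -
  define F where "F = (\<Sum>x\<in>X. norm (f x))"
  have F0: "F \<ge> 0" unfolding F_def by (intro sum_nonneg) auto
  define J0 where "J0 = {J\<in>D. (\<Sum>x\<in>J. norm (f x)) > t * card J}"
  have cc: "c \<le> c\<^sup>2" using c_ge_1 by (simp add: power2_eq_square)
  show ?thesis
  \<comment> \<open>If the average over \<open>X\<close> already exceeds \<open>t\<close> there is
    no parent to compare with, but then the trivial count \<open>card X\<close> is small
    enough.\<close>
  proof (cases "X \<in> J0")
    case True
    have "real (card {x\<in>X. norm (T f x) > t}) * t \<le> real (card X) * t"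
      using t finite_X by (intro mult_right_mono of_nat_mono card_mono) auto
    also have "\<dots> \<le> 1 * F" using True by (auto simp: J0_def F_def mult.commute)
    also have "\<dots> \<le> W * F" using c_ge_1 F0 cc by (intro mult_right_mono) (auto simp: W_def)
    finally show ?thesis unfolding F_def .
  next
    case False
    define J where "J = maximal_sets J0"
    define U where "U = \<Union>J"
    have J0D: "J0 \<subseteq> D" by (auto simp: J0_def)
    have finJ0: "finite J0" using J0D finite_D finite_subset by blast
    have lam: "laminar J0" using laminar_subset[OF laminar_D J0D] .
    have JJ0: "J \<subseteq> J0" unfolding J_def by (rule maximal_sets_subset)
    then have JD: "Q \<in> D" if "Q \<in> J" for Q using J0D that by blast
    have finJ: "finite J" using JJ0 finJ0 finite_subset by blast
    have UJ: "U = \<Union>J0" unfolding U_def J_def using Union_maximal_sets[OF finJ0] .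
    have UX: "U \<subseteq> X" unfolding U_def using JD D_subset by blast
    have disj: "A \<inter> B = {}" if "A \<in> J" "B \<in> J" "A \<noteq> B" for A B
      using maximal_sets_disjoint[OF lam] that unfolding J_def by blast
    have sumJ: "(\<Sum>Q\<in>J. sum h Q) = sum h U" for h :: "'a \<Rightarrow> real"
      unfolding J_def UJ by (rule sum_Union_maximal[OF finJ0 lam]) (use J0D finite_member in blast)
    have sumJF: "(\<Sum>Q\<in>J. \<Sum>x\<in>Q. norm (f x)) \<le> F"
      unfolding sumJ F_def using UX finite_X by (intro sum_mono2) auto
    have cardJ: "(\<Sum>Q\<in>J. real (card Q)) * t \<le> F"
    proof -
      have "(\<Sum>Q\<in>J. real (card Q)) * t = (\<Sum>Q\<in>J. t * card Q)" by (simp add: sum_distrib_left mult.commute)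
      also have "\<dots> \<le> (\<Sum>Q\<in>J. \<Sum>x\<in>Q. norm (f x))"
        using JJ0 by (intro sum_mono) (auto simp: J0_def less_imp_le)
      finally show ?thesis using sumJF by simp
    qed
    \<comment> \<open>By maximality the parent of \<open>Q\<close> is not in \<open>J0\<close>; the
      8 is the growth of the cardinality towards the parent.\<close>
    have avg: "(\<Sum>x\<in>Q. norm (f x)) \<le> 8 * t * card Q" if Q: "Q \<in> J" for Q
    proof -
      have "Q \<noteq> X" using False Q JJ0 by blast
      then obtain R where R: "R \<in> D" "Q \<subset> R" "card R \<le> 8 * card Q" using parent JD[OF Q] by blast
      then have "R \<notin> J0" using Q unfolding J_def maximal_sets_def by blast
      then have "(\<Sum>x\<in>R. norm (f x)) \<le> t * card R" using R by (auto simp: J0_def)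
      moreover have "(\<Sum>x\<in>Q. norm (f x)) \<le> (\<Sum>x\<in>R. norm (f x))"
        using R finite_member by (intro sum_mono2) auto
      moreover have "t * card R \<le> t * (8 * card Q)"
        using R t by (intro mult_left_mono) (auto simp flip: of_nat_mult)
      ultimately show ?thesis by (simp add: mult_ac)
    qed
    have offU: "norm (f x) \<le> t" if "x \<in> X - U" for x
      using that singleton_in_D[of x] unfolding UJ J0_def by (fastforce simp: not_less)
    have "\<forall>Q\<in>J. \<exists>\<rho>. (\<forall>y\<in>Q. \<forall>z\<in>Q. norm (\<rho> y z) * card Q \<le> c) \<and>
        (\<forall>y\<in>Q. (\<Sum>x\<in>X - star Q. norm (K x y - (\<Sum>z\<in>Q. K x z * \<rho> y z))) \<le> c)"
      using kernel_cancellation JD by blast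
    from bchoice[OF this] obtain \<rho> where \<rho>: "\<forall>Q\<in>J. (\<forall>y\<in>Q. \<forall>z\<in>Q. norm (\<rho> Q y z) * card Q \<le> c) \<and>
        (\<forall>y\<in>Q. (\<Sum>x\<in>X - star Q. norm (K x y - (\<Sum>z\<in>Q. K x z * \<rho> Q y z))) \<le> c)" ..
    have \<rho>1: "norm (\<rho> Q y z) * card Q \<le> c" if "Q \<in> J" "y \<in> Q" "z \<in> Q" for Q y z
      using \<rho> that by blast
    have \<rho>2: "(\<Sum>x\<in>X - star Q. norm (K x y - (\<Sum>z\<in>Q. K x z * \<rho> Q y z))) \<le> c"
      if "Q \<in> J" "y \<in> Q" for Q y
      using \<rho> that by blast
    define q where "q Q x = (if x \<in> Q then \<Sum>y\<in>Q. f y * \<rho> Q y x else 0)" for Q x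
    define g where "g x = (if x \<in> U then (\<Sum>Q\<in>J. q Q x) else f x)" for x
    define b where "b Q x = (if x \<in> Q then f x else 0) - q Q x" for Q x
    have qbound: "norm (q Q x) * card Q \<le> c * (\<Sum>y\<in>Q. norm (f y))" if Q: "Q \<in> J" and x: "x \<in> Q" for Q x
    proof -
      have "norm (q Q x) * card Q \<le> (\<Sum>y\<in>Q. norm (f y) * norm (\<rho> Q y x)) * card Q"
        unfolding q_def using x by (auto intro!: mult_right_mono sum_norm_le simp: norm_mult)
      also have "\<dots> = (\<Sum>y\<in>Q. norm (f y) * (norm (\<rho> Q y x) * card Q))"
        by (simp add: sum_distrib_right mult.assoc)
      also have "\<dots> \<le> (\<Sum>y\<in>Q. norm (f y) * c)"
        using \<rho>1[OF Q _ x] by (intro sum_mono mult_left_mono) auto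
      finally show ?thesis by (simp add: sum_distrib_left mult.commute)
    qed
    have qle: "norm (q Q x) \<le> 8 * c * t" if Q: "Q \<in> J" and x: "x \<in> Q" for Q x
    proof -
      have "norm (q Q x) * card Q \<le> c * (8 * t * card Q)"
        using qbound[OF that] avg[OF Q] c_ge_1
        by (meson mult_left_mono order_trans zero_le_one)
      then have "norm (q Q x) * card Q \<le> (8 * c * t) * card Q" by (simp add: mult_ac)
      then show ?thesis using card_pos_D[OF JD[OF Q]] by simp
    qed
    have sumq: "(\<Sum>Q'\<in>J. q Q' x) = q Q x" if "Q \<in> J" "x \<in> Q" for Q x
    proof -
      have "(\<Sum>Q'\<in>J. q Q' x) = (\<Sum>Q'\<in>{Q}. q Q' x)"
        using that finJ disj by (intro sum.mono_neutral_right) (auto simp: q_def)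
      then show ?thesis by simp
    qed
    have gle: "norm (g x) \<le> 8 * c * t" if x: "x \<in> X" for x
    proof (cases "x \<in> U")
      case True
      then obtain Q where "Q \<in> J" "x \<in> Q" unfolding U_def by blast
      then show ?thesis using qle sumq True by (simp add: g_def)
    next
      case False
      have "norm (f x) \<le> 1 * t" using offU False x by simp
      also have "\<dots> \<le> (8 * c) * t" using c_ge_1 t by (intro mult_right_mono) auto
      finally show ?thesis using False by (simp add: g_def)
    qed
    have sumgU: "(\<Sum>x\<in>U. norm (g x)) \<le> c * (\<Sum>x\<in>U. norm (f x))"
    proof -
      have "(\<Sum>x\<in>U. norm (g x)) = (\<Sum>Q\<in>J. \<Sum>x\<in>Q. norm (g x))" by (simp only: sumJ)
      also have "\<dots> \<le> (\<Sum>Q\<in>J. c * (\<Sum>x\<in>Q. norm (f x)))"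
      proof (rule sum_mono)
        fix Q assume Q: "Q \<in> J"
        have cp: "real (card Q) > 0" using card_pos_D[OF JD[OF Q]] by simp
        have "(\<Sum>x\<in>Q. norm (g x)) \<le> (\<Sum>x\<in>Q. c * (\<Sum>x\<in>Q. norm (f x)) / card Q)"
        proof (rule sum_mono)
          fix x assume x: "x \<in> Q"
          then have "x \<in> U" using Q unfolding U_def by blast
          then have "g x = q Q x" using sumq[OF Q x] by (simp add: g_def)
          then show "norm (g x) \<le> c * (\<Sum>x\<in>Q. norm (f x)) / card Q"
            using qbound[OF Q x] cp by (simp add: pos_le_divide_eq)
        qed
        also have "\<dots> = c * (\<Sum>x\<in>Q. norm (f x))" using cp by simp
        finally show "(\<Sum>x\<in>Q. norm (g x)) \<le> c * (\<Sum>x\<in>Q. norm (f x))" .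
      qed
      also have "\<dots> = c * (\<Sum>x\<in>U. norm (f x))" by (simp flip: sum_distrib_left add: sumJ)
      finally show ?thesis .
    qed
    have sumg: "(\<Sum>x\<in>X. norm (g x)) \<le> c * F"
    proof -
      have split: "(\<Sum>x\<in>X. h x) = (\<Sum>x\<in>X - U. h x) + (\<Sum>x\<in>U. h x)" for h :: "'a \<Rightarrow> real"
        using UX finite_X by (metis sum.subset_diff)
      have "(\<Sum>x\<in>X - U. norm (g x)) = (\<Sum>x\<in>X - U. norm (f x))" by (intro sum.cong) (auto simp: g_def)
      moreover have "(\<Sum>x\<in>X - U. norm (f x)) \<le> c * (\<Sum>x\<in>X - U. norm (f x))"
        using c_ge_1 mult_right_mono[of 1 c "\<Sum>x\<in>X - U. norm (f x)"] by (simp add: sum_nonneg)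
      ultimately show ?thesis using sumgU unfolding F_def split by (simp add: distrib_left)
    qed
    have sumg2: "(\<Sum>x\<in>X. (norm (g x))\<^sup>2) \<le> 8 * c\<^sup>2 * t * F"
    proof -
      have "(\<Sum>x\<in>X. (norm (g x))\<^sup>2) \<le> (\<Sum>x\<in>X. (8 * c * t) * norm (g x))"
        unfolding power2_eq_square using gle by (intro sum_mono mult_right_mono) auto
      also have "\<dots> = (8 * c * t) * (\<Sum>x\<in>X. norm (g x))" by (simp add: sum_distrib_left)
      also have "\<dots> \<le> (8 * c * t) * (c * F)" using sumg c_ge_1 t by (intro mult_left_mono) auto
      finally show ?thesis by (simp add: power2_eq_square mult_ac)
    qed
    \<comment> \<open>Chebyshev's inequality for the squares: \<open>8 * c\<^sup>2 * t * F\<close>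
      divided by \<open>(t/2)\<^sup>2\<close> is \<open>32 * c\<^sup>2 * F / t\<close>.\<close>
    have good: "real (card {x\<in>X. norm (T g x) > t/2}) * t \<le> 32 * c\<^sup>2 * F"
    proof -
      have "norm z > t/2 \<longleftrightarrow> (norm z)\<^sup>2 > (t/2)\<^sup>2" for z :: complex
        using t power_strict_mono[of "t/2" "norm z" 2] power2_less_imp_less[of "t/2" "norm z"] by auto
      then have "{x\<in>X. norm (T g x) > t/2} = {x\<in>X. (norm (T g x))\<^sup>2 > (t/2)\<^sup>2}" by simp
      then have "real (card {x\<in>X. norm (T g x) > t/2}) * (t/2)\<^sup>2 \<le> (\<Sum>x\<in>X. (norm (T g x))\<^sup>2)"
        using card_superlevel_le[OF finite_X, of "\<lambda>x. (norm (T g x))\<^sup>2" "(t/2)\<^sup>2"] by simp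
      also have "\<dots> \<le> 8 * c\<^sup>2 * t * F" using L2_bound[of g] sumg2 unfolding T_def by linarith
      finally have "(real (card {x\<in>X. norm (T g x) > t/2}) * t) * t \<le> (32 * c\<^sup>2 * F) * t"
        by (simp add: power2_eq_square field_simps)
      then show ?thesis using t by simp
    qed
    have f_split: "T f x = T g x + (\<Sum>Q\<in>J. T (b Q) x)" for x
    proof -
      have "f y = g y + (\<Sum>Q\<in>J. b Q y)" for y
      proof (cases "y \<in> U")
        case True
        then obtain Q where Q: "Q \<in> J" "y \<in> Q" unfolding U_def by blast
        have "(\<Sum>Q\<in>J. b Q y) = (\<Sum>Q'\<in>J. if y \<in> Q' then f y else 0) - (\<Sum>Q\<in>J. q Q y)"
          by (simp add: b_def sum_subtractf)
        also have "(\<Sum>Q'\<in>J. if y \<in> Q' then f y else 0) = (\<Sum>Q'\<in>{Q}. if y \<in> Q' then f y else 0)"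
          using Q finJ disj by (intro sum.mono_neutral_right) auto
        finally show ?thesis using True Q by (simp add: g_def)
      next
        case False
        then have "b Q y = 0" if "Q \<in> J" for Q using that by (auto simp: U_def b_def q_def)
        then show ?thesis using False by (simp add: g_def)
      qed
      then have "T f x = (\<Sum>y\<in>X. K x y * (g y + (\<Sum>Q\<in>J. b Q y)))" by (simp add: T_def)
      also have "\<dots> = T g x + (\<Sum>y\<in>X. \<Sum>Q\<in>J. K x y * b Q y)"
        by (simp add: T_def distrib_left sum.distrib sum_distrib_left)
      also have "(\<Sum>y\<in>X. \<Sum>Q\<in>J. K x y * b Q y) = (\<Sum>Q\<in>J. T (b Q) x)"
        unfolding T_def by (rule sum.swap)
      finally show ?thesis .
    qed
    have Tb: "T (b Q) x = (\<Sum>y\<in>Q. f y * (K x y - (\<Sum>z\<in>Q. K x z * \<rho> Q y z)))" if Q: "Q \<in> J" for Q x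
    proof -
      have QX: "Q \<subseteq> X" using JD[OF Q] D_subset by blast
      have "T (b Q) x = (\<Sum>y\<in>Q. K x y * b Q y)"
        unfolding T_def using QX finite_X by (intro sum.mono_neutral_right) (auto simp: b_def q_def)
      also have "\<dots> = (\<Sum>y\<in>Q. K x y * f y) - (\<Sum>z\<in>Q. \<Sum>y\<in>Q. K x z * (f y * \<rho> Q y z))"
        by (simp add: b_def q_def right_diff_distrib sum_subtractf sum_distrib_left)
      also have "(\<Sum>z\<in>Q. \<Sum>y\<in>Q. K x z * (f y * \<rho> Q y z)) = (\<Sum>y\<in>Q. \<Sum>z\<in>Q. K x z * (f y * \<rho> Q y z))"
        by (rule sum.swap)
      finally show ?thesis by (simp add: right_diff_distrib sum_subtractf sum_distrib_left mult_ac)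
    qed
    have Tbsum: "(\<Sum>x\<in>X - star Q. norm (T (b Q) x)) \<le> c * (\<Sum>y\<in>Q. norm (f y))" if Q: "Q \<in> J" for Q
    proof -
      have "(\<Sum>x\<in>X - star Q. norm (T (b Q) x))
        \<le> (\<Sum>x\<in>X - star Q. \<Sum>y\<in>Q. norm (f y) * norm (K x y - (\<Sum>z\<in>Q. K x z * \<rho> Q y z)))"
        unfolding Tb[OF Q] by (intro sum_mono sum_norm_le) (simp add: norm_mult)
      also have "\<dots> = (\<Sum>y\<in>Q. norm (f y) * (\<Sum>x\<in>X - star Q. norm (K x y - (\<Sum>z\<in>Q. K x z * \<rho> Q y z))))"
        by (subst sum.swap) (simp add: sum_distrib_left)
      also have "\<dots> \<le> (\<Sum>y\<in>Q. norm (f y) * c)"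
        using \<rho>2[OF Q] by (intro sum_mono mult_left_mono) auto
      finally show ?thesis by (simp add: sum_distrib_left mult.commute)
    qed
    define V where "V = (\<Union>Q\<in>J. star Q)"
    have VX: "V \<subseteq> X" unfolding V_def using star_subset JD by blast
    have cardV: "real (card V) * t \<le> c * F"
    proof -
      have "real (card V) \<le> (\<Sum>Q\<in>J. real (card (star Q)))"
        unfolding V_def using card_UN_le[OF finJ, of star] by (simp flip: of_nat_sum)
      also have "\<dots> \<le> (\<Sum>Q\<in>J. c * card Q)" using card_star JD by (intro sum_mono) auto
      finally have "real (card V) * t \<le> c * ((\<Sum>Q\<in>J. real (card Q)) * t)"
        using t by (simp add: sum_distrib_left[symmetric])
      also have "\<dots> \<le> c * F" using cardJ c_ge_1 by (intro mult_left_mono) auto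
      finally show ?thesis .
    qed
    have bad: "real (card {x\<in>X - V. norm (\<Sum>Q\<in>J. T (b Q) x) > t/2}) * t \<le> 2 * c * F"
    proof -
      have "real (card {x\<in>X - V. norm (\<Sum>Q\<in>J. T (b Q) x) > t/2}) * (t/2)
        \<le> (\<Sum>x\<in>X - V. norm (\<Sum>Q\<in>J. T (b Q) x))"
        using t finite_X by (intro card_superlevel_le) auto
      also have "\<dots> \<le> (\<Sum>x\<in>X - V. \<Sum>Q\<in>J. norm (T (b Q) x))"
        by (intro sum_mono norm_sum)
      also have "\<dots> = (\<Sum>Q\<in>J. \<Sum>x\<in>X - V. norm (T (b Q) x))" by (rule sum.swap)
      also have "\<dots> \<le> (\<Sum>Q\<in>J. c * (\<Sum>y\<in>Q. norm (f y)))"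
      proof (rule sum_mono)
        fix Q assume Q: "Q \<in> J"
        have "(\<Sum>x\<in>X - V. norm (T (b Q) x)) \<le> (\<Sum>x\<in>X - star Q. norm (T (b Q) x))"
          using Q finite_X by (intro sum_mono2) (auto simp: V_def)
        then show "(\<Sum>x\<in>X - V. norm (T (b Q) x)) \<le> c * (\<Sum>y\<in>Q. norm (f y))"
          using Tbsum[OF Q] by linarith
      qed
      also have "\<dots> \<le> c * F" using sumJF c_ge_1 by (simp flip: sum_distrib_left)
      finally show ?thesis by simp
    qed
    have "{x\<in>X. norm (T f x) > t} \<subseteq> {x\<in>X. norm (T g x) > t/2} \<union>
        (V \<union> {x\<in>X - V. norm (\<Sum>Q\<in>J. T (b Q) x) > t/2})"
    proof
      fix x assume x: "x \<in> {x\<in>X. norm (T f x) > t}"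
      then have "t < norm (T g x) + norm (\<Sum>Q\<in>J. T (b Q) x)"
        using norm_triangle_ineq[of "T g x" "\<Sum>Q\<in>J. T (b Q) x"] f_split[of x] by auto
      then have "norm (T g x) > t/2 \<or> norm (\<Sum>Q\<in>J. T (b Q) x) > t/2" by linarith
      then show "x \<in> {x\<in>X. norm (T g x) > t/2} \<union> (V \<union> {x\<in>X - V. norm (\<Sum>Q\<in>J. T (b Q) x) > t/2})"
        using x by auto
    qed
    then have "card {x\<in>X. norm (T f x) > t} \<le> card {x\<in>X. norm (T g x) > t/2} +
        (card V + card {x\<in>X - V. norm (\<Sum>Q\<in>J. T (b Q) x) > t/2})"
    proof (rule order_trans[OF card_mono[rotated]])
      show "finite ({x\<in>X. norm (T g x) > t/2} \<union>
          (V \<union> {x\<in>X - V. norm (\<Sum>Q\<in>J. T (b Q) x) > t/2}))"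
        using finite_X finite_subset[OF VX] by auto
    qed (rule order_trans[OF card_Un_le] add_left_mono card_Un_le)+
    then have "real (card {x\<in>X. norm (T f x) > t}) * t \<le> (real (card {x\<in>X. norm (T g x) > t/2}) +
        (real (card V) + real (card {x\<in>X - V. norm (\<Sum>Q\<in>J. T (b Q) x) > t/2}))) * t"
      using t by (intro mult_right_mono) (auto simp flip: of_nat_add)
    also have "\<dots> \<le> 32 * c\<^sup>2 * F + (c * F + 2 * c * F)"
      unfolding distrib_right using good cardV bad by linarith
    also have "\<dots> \<le> W * F"
      using F0 mult_right_mono[of "32 * c\<^sup>2 + 3 * c" W F] by (simp add: W_def algebra_simps)
    finally show ?thesis unfolding F_def .
  qed
qed


text \<open>\<open>threshold\<close>: at this multiple of \<open>t\<close> the level sets of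
  \<open>T F\<close> and of the maximal function together fill at most 1/64 of \<open>Q\<close>.
  \<open>threshold'\<close>: the same for the part of \<open>F\<close> on \<open>star R\<close>,
  whose total is at most \<open>c * card R * threshold * t\<close>, with 1/32 of \<open>R\<close>.
  \<open>remote\<close> adds the Remez bound for the part beyond \<open>star R\<close> and the size
  bound for the ring between \<open>star P\<close> and \<open>star R\<close>. In
  \<open>form_const\<close> the 2 pays for keeping half of \<open>Q\<close>, and
  \<open>c\<^sup>2\<close> for two uses of \<open>M_star\<close>.\<close>

definition threshold :: real where "threshold = 64 * (W + c)"
definition threshold' :: real where "threshold' = 32 * W * c * threshold"
definition remote :: real where "remote = c * (threshold + threshold') + 8 * c\<^sup>2 * threshold"
definition form_const :: real where "form_const = 2 * c\<^sup>2 * remote"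

lemma W_pos: "W > 0"
  using c_ge_1 unfolding W_def by (intro add_nonneg_pos) auto

lemma threshold_pos: "threshold > 0" and threshold'_pos: "threshold' > 0"
  using W_pos c_ge_1 by (auto simp: threshold_def threshold'_def)

lemma threshold_le_remote: "threshold \<le> remote"
proof -
  have "threshold * 1 \<le> c * (threshold + threshold')"
    using c_ge_1 threshold_pos threshold'_pos by (subst mult.commute) (intro mult_mono, auto)
  moreover have "0 \<le> 8 * c\<^sup>2 * threshold" using threshold_pos by simp
  ultimately show ?thesis unfolding remote_def by linarith
qed

text \<open>\<open>M\<close> is abstract; its sign comes from \<open>M_star\<close> at the singleton
  \<open>{x}\<close>.\<close>

lemma M_nonneg:
  assumes "\<And>x. x \<in> X \<Longrightarrow> f x \<ge> 0" "x \<in> X"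
  shows "M f x \<ge> 0"
proof -
  have "0 \<le> (\<Sum>y\<in>star {x}. f y)"
    using star_subset[OF singleton_in_D[OF assms(2)]] assms(1) by (intro sum_nonneg) auto
  also have "\<dots> \<le> c * M f x"
    using M_star[of f "{x}" x] assms singleton_in_D by simp
  finally show ?thesis using c_ge_1 by (simp add: zero_le_mult_iff)
qed

text \<open>Recursion over stopping sets. With \<open>t\<close> the normalized mass of
  \<open>f\<close> on \<open>star Q\<close>, the operator is at most \<open>remote * t\<close> off
  the stopping sets, and on a stopping set \<open>P\<close> it differs by at most
  \<open>remote * t\<close> from the operator localized to \<open>star P\<close>, to which the
  induction hypothesis applies. The errors of \<open>Q\<close> total \<open>remote * t\<close> times
  the mass of \<open>g\<close> and are paid by the sum of the product of the maximal functions over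
  \<open>Q - U\<close> alone. These remainders are disjoint over all generations, so nothing
  accumulates.\<close>

lemma local_form_bound:
  assumes "Q \<in> D"
  shows "norm (\<Sum>x\<in>Q. (\<Sum>y\<in>star Q. K x y * f y) * g x) \<le>
    form_const * (\<Sum>x\<in>Q. M (\<lambda>x. norm (f x)) x * M (\<lambda>x. norm (g x)) x)"
  using assms
proof (induction "card Q" arbitrary: Q rule: less_induct)
  case less
  note Q = less.prems
  define mf where "mf = M (\<lambda>x. norm (f x))"
  define mg where "mg = M (\<lambda>x. norm (g x))"
  have m0: "mf x \<ge> 0" "mg x \<ge> 0" if "x \<in> X" for x
    using M_nonneg that by (auto simp: mf_def mg_def)
  have QX: "Q \<subseteq> X" and sQX: "star Q \<subseteq> X" and QsQ: "Q \<subseteq> star Q"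
    using Q D_subset star_subset star_superset by auto
  have finQ: "finite Q" and finsQ: "finite (star Q)"
    using QX sQX finite_X finite_subset by auto
  have cQ: "real (card Q) > 0" using card_pos_D[OF Q] by simp
  have remote0: "remote \<ge> 0" using threshold_le_remote threshold_pos by linarith
  define F where "F y = (if y \<in> star Q then f y else 0)" for y
  define t where "t = (\<Sum>y\<in>star Q. norm (f y)) / card Q"
  have t0: "t \<ge> 0" unfolding t_def by (intro divide_nonneg_nonneg sum_nonneg) auto
  have TF: "T F x = (\<Sum>y\<in>star Q. K x y * f y)" for x
    unfolding T_def F_def using sQX finite_X by (intro sum.mono_neutral_cong_right) auto
  have sumF: "(\<Sum>y\<in>X. norm (F y)) = t * card Q"
    unfolding t_def F_def using sQX finite_X cQ
    by (simp, intro sum.mono_neutral_cong_right) auto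
  show ?case
  proof (cases "t = 0")
    case True
    then have "\<forall>y\<in>star Q. norm (f y) = 0"
      using cQ finsQ unfolding t_def by (subst (asm) divide_eq_0_iff) (simp add: sum_nonneg_eq_0_iff)
    then have "(\<Sum>x\<in>Q. (\<Sum>y\<in>star Q. K x y * f y) * g x) = 0" by (simp add: sum.neutral)
    moreover have "0 \<le> (\<Sum>x\<in>Q. mf x * mg x)" using m0 QX by (intro sum_nonneg mult_nonneg_nonneg) auto
    ultimately show ?thesis using remote0 by (simp add: form_const_def mf_def mg_def)
  next
    case False
    with t0 have t: "t > 0" by simp
    define Om where "Om = {x\<in>Q. norm (T F x) > threshold * t \<or> M (\<lambda>x. norm (F x)) x > threshold * t}"
    have cardO: "64 * real (card Om) \<le> card Q"
    proof -
      have a: "real (card {x\<in>X. norm (T F x) > threshold * t}) * (threshold * t) \<le> W * (t * card Q)"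
        using weak_type[of "threshold * t" F] threshold_pos t sumF by simp
      have b: "real (card {x\<in>X. M (\<lambda>x. norm (F x)) x > threshold * t}) * (threshold * t) \<le> c * (t * card Q)"
        using M_weak[of "\<lambda>x. norm (F x)" "threshold * t"] threshold_pos t sumF by simp
      have "card Om \<le> card ({x\<in>X. norm (T F x) > threshold * t} \<union> {x\<in>X. M (\<lambda>x. norm (F x)) x > threshold * t})"
        unfolding Om_def using finite_X QX by (intro card_mono) auto
      also have "\<dots> \<le> card {x\<in>X. norm (T F x) > threshold * t} + card {x\<in>X. M (\<lambda>x. norm (F x)) x > threshold * t}"
        by (rule card_Un_le)
      finally have "real (card Om) * (threshold * t) \<le> (real (card {x\<in>X. norm (T F x) > threshold * t})
          + real (card {x\<in>X. M (\<lambda>x. norm (F x)) x > threshold * t})) * (threshold * t)"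
        using threshold_pos t by (intro mult_right_mono) auto
      also have "\<dots> \<le> (W + c) * (t * card Q)" unfolding distrib_right using a b by linarith
      finally have "(64 * real (card Om)) * ((W + c) * t) \<le> card Q * ((W + c) * t)"
        by (simp add: threshold_def mult_ac)
      then show ?thesis using t W_pos c_ge_1 by (simp add: mult_le_cancel_right)
    qed
    \<comment> \<open>Stop where the exceptional set has density above 1/32. Its density in
      \<open>Q\<close> is at most 1/64, so \<open>Q\<close> itself does not stop; singletons in
      \<open>Om\<close> do, so \<open>Om\<close> is covered; and the stopping sets fill at most
      \<open>32 / 64\<close> of \<open>Q\<close>.\<close>
    define S where "S = {J\<in>D. J \<subseteq> Q \<and> 32 * card (J \<inter> Om) > card J}"
    define J where "J = maximal_sets S"
    define U where "U = \<Union>J"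
    have SD: "S \<subseteq> D" by (auto simp: S_def)
    have finS: "finite S" using SD finite_D finite_subset by blast
    have lam: "laminar S" using laminar_subset[OF laminar_D SD] .
    have JS: "J \<subseteq> S" unfolding J_def by (rule maximal_sets_subset)
    then have JD: "P \<in> D" and JQ: "P \<subseteq> Q" if "P \<in> J" for P using that by (auto simp: S_def)
    have UJ: "U = \<Union>S" unfolding U_def J_def using Union_maximal_sets[OF finS] .
    have UQ: "U \<subseteq> Q" unfolding U_def using JQ by blast
    have finJ: "finite J" using JS finS finite_subset by blast
    have finSm: "finite A" if "A \<in> S" for A using that SD finite_member by blast
    have sumJ: "(\<Sum>P\<in>J. sum h P) = sum h U" for h :: "'a \<Rightarrow> real"
      unfolding J_def UJ by (rule sum_Union_maximal[OF finS lam finSm])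
    have sumJc: "(\<Sum>P\<in>J. sum h P) = sum h U" for h :: "'a \<Rightarrow> complex"
      unfolding J_def UJ by (rule sum_Union_maximal[OF finS lam finSm])
    have QS: "Q \<notin> S"
    proof
      assume "Q \<in> S"
      moreover have "Q \<inter> Om = Om" by (auto simp: Om_def)
      ultimately have "card Q < 32 * card Om" by (simp add: S_def)
      then show False using cardO by linarith
    qed
    have OU: "Om \<subseteq> U"
    proof
      fix x assume x: "x \<in> Om"
      then have "x \<in> Q" by (simp add: Om_def)
      then have "{x} \<in> S" using x QX singleton_in_D[of x] by (auto simp: S_def)
      then show "x \<in> U" unfolding UJ by blast
    qed
    have cardU: "2 * card U \<le> card Q"
    proof -
      have "real (card U) = (\<Sum>P\<in>J. real (card P))" using sumJ[of "\<lambda>_. 1"] by simp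
      also have "\<dots> \<le> (\<Sum>P\<in>J. 32 * (\<Sum>x\<in>P. if x \<in> Om then 1 else 0))"
      proof (rule sum_mono)
        fix P assume P: "P \<in> J"
        then have "card P < 32 * card (P \<inter> Om)" using JS by (auto simp: S_def)
        moreover have "(\<Sum>x\<in>P. if x \<in> Om then 1 else 0) = real (card (P \<inter> Om))"
          using finite_member[OF JD[OF P]] by (simp flip: sum.inter_restrict)
        ultimately show "real (card P) \<le> 32 * (\<Sum>x\<in>P. if x \<in> Om then 1 else 0)" by simp
      qed
      also have "\<dots> = 32 * (\<Sum>x\<in>U. if x \<in> Om then 1 else 0)"
        by (simp flip: sum_distrib_left add: sumJ)
      also have "(\<Sum>x\<in>U. if x \<in> Om then 1 else 0) = real (card (U \<inter> Om))"
        using finite_subset[OF UQ finQ] by (simp flip: sum.inter_restrict)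
      also have "U \<inter> Om = Om" using OU by blast
      finally show ?thesis using cardO by linarith
    qed
    have near: "norm (\<Sum>y\<in>X - star P. K x y * F y) \<le> remote * t" if P: "P \<in> J" and x: "x \<in> P" for P x
    proof -
      have PD: "P \<in> D" and PQ: "P \<subseteq> Q" and PnQ: "P \<noteq> Q" using JD JQ JS P QS by auto
      have "P \<noteq> X" using PQ PnQ QX by blast
      then obtain R0 where R0: "R0 \<in> D" "P \<subset> R0" "card R0 \<le> 8 * card P" using parent[OF PD] by blast
      \<comment> \<open>If the parent leaves \<open>Q\<close>, laminarity puts \<open>Q\<close>
        inside it, and \<open>Q\<close> serves instead: it contains \<open>P\<close> strictly and
        does not stop either.\<close>
      obtain R where R: "R \<in> D" "P \<subset> R" "card R \<le> 8 * card P" "R \<subseteq> Q"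
      proof (cases "R0 \<subseteq> Q")
        case True then show ?thesis using R0 that by blast
      next
        case False
        have "R0 \<inter> Q \<noteq> {}" using R0 PQ D_nonempty[OF PD] by blast
        then have "Q \<subseteq> R0" using False laminar_D R0(1) Q unfolding laminar_def by metis
        then have "card Q \<le> card R0" using finite_member[OF R0(1)] card_mono by blast
        then show ?thesis using that[OF Q] PQ PnQ R0 by auto
      qed
      have "R \<notin> S" using P R(2) unfolding J_def maximal_sets_def by blast
      then have RO: "32 * card (R \<inter> Om) \<le> card R" using R by (simp add: S_def)
      have finR: "finite R" using R finite_member by blast
      have cR: "card R > 0" using card_pos_D R by blast
      have "\<not> R \<subseteq> Om"
      proof
        assume "R \<subseteq> Om"
        then have "R \<inter> Om = R" by blast
        then show False using RO cR by simp
      qed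
      then obtain x0 where x0: "x0 \<in> R" "x0 \<notin> Om" by blast
      then have Mx0: "M (\<lambda>x. norm (F x)) x0 \<le> threshold * t" using R by (auto simp: Om_def)
      have sR: "star R \<subseteq> star Q" "star R \<subseteq> X" "star P \<subseteq> star R"
        using star_mono R Q PD star_subset by auto
      have sumR: "(\<Sum>y\<in>star R. norm (F y)) \<le> c * card R * (threshold * t)"
      proof -
        have "(\<Sum>y\<in>star R. norm (F y)) \<le> c * card R * M (\<lambda>x. norm (F x)) x0"
          using M_star[of "\<lambda>x. norm (F x)" R x0] R x0 by simp
        also have "\<dots> \<le> c * card R * (threshold * t)"
          using Mx0 c_ge_1 by (intro mult_left_mono) auto
        finally show ?thesis .
      qed
      define G where "G y = (if y \<in> star R then F y else 0)" for y
      have sumG: "(\<Sum>y\<in>X. norm (G y)) = (\<Sum>y\<in>star R. norm (F y))"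
        unfolding G_def using sR finite_X by (intro sum.mono_neutral_cong_right) auto
      have TG: "T G x = (\<Sum>y\<in>star R. K x y * F y)" for x
        unfolding T_def G_def using sR finite_X by (intro sum.mono_neutral_cong_right) auto
      have TF_split: "T F x = (\<Sum>y\<in>X - star R. K x y * F y) + T G x" for x
        unfolding TG unfolding T_def by (rule sum.subset_diff[OF sR(2) finite_X])
      \<comment> \<open>On \<open>E\<close> the far part is a difference of two controlled terms.
        Outside \<open>E\<close> lie \<open>R \<inter> Om\<close> and a level set of
        \<open>T G\<close>, at most 1/32 of \<open>R\<close> each, which is the sixteenth that
        \<open>far_part_remez\<close> tolerates.\<close>
      define E where "E = {x\<in>R. x \<notin> Om \<and> norm (T G x) \<le> threshold' * t}"
      have "16 * card (R - E) \<le> card R"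
      proof -
        have "real (card {x\<in>X. norm (T G x) > threshold' * t}) * (threshold' * t) \<le> W * (\<Sum>y\<in>star R. norm (F y))"
          using weak_type[of "threshold' * t" G] threshold'_pos t sumG by simp
        also have "\<dots> \<le> W * (c * card R * (threshold * t))" using sumR W_pos by (intro mult_left_mono) auto
        finally have "(32 * real (card {x\<in>X. norm (T G x) > threshold' * t})) * (W * c * threshold * t)
            \<le> card R * (W * c * threshold * t)" by (simp add: threshold'_def mult_ac)
        moreover have "W * c * threshold * t > 0" using W_pos c_ge_1 threshold_pos t by auto
        ultimately have *: "32 * card {x\<in>X. norm (T G x) > threshold' * t} \<le> card R"
          by (simp add: mult_le_cancel_right)
        have "R \<subseteq> X" using R D_subset by blast
        then have "card (R - E) \<le> card ((R \<inter> Om) \<union> {x\<in>X. norm (T G x) > threshold' * t})"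
          using finite_X finR by (intro card_mono) (auto simp: E_def)
        also have "\<dots> \<le> card (R \<inter> Om) + card {x\<in>X. norm (T G x) > threshold' * t}" by (rule card_Un_le)
        finally show ?thesis using * RO by linarith
      qed
      moreover have "norm (\<Sum>y\<in>X - star R. K x y * F y) \<le> (threshold + threshold') * t" if x: "x \<in> E" for x
      proof -
        have "norm (T F x) \<le> threshold * t" "norm (T G x) \<le> threshold' * t"
          using x R by (auto simp: E_def Om_def)
        moreover have "(\<Sum>y\<in>X - star R. K x y * F y) = T F x - T G x" using TF_split[of x] by simp
        ultimately show ?thesis
          using norm_triangle_ineq4[of "T F x" "T G x"] by (simp add: distrib_right)
      qed
      moreover have "M (\<lambda>x. norm (F x)) x0 \<le> (threshold + threshold') * t"
        using Mx0 threshold'_pos t by (simp add: distrib_right add_increasing2)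
      moreover have "E \<subseteq> R" by (auto simp: E_def)
      ultimately have "\<forall>x\<in>R. norm (\<Sum>y\<in>X - star R. K x y * F y) \<le> c * ((threshold + threshold') * t)"
        using far_part_remez[OF R(1) x0(1)] by blast
      then have 1: "norm (\<Sum>y\<in>X - star R. K x y * F y) \<le> c * ((threshold + threshold') * t)"
        using x R(2) by blast
      have 2: "norm (\<Sum>y\<in>star R - star P. K x y * F y) \<le> 8 * c\<^sup>2 * threshold * t"
      proof -
        have cP: "real (card P) > 0" using card_pos_D[OF PD] by simp
        have "norm (\<Sum>y\<in>star R - star P. K x y * F y) * card P
            \<le> (\<Sum>y\<in>star R - star P. norm (K x y) * norm (F y)) * card P"
          by (intro mult_right_mono sum_norm_le) (auto simp: norm_mult)
        also have "\<dots> = (\<Sum>y\<in>star R - star P. (norm (K x y) * card P) * norm (F y))"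
          by (subst sum_distrib_right, rule sum.cong) (simp_all add: mult_ac)
        also have "\<dots> \<le> (\<Sum>y\<in>star R - star P. c * norm (F y))"
          using kernel_size[OF PD x] sR by (intro sum_mono mult_right_mono) auto
        also have "\<dots> \<le> (\<Sum>y\<in>star R. c * norm (F y))"
          using c_ge_1 finite_subset[OF sR(2) finite_X] by (intro sum_mono2) auto
        also have "\<dots> = c * (\<Sum>y\<in>star R. norm (F y))" by (simp add: sum_distrib_left)
        also have "\<dots> \<le> c * (c * card R * (threshold * t))" using sumR c_ge_1 by (intro mult_left_mono) auto
        also have "\<dots> = (c\<^sup>2 * threshold * t) * card R" by (simp add: power2_eq_square mult_ac)
        also have "\<dots> \<le> (c\<^sup>2 * threshold * t) * (8 * card P)"
          using R(3) c_ge_1 threshold_pos t by (intro mult_left_mono) (auto simp flip: of_nat_mult)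
        finally have "norm (\<Sum>y\<in>star R - star P. K x y * F y) * card P \<le> (8 * c\<^sup>2 * threshold * t) * card P"
          by (simp add: mult_ac)
        then show ?thesis using cP by simp
      qed
      have "(\<Sum>y\<in>X - star P. K x y * F y) =
          (\<Sum>y\<in>X - star R. K x y * F y) + (\<Sum>y\<in>star R - star P. K x y * F y)"
      proof -
        have "X - star P = (X - star R) \<union> (star R - star P)" using sR by blast
        moreover have "(X - star R) \<inter> (star R - star P) = {}" by blast
        ultimately show ?thesis
          using finite_X finite_subset[OF sR(2) finite_X] by (simp add: sum.union_disjoint)
      qed
      then have "norm (\<Sum>y\<in>X - star P. K x y * F y) \<le> c * ((threshold + threshold') * t) + 8 * c\<^sup>2 * threshold * t"
        using 1 2 norm_triangle_ineq[of "\<Sum>y\<in>X - star R. K x y * F y" "\<Sum>y\<in>star R - star P. K x y * F y"]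
        by simp
      also have "\<dots> = remote * t" by (simp add: remote_def algebra_simps)
      finally show ?thesis .
    qed
    have stop: "norm (\<Sum>x\<in>P. T F x * g x) \<le>
        form_const * (\<Sum>x\<in>P. mf x * mg x) + remote * t * (\<Sum>x\<in>P. norm (g x))" if P: "P \<in> J" for P
    proof -
      have PD: "P \<in> D" and PQ: "P \<subset> Q" using JD JQ JS P QS by auto
      have sP: "star P \<subseteq> X" "star P \<subseteq> star Q" using star_subset star_mono PD Q PQ by auto
      have IH: "norm (\<Sum>x\<in>P. (\<Sum>y\<in>star P. K x y * f y) * g x) \<le> form_const * (\<Sum>x\<in>P. mf x * mg x)"
        unfolding mf_def mg_def using less.hyps[OF psubset_card_mono[OF finQ PQ] PD] .
      have "T F x = (\<Sum>y\<in>star P. K x y * f y) + (\<Sum>y\<in>X - star P. K x y * F y)" for x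
      proof -
        have "T F x = (\<Sum>y\<in>X - star P. K x y * F y) + (\<Sum>y\<in>star P. K x y * F y)"
          unfolding T_def by (rule sum.subset_diff[OF sP(1) finite_X])
        moreover have "(\<Sum>y\<in>star P. K x y * F y) = (\<Sum>y\<in>star P. K x y * f y)"
          using sP by (intro sum.cong) (auto simp: F_def)
        ultimately show ?thesis by simp
      qed
      then have "(\<Sum>x\<in>P. T F x * g x) = (\<Sum>x\<in>P. (\<Sum>y\<in>star P. K x y * f y) * g x)
          + (\<Sum>x\<in>P. (\<Sum>y\<in>X - star P. K x y * F y) * g x)"
        by (simp add: distrib_right sum.distrib)
      moreover have "norm (\<Sum>x\<in>P. (\<Sum>y\<in>X - star P. K x y * F y) * g x) \<le> (\<Sum>x\<in>P. remote * t * norm (g x))"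
        using near[OF P] by (intro sum_norm_le) (simp add: norm_mult mult_right_mono)
      ultimately show ?thesis
        using IH norm_triangle_ineq[of "\<Sum>x\<in>P. (\<Sum>y\<in>star P. K x y * f y) * g x"
            "\<Sum>x\<in>P. (\<Sum>y\<in>X - star P. K x y * F y) * g x"]
        by (simp add: sum_distrib_left)
    qed
    have "norm (\<Sum>x\<in>U. T F x * g x) \<le> (\<Sum>P\<in>J. norm (\<Sum>x\<in>P. T F x * g x))"
      unfolding sumJc[symmetric] by (rule norm_sum)
    also have "\<dots> \<le> (\<Sum>P\<in>J. form_const * (\<Sum>x\<in>P. mf x * mg x) + remote * t * (\<Sum>x\<in>P. norm (g x)))"
      using stop by (rule sum_mono)
    also have "\<dots> = form_const * (\<Sum>x\<in>U. mf x * mg x) + remote * t * (\<Sum>x\<in>U. norm (g x))"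
      by (simp add: sum.distrib flip: sum_distrib_left sumJ)
    finally have onU: "norm (\<Sum>x\<in>U. T F x * g x) \<le>
        form_const * (\<Sum>x\<in>U. mf x * mg x) + remote * t * (\<Sum>x\<in>U. norm (g x))" .
    have offU: "norm (\<Sum>x\<in>Q - U. T F x * g x) \<le> remote * t * (\<Sum>x\<in>Q - U. norm (g x))"
      unfolding sum_distrib_left
    proof (rule sum_norm_le)
      fix x assume x: "x \<in> Q - U"
      then have "norm (T F x) \<le> threshold * t" using OU by (auto simp: Om_def)
      also have "\<dots> \<le> remote * t" using threshold_le_remote t by (intro mult_right_mono) auto
      finally show "norm (T F x * g x) \<le> remote * t * norm (g x)"
        by (simp add: norm_mult mult_right_mono)
    qed
    have split: "sum h Q = sum h (Q - U) + sum h U" for h :: "'a \<Rightarrow> 'z::comm_monoid_add"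
      using sum.subset_diff[OF UQ finQ] .
    \<comment> \<open>At every point of \<open>Q\<close> the value \<open>t\<close> is at most
      \<open>c * mf x\<close> and the average of \<open>norm (g x)\<close> at most
      \<open>c * mg x\<close>. Summing over \<open>Q - U\<close> only costs a factor 2, because
      \<open>U\<close> is at most half of \<open>Q\<close>.\<close>
    have main: "t * (\<Sum>x\<in>Q. norm (g x)) \<le> 2 * c\<^sup>2 * (\<Sum>x\<in>Q - U. mf x * mg x)"
    proof -
      let ?G = "\<Sum>x\<in>Q. norm (g x)"
      have "t * ?G \<le> c\<^sup>2 * card Q * (mf x * mg x)" if x: "x \<in> Q" for x
      proof -
        have a: "t \<le> c * mf x"
          using M_star[of "\<lambda>x. norm (f x)" Q x] Q x cQ by (simp add: t_def mf_def pos_divide_le_eq mult_ac)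
        have "?G \<le> (\<Sum>x\<in>star Q. norm (g x))" using QsQ finsQ by (intro sum_mono2) auto
        also have "\<dots> \<le> c * card Q * mg x"
          using M_star[of "\<lambda>x. norm (g x)" Q x] Q x by (simp add: mg_def)
        finally have "t * ?G \<le> (c * mf x) * (c * card Q * mg x)"
          using a t0 m0(1)[of x] x QX c_ge_1 by (intro mult_mono) (auto intro: sum_nonneg)
        then show ?thesis by (simp add: power2_eq_square mult_ac)
      qed
      then have "(\<Sum>x\<in>Q - U. t * ?G) \<le> (\<Sum>x\<in>Q - U. c\<^sup>2 * card Q * (mf x * mg x))"
        by (intro sum_mono) auto
      then have 1: "real (card (Q - U)) * (t * ?G) \<le> c\<^sup>2 * card Q * (\<Sum>x\<in>Q - U. mf x * mg x)"
        by (simp add: sum_distrib_left)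
      have "card (Q - U) = card Q - card U" using UQ finQ by (meson card_Diff_subset finite_subset)
      then have "real (card Q) / 2 \<le> real (card (Q - U))" using cardU by linarith
      then have "real (card Q) / 2 * (t * ?G) \<le> real (card (Q - U)) * (t * ?G)"
        using t0 by (intro mult_right_mono mult_nonneg_nonneg sum_nonneg) auto
      with 1 have "(t * ?G) * card Q \<le> (2 * c\<^sup>2 * (\<Sum>x\<in>Q - U. mf x * mg x)) * card Q"
        by (simp add: mult_ac)
      then show ?thesis using cQ by simp
    qed
    have "norm (\<Sum>x\<in>Q. T F x * g x) \<le> norm (\<Sum>x\<in>Q - U. T F x * g x) + norm (\<Sum>x\<in>U. T F x * g x)"
      unfolding split by (rule norm_triangle_ineq)
    also have "\<dots> \<le> form_const * (\<Sum>x\<in>U. mf x * mg x) + remote * (t * (\<Sum>x\<in>Q. norm (g x)))"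
      using onU offU split[of "\<lambda>x. norm (g x)"] by (simp add: distrib_left mult_ac)
    also have "\<dots> \<le> form_const * (\<Sum>x\<in>U. mf x * mg x) + remote * (2 * c\<^sup>2 * (\<Sum>x\<in>Q - U. mf x * mg x))"
      using main remote0 by (intro add_left_mono mult_left_mono)
    also have "\<dots> = form_const * (\<Sum>x\<in>Q. mf x * mg x)"
      unfolding split[of "\<lambda>x. mf x * mg x"] by (simp add: form_const_def distrib_left mult_ac)
    finally show ?thesis unfolding TF mf_def mg_def .
  qed
qed

theorem form_bound:
  "norm (\<Sum>x\<in>X. (\<Sum>y\<in>X. K x y * f y) * g x) \<le>
    form_const * (\<Sum>x\<in>X. M (\<lambda>x. norm (f x)) x * M (\<lambda>x. norm (g x)) x)"
proof -
  have "star X = X" using star_subset[OF X_in_D] star_superset[OF X_in_D] by blast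
  then show ?thesis using local_form_bound[OF X_in_D, of f g] by simp
qed

end

section \<open>Weights and maximal functions on trees\<close>

context prob_space
begin

definition ih :: "('a \<Rightarrow> real) \<Rightarrow> 'a set \<Rightarrow> real" where
  "ih h B = (LINT x|M. indicator B x * h x)"

lemma integrable_ih: "integrable M h \<Longrightarrow> B \<in> sets M \<Longrightarrow> integrable M (\<lambda>x. indicator B x * h x :: real)"
  using integrable_mult_indicator[of B M h] by simp

lemma ih_cong: "(\<And>x. x \<in> B \<Longrightarrow> h x = h' x) \<Longrightarrow> ih h B = ih h' B"
  unfolding ih_def by (intro Bochner_Integration.integral_cong) (auto simp: indicator_def)

lemma ih_mono:
  assumes "integrable M h" "integrable M h'" "B \<in> sets M" "\<And>x. x \<in> B \<Longrightarrow> h x \<le> h' x"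
  shows "ih h B \<le> ih h' B"
  unfolding ih_def using assms by (intro integral_mono integrable_ih) (auto simp: indicator_def)

lemma ih_mono_set:
  assumes "integrable M h" "B \<in> sets M" "B' \<in> sets M" "B \<subseteq> B'" "\<And>x. x \<in> B' \<Longrightarrow> h x \<ge> 0"
  shows "ih h B \<le> ih h B'"
  unfolding ih_def using assms by (intro integral_mono integrable_ih) (auto simp: indicator_def)

lemma ih_nonneg: "(\<And>x. x \<in> B \<Longrightarrow> h x \<ge> 0) \<Longrightarrow> ih h B \<ge> 0"
  unfolding ih_def by (intro integral_nonneg_AE) (auto simp: indicator_def)

lemma ih_const: "B \<in> sets M \<Longrightarrow> ih (\<lambda>_. k) B = k * prob B"
  unfolding ih_def by simp

lemma ih_cmult: "ih (\<lambda>x. k * h x) B = k * ih h B"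
  unfolding ih_def by (simp add: mult.left_commute[of _ k])

lemma ih_add:
  assumes "integrable M h" "integrable M h'" "B \<in> sets M"
  shows "ih (\<lambda>x. h x + h' x) B = ih h B + ih h' B"
  unfolding ih_def distrib_left using assms by (intro Bochner_Integration.integral_add integrable_ih)

lemma ih_affine:
  assumes "integrable M h" "integrable M h'" "B \<in> sets M"
  shows "ih (\<lambda>x. k * h x + l * h' x) B = k * ih h B + l * ih h' B"
  using assms by (subst ih_add) (simp_all only: ih_cmult integrable_mult_right)

lemma ih_affine_const:
  assumes "integrable M h" "B \<in> sets M"
  shows "ih (\<lambda>x. k + l * h x) B = k * prob B + l * ih h B"
  using ih_affine[of "\<lambda>_. 1" h B k l] assms ih_const[of B 1] by simp

lemma ih_Union:
  assumes "integrable M h" "finite S" "\<And>A. A \<in> S \<Longrightarrow> A \<in> sets M"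
    "\<And>A B. A \<in> S \<Longrightarrow> B \<in> S \<Longrightarrow> A \<noteq> B \<Longrightarrow> A \<inter> B = {}"
  shows "ih h (\<Union>S) = (\<Sum>A\<in>S. ih h A)"
proof -
  have "indicator (\<Union>S) x = (\<Sum>A\<in>S. indicator A x :: real)" for x
    using indicator_UN_disjoint[OF assms(2), of id x] assms(4) by (auto simp: disjoint_family_on_def)
  then have "ih h (\<Union>S) = (LINT x|M. (\<Sum>A\<in>S. indicator A x * h x))"
    unfolding ih_def by (simp only: sum_distrib_right)
  also have "\<dots> = (\<Sum>A\<in>S. ih h A)"
    unfolding ih_def using assms by (intro Bochner_Integration.integral_sum integrable_ih)
  finally show ?thesis .
qed

lemma ih_Un:
  assumes "integrable M h" "A \<in> sets M" "B \<in> sets M" "A \<inter> B = {}"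
  shows "ih h (A \<union> B) = ih h A + ih h B"
  using assms by (cases "A = B") (use ih_Union[of h "{A, B}"] in \<open>auto simp: ih_def\<close>)

end

section \<open>Weights \<open>t powr a x\<close> for a pair of conjugate exponents\<close>

lemma young_le:
  fixes u v :: real
  assumes "a > 1" "b > 1" "1/a + 1/b = 1" "u \<ge> 0" "v \<ge> 0"
  shows "u * v \<le> u powr a + v powr b"
proof -
  have "u powr a / a \<le> u powr a / 1" "v powr b / b \<le> v powr b / 1"
    using assms by (intro divide_left_mono; simp)+
  then show ?thesis using Youngs_inequality[OF assms] by simp
qed

text \<open>The bounds hold at every point rather than almost everywhere, which avoids null sets
  throughout; the final theorem gets there by truncating the exponent. Of the exponents only the
  common bound \<open>q\<close> enters the constants.\<close>

locale exponent_pair = prob_space M for M :: "'a measure" +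
  fixes a b :: "'a \<Rightarrow> real" and q :: real
  assumes measurable_a: "a \<in> borel_measurable M" and measurable_b: "b \<in> borel_measurable M"
    and a_gt_1: "\<And>x. a x > 1" and a_le: "\<And>x. a x \<le> q"
    and b_gt_1: "\<And>x. b x > 1" and b_le: "\<And>x. b x \<le> q"
    and conj_ab: "\<And>x. 1 / a x + 1 / b x = 1"
begin

lemma dual: "exponent_pair M b a q"
  using measurable_a measurable_b a_gt_1 a_le b_gt_1 b_le conj_ab
  by unfold_locales (auto simp: add.commute)

lemma q_gt_1: "q > 1" using a_gt_1 a_le by (meson less_le_trans)

lemma young: "u \<ge> 0 \<Longrightarrow> v \<ge> 0 \<Longrightarrow> u * v \<le> u powr a x + v powr b x"
  using young_le a_gt_1 b_gt_1 conj_ab by blast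

lemma ab: "a x * (b x - 1) = b x"
proof -
  have "a x > 1" "b x > 1" using a_gt_1 b_gt_1 by auto
  then show ?thesis using conj_ab[of x] by (simp add: field_simps)
qed

lemma powr_le_max:
  assumes "0 \<le> t" "0 \<le> e" "e \<le> q"
  shows "t powr e \<le> (max 1 t) powr q"
  using assms by (smt (verit) powr_mono powr_mono2)

lemma integrable_powr_const [simp, intro]:
  assumes "0 \<le> t"
  shows "integrable M (\<lambda>x. t powr a x)" "integrable M (\<lambda>x. t powr b x)"
proof -
  have 1: "0 \<le> a x" "0 \<le> b x" for x using a_gt_1[of x] b_gt_1[of x] by auto
  show "integrable M (\<lambda>x. t powr a x)"
    using measurable_a powr_le_max[OF assms 1(1) a_le]
    by (intro integrable_const_bound[where B="(max 1 t) powr q"]) auto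
  show "integrable M (\<lambda>x. t powr b x)"
    using measurable_b powr_le_max[OF assms 1(2) b_le]
    by (intro integrable_const_bound[where B="(max 1 t) powr q"]) auto
qed

text \<open>The modular of \<open>t\<close> times the indicator of the set, with
  \<open>dmass\<close> for the dual exponent; so \<open>mass (1 / l) I \<le> 1\<close> implies that
  the norm of the indicator is at most \<open>l\<close>.\<close>

definition mass :: "real \<Rightarrow> 'a set \<Rightarrow> real" where "mass t = ih (\<lambda>x. t powr a x)"
definition dmass :: "real \<Rightarrow> 'a set \<Rightarrow> real" where "dmass t = ih (\<lambda>x. t powr b x)"

text \<open>
  With \<open>T = 1 / \<parallel>\<chi>\<^sub>I\<parallel>\<close> this is the Muckenhoupt-type condition on \<open>I\<close> up to constants, in a form that is
  symmetric in the two exponents.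
\<close>

definition balanced :: "real \<Rightarrow> 'a set \<Rightarrow> bool" where
  "balanced C I \<longleftrightarrow> I \<in> sets M \<and> prob I > 0 \<and>
    (\<exists>T>0. \<exists>S>0. T * S * prob I = 1 \<and> mass T I \<le> C \<and> dmass S I \<le> C)"

lemma mass_nonneg: "mass t I \<ge> 0"
  unfolding mass_def by (auto intro: ih_nonneg)

lemma mass_one: "I \<in> sets M \<Longrightarrow> mass 1 I = prob I" "I \<in> sets M \<Longrightarrow> dmass 1 I = prob I"
  unfolding mass_def dmass_def using ih_const[of I 1] by (auto simp: ih_def)

lemma mass_ge_prob:
  assumes "I \<in> sets M" "t \<ge> 1"
  shows "t * prob I \<le> mass t I"
proof -
  have "ih (\<lambda>_. t) I \<le> mass t I"
    unfolding mass_def using assms a_gt_1 powr_mono[of 1 "a _" t]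
    by (intro ih_mono) (auto simp: less_imp_le)
  then show ?thesis by (simp add: ih_const[OF assms(1)])
qed

text \<open>The summand 1 covers \<open>t = 1\<close>, the second one \<open>t \<le> T\<close>, and
  1 with the third \<open>t > T\<close> in \<open>dual_mass_le\<close>.\<close>

definition jensen_const :: "real \<Rightarrow> real \<Rightarrow> real" where
  "jensen_const C d = 1 + 2 powr q * (1 + C powr q * C)
     + ((16 * C * (d + 1)) powr q * C) powr q * C"

lemma jensen_const_ge_1: "C \<ge> 1 \<Longrightarrow> jensen_const C d \<ge> 1"
  unfolding jensen_const_def by (simp add: add_increasing2)

text \<open>
  The dual weight at the level \<open>s = W / t\<close>, where \<open>W\<close> is the average of \<open>t powr a\<close>, has mass
  comparable to the weight at level \<open>t\<close>. For levels below \<open>T\<close> one writes \<open>t = T powr \<theta>\<close> with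
  \<open>\<theta> \<le> 1\<close> and uses that the condition at \<open>T\<close> is inherited by powers smaller than one of the weight.
\<close>

lemma dual_mass_le:
  assumes I: "balanced C I" and C: "C \<ge> 1" and d: "d \<ge> 0" and t: "t \<ge> 1" and td: "mass t I \<le> d"
  shows "dmass (mass t I / prob I / t) I \<le> jensen_const C d * mass t I"
proof -
  obtain T S where I: "I \<in> sets M" and mpos: "prob I > 0" and T: "T > 0" and S: "S > 0"
    and TS: "T * S * prob I = 1" and mT: "mass T I \<le> C" and mS: "dmass S I \<le> C"
    using I unfolding balanced_def by blast
  define m where "m = prob I"
  define Wt where "Wt = mass t I / m"
  have m: "m > 0" using mpos m_def by simp
  have mass_t: "mass t I = Wt * m" using m by (simp add: Wt_def)
  have Wt: "Wt \<ge> 1"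
  proof -
    have "1 * m \<le> t * m" using t m by (intro mult_right_mono) auto
    then have "m \<le> mass t I" using mass_ge_prob[OF I t] unfolding m_def by linarith
    then show ?thesis using m by (simp add: Wt_def)
  qed
  have b1: "0 \<le> b x - 1" "b x - 1 \<le> q" "0 \<le> a x" "0 \<le> b x" for x
    using a_gt_1[of x] b_gt_1[of x] b_le[of x] by auto
  text \<open>Everything is reduced to a pointwise bound of the dual weight by its model at \<open>S\<close>.\<close>
  have key: "dmass (Wt / t) I \<le> L * (1 + L' * C) * mass t I"
    if "\<And>x. (Wt / t powr a x) powr (b x - 1) \<le> L * (1 + L' * (m * S powr b x))" "L \<ge> 0" "L' \<ge> 0" for L L'
  proof -
    have "(Wt / t) powr b x \<le> Wt * (L * (1 + L' * (m * S powr b x)))" for x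
    proof -
      have "(Wt / t) powr b x = Wt * (Wt / t powr a x) powr (b x - 1)"
      proof -
        have "(Wt / t powr a x) powr (b x - 1) = Wt powr (b x - 1) / t powr b x"
          by (simp add: powr_divide powr_powr ab)
        moreover have "Wt * Wt powr (b x - 1) = Wt powr b x"
          using Wt powr_add[of Wt 1 "b x - 1"] by simp
        moreover have "(Wt / t) powr b x = Wt powr b x / t powr b x" by (rule powr_divide)
        ultimately show ?thesis by (metis times_divide_eq_right)
      qed
      then show ?thesis using that(1)[of x] Wt by (simp add: mult_left_mono)
    qed
    then have "dmass (Wt / t) I \<le> ih (\<lambda>x. Wt * (L * (1 + L' * (m * S powr b x)))) I"
      unfolding dmass_def using I Wt t S
      by (intro ih_mono) (auto intro!: integrable_mult_right Bochner_Integration.integrable_add)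
    also have "\<dots> = Wt * (L * (m + L' * (m * dmass S I)))"
      unfolding ih_cmult dmass_def m_def
      using ih_affine_const[of "\<lambda>x. prob I * S powr b x" I 1 L'] I S by (simp add: ih_cmult)
    also have "\<dots> \<le> Wt * (L * (m + L' * (m * C)))"
      using Wt that(2,3) m mS by (intro mult_left_mono add_left_mono) auto
    finally show ?thesis by (simp add: mass_t algebra_simps)
  qed
  \<comment> \<open>The link between the two weights: \<open>T * S * m = 1\<close> and
    \<open>a * (b - 1) = b\<close> turn the dual weight at \<open>S\<close> into a power of the
    weight at \<open>T\<close>.\<close>
  have mSb: "(1 / (m * T powr a x)) powr (b x - 1) = m * S powr b x" for x
  proof -
    have S_eq: "S = 1 / (m * T)" using TS T m by (simp add: m_def field_simps)
    have "m powr (1 - b x) = m / m powr b x" using m by (simp add: powr_diff)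
    then have "m * S powr b x = m powr (1 - b x) / T powr b x"
      by (simp add: S_eq powr_divide powr_mult)
    also have "\<dots> = (1 / (m * T powr a x)) powr (b x - 1)"
      using powr_minus_divide[of m "b x - 1"] by (simp add: powr_divide powr_mult powr_powr ab)
    finally show ?thesis by simp
  qed
  have powrq: "y powr (b x - 1) \<le> y powr q" if "y \<ge> 1" for x y
    using that b1 by (intro powr_mono) auto
  have J: "jensen_const C d \<ge> 1" "2 powr q * (1 + C powr q * C) \<le> jensen_const C d"
    "((16 * C * (d + 1)) powr q * C) powr q * C \<le> jensen_const C d"
    using C by (auto simp: jensen_const_def add_increasing2 add_increasing)
  have "dmass (Wt / t) I \<le> jensen_const C d * mass t I"
  proof (cases "t = 1")
    case True
    then have "Wt = 1" using mass_one(1)[OF I] m by (simp add: Wt_def m_def)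
    then have "dmass (Wt / t) I = mass t I" using mass_one[OF I] True by simp
    then show ?thesis using mult_right_mono[OF J(1) mass_nonneg[of t I]] by simp
  next
    case t1: False
    show ?thesis
    proof (cases "t \<le> T")
      case True
      define \<theta> where "\<theta> = ln t / ln T"
      have lnT: "ln t > 0" "ln T > 0" "ln t \<le> ln T" using t t1 True by auto
      then have \<theta>: "0 \<le> \<theta>" "\<theta> \<le> 1" by (auto simp: \<theta>_def)
      have tT: "t = T powr \<theta>" using lnT T t by (simp add: powr_def \<theta>_def)
      have powr_theta: "y powr \<theta> \<le> 1 + y" if "y \<ge> 0" for y
      proof (cases "y \<le> 1")
        case True then show ?thesis using powr_le1[of \<theta> y] \<theta> that by simp
      next
        case False then show ?thesis using powr_mono[of \<theta> 1 y] \<theta> by simp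
      qed
      \<comment> \<open>The crude \<open>y powr \<theta> \<le> 1 + y\<close>, scaled so that
        \<open>y\<close> has average at most 1, stands in for Jensen's inequality for the concave
        power.\<close>
      have W2: "Wt \<le> 2 * (C / m) powr \<theta>"
      proof -
        have "t powr a x \<le> (C / m) powr \<theta> * (1 + m / C * T powr a x)" for x
        proof -
          have "t powr a x = (C / m) powr \<theta> * (m / C * T powr a x) powr \<theta>"
            using C m by (simp add: tT powr_powr mult.commute flip: powr_mult)
          also have "\<dots> \<le> (C / m) powr \<theta> * (1 + m / C * T powr a x)"
            using powr_theta[of "m / C * T powr a x"] C m by (intro mult_left_mono) auto
          finally show ?thesis .
        qed
        then have "mass t I \<le> ih (\<lambda>x. (C / m) powr \<theta> * (1 + m / C * T powr a x)) I"
          unfolding mass_def using I t T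
          by (intro ih_mono) (auto intro!: integrable_mult_right Bochner_Integration.integrable_add)
        also have "\<dots> = (C / m) powr \<theta> * (m + m / C * mass T I)"
          unfolding ih_cmult mass_def m_def
          using ih_affine_const[of "\<lambda>x. T powr a x" I 1 "prob I / C"] I T by simp
        also have "\<dots> \<le> (C / m) powr \<theta> * (m + m / C * C)"
          using mT C m by (intro mult_left_mono add_left_mono) auto
        finally show ?thesis using m C by (simp add: Wt_def field_simps)
      qed
      have "(Wt / t powr a x) powr (b x - 1) \<le> 2 powr q * (1 + C powr q * (m * S powr b x))" for x
      proof -
        have "Wt / t powr a x \<le> 2 * (C / m) powr \<theta> / t powr a x"
          using W2 by (intro divide_right_mono) auto
        also have "\<dots> = 2 * (C * (1 / (m * T powr a x))) powr \<theta>"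
          using m T C by (simp add: tT powr_powr powr_divide powr_mult mult.commute)
        finally have "(Wt / t powr a x) powr (b x - 1)
            \<le> (2 * (C * (1 / (m * T powr a x))) powr \<theta>) powr (b x - 1)"
          using Wt b1 by (intro powr_mono2) auto
        also have "\<dots> = 2 powr (b x - 1) * (C powr (b x - 1) * (m * S powr b x)) powr \<theta>"
          unfolding mSb[symmetric] powr_mult by (simp add: powr_powr mult.commute)
        also have "\<dots> \<le> 2 powr (b x - 1) * (1 + C powr (b x - 1) * (m * S powr b x))"
          using powr_theta m by (intro mult_left_mono) auto
        also have "\<dots> \<le> 2 powr q * (1 + C powr q * (m * S powr b x))"
          using powrq[of 2 x] powrq[OF C, of x] m by (intro mult_mono add_left_mono mult_right_mono) auto
        finally show ?thesis .
      qed
      from key[OF this] have "dmass (Wt / t) I \<le> 2 powr q * (1 + C powr q * C) * mass t I" by simp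
      also have "\<dots> \<le> jensen_const C d * mass t I"
        using J(2) mass_nonneg by (rule mult_right_mono)
      finally show ?thesis .
    next
      case False
      \<comment> \<open>The bound \<open>d\<close> on the mass keeps \<open>t\<close> within a
        constant of \<open>T\<close>: were \<open>t\<close> above \<open>k * T\<close>, Young's
        inequality with weight \<open>e\<close> would integrate to
        \<open>1 = T * S * m \<le> 1/4 + 1/4\<close>.\<close>
      define k where "k = 16 * C * (d + 1)"
      have k: "k \<ge> 1" using C d mult_mono[of 1 C 1 "d + 1"] by (simp add: k_def)
      have tk: "t \<le> k * T"
      proof (rule ccontr)
        assume "\<not> t \<le> k * T"
        then have kT: "k * T \<le> t" by simp
        define e where "e = 1 / (4 * C)"
        have e: "0 < e" "e \<le> 1" using C by (auto simp: e_def)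
        have ke: "k * e = 4 * (d + 1)" using C by (simp add: k_def e_def)
        have "T * S \<le> t powr a x / (4 * (d + 1)) + e * S powr b x" for x
        proof -
          have "T / e \<le> t / (4 * (d + 1))"
            using kT e d unfolding ke[symmetric] using k by (simp add: field_simps)
          then have "(T / e) powr a x \<le> (t / (4 * (d + 1))) powr a x"
            using T e b1 by (intro powr_mono2) auto
          also have "\<dots> = t powr a x / (4 * (d + 1)) powr a x" by (rule powr_divide)
          also have "\<dots> \<le> t powr a x / (4 * (d + 1)) powr 1"
            using d a_gt_1[of x] by (intro divide_left_mono powr_mono) auto
          finally have 1: "(T / e) powr a x \<le> t powr a x / (4 * (d + 1))" using d by simp
          have "(e * S) powr b x = e powr b x * S powr b x" by (rule powr_mult)
          also have "\<dots> \<le> e powr 1 * S powr b x"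
            using e b_gt_1[of x] by (intro mult_right_mono powr_mono') auto
          finally have 2: "(e * S) powr b x \<le> e * S powr b x" using e by simp
          have "T * S = (T / e) * (e * S)" using e by simp
          also have "\<dots> \<le> (T / e) powr a x + (e * S) powr b x" using T S e by (intro young) auto
          finally show ?thesis using 1 2 by linarith
        qed
        then have "ih (\<lambda>_. T * S) I \<le> ih (\<lambda>x. (1 / (4 * (d + 1))) * t powr a x + e * S powr b x) I"
          using I t S by (intro ih_mono) (auto intro!: integrable_mult_right Bochner_Integration.integrable_add)
        also have "\<dots> = 1 / (4 * (d + 1)) * mass t I + e * dmass S I"
          unfolding mass_def dmass_def using I t S by (intro ih_affine) auto
        also have "\<dots> \<le> 1 / (4 * (d + 1)) * d + e * C"
          using td mS d e by (intro add_mono mult_left_mono) auto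
        also have "\<dots> \<le> 1/4 + 1/4"
          using d C by (intro add_mono) (auto simp: e_def field_simps)
        finally show False using TS I by (simp add: ih_const)
      qed
      have W2: "Wt \<le> k powr q * C / m"
      proof -
        have "t powr a x \<le> k powr q * T powr a x" for x
        proof -
          have "t powr a x \<le> (k * T) powr a x" using tk t b1 by (intro powr_mono2) auto
          also have "\<dots> = k powr a x * T powr a x" by (rule powr_mult)
          also have "\<dots> \<le> k powr q * T powr a x" using k a_le by (intro mult_right_mono powr_mono) auto
          finally show ?thesis .
        qed
        then have "mass t I \<le> ih (\<lambda>x. k powr q * T powr a x) I"
          unfolding mass_def using I t T by (intro ih_mono) (auto intro!: integrable_mult_right)
        also have "\<dots> = k powr q * mass T I" by (simp add: ih_cmult mass_def)
        also have "\<dots> \<le> k powr q * C" using mT by (intro mult_left_mono) auto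
        finally show ?thesis using m by (simp add: Wt_def divide_right_mono)
      qed
      have kC: "1 \<le> k powr q * C"
        using C k q_gt_1 mult_mono[of 1 "k powr q" 1 C] by (simp add: ge_one_powr_ge_zero)
      have pt: "(Wt / t powr a x) powr (b x - 1) \<le> (k powr q * C) powr q * (m * S powr b x)" for x
      proof -
        have "Wt / t powr a x \<le> (k powr q * C / m) / T powr a x"
          using W2 T False b1 C m Wt
          by (intro frac_le powr_mono2) auto
        then have "(Wt / t powr a x) powr (b x - 1) \<le> ((k powr q * C) * (1 / (m * T powr a x))) powr (b x - 1)"
          using Wt b1 by (intro powr_mono2) (auto simp: divide_divide_eq_left)
        also have "\<dots> = (k powr q * C) powr (b x - 1) * (m * S powr b x)"
          unfolding powr_mult[of "k powr q * C"] mSb ..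
        also have "\<dots> \<le> (k powr q * C) powr q * (m * S powr b x)"
          using powrq[OF kC] m by (intro mult_right_mono) auto
        finally show ?thesis .
      qed
      have "(Wt / t powr a x) powr (b x - 1) \<le> 1 * (1 + (k powr q * C) powr q * (m * S powr b x))" for x
        by (rule order_trans[OF pt]) simp
      from key[OF this] have "dmass (Wt / t) I \<le> (1 + (k powr q * C) powr q * C) * mass t I" by simp
      also have "\<dots> \<le> jensen_const C d * mass t I"
        using mass_nonneg C by (intro mult_right_mono) (auto simp: jensen_const_def k_def)
      finally show ?thesis .
    qed
  qed
  then show ?thesis by (simp add: Wt_def m_def)
qed

definition half_const :: "real \<Rightarrow> real \<Rightarrow> real" where
  "half_const C d = 4 * (4 * jensen_const C d) powr q"

lemma half_const_ge: "C \<ge> 1 \<Longrightarrow> half_const C d \<ge> 4"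
  using jensen_const_ge_1[of C d] q_gt_1 by (simp add: half_const_def ge_one_powr_ge_zero)

text \<open>An A-infinity property: half of the measure carries a fixed part of the weight. Write
  the average \<open>Wt\<close> as \<open>(t / e) * (e * s)\<close>, apply Young at each point and
  integrate over \<open>E\<close>. By \<open>dual_mass_le\<close> the dual term is at most
  \<open>e * j\<close> times the mass, a quarter for \<open>e = 1 / (4 * j)\<close>, while the left
  side is at least half of the mass.\<close>

lemma mass_le_half:
  assumes I: "balanced C I" and C: "C \<ge> 1" and d: "d \<ge> 0" and t: "t \<ge> 1" and td: "mass t I \<le> d"
    and E: "E \<in> sets M" "E \<subseteq> I" "prob I \<le> 2 * prob E"
  shows "mass t I \<le> half_const C d * mass t E"
proof -
  have Im: "I \<in> sets M" and m: "prob I > 0" using I by (auto simp: balanced_def)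
  define Wt where "Wt = mass t I / prob I"
  define s where "s = Wt / t"
  define j where "j = jensen_const C d"
  define e where "e = 1 / (4 * j)"
  have j: "j \<ge> 1" using jensen_const_ge_1[OF C] by (simp add: j_def)
  have e: "0 < e" "e \<le> 1" using j by (auto simp: e_def)
  have Wt0: "Wt \<ge> 0" and s0: "s \<ge> 0" using mass_nonneg t m by (auto simp: Wt_def s_def)
  have ds: "dmass s I \<le> j * mass t I"
    using dual_mass_le[OF I C d t td] by (simp add: s_def Wt_def j_def)
  have "Wt \<le> (4 * j) powr q * t powr a x + e * s powr b x" for x
  proof -
    have "(t / e) powr a x = (4 * j) powr a x * t powr a x" by (simp add: e_def powr_mult)
    also have "\<dots> \<le> (4 * j) powr q * t powr a x" using j a_le by (intro mult_right_mono powr_mono) auto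
    finally have 1: "(t / e) powr a x \<le> (4 * j) powr q * t powr a x" .
    have "(e * s) powr b x = e powr b x * s powr b x" by (rule powr_mult)
    also have "\<dots> \<le> e powr 1 * s powr b x"
      using e b_gt_1[of x] by (intro mult_right_mono powr_mono') auto
    finally have 2: "(e * s) powr b x \<le> e * s powr b x" using e by simp
    have "Wt = (t / e) * (e * s)" using e t by (simp add: s_def)
    also have "\<dots> \<le> (t / e) powr a x + (e * s) powr b x" using t e s0 by (intro young) auto
    finally show ?thesis using 1 2 by linarith
  qed
  then have "ih (\<lambda>_. Wt) E \<le> ih (\<lambda>x. (4 * j) powr q * t powr a x + e * s powr b x) E"
    using E t s0 by (intro ih_mono) (auto intro!: integrable_mult_right Bochner_Integration.integrable_add)
  also have "\<dots> = (4 * j) powr q * mass t E + e * dmass s E"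
    unfolding mass_def dmass_def using E t s0 by (intro ih_affine) auto
  also have "\<dots> \<le> (4 * j) powr q * mass t E + e * dmass s I"
    unfolding dmass_def using E Im s0 e by (intro add_left_mono mult_left_mono ih_mono_set) auto
  finally have "Wt * prob E \<le> (4 * j) powr q * mass t E + e * dmass s I"
    using e E by (simp add: ih_const)
  moreover have "e * dmass s I \<le> e * (j * mass t I)" using ds e by (intro mult_left_mono) auto
  moreover have "e * (j * mass t I) = mass t I / 4" using j by (simp add: e_def)
  moreover have "Wt * (prob I / 2) \<le> Wt * prob E" using E Wt0 by (intro mult_left_mono) auto
  moreover have "Wt * (prob I / 2) = mass t I / 2" using m by (simp add: Wt_def)
  ultimately have "mass t I \<le> 4 * ((4 * j) powr q * mass t E)" by linarith
  then show ?thesis by (simp add: half_const_def j_def)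
qed

lemma dual_mass_eq: "exponent_pair.mass M b = dmass" "exponent_pair.dmass M a = mass"
proof -
  interpret d: exponent_pair M b a q by (rule dual)
  show "exponent_pair.mass M b = dmass" "exponent_pair.dmass M a = mass"
    by (simp_all add: fun_eq_iff mass_def d.mass_def d.dmass_def dmass_def)
qed

lemma balanced_dual: "exponent_pair.balanced M b a C I \<longleftrightarrow> balanced C I"
proof -
  interpret d: exponent_pair M b a q by (rule dual)
  have 1: "balanced C I" if bal: "d.balanced C I"
  proof -
    obtain T S where "I \<in> sets M" "prob I > 0" "T > 0" "S > 0" "T * S * prob I = 1"
      "dmass T I \<le> C" "mass S I \<le> C"
      using bal unfolding d.balanced_def dual_mass_eq by blast
    then show ?thesis unfolding balanced_def by (intro conjI exI[of _ S] exI[of _ T]) (auto simp: mult.commute)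
  qed
  have 2: "d.balanced C I" if bal: "balanced C I"
  proof -
    obtain T S where "I \<in> sets M" "prob I > 0" "T > 0" "S > 0" "T * S * prob I = 1"
      "mass T I \<le> C" "dmass S I \<le> C"
      using bal unfolding balanced_def by blast
    then show ?thesis unfolding d.balanced_def dual_mass_eq
      by (intro conjI exI[of _ S] exI[of _ T]) (auto simp: mult.commute)
  qed
  show ?thesis using 1 2 by (rule iffI)
qed

section \<open>Modular estimate for the maximal function of a tree\<close>

definition avg :: "('a \<Rightarrow> real) \<Rightarrow> 'a set \<Rightarrow> real" where
  "avg f R = ih f R / prob R"

text \<open>The inserted 0 makes \<open>Max\<close> meaningful at points outside all members of
  \<open>D\<close>, and the function nonnegative.\<close>

definition maxfun :: "'a set set \<Rightarrow> ('a \<Rightarrow> real) \<Rightarrow> 'a \<Rightarrow> real" where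
  "maxfun D f x = Max (insert 0 (avg f ` {R\<in>D. x \<in> R}))"

definition tree :: "real \<Rightarrow> 'a set set \<Rightarrow> bool" where
  "tree C D \<longleftrightarrow> finite D \<and> laminar D \<and> space M \<in> D \<and> (\<forall>I\<in>D. balanced C I) \<and>
     (\<forall>I\<in>D. I \<noteq> space M \<longrightarrow> (\<exists>R\<in>D. I \<subset> R \<and> prob R \<le> 8 * prob I))"

text \<open>\<open>level_const\<close> bounds the mass at every level reached by an average;
  \<open>dual_const\<close> is the resulting factor in \<open>dual_mass_le\<close>.
  \<open>decay\<close> bounds the part of a dual mass that survives from one generation of level
  sets to the next. \<open>growth\<close> is chosen with
  \<open>growth powr q * decay = sqrt decay\<close>, so that a geometrically growing factor still
  leaves a convergent series, and \<open>eps0\<close> makes that series contribute at most half of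
  the mass.\<close>

definition level_const :: "real \<Rightarrow> real" where
  "level_const C = (1 + C) powr q * C"
definition dual_const :: "real \<Rightarrow> real" where
  "dual_const C = jensen_const C (level_const C)"
definition decay :: "real \<Rightarrow> real" where
  "decay C = 1 - 1 / half_const C (dual_const C * level_const C)"
definition growth :: "real \<Rightarrow> real" where
  "growth C = decay C powr (- 1 / (2 * q))"
definition eps0 :: "real \<Rightarrow> real" where
  "eps0 C = (1 - sqrt (decay C)) / (2 * dual_const C)"
definition maximal_const :: "real \<Rightarrow> real" where
  "maximal_const C = 16 powr q * (1 + 2 / eps0 C powr q / (1 - 1 / growth C))"

lemma ih_indicator: "ih (\<lambda>x. indicator B x * h x) A = ih h (A \<inter> B)"
  unfolding ih_def by (intro Bochner_Integration.integral_cong) (auto simp: indicator_def)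

context
  fixes C :: real assumes C: "C \<ge> 1"
begin

lemma level_const_ge: "level_const C \<ge> 0" using C by (simp add: level_const_def)

lemma dual_const_ge: "dual_const C \<ge> 1" using C jensen_const_ge_1 by (simp add: dual_const_def)

lemma decay_bounds: "3/4 \<le> decay C" "decay C < 1"
proof -
  have "half_const C (dual_const C * level_const C) \<ge> 4" using half_const_ge C by blast
  then show "3/4 \<le> decay C" "decay C < 1" by (auto simp: decay_def field_simps)
qed

lemma growth_gt_1: "growth C > 1"
  using decay_bounds q_gt_1 powr_less_mono2_neg[of "- 1 / (2 * q)" "decay C" 1]
  by (simp add: growth_def)

lemma growth_decay: "growth C powr q * decay C = sqrt (decay C)"
proof -
  have "growth C powr q = decay C powr (- 1 / 2)"
    using q_gt_1 by (simp add: growth_def powr_powr)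
  then have "growth C powr q * decay C = decay C powr (- 1 / 2 + 1)"
    using decay_bounds unfolding powr_add by simp
  then show ?thesis using decay_bounds by (simp add: powr_half_sqrt)
qed

lemma sqrt_decay: "0 \<le> sqrt (decay C)" "sqrt (decay C) < 1"
  using decay_bounds by auto

lemma eps0_bounds: "0 < eps0 C" "eps0 C \<le> 1"
proof -
  show "0 < eps0 C" unfolding eps0_def using sqrt_decay(2) dual_const_ge by (intro divide_pos_pos) auto
  have "1 - sqrt (decay C) \<le> 1 * (2 * dual_const C)" using sqrt_decay(1) dual_const_ge by linarith
  then show "eps0 C \<le> 1" unfolding eps0_def using dual_const_ge by (subst pos_divide_le_eq) auto
qed

lemma avg_space_le:
  assumes f: "f \<in> borel_measurable M" "\<And>x. f x \<ge> 0" and i: "integrable M (\<lambda>x. f x powr a x)"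
    and le: "(LINT x|M. f x powr a x) \<le> 1"
  shows "integrable M f" "avg f (space M) \<le> 2"
proof -
  have pt: "f x \<le> 1 + f x powr a x" for x
  proof (cases "f x \<le> 1")
    case True
    then show ?thesis by (simp add: add_increasing2)
  next
    case False
    then show ?thesis using powr_mono[of 1 "a x" "f x"] a_gt_1[of x] f(2)[of x] by simp
  qed
  have nle: "norm (f x) \<le> norm (1 + f x powr a x)" for x
    using pt[of x] f(2)[of x] unfolding real_norm_def by linarith
  show fi: "integrable M f"
  proof (rule Bochner_Integration.integrable_bound)
    show "integrable M (\<lambda>x. 1 + f x powr a x)" using i by simp
    show "AE x in M. norm (f x) \<le> norm (1 + f x powr a x)" using nle by (rule AE_I2)
  qed (use f in simp)
  have "ih f (space M) \<le> ih (\<lambda>x. 1 + f x powr a x) (space M)"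
    using fi i pt by (intro ih_mono) auto
  also have "\<dots> = 1 + ih (\<lambda>x. f x powr a x) (space M)"
    using ih_affine_const[OF i, of "space M" 1 1] by (simp add: prob_space)
  also have "ih (\<lambda>x. f x powr a x) (space M) = (LINT x|M. f x powr a x)"
    unfolding ih_def by (intro Bochner_Integration.integral_cong) auto
  finally show "avg f (space M) \<le> 2" using le by (simp add: avg_def prob_space)
qed

text \<open>Young against the level \<open>S\<close> bounds \<open>S\<close> times the integral of
  \<open>f\<close> over \<open>P\<close> by \<open>1 + C\<close>, so by
  \<open>T * S * prob P = 1\<close> the average is at most \<open>(1 + C) * T\<close>: averages
  never rise far above the level of the condition.\<close>

lemma mass_avg_le:
  assumes f: "\<And>x. f x \<ge> 0" "integrable M f" and i: "integrable M (\<lambda>x. f x powr a x)"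
    and le: "(LINT x|M. f x powr a x) \<le> 1"
    and P: "balanced C P" and t: "0 \<le> t" "t \<le> avg f P"
  shows "mass t P \<le> level_const C"
proof -
  obtain T S where Pm: "P \<in> sets M" and m: "prob P > 0" and T: "T > 0" and S: "S > 0"
    and TS: "T * S * prob P = 1" and mT: "mass T P \<le> C" and mS: "dmass S P \<le> C"
    using P unfolding balanced_def by blast
  have "f x * S \<le> f x powr a x + S powr b x" for x using f S by (intro young) auto
  then have "ih (\<lambda>x. f x * S) P \<le> ih (\<lambda>x. f x powr a x + S powr b x) P"
    using f S Pm i by (intro ih_mono) auto
  also have "\<dots> = ih (\<lambda>x. f x powr a x) P + dmass S P"
    unfolding dmass_def using i S Pm by (subst ih_add) auto
  also have "ih (\<lambda>x. f x powr a x) P \<le> ih (\<lambda>x. f x powr a x) (space M)"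
    using i Pm sets.sets_into_space by (intro ih_mono_set) auto
  also have "ih (\<lambda>x. f x powr a x) (space M) = (LINT x|M. f x powr a x)"
    unfolding ih_def by (intro Bochner_Integration.integral_cong) auto
  finally have "S * ih f P \<le> 1 + C" using le mS ih_cmult[of S f P] by (simp add: mult.commute)
  moreover have "t * prob P \<le> ih f P" using t m by (simp add: avg_def pos_le_divide_eq)
  ultimately have "S * (t * prob P) \<le> 1 + C" using S by (meson mult_left_mono less_imp_le order_trans)
  then have "T * (S * (t * prob P)) \<le> T * (1 + C)" using T by (intro mult_left_mono) auto
  moreover have "T * (S * (t * prob P)) = t" using TS by (simp add: mult_ac)
  ultimately have tT: "t \<le> (1 + C) * T" by (simp add: mult.commute)
  have "t powr a x \<le> (1 + C) powr q * T powr a x" for x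
  proof -
    have "t powr a x \<le> ((1 + C) * T) powr a x" using tT t a_gt_1[of x] by (intro powr_mono2) auto
    also have "\<dots> = (1 + C) powr a x * T powr a x" by (rule powr_mult)
    also have "\<dots> \<le> (1 + C) powr q * T powr a x" using C a_le by (intro mult_right_mono powr_mono) auto
    finally show ?thesis .
  qed
  then have "mass t P \<le> ih (\<lambda>x. (1 + C) powr q * T powr a x) P"
    unfolding mass_def using Pm t T by (intro ih_mono) auto
  also have "\<dots> = (1 + C) powr q * mass T P" by (simp add: ih_cmult mass_def)
  also have "\<dots> \<le> level_const C" unfolding level_const_def using mT by (intro mult_left_mono) auto
  finally show ?thesis .
qed

end

end

lemma geometric_sum_le:
  fixes x :: real
  assumes "0 \<le> x" "x < 1"
  shows "(\<Sum>i<n. x ^ i) \<le> 1 / (1 - x)"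
proof -
  have "(1 - x) * (\<Sum>i<n. x ^ i) \<le> 1" using assms by (simp flip: one_diff_power_eq)
  then show ?thesis using assms by (simp add: pos_le_divide_eq mult.commute)
qed

context exponent_pair
begin

context
  fixes C :: real assumes C: "C \<ge> 1"
begin

text \<open>Level sets at powers of 16. On a maximal interval \<open>P\<close> of level
  \<open>16 ^ k\<close> the dual weight at level \<open>s\<close> has mass at most a constant times
  the mass to be estimated, and its part on deeper level sets decays geometrically. Hence
  \<open>s * f\<close> on the layers \<open>E (k + i)\<close> inside \<open>P\<close> can be split
  by Young with parameter \<open>\<epsilon> * \<rho> ^ i\<close>: the dual part is absorbed into the
  left side, and the modular of \<open>f\<close> on the layer gets the factor
  \<open>1 / \<rho> ^ i\<close>. The sum over \<open>k\<close> converges because each layer is met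
  with summable weights.\<close>

theorem maximal_modular:
  assumes D: "tree C D"
    and f: "f \<in> borel_measurable M" "\<And>x. f x \<ge> 0" and i: "integrable M (\<lambda>x. f x powr a x)"
    and le: "(LINT x|M. f x powr a x) \<le> 1"
  shows "integrable M (\<lambda>x. maxfun D f x powr a x)"
    and "(LINT x|M. maxfun D f x powr a x) \<le> maximal_const C"
proof -
  note const_facts = level_const_ge[OF C] dual_const_ge[OF C] sqrt_decay[OF C]
  have finD: "finite D" and lam: "laminar D" and spD: "space M \<in> D" and bal: "\<And>R. R \<in> D \<Longrightarrow> balanced C R"
    and par: "\<And>R. R \<in> D \<Longrightarrow> R \<noteq> space M \<Longrightarrow> \<exists>R'\<in>D. R \<subset> R' \<and> prob R' \<le> 8 * prob R"
    using D unfolding tree_def by auto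
  have Dm: "R \<in> sets M" and Dp: "prob R > 0" if "R \<in> D" for R
    using bal[OF that] by (auto simp: balanced_def)
  note fi = avg_space_le(1)[OF C f i le] and fsp = avg_space_le(2)[OF C f i le]
  define fa where "fa = (\<lambda>x. f x powr a x)"
  have fai: "integrable M fa" and fa0: "fa x \<ge> 0" for x using i by (auto simp: fa_def)
  define h where "h = half_const C (dual_const C * level_const C)"
  define \<beta> where "\<beta> = decay C"
  define \<rho> where "\<rho> = growth C"
  define \<epsilon> where "\<epsilon> = eps0 C"
  have h4: "h \<ge> 4" using half_const_ge C by (simp add: h_def)
  have \<beta>: "\<beta> = 1 - 1 / h" "0 \<le> \<beta>" using decay_bounds[OF C] by (auto simp: \<beta>_def decay_def h_def)
  have \<rho>: "\<rho> > 1" using growth_gt_1[OF C] by (simp add: \<rho>_def)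
  have \<epsilon>: "0 < \<epsilon>" "\<epsilon> \<le> 1" using eps0_bounds[OF C] by (auto simp: \<epsilon>_def)
  define L where "L k = {R\<in>D. avg f R > 16 ^ k}" for k :: nat
  define Om where "Om k = \<Union>(L k)" for k
  define Pk where "Pk k = maximal_sets (L k)" for k
  define E where "E k = Om k - Om (Suc k)" for k
  have LD: "L k \<subseteq> D" and finL: "finite (L k)" and lamL: "laminar (L k)" for k
  proof -
    show "L k \<subseteq> D" by (auto simp: L_def)
    then show "finite (L k)" "laminar (L k)" using finD finite_subset laminar_subset[OF lam] by auto
  qed
  have PL: "Pk k \<subseteq> L k" for k unfolding Pk_def by (rule maximal_sets_subset)
  then have PD: "P \<in> D" and Pavg: "avg f P > 16 ^ k" if "P \<in> Pk k" for P k
    using that by (auto simp: L_def)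
  have finP: "finite (Pk k)" for k using finL PL finite_subset by blast
  have OmP: "\<Union>(Pk k) = Om k" for k unfolding Pk_def Om_def by (rule Union_maximal_sets[OF finL])
  have disP: "A \<inter> B = {}" if "A \<in> Pk k" "B \<in> Pk k" "A \<noteq> B" for A B k
    using maximal_sets_disjoint[OF lamL] that unfolding Pk_def by blast
  have Om_meas: "Om k \<in> sets M" for k
    unfolding Om_def using finL LD Dm by (intro sets.finite_Union) auto
  have E_meas: "E k \<in> sets M" for k unfolding E_def using Om_meas by blast
  have L_mono: "L j \<subseteq> L k" if "k \<le> j" for j k
  proof -
    have "16 ^ k \<le> (16 ^ j :: real)" using that by (intro power_increasing) auto
    then show ?thesis unfolding L_def using le_less_trans by blast
  qed
  have Om_mono: "Om j \<subseteq> Om k" if "k \<le> j" for j k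
    unfolding Om_def using L_mono[OF that] by blast
  have nested: "R \<subseteq> P" if "P \<in> Pk k" "R \<in> Pk j" "k \<le> j" "R \<inter> P \<noteq> {}" for P R k j
  proof -
    have "R \<subseteq> P \<or> P \<subseteq> R" using lam PD that unfolding laminar_def by metis
    moreover have "R = P" if "P \<subseteq> R"
    proof -
      have "R \<in> L k" using L_mono[OF \<open>k \<le> j\<close>] PL \<open>R \<in> Pk j\<close> by blast
      then show ?thesis using \<open>P \<in> Pk k\<close> that unfolding Pk_def maximal_sets_def by blast
    qed
    ultimately show ?thesis by blast
  qed
  have cover: "P \<inter> Om j = \<Union>{R\<in>Pk j. R \<subseteq> P}" if P: "P \<in> Pk k" and kj: "k \<le> j" for P k j
    unfolding OmP[symmetric] using nested[OF P _ kj] by blast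
  \<comment> \<open>The base 16 is twice the parent factor 8: the average over \<open>R\<close> is
    at most \<open>8 * 16 ^ j\<close>, so the part of \<open>R\<close> at level
    \<open>16 ^ Suc j\<close> is at most half. For \<open>j \<ge> 1\<close> the set \<open>R\<close>
    is not the whole space, whose average is at most 2, and so has a parent.\<close>
  have small: "2 * prob (R \<inter> Om (Suc j)) \<le> prob R" if R: "R \<in> Pk j" and j: "1 \<le> j" for R j
  proof -
    let ?S = "{R'\<in>Pk (Suc j). R' \<subseteq> R}"
    have RD: "R \<in> D" using PD R by blast
    have Sm: "A \<in> sets M" if "A \<in> ?S" for A using that PD Dm by blast
    have dis: "A \<inter> B = {}" if "A \<in> ?S" "B \<in> ?S" "A \<noteq> B" for A B using that disP by blast
    have finS: "finite ?S" using finP by simp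
    have "16 ^ Suc j * prob (R \<inter> Om (Suc j)) = ih (\<lambda>_. 16 ^ Suc j) (\<Union>?S)"
      using cover[OF R, of "Suc j"] Sm finS by (subst ih_const) (auto intro!: sets.finite_Union)
    also have "\<dots> = (\<Sum>A\<in>?S. ih (\<lambda>_. 16 ^ Suc j) A)"
      using finS Sm dis by (intro ih_Union) auto
    also have "\<dots> \<le> (\<Sum>A\<in>?S. ih f A)"
    proof (rule sum_mono)
      fix A assume A: "A \<in> ?S"
      then have "16 ^ Suc j < ih f A / prob A" "prob A > 0" "A \<in> sets M"
        using Pavg[of A "Suc j"] PD Dp Dm by (auto simp: avg_def)
      then show "ih (\<lambda>_. 16 ^ Suc j) A \<le> ih f A"
        by (simp only: ih_const) (simp add: pos_less_divide_eq less_imp_le)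
    qed
    also have "\<dots> = ih f (\<Union>?S)" using fi finS Sm dis by (intro ih_Union[symmetric]) auto
    also have "\<dots> \<le> ih f R"
      using fi f RD Dm Sm finS by (intro ih_mono_set sets.finite_Union) auto
    also have "\<dots> \<le> 8 * 16 ^ j * prob R"
    proof -
      have "16 \<le> (16 ^ j :: real)" using j power_increasing[of 1 j "16::real"] by simp
      then have "avg f R > 2" using Pavg[OF R] by linarith
      then have "R \<noteq> space M" using fsp by auto
      then obtain R' where R': "R' \<in> D" "R \<subset> R'" "prob R' \<le> 8 * prob R" using par RD by blast
      then have "R' \<notin> L j" using R unfolding Pk_def maximal_sets_def by blast
      then have "ih f R' / prob R' \<le> 16 ^ j" using R' by (auto simp: L_def avg_def)
      then have "ih f R' \<le> 16 ^ j * prob R'" using Dp[OF R'(1)] by (simp add: pos_divide_le_eq)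
      also have "\<dots> \<le> 16 ^ j * (8 * prob R)" using R' by (intro mult_left_mono) auto
      finally have "ih f R' \<le> 8 * 16 ^ j * prob R" by simp
      moreover have "ih f R \<le> ih f R'" using fi f R' RD Dm by (intro ih_mono_set) auto
      ultimately show ?thesis by simp
    qed
    finally have "(2 * prob (R \<inter> Om (Suc j))) * (8 * 16 ^ j) \<le> prob R * (8 * 16 ^ j)" by simp
    then show ?thesis by (simp add: mult_le_cancel_right)
  qed
  obtain n0 :: nat where n0: "\<forall>R\<in>D. avg f R \<le> 16 ^ n0"
  proof -
    obtain n0 :: nat where "Max (avg f ` D) < 16 ^ n0" using real_arch_pow[of 16 "Max (avg f ` D)"] by auto
    moreover have "avg f R \<le> Max (avg f ` D)" if "R \<in> D" for R using that finD by simp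
    ultimately show ?thesis using that by (meson less_imp_le order_trans)
  qed
  define n where "n = Suc n0"
  have Om_empty: "Om j = {}" if "n0 \<le> j" for j
  proof -
    have "16 ^ n0 \<le> (16 ^ j :: real)" using that by (intro power_increasing) auto
    then have "\<not> avg f R > 16 ^ j" if "R \<in> D" for R using n0 that by (meson not_le order_trans)
    then show ?thesis by (auto simp: Om_def L_def)
  qed
  have layer: "\<exists>i<n. x \<in> E (k + i)" if "x \<in> Om k" for x k
  proof -
    define j where "j = (GREATEST j. x \<in> Om j)"
    have bd: "y \<le> n0" if "x \<in> Om y" for y using that Om_empty[of y] by (metis empty_iff nat_le_linear)
    have j: "x \<in> Om j" unfolding j_def by (rule GreatestI_nat[of _ k]) (use that bd in auto)
    have kj: "k \<le> j" unfolding j_def by (rule Greatest_le_nat) (use that bd in auto)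
    have "x \<notin> Om (Suc j)"
    proof
      assume "x \<in> Om (Suc j)"
      then have "Suc j \<le> j" unfolding j_def by (rule Greatest_le_nat) (use bd in auto)
      then show False by simp
    qed
    then have "x \<in> E (k + (j - k))" using j kj by (simp add: E_def)
    moreover have "j - k < n" using bd[OF j] by (simp add: n_def)
    ultimately show ?thesis by blast
  qed
  have local_est: "mass (16 ^ k) P \<le> 2 / \<epsilon> powr q * (\<Sum>i<n. 1 / \<rho> ^ i * ih fa (P \<inter> E (k + i)))"
    if P: "P \<in> Pk k" and k: "1 \<le> k" for P k
  proof -
    define t :: real where "t = 16 ^ k"
    define Wt where "Wt = mass t P / prob P"
    define s where "s = Wt / t"
    have t1: "t \<ge> 1" by (simp add: t_def)
    have Pd: "P \<in> D" and Pm: "P \<in> sets M" and m: "prob P > 0" using PD[OF P] Dm Dp by auto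
    have td: "mass t P \<le> level_const C"
      using mass_avg_le[OF C f(2) fi i le bal[OF Pd], of t] Pavg[OF P] t1 by (simp add: t_def)
    have Wm: "mass t P = Wt * prob P" using m by (simp add: Wt_def)
    have "t \<le> Wt" using mass_ge_prob[OF Pm t1] m by (simp add: Wt_def pos_le_divide_eq)
    then have s1: "s \<ge> 1" using t1 by (simp add: s_def)
    have ds: "dmass s P \<le> dual_const C * mass t P"
      using dual_mass_le[OF bal[OF Pd] C level_const_ge[OF C] t1 td] by (simp add: s_def Wt_def dual_const_def)
    also have "\<dots> \<le> dual_const C * level_const C"
      using td const_facts by (intro mult_left_mono) auto
    finally have dsP: "dmass s P \<le> dual_const C * level_const C" .
    interpret d: exponent_pair M b a q by (rule dual)
    \<comment> \<open>The dual weight is a weight of the exchanged pair, at a level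
      \<open>s \<ge> 1\<close> with bounded mass, so \<open>mass_le_half\<close> applies to it on
      \<open>R - Om (Suc j)\<close>, which is at least half of \<open>R\<close>.\<close>
    have one_step: "dmass s (R \<inter> Om (Suc j)) \<le> \<beta> * dmass s R"
      if R: "R \<in> Pk j" "R \<subseteq> P" and j: "1 \<le> j" for R j
    proof -
      have Rd: "R \<in> D" and Rm: "R \<in> sets M" using PD R Dm by auto
      have "dmass s R \<le> dmass s P"
        unfolding dmass_def using R Rm Pm s1 by (intro ih_mono_set) auto
      then have dR: "dmass s R \<le> dual_const C * level_const C" using dsP by linarith
      have pr: "prob R = prob (R \<inter> Om (Suc j)) + prob (R - Om (Suc j))"
        using finite_measure_Union[of "R \<inter> Om (Suc j)" "R - Om (Suc j)"] Rm Om_meas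
        by (simp add: Int_Diff_Un sets.Int sets.Diff Int_Diff_disjoint)
      have "d.mass s R \<le> half_const C (dual_const C * level_const C) * d.mass s (R - Om (Suc j))"
      proof (rule d.mass_le_half)
        show "d.balanced C R" using bal[OF Rd] balanced_dual by simp
        show "0 \<le> dual_const C * level_const C" using const_facts by simp
        show "d.mass s R \<le> dual_const C * level_const C" using dR by (simp add: dual_mass_eq)
        show "prob R \<le> 2 * prob (R - Om (Suc j))" using small[OF R(1) j] pr by linarith
      qed (use C s1 Rm Om_meas in auto)
      then have 1: "dmass s R \<le> h * dmass s (R - Om (Suc j))" by (simp add: dual_mass_eq h_def)
      have "dmass s R = dmass s (R \<inter> Om (Suc j)) + dmass s (R - Om (Suc j))"
        unfolding dmass_def using Rm Om_meas s1
          ih_Un[of "\<lambda>x. s powr b x" "R \<inter> Om (Suc j)" "R - Om (Suc j)"]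
        by (simp add: Int_Diff_Un sets.Int sets.Diff Int_Diff_disjoint)
      then show ?thesis using 1 h4 by (simp add: \<beta>(1) field_simps)
    qed
    have decays: "dmass s (P \<inter> Om (k + i)) \<le> \<beta> ^ i * dmass s P" for i
    proof (induction i)
      case 0
      have "P \<inter> Om k = P" using P OmP[of k] by blast
      then show ?case by simp
    next
      case (Suc i)
      let ?j = "k + i"
      let ?S = "{R\<in>Pk ?j. R \<subseteq> P}"
      have finS: "finite ?S" using finP by simp
      have dis: "A \<inter> B = {}" if "A \<in> ?S" "B \<in> ?S" "A \<noteq> B" for A B using that disP by blast
      have Sm: "A \<in> sets M" if "A \<in> ?S" for A using that PD Dm by blast
      have si: "integrable M (\<lambda>x. s powr b x)" using s1 by simp
      have si': "integrable M (\<lambda>x. indicator (Om (Suc ?j)) x * s powr b x)"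
        using integrable_ih[OF si Om_meas] .
      have cov: "P \<inter> Om ?j = \<Union>?S" using cover[OF P] by simp
      have "Om (Suc ?j) \<subseteq> Om ?j" by (rule Om_mono) simp
      then have "P \<inter> Om (Suc ?j) = (P \<inter> Om ?j) \<inter> Om (Suc ?j)" by blast
      then have "P \<inter> Om (Suc ?j) = \<Union>?S \<inter> Om (Suc ?j)" unfolding cov .
      then have "dmass s (P \<inter> Om (Suc ?j)) = ih (\<lambda>x. indicator (Om (Suc ?j)) x * s powr b x) (\<Union>?S)"
        by (simp add: dmass_def ih_indicator)
      also have "\<dots> = (\<Sum>R\<in>?S. ih (\<lambda>x. indicator (Om (Suc ?j)) x * s powr b x) R)"
        using si' finS Sm dis by (rule ih_Union)
      also have "\<dots> = (\<Sum>R\<in>?S. dmass s (R \<inter> Om (Suc ?j)))" by (simp add: dmass_def ih_indicator)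
      also have "\<dots> \<le> (\<Sum>R\<in>?S. \<beta> * dmass s R)"
        using one_step k by (intro sum_mono) auto
      also have "\<dots> = \<beta> * dmass s (\<Union>?S)"
        unfolding dmass_def using ih_Union[OF si finS Sm dis] by (simp add: sum_distrib_left)
      also have "\<dots> \<le> \<beta> * (\<beta> ^ i * dmass s P)"
        using Suc \<beta>(2) unfolding cov[symmetric] by (intro mult_left_mono)
      finally show ?case by simp
    qed
    \<comment> \<open>Young's bound for \<open>s * f x\<close> with weight
      \<open>\<epsilon> * \<rho> ^ i\<close>, made uniform in the exponents:
      \<open>\<epsilon> \<le> 1 \<le> \<rho>\<close> together with exponents between 1 and
      \<open>q\<close> decides which power of each to keep.\<close>
    define u where "u i x = 1 / \<epsilon> powr q * (1 / \<rho> ^ i * fa x) + \<epsilon> * ((\<rho> powr q) ^ i * s powr b x)" for i x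
    have u0: "u i x \<ge> 0" for i x using fa0 \<epsilon> \<rho> by (simp add: u_def)
    have ui: "integrable M (u i)" for i
      unfolding u_def using fai s1 by (intro Bochner_Integration.integrable_add integrable_mult_right) auto
    have young_u: "s * f x \<le> u i x" for i x
    proof -
      define r where "r = \<epsilon> * \<rho> ^ i"
      have \<rho>i: "\<rho> ^ i \<ge> 1" using \<rho> by simp
      have r: "r > 0" using \<epsilon> \<rho> by (simp add: r_def)
      have ax: "1 \<le> a x" "a x \<le> q" "1 \<le> b x" "b x \<le> q"
        using a_gt_1[of x] b_gt_1[of x] a_le b_le by (auto simp: less_imp_le)
      have "\<epsilon> powr q * \<rho> ^ i \<le> \<epsilon> powr a x * (\<rho> ^ i) powr a x"
        using \<epsilon> \<rho>i ax powr_mono'[of "a x" q \<epsilon>] powr_mono[of 1 "a x" "\<rho> ^ i"] by (intro mult_mono) auto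
      then have "\<epsilon> powr q * \<rho> ^ i \<le> r powr a x" unfolding r_def powr_mult .
      then have "(f x / r) powr a x \<le> f x powr a x / (\<epsilon> powr q * \<rho> ^ i)"
        unfolding powr_divide using \<epsilon> \<rho> r by (intro divide_left_mono mult_pos_pos) auto
      then have 1: "(f x / r) powr a x \<le> 1 / \<epsilon> powr q * (1 / \<rho> ^ i * fa x)" by (simp add: fa_def)
      have "(r * s) powr b x = \<epsilon> powr b x * ((\<rho> ^ i) powr b x * s powr b x)"
        by (simp add: r_def powr_mult)
      also have "\<dots> \<le> \<epsilon> * ((\<rho> powr q) ^ i * s powr b x)"
      proof (intro mult_mono mult_right_mono)
        show "\<epsilon> powr b x \<le> \<epsilon>" using \<epsilon> ax powr_mono'[of 1 "b x" \<epsilon>] by simp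
        have "(\<rho> ^ i) powr b x \<le> (\<rho> ^ i) powr q" using \<rho>i ax by (intro powr_mono) auto
        also have "\<dots> = (\<rho> powr q) ^ i"
          using \<rho> by (simp add: powr_power powr_powr mult.commute flip: powr_realpow)
        finally show "(\<rho> ^ i) powr b x \<le> (\<rho> powr q) ^ i" .
      qed (use \<epsilon> \<rho> in auto)
      finally have 2: "(r * s) powr b x \<le> \<epsilon> * ((\<rho> powr q) ^ i * s powr b x)" .
      have "s * f x = (f x / r) * (r * s)" using r by simp
      also have "\<dots> \<le> (f x / r) powr a x + (r * s) powr b x" using r s1 f(2)[of x] by (intro young) auto
      finally show ?thesis using 1 2 by (simp add: u_def)
    qed
    have "mass t P = s * (t * prob P)" using t1 by (simp add: Wm s_def)
    also have "\<dots> \<le> s * ih f P"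
    proof -
      have "t < ih f P / prob P" using Pavg[OF P] by (simp add: t_def avg_def)
      then have "t * prob P \<le> ih f P" using m by (simp add: pos_less_divide_eq less_imp_le)
      then show ?thesis using s1 by (intro mult_left_mono) auto
    qed
    also have "\<dots> = ih (\<lambda>x. s * f x) P" by (simp add: ih_cmult)
    also have "\<dots> \<le> ih (\<lambda>x. \<Sum>i<n. indicator (E (k + i)) x * u i x) P"
    proof (rule ih_mono)
      show "integrable M (\<lambda>x. \<Sum>i<n. indicator (E (k + i)) x * u i x)"
        using ui E_meas by (intro Bochner_Integration.integrable_sum integrable_ih) auto
      fix x assume "x \<in> P"
      then have "x \<in> Om k" using P OmP by blast
      then obtain i where i: "i < n" "x \<in> E (k + i)" using layer by blast
      have "s * f x \<le> indicator (E (k + i)) x * u i x" using young_u i by simp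
      also have "\<dots> \<le> (\<Sum>i<n. indicator (E (k + i)) x * u i x)"
        using i u0 by (intro member_le_sum) auto
      finally show "s * f x \<le> (\<Sum>i<n. indicator (E (k + i)) x * u i x)" .
    qed (use fi Pm in auto)
    also have "\<dots> = (\<Sum>i<n. ih (u i) (P \<inter> E (k + i)))"
    proof -
      have "ih (\<lambda>x. \<Sum>i<n. indicator (E (k + i)) x * u i x) P
          = (LINT x|M. (\<Sum>i<n. indicator P x * (indicator (E (k + i)) x * u i x)))"
        unfolding ih_def by (simp only: sum_distrib_left)
      also have "\<dots> = (\<Sum>i<n. ih (\<lambda>x. indicator (E (k + i)) x * u i x) P)"
        unfolding ih_def using ui E_meas Pm
        by (intro Bochner_Integration.integral_sum integrable_ih) auto
      finally show ?thesis by (simp add: ih_indicator)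
    qed
    also have "\<dots> \<le> (\<Sum>i<n. 1 / \<epsilon> powr q * (1 / \<rho> ^ i * ih fa (P \<inter> E (k + i)))
        + \<epsilon> * dual_const C * mass t P * sqrt (decay C) ^ i)"
    proof (rule sum_mono)
      fix i
      have PE: "P \<inter> E (k + i) \<in> sets M" using Pm E_meas by blast
      have "ih (u i) (P \<inter> E (k + i)) = 1 / \<epsilon> powr q * (1 / \<rho> ^ i * ih fa (P \<inter> E (k + i)))
          + \<epsilon> * ((\<rho> powr q) ^ i * dmass s (P \<inter> E (k + i)))"
      proof -
        have "integrable M (\<lambda>x. 1 / \<rho> ^ i * fa x)" using fai by (intro integrable_mult_right) auto
        moreover have "integrable M (\<lambda>x. (\<rho> powr q) ^ i * s powr b x)"
          using s1 by (intro integrable_mult_right) auto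
        ultimately show ?thesis
          using ih_affine[OF _ _ PE, of "\<lambda>x. 1 / \<rho> ^ i * fa x" "\<lambda>x. (\<rho> powr q) ^ i * s powr b x"
              "1 / \<epsilon> powr q" \<epsilon>]
          unfolding u_def dmass_def ih_cmult by blast
      qed
      moreover have "dmass s (P \<inter> E (k + i)) \<le> dmass s (P \<inter> Om (k + i))"
        unfolding dmass_def using PE Pm Om_meas s1 by (intro ih_mono_set) (auto simp: E_def)
      moreover have "dmass s (P \<inter> Om (k + i)) \<le> \<beta> ^ i * (dual_const C * mass t P)"
        using decays[of i] ds \<beta>(2) by (meson mult_left_mono order_trans zero_le_power)
      ultimately have "ih (u i) (P \<inter> E (k + i)) \<le> 1 / \<epsilon> powr q * (1 / \<rho> ^ i * ih fa (P \<inter> E (k + i)))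
          + \<epsilon> * ((\<rho> powr q) ^ i * (\<beta> ^ i * (dual_const C * mass t P)))"
        using \<epsilon> by (simp add: mult_left_mono)
      also have "(\<rho> powr q) ^ i * (\<beta> ^ i * (dual_const C * mass t P))
          = (\<rho> powr q * \<beta>) ^ i * (dual_const C * mass t P)" by (simp add: power_mult_distrib)
      also have "\<rho> powr q * \<beta> = sqrt (decay C)" using growth_decay[OF C] by (simp add: \<rho>_def \<beta>_def)
      finally show "ih (u i) (P \<inter> E (k + i)) \<le> 1 / \<epsilon> powr q * (1 / \<rho> ^ i * ih fa (P \<inter> E (k + i)))
        + \<epsilon> * dual_const C * mass t P * sqrt (decay C) ^ i" by (simp add: mult_ac)
    qed
    also have "\<dots> = 1 / \<epsilon> powr q * (\<Sum>i<n. 1 / \<rho> ^ i * ih fa (P \<inter> E (k + i)))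
        + \<epsilon> * dual_const C * mass t P * (\<Sum>i<n. sqrt (decay C) ^ i)"
      by (simp only: sum.distrib sum_distrib_left)
    also have "\<dots> \<le> 1 / \<epsilon> powr q * (\<Sum>i<n. 1 / \<rho> ^ i * ih fa (P \<inter> E (k + i)))
        + \<epsilon> * dual_const C * mass t P * (1 / (1 - sqrt (decay C)))"
    proof (intro add_left_mono mult_left_mono)
      show "(\<Sum>i<n. sqrt (decay C) ^ i) \<le> 1 / (1 - sqrt (decay C))"
        using const_facts by (intro geometric_sum_le) auto
    qed (use \<epsilon> const_facts mass_nonneg in auto)
    also have "\<epsilon> * dual_const C * mass t P * (1 / (1 - sqrt (decay C))) = mass t P / 2"
    proof -
      have "y / (2 * z) * z * m * (1 / y) = m / 2" if "y \<noteq> 0" "z \<noteq> 0" for y z m :: real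
        using that by simp
      moreover have "1 - sqrt (decay C) \<noteq> 0" "dual_const C \<noteq> 0" using const_facts by linarith+
      ultimately show ?thesis unfolding \<epsilon>_def eps0_def by blast
    qed
    finally show ?thesis by (simp add: t_def)
  qed
  have level_est: "mass (16 ^ k) (Om k) \<le> 2 / \<epsilon> powr q * (\<Sum>i<n. 1 / \<rho> ^ i * ih fa (E (k + i)))"
    if k: "1 \<le> k" for k
  proof -
    have Pm: "A \<in> sets M" if "A \<in> Pk k" for A using that PD Dm by blast
    have ti: "integrable M (\<lambda>x. (16 ^ k) powr a x)" by simp
    have collapse: "(\<Sum>P\<in>Pk k. ih fa (P \<inter> E (k + i))) = ih fa (E (k + i))" for i
    proof -
      have "(\<Sum>P\<in>Pk k. ih fa (P \<inter> E (k + i))) = (\<Sum>P\<in>Pk k. ih (\<lambda>x. indicator (E (k + i)) x * fa x) P)"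
        by (simp only: ih_indicator)
      also have "\<dots> = ih (\<lambda>x. indicator (E (k + i)) x * fa x) (\<Union>(Pk k))"
        using finP Pm disP integrable_ih[OF fai E_meas] by (intro ih_Union[symmetric]) auto
      also have "\<dots> = ih fa (Om k \<inter> E (k + i))" by (simp only: ih_indicator OmP)
      also have "Om k \<inter> E (k + i) = E (k + i)" using Om_mono[of k "k + i"] by (auto simp: E_def)
      finally show ?thesis .
    qed
    have "mass (16 ^ k) (Om k) = (\<Sum>P\<in>Pk k. mass (16 ^ k) P)"
      unfolding mass_def OmP[symmetric] using ti finP Pm disP by (rule ih_Union)
    also have "\<dots> \<le> (\<Sum>P\<in>Pk k. 2 / \<epsilon> powr q * (\<Sum>i<n. 1 / \<rho> ^ i * ih fa (P \<inter> E (k + i))))"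
      using local_est k by (intro sum_mono)
    also have "\<dots> = 2 / \<epsilon> powr q * (\<Sum>i<n. 1 / \<rho> ^ i * (\<Sum>P\<in>Pk k. ih fa (P \<inter> E (k + i))))"
      unfolding sum_distrib_left[symmetric]
      by (subst sum.swap) (simp only: sum_distrib_left)
    also have "\<dots> = 2 / \<epsilon> powr q * (\<Sum>i<n. 1 / \<rho> ^ i * ih fa (E (k + i)))"
      by (simp only: collapse)
    finally show ?thesis .
  qed
  have E_dis: "E i \<inter> E j = {}" if "i \<noteq> j" for i j
  proof (cases "i < j")
    case True
    then have "Om j \<subseteq> Om (Suc i)" by (intro Om_mono) auto
    then show ?thesis by (auto simp: E_def)
  next
    case False
    then have "Om i \<subseteq> Om (Suc j)" using that by (intro Om_mono) auto
    then show ?thesis by (auto simp: E_def)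
  qed
  have sumE: "(\<Sum>k\<in>{1..n}. ih fa (E (k + i))) \<le> 1" for i
  proof -
    have inj: "inj_on (\<lambda>k. E (k + i)) {k\<in>{1..n}. E (k + i) \<noteq> {}}"
      using E_dis by (intro inj_onI) (metis (mono_tags, lifting) Int_absorb add_right_imp_eq mem_Collect_eq)
    let ?S = "(\<lambda>k. E (k + i)) ` {k\<in>{1..n}. E (k + i) \<noteq> {}}"
    have "(\<Sum>k\<in>{1..n}. ih fa (E (k + i))) = (\<Sum>k\<in>{k\<in>{1..n}. E (k + i) \<noteq> {}}. ih fa (E (k + i)))"
      by (rule sum.mono_neutral_right) (auto simp: ih_def)
    also have "\<dots> = (\<Sum>A\<in>?S. ih fa A)" using inj by (simp add: sum.reindex)
    also have "\<dots> = ih fa (\<Union>?S)"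
    proof (rule ih_Union[symmetric])
      fix A B assume "A \<in> ?S" "B \<in> ?S" "A \<noteq> B"
      then obtain j k where "A = E (j + i)" "B = E (k + i)" by blast
      then show "A \<inter> B = {}" using E_dis[of "j + i" "k + i"] \<open>A \<noteq> B\<close> by auto
    qed (use fai E_meas in auto)
    also have "\<dots> \<le> ih fa (space M)"
      using fai E_meas fa0 sets.sets_into_space[OF E_meas]
      by (intro ih_mono_set) (auto intro!: sets.finite_UN)
    also have "\<dots> = (LINT x|M. f x powr a x)"
      unfolding ih_def fa_def by (intro Bochner_Integration.integral_cong) auto
    finally show ?thesis using le by simp
  qed
  have total: "(\<Sum>k\<in>{1..n}. mass (16 ^ k) (Om k)) \<le> 2 / \<epsilon> powr q / (1 - 1 / \<rho>)"
  proof -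
    have "(\<Sum>k\<in>{1..n}. mass (16 ^ k) (Om k))
        \<le> (\<Sum>k\<in>{1..n}. 2 / \<epsilon> powr q * (\<Sum>i<n. 1 / \<rho> ^ i * ih fa (E (k + i))))"
      using level_est by (intro sum_mono) auto
    also have "\<dots> = 2 / \<epsilon> powr q * (\<Sum>i<n. 1 / \<rho> ^ i * (\<Sum>k\<in>{1..n}. ih fa (E (k + i))))"
      unfolding sum_distrib_left[symmetric]
      by (subst sum.swap) (simp only: sum_distrib_left)
    also have "\<dots> \<le> 2 / \<epsilon> powr q * (\<Sum>i<n. 1 / \<rho> ^ i * 1)"
      using sumE \<rho> by (intro mult_left_mono sum_mono) auto
    also have "\<dots> \<le> 2 / \<epsilon> powr q * (1 / (1 - 1 / \<rho>))"
    proof (rule mult_left_mono)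
      have "(\<Sum>i<n. 1 / \<rho> ^ i * 1) = (\<Sum>i<n. (1 / \<rho>) ^ i)" by (simp add: power_divide)
      also have "\<dots> \<le> 1 / (1 - 1 / \<rho>)" using \<rho> by (intro geometric_sum_le) auto
      finally show "(\<Sum>i<n. 1 / \<rho> ^ i * 1) \<le> 1 / (1 - 1 / \<rho>)" .
    qed simp
    finally show ?thesis by simp
  qed
  have mf0: "maxfun D f x \<ge> 0" for x unfolding maxfun_def using finD by (intro Max_ge) auto
  have mf_le: "maxfun D f x \<le> l" if "l \<ge> 0" "\<And>R. R \<in> D \<Longrightarrow> x \<in> R \<Longrightarrow> avg f R \<le> l" for x l
    unfolding maxfun_def using finD that by (subst Max_le_iff) auto
  define w where "w x = 16 powr q * (1 + (\<Sum>k\<in>{1..n}. indicator (Om k) x * (16 ^ k) powr a x))" for x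
  have pw: "maxfun D f x powr a x \<le> w x" for x
  proof (cases "x \<in> Om 1")
    case False
    then have "avg f R \<le> 16" if "R \<in> D" "x \<in> R" for R using that by (force simp: Om_def L_def not_less)
    then have "maxfun D f x \<le> 16" by (intro mf_le) auto
    then have "maxfun D f x powr a x \<le> 16 powr a x" using mf0 a_gt_1[of x] by (intro powr_mono2) auto
    also have "\<dots> \<le> 16 powr q * 1" using a_le by simp
    also have "\<dots> \<le> w x" unfolding w_def by (intro mult_left_mono) (auto intro!: sum_nonneg)
    finally show ?thesis .
  next
    case True
    then obtain i where i: "i < n" "x \<in> E (1 + i)" using layer by blast
    define k where "k = 1 + i"
    have k: "k \<in> {1..n}" "x \<in> Om k" "x \<notin> Om (Suc k)" using i by (auto simp: k_def E_def)
    have "avg f R \<le> 16 ^ Suc k" if "R \<in> D" "x \<in> R" for R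
      using k(3) that by (force simp: Om_def L_def not_less)
    then have "maxfun D f x \<le> 16 ^ Suc k" by (intro mf_le) auto
    then have "maxfun D f x powr a x \<le> (16 * 16 ^ k) powr a x" using mf0 a_gt_1[of x] by (intro powr_mono2) auto
    also have "\<dots> = 16 powr a x * (16 ^ k) powr a x" by (rule powr_mult)
    also have "\<dots> \<le> 16 powr q * (indicator (Om k) x * (16 ^ k) powr a x)" using a_le k by simp
    also have "\<dots> \<le> w x"
      unfolding w_def using k member_le_sum[of k "{1..n}" "\<lambda>k. indicator (Om k) x * (16 ^ k) powr a x"]
      by (intro mult_left_mono) auto
    finally show ?thesis .
  qed
  have wi: "integrable M w"
    unfolding w_def using Om_meas
    by (intro integrable_mult_right Bochner_Integration.integrable_add Bochner_Integration.integrable_sum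
        integrable_ih) auto
  have "maxfun D f x = Max (insert 0 ((\<lambda>R. avg f R * indicator R x) ` D))" for x
  proof (rule antisym)
    show "maxfun D f x \<le> Max (insert 0 ((\<lambda>R. avg f R * indicator R x) ` D))"
      unfolding maxfun_def using finD by (intro Max_mono) (auto simp: image_iff indicator_def)
    show "Max (insert 0 ((\<lambda>R. avg f R * indicator R x) ` D)) \<le> maxfun D f x"
      using finD mf0[of x] by (subst Max_le_iff) (auto simp: maxfun_def indicator_def)
  qed
  moreover have "(\<lambda>x. Max (insert 0 ((\<lambda>R. avg f R * indicator R x) ` D))) \<in> borel_measurable M"
  proof -
    \<comment> \<open>\<open>None\<close> carries the inserted 0, so that the maximum runs over a
      fixed finite index set.\<close>
    have "(\<lambda>x. Max ((\<lambda>i. case i of None \<Rightarrow> 0 | Some R \<Rightarrow> avg f R * indicator R x) ` (insert None (Some ` D))))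
        \<in> borel_measurable M"
      using finD Dm by (intro borel_measurable_Max) (auto split: option.split)
    then show ?thesis by (simp add: image_image)
  qed
  ultimately have mm: "maxfun D f \<in> borel_measurable M" by presburger
  show int: "integrable M (\<lambda>x. maxfun D f x powr a x)"
    using wi mm measurable_a pw by (intro Bochner_Integration.integrable_bound[OF wi]) (auto intro: order_trans[OF _ abs_ge_self])
  have "(LINT x|M. maxfun D f x powr a x) \<le> (LINT x|M. w x)"
    using int wi pw by (intro integral_mono) auto
  also have "\<dots> = 16 powr q * (1 + (\<Sum>k\<in>{1..n}. mass (16 ^ k) (Om k)))"
  proof -
    define v where "v k x = indicator (Om k) x * (16 ^ k) powr a x" for k x
    have vi: "integrable M (v k)" for k unfolding v_def using Om_meas by (intro integrable_ih) auto
    have "(LINT x|M. w x) = 16 powr q * (LINT x|M. 1 + (\<Sum>k\<in>{1..n}. v k x))"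
      unfolding w_def v_def by (rule integral_mult_right_zero)
    also have "(LINT x|M. 1 + (\<Sum>k\<in>{1..n}. v k x)) = (LINT x|M. 1) + (LINT x|M. (\<Sum>k\<in>{1..n}. v k x))"
      using vi by (intro Bochner_Integration.integral_add Bochner_Integration.integrable_sum) auto
    also have "(LINT x|M. (\<Sum>k\<in>{1..n}. v k x)) = (\<Sum>k\<in>{1..n}. LINT x|M. v k x)"
      using vi by (intro Bochner_Integration.integral_sum) auto
    finally show ?thesis by (simp add: prob_space v_def mass_def ih_def)
  qed
  also have "\<dots> \<le> maximal_const C"
    unfolding maximal_const_def using total by (simp add: \<epsilon>_def \<rho>_def)
  finally show "(LINT x|M. maxfun D f x powr a x) \<le> maximal_const C" .
qed

end

end

lemma powr_convex_combination:
  fixes u v l m e :: real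
  assumes "0 \<le> u" "0 \<le> v" "0 < l" "0 < m" "1 \<le> e"
  shows "((u + v) / (l + m)) powr e \<le> l / (l + m) * (u / l) powr e + m / (l + m) * (v / m) powr e"
proof -
  have shrink: "(w / (l + m)) powr e \<le> k / (l + m) * (w / k) powr e"
    if "0 \<le> w" "0 < k" "k \<le> l + m" for w k
  proof -
    have "(w / (l + m)) powr e = (k / (l + m)) powr e * (w / k) powr e"
      using that by (simp flip: powr_mult)
    also have "\<dots> \<le> k / (l + m) * (w / k) powr e"
      using that assms by (intro mult_right_mono powr_le_one_le) auto
    finally show ?thesis .
  qed
  consider "u = 0" | "v = 0" | "u > 0" "v > 0" using assms by linarith
  then show ?thesis
  proof cases
    case 1 then show ?thesis using shrink[of v m] assms by simp
  next
    case 2 then show ?thesis using shrink[of u l] assms by simp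
  next
    case 3
    have "(l / (l + m) * (u / l) + m / (l + m) * (v / m)) powr e
        \<le> l / (l + m) * (u / l) powr e + m / (l + m) * (v / m) powr e"
      using convex_onD[OF powr_convex[OF assms(5)], of "m / (l + m)" "u / l" "v / m"] 3 assms
      by (simp add: field_simps)
    then show ?thesis using assms by (simp add: add_divide_distrib)
  qed
qed

section \<open>Variable exponent norms\<close>

locale var_exponent = prob_space M for M :: "'a measure" +
  fixes e :: "'a \<Rightarrow> real" and q :: real
  assumes measurable_e [measurable]: "e \<in> borel_measurable M"
    and e_ge_1: "\<And>x. 1 \<le> e x" and e_le: "\<And>x. e x \<le> q"
begin

lemma e_nonneg: "0 \<le> e x" using e_ge_1[of x] by simp
lemma modular_scale:
  assumes [measurable]: "f \<in> borel_measurable M" and l: "0 < l" "l \<le> l'"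
  shows "var_modular M e f l' \<le> ennreal (l / l') * var_modular M e f l"
proof -
  have "(norm (f x) / l') powr e x \<le> l / l' * (norm (f x) / l) powr e x" for x
  proof -
    have "(norm (f x) / l') powr e x = (l / l') powr e x * (norm (f x) / l) powr e x"
      using l by (simp flip: powr_mult)
    also have "\<dots> \<le> l / l' * (norm (f x) / l) powr e x"
      using l e_ge_1 by (intro mult_right_mono powr_le_one_le) auto
    finally show ?thesis .
  qed
  then have "var_modular M e f l' \<le> (\<integral>\<^sup>+x. ennreal (l / l') * ennreal ((norm (f x) / l) powr e x) \<partial>M)"
    unfolding var_modular_def using l
    by (intro nn_integral_mono) (auto simp flip: ennreal_mult intro!: ennreal_leI)
  then show ?thesis unfolding var_modular_def by (subst (asm) nn_integral_cmult) auto
qed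

lemma modular_shrink:
  assumes [measurable]: "f \<in> borel_measurable M" and l: "0 < l'" "l' \<le> l"
  shows "var_modular M e f l' \<le> ennreal ((l / l') powr q) * var_modular M e f l"
proof -
  have "(norm (f x) / l') powr e x \<le> (l / l') powr q * (norm (f x) / l) powr e x" for x
  proof -
    have "(norm (f x) / l') powr e x = (l / l') powr e x * (norm (f x) / l) powr e x"
      using l by (simp flip: powr_mult)
    also have "\<dots> \<le> (l / l') powr q * (norm (f x) / l) powr e x"
      using l e_le by (intro mult_right_mono powr_mono) auto
    finally show ?thesis .
  qed
  then have "var_modular M e f l' \<le> (\<integral>\<^sup>+x. ennreal ((l / l') powr q) * ennreal ((norm (f x) / l) powr e x) \<partial>M)"
    unfolding var_modular_def using l
    by (intro nn_integral_mono) (auto simp flip: ennreal_mult intro!: ennreal_leI)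
  then show ?thesis unfolding var_modular_def by (subst (asm) nn_integral_cmult) auto
qed

lemma modular_mono:
  assumes l: "0 < l" "l \<le> l'" and fg: "AE x in M. norm (f x) \<le> norm (g x)"
  shows "var_modular M e f l' \<le> var_modular M e g l"
  unfolding var_modular_def
proof (rule nn_integral_mono_AE)
  show "AE x in M. ennreal ((norm (f x) / l') powr e x) \<le> ennreal ((norm (g x) / l) powr e x)"
    using fg
  proof eventually_elim
    case (elim x)
    show ?case using elim l e_nonneg by (intro ennreal_leI powr_mono2 frac_le) auto
  qed
qed

lemma var_norm_le: "0 < l \<Longrightarrow> var_modular M e f l \<le> 1 \<Longrightarrow> var_norm M e f \<le> ennreal l"
  unfolding var_norm_def by (intro Inf_lower) auto

lemma modular_le_1:
  assumes "var_norm M e f < ennreal l"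
  shows "0 < l" "var_modular M e f l \<le> 1"
proof -
  obtain l' where l': "0 < l'" "var_modular M e f l' \<le> 1" "ennreal l' < ennreal l"
    using assms unfolding var_norm_def Inf_less_iff by auto
  then have "l' < l" by (simp add: ennreal_less_iff)
  then show "0 < l" "var_modular M e f l \<le> 1"
    using l' modular_mono[of l' l f f] by auto
qed

lemma var_norm_mono:
  assumes "AE x in M. norm (f x) \<le> norm (g x)"
  shows "var_norm M e f \<le> var_norm M e g"
  unfolding var_norm_def
  by (rule Inf_superset_mono) (use modular_mono[OF _ _ assms] in \<open>fastforce intro: order_trans\<close>)

lemma var_norm_le_bound:
  assumes "0 < B" "AE x in M. norm (f x) \<le> B"
  shows "var_norm M e f \<le> ennreal B"
proof (rule var_norm_le)
  have "var_modular M e f B \<le> (\<integral>\<^sup>+x. 1 \<partial>M)"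
    unfolding var_modular_def
  proof (rule nn_integral_mono_AE)
    show "AE x in M. ennreal ((norm (f x) / B) powr e x) \<le> 1"
      using assms(2)
    proof eventually_elim
      case (elim x)
      have "(norm (f x) / B) powr e x \<le> 1" using elim assms(1) e_nonneg by (intro powr_le1) auto
      then show ?case using ennreal_leI by fastforce
    qed
  qed
  then show "var_modular M e f B \<le> 1" using emeasure_space_1 by simp
qed fact

text \<open>The modular is controlled only at levels \<open>l\<close> strictly above the norm;
  bounds are proved for each of these and passed to the limit here.\<close>

lemma le_var_norm_of_less:
  assumes "\<And>l. 0 < l \<Longrightarrow> var_norm M e f < ennreal l \<Longrightarrow> z \<le> ennreal (c * l)" "0 \<le> c"
    and fin: "var_norm M e f < \<infinity>"
  shows "z \<le> ennreal c * var_norm M e f"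
proof -
  define F where "F = enn2real (var_norm M e f)"
  have F: "var_norm M e f = ennreal F" "0 \<le> F" using fin by (auto simp: F_def)
  have "z \<le> ennreal (c * F) + ennreal \<epsilon>" if "\<epsilon> > 0" for \<epsilon>
  proof -
    define \<delta> where "\<delta> = \<epsilon> / (c + 1)"
    have \<delta>: "\<delta> > 0" "c * \<delta> \<le> \<epsilon>" using that assms(2) by (auto simp: \<delta>_def field_simps)
    have "z \<le> ennreal (c * (F + \<delta>))" using \<delta> F by (intro assms(1)) (auto simp: ennreal_less_iff)
    also have "\<dots> \<le> ennreal (c * F + \<epsilon>)" using \<delta> by (intro ennreal_leI) (simp add: distrib_left)
    finally show ?thesis using F assms(2) that by (simp add: ennreal_plus)
  qed
  then have "z \<le> ennreal (c * F)" by (rule ennreal_le_epsilon) auto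
  then show ?thesis using F assms(2) by (simp add: ennreal_mult)
qed

lemma var_norm_triangle:
  assumes [measurable]: "f \<in> borel_measurable M" "g \<in> borel_measurable M"
  shows "var_norm M e (\<lambda>x. f x + g x) \<le> var_norm M e f + var_norm M e g"
proof (cases "var_norm M e f < \<infinity> \<and> var_norm M e g < \<infinity>")
  case False
  then show ?thesis by (auto simp: not_less top_unique)
next
  case True
  define F G where "F = enn2real (var_norm M e f)" and "G = enn2real (var_norm M e g)"
  have F: "var_norm M e f = ennreal F" "0 \<le> F" and G: "var_norm M e g = ennreal G" "0 \<le> G"
    using True by (auto simp: F_def G_def)
  have "var_norm M e (\<lambda>x. f x + g x) \<le> ennreal (F + G) + ennreal \<epsilon>" if "\<epsilon> > 0" for \<epsilon>
  proof -
    define l m where "l = F + \<epsilon> / 2" and "m = G + \<epsilon> / 2"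
    have l: "var_norm M e f < ennreal l" and m: "var_norm M e g < ennreal m"
      using F G that by (auto simp: l_def m_def ennreal_less_iff)
    note l = modular_le_1[OF l] and m = modular_le_1[OF m]
    have "var_modular M e (\<lambda>x. f x + g x) (l + m)
        \<le> (\<integral>\<^sup>+x. ennreal (l / (l + m)) * ennreal ((norm (f x) / l) powr e x)
          + ennreal (m / (l + m)) * ennreal ((norm (g x) / m) powr e x) \<partial>M)"
      unfolding var_modular_def
    proof (rule nn_integral_mono)
      fix x
      have "(norm (f x + g x) / (l + m)) powr e x \<le> ((norm (f x) + norm (g x)) / (l + m)) powr e x"
        using l m e_nonneg by (intro powr_mono2 divide_right_mono norm_triangle_ineq) auto
      also have "\<dots> \<le> l / (l + m) * (norm (f x) / l) powr e x + m / (l + m) * (norm (g x) / m) powr e x"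
        using l m e_ge_1 by (intro powr_convex_combination) auto
      finally show "ennreal ((norm (f x + g x) / (l + m)) powr e x)
          \<le> ennreal (l / (l + m)) * ennreal ((norm (f x) / l) powr e x)
          + ennreal (m / (l + m)) * ennreal ((norm (g x) / m) powr e x)"
        using l m by (simp flip: ennreal_mult ennreal_plus add: ennreal_leI)
    qed
    also have "\<dots> = ennreal (l / (l + m)) * var_modular M e f l + ennreal (m / (l + m)) * var_modular M e g m"
      unfolding var_modular_def by (subst nn_integral_add) (auto simp: nn_integral_cmult)
    also have "\<dots> \<le> ennreal (l / (l + m)) * 1 + ennreal (m / (l + m)) * 1"
      using l m by (intro add_mono mult_left_mono) auto
    also have "\<dots> = 1"
    proof -
      have "l / (l + m) + m / (l + m) = 1" using l m by (simp flip: add_divide_distrib)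
      then show ?thesis using l m by (simp flip: ennreal_plus)
    qed
    finally have "var_norm M e (\<lambda>x. f x + g x) \<le> ennreal (l + m)"
      using l m by (intro var_norm_le) auto
    also have "l + m = (F + G) + \<epsilon>" by (simp add: l_def m_def)
    finally show ?thesis using F G that by (simp add: ennreal_plus)
  qed
  then have "var_norm M e (\<lambda>x. f x + g x) \<le> ennreal (F + G)" by (rule ennreal_le_epsilon) auto
  then show ?thesis using F G by (simp add: ennreal_plus)
qed

lemma modular_cmult: "c > 0 \<Longrightarrow> var_modular M e (\<lambda>x. of_real c * f x) (c * l) = var_modular M e f l"
  unfolding var_modular_def by (simp add: norm_mult)

lemma var_norm_cmult_le:
  assumes "c > 0"
  shows "var_norm M e (\<lambda>x. of_real c * f x) \<le> ennreal c * var_norm M e f"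
proof (cases "var_norm M e f < \<infinity>")
  case True
  show ?thesis
  proof (rule le_var_norm_of_less[OF _ _ True])
    fix l assume "0 < l" "var_norm M e f < ennreal l"
    then show "var_norm M e (\<lambda>x. of_real c * f x) \<le> ennreal (c * l)"
      using assms modular_le_1[of f l] modular_cmult[OF assms, of f l] by (intro var_norm_le) auto
  qed (use assms in simp)
next
  case False
  then show ?thesis using assms by (simp add: not_less top_unique ennreal_mult_top)
qed

lemma var_norm_cmult:
  assumes "c > 0"
  shows "var_norm M e (\<lambda>x. of_real c * f x) = ennreal c * var_norm M e f"
proof (rule antisym[OF var_norm_cmult_le[OF assms]])
  have "var_norm M e (\<lambda>x. of_real (1 / c) * (of_real c * f x)) \<le> ennreal (1 / c) * var_norm M e (\<lambda>x. of_real c * f x)"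
    using assms by (intro var_norm_cmult_le) auto
  then have "var_norm M e f \<le> ennreal (1 / c) * var_norm M e (\<lambda>x. of_real c * f x)"
    using assms by simp
  then have "ennreal c * var_norm M e f \<le> ennreal c * (ennreal (1 / c) * var_norm M e (\<lambda>x. of_real c * f x))"
    by (rule mult_left_mono) simp
  also have "\<dots> = ennreal (c * (1 / c)) * var_norm M e (\<lambda>x. of_real c * f x)"
    using assms by (subst ennreal_mult) (auto simp: mult.assoc)
  finally show "ennreal c * var_norm M e f \<le> var_norm M e (\<lambda>x. of_real c * f x)"
    using assms by simp
qed

lemma var_norm_uminus: "var_norm M e (\<lambda>x. - f x) = var_norm M e f"
  unfolding var_norm_def var_modular_def by simp

lemma var_norm_diff_commute: "var_norm M e (\<lambda>x. f x - g x) = var_norm M e (\<lambda>x. g x - f x)"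
  unfolding var_norm_def var_modular_def by (simp add: norm_minus_commute)

lemma var_Lp_iff: "f \<in> var_Lp M e \<longleftrightarrow> f \<in> borel_measurable M \<and> var_norm M e f < \<infinity>"
proof
  assume f: "f \<in> var_Lp M e"
  then obtain l where l: "l > 0" "var_modular M e f l < \<infinity>" and fm: "f \<in> borel_measurable M"
    by (auto simp: var_Lp_def)
  define k where "k = max 1 (enn2real (var_modular M e f l))"
  have k: "k \<ge> 1" "var_modular M e f l \<le> ennreal k"
  proof -
    show "k \<ge> 1" by (simp add: k_def)
    have "var_modular M e f l = ennreal (enn2real (var_modular M e f l))" using l by simp
    also have "\<dots> \<le> ennreal k" unfolding k_def by (intro ennreal_leI) simp
    finally show "var_modular M e f l \<le> ennreal k" .
  qed
  have "var_modular M e f (k * l) \<le> ennreal (l / (k * l)) * var_modular M e f l"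
    using l k by (intro modular_scale fm) auto
  also have "\<dots> \<le> ennreal (l / (k * l)) * ennreal k" using k by (intro mult_left_mono) auto
  also have "\<dots> = 1" using l k by (simp flip: ennreal_mult)
  finally have "var_norm M e f \<le> ennreal (k * l)" using l k by (intro var_norm_le) auto
  then show "f \<in> borel_measurable M \<and> var_norm M e f < \<infinity>" using fm by (auto simp: le_less_trans)
next
  assume f: "f \<in> borel_measurable M \<and> var_norm M e f < \<infinity>"
  then have "var_norm M e f < ennreal (enn2real (var_norm M e f) + 1)"
    by (cases "var_norm M e f") (auto simp: ennreal_less_iff)
  from modular_le_1[OF this] show "f \<in> var_Lp M e"
    using f unfolding var_Lp_def by (auto intro!: exI[of _ "enn2real (var_norm M e f) + 1"] simp: le_less_trans)
qed

lemma norm_less_integrable: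
  assumes f: "f \<in> borel_measurable M" and l: "var_norm M e f < ennreal l"
  shows "integrable M f" "(\<integral>\<^sup>+x. ennreal (norm (f x)) \<partial>M) \<le> ennreal (2 * l)"
proof -
  note [measurable] = f
  note l = modular_le_1[OF l]
  have "norm (f x) \<le> l * (1 + (norm (f x) / l) powr e x)" for x
  proof (cases "norm (f x) \<le> l")
    case True
    have "norm (f x) \<le> l * 1" using True by simp
    also have "\<dots> \<le> l * (1 + (norm (f x) / l) powr e x)" using l by (intro mult_left_mono) auto
    finally show ?thesis .
  next
    case False
    then have "norm (f x) / l \<le> (norm (f x) / l) powr e x"
      using powr_mono[OF e_ge_1[of x], of "norm (f x) / l"] l by simp
    then have "norm (f x) \<le> l * (norm (f x) / l) powr e x" using l by (simp add: pos_divide_le_eq mult.commute)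
    also have "\<dots> \<le> l * (1 + (norm (f x) / l) powr e x)" using l by (intro mult_left_mono) auto
    finally show ?thesis .
  qed
  then have "(\<integral>\<^sup>+x. ennreal (norm (f x)) \<partial>M) \<le> (\<integral>\<^sup>+x. ennreal l * (1 + ennreal ((norm (f x) / l) powr e x)) \<partial>M)"
    using l by (intro nn_integral_mono) (simp flip: ennreal_mult ennreal_plus ennreal_1 add: ennreal_leI)
  also have "\<dots> = ennreal l * (1 + var_modular M e f l)"
    unfolding var_modular_def using emeasure_space_1 by (subst nn_integral_cmult) (auto simp: nn_integral_add)
  also have "\<dots> \<le> ennreal l * (1 + 1)" using l by (intro mult_left_mono add_left_mono) auto
  also have "\<dots> = ennreal (2 * l)" using l by (simp add: ennreal_mult mult.commute)
  finally show 1: "(\<integral>\<^sup>+x. ennreal (norm (f x)) \<partial>M) \<le> ennreal (2 * l)" .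
  then show "integrable M f" by (intro integrableI_bounded f) (auto simp: le_less_trans)
qed

lemma var_Lp_integrable: "f \<in> var_Lp M e \<Longrightarrow> integrable M f"
proof -
  assume f: "f \<in> var_Lp M e"
  then have "var_norm M e f < ennreal (enn2real (var_norm M e f) + 1)"
    by (cases "var_norm M e f") (auto simp: ennreal_less_iff var_Lp_iff)
  moreover have "f \<in> borel_measurable M" using f by (simp add: var_Lp_def)
  ultimately show ?thesis using norm_less_integrable(1) by blast
qed

lemma var_Lp_add: "f \<in> var_Lp M e \<Longrightarrow> g \<in> var_Lp M e \<Longrightarrow> (\<lambda>x. f x + g x) \<in> var_Lp M e"
  unfolding var_Lp_iff using var_norm_triangle[of f g] by (auto intro: le_less_trans simp: ennreal_add_less_top)

lemma var_Lp_uminus: "f \<in> var_Lp M e \<Longrightarrow> (\<lambda>x. - f x) \<in> var_Lp M e"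
  unfolding var_Lp_iff by (auto simp: var_norm_uminus)

lemma var_Lp_diff: "f \<in> var_Lp M e \<Longrightarrow> g \<in> var_Lp M e \<Longrightarrow> (\<lambda>x. f x - g x) \<in> var_Lp M e"
  using var_Lp_add[OF _ var_Lp_uminus, of f g] by simp

lemma var_Lp_cmult: "f \<in> var_Lp M e \<Longrightarrow> c > 0 \<Longrightarrow> (\<lambda>x. of_real c * f x) \<in> var_Lp M e"
  unfolding var_Lp_iff by (auto simp: var_norm_cmult ennreal_mult_less_top)

lemma bounded_in_var_Lp:
  assumes "f \<in> borel_measurable M" "\<And>x. x \<in> space M \<Longrightarrow> norm (f x) \<le> B"
  shows "f \<in> var_Lp M e"
proof -
  have "var_norm M e f \<le> ennreal (max 1 B)"
    using assms by (intro var_norm_le_bound AE_I2) (auto simp: le_max_iff_disj)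
  then show ?thesis unfolding var_Lp_iff using assms(1) le_less_trans[OF _ ennreal_less_top] by auto
qed

text \<open>For functions with a common bound, smallness in \<open>L\<^sup>1\<close> suffices: with
  \<open>v = norm (h x) / \<epsilon>\<close> the power \<open>v powr e x\<close> is \<open>v\<close>
  times a bounded factor, so the modular is at most linear in the integral.\<close>

lemma var_norm_le_L1:
  assumes [measurable]: "h \<in> borel_measurable M" and B: "\<And>x. x \<in> space M \<Longrightarrow> norm (h x) \<le> B"
    and \<epsilon>: "0 < \<epsilon>" and le: "(\<integral>\<^sup>+x. ennreal (norm (h x)) \<partial>M) \<le> ennreal (\<epsilon> / (max 1 (B / \<epsilon>)) powr q)"
  shows "var_norm M e h \<le> ennreal \<epsilon>"
proof (rule var_norm_le[OF \<epsilon>])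
  define m where "m = (max 1 (B / \<epsilon>)) powr q"
  have m: "m > 0" by (simp add: m_def)
  have "(norm (h x) / \<epsilon>) powr e x \<le> m / \<epsilon> * norm (h x)" if "x \<in> space M" for x
  proof (cases "h x = 0")
    case False
    define v where "v = norm (h x) / \<epsilon>"
    have v: "0 < v" "v \<le> max 1 (B / \<epsilon>)"
      using False \<epsilon> B[OF that] by (auto simp: v_def le_max_iff_disj divide_right_mono)
    have "v powr e x = v * v powr (e x - 1)" using v powr_add[of v 1 "e x - 1"] by simp
    also have "v powr (e x - 1) \<le> (max 1 (B / \<epsilon>)) powr (e x - 1)"
      using v e_ge_1[of x] by (intro powr_mono2) auto
    also have "\<dots> \<le> m" unfolding m_def using e_le[of x] by (intro powr_mono) auto
    finally have "v powr e x \<le> v * m" using v by (simp add: mult_left_mono)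
    then show ?thesis by (simp add: v_def mult.commute)
  qed simp
  then have "var_modular M e h \<epsilon> \<le> (\<integral>\<^sup>+x. ennreal (m / \<epsilon>) * ennreal (norm (h x)) \<partial>M)"
    unfolding var_modular_def using m \<epsilon>
    by (intro nn_integral_mono) (auto simp flip: ennreal_mult intro!: ennreal_leI)
  also have "\<dots> = ennreal (m / \<epsilon>) * (\<integral>\<^sup>+x. ennreal (norm (h x)) \<partial>M)" by (simp add: nn_integral_cmult)
  also have "\<dots> \<le> ennreal (m / \<epsilon>) * ennreal (\<epsilon> / m)" using le unfolding m_def by (intro mult_left_mono) auto
  also have "\<dots> = 1" using m \<epsilon> by (simp flip: ennreal_mult)
  finally show "var_modular M e h \<epsilon> \<le> 1" .
qed

text \<open>The finite upper bound of the exponent matters: the modular of \<open>f\<close>, finite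
  at some level, is then finite at level \<open>\<epsilon>\<close> and supplies the dominating
  function.\<close>

lemma truncation_dense:
  assumes f: "f \<in> var_Lp M e" and \<epsilon>: "0 < \<epsilon>"
  shows "\<exists>B::nat. var_norm M e (\<lambda>x. f x - (if norm (f x) \<le> B then f x else 0)) \<le> ennreal \<epsilon>"
proof -
  have [measurable]: "f \<in> borel_measurable M" using f by (simp add: var_Lp_def)
  obtain l where l: "l > 0" "var_modular M e f l < \<infinity>" using f by (auto simp: var_Lp_def)
  define u where "u x = (norm (f x) / \<epsilon>) powr e x" for x
  have um[measurable]: "u \<in> borel_measurable M" unfolding u_def by measurable
  have fin: "(\<integral>\<^sup>+x. ennreal (u x) \<partial>M) < \<infinity>"
  proof (cases "\<epsilon> \<le> l")
    case True
    show ?thesis using modular_shrink[OF _ \<epsilon> True, of f] l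
      by (auto simp: u_def var_modular_def ennreal_mult_less_top intro: le_less_trans)
  next
    case False
    then show ?thesis using modular_mono[of l \<epsilon> f f] l by (auto simp: u_def var_modular_def intro: le_less_trans)
  qed
  define h where "h B x = f x - (if norm (f x) \<le> real B then f x else 0)" for B x
  have "(\<lambda>B. \<integral>\<^sup>+x. ennreal ((norm (h B x) / \<epsilon>) powr e x) \<partial>M) \<longlonglongrightarrow> (\<integral>\<^sup>+x. 0 \<partial>M)"
  proof (rule nn_integral_dominated_convergence[where w="\<lambda>x. ennreal (u x)"])
    show "(\<lambda>x. ennreal ((norm (h B x) / \<epsilon>) powr e x)) \<in> borel_measurable M" for B unfolding h_def by measurable
    show "AE x in M. ennreal ((norm (h B x) / \<epsilon>) powr e x) \<le> ennreal (u x)" for B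
      by (intro AE_I2) (auto simp: h_def u_def)
    show "AE x in M. (\<lambda>B. ennreal ((norm (h B x) / \<epsilon>) powr e x)) \<longlonglongrightarrow> 0"
    proof (intro AE_I2)
      fix x
      have "eventually (\<lambda>B. ennreal ((norm (h B x) / \<epsilon>) powr e x) = 0) sequentially"
        using eventually_ge_at_top[of "nat \<lceil>norm (f x)\<rceil>"]
      proof eventually_elim
        case (elim B)
        then have "norm (f x) \<le> real B" by linarith
        then show ?case by (simp add: h_def)
      qed
      then show "(\<lambda>B. ennreal ((norm (h B x) / \<epsilon>) powr e x)) \<longlonglongrightarrow> 0" by (rule tendsto_eventually)
    qed
  qed (use fin in auto)
  then have "(\<lambda>B. var_modular M e (h B) \<epsilon>) \<longlonglongrightarrow> 0" by (simp add: var_modular_def)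
  then have "eventually (\<lambda>B. var_modular M e (h B) \<epsilon> < 1) sequentially"
    by (rule order_tendstoD) simp
  then obtain B where "var_modular M e (h B) \<epsilon> < 1" using eventually_happens by force
  then have "var_norm M e (h B) \<le> ennreal \<epsilon>" using \<epsilon> by (intro var_norm_le) auto
  then show ?thesis unfolding h_def by blast
qed

text \<open>Completeness in the form the ball argument needs, with radii instead of a Cauchy
  condition. Summability of the \<open>L\<^sup>1\<close> norms gives convergence almost everywhere,
  and Fatou's lemma carries the modular bound to the limit.\<close>

lemma rapid_Cauchy_limit:
  fixes y :: "nat \<Rightarrow> 'a \<Rightarrow> complex"
  assumes ym: "\<And>j. y j \<in> borel_measurable M" and d: "\<And>j. 0 < d j" "\<And>j. d (Suc j) \<le> d j / 2"
    and y: "\<And>j. var_norm M e (\<lambda>x. y (Suc j) x - y j x) \<le> ennreal (d j / 2)"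
  shows "\<exists>z\<in>borel_measurable M. \<forall>j. var_norm M e (\<lambda>x. z x - y j x) \<le> ennreal (d j)"
proof -
  note [measurable] = ym
  \<comment> \<open>Since \<open>d (Suc j) \<le> d j / 2\<close>, a step of size
    \<open>d j / 2\<close> is at most \<open>d j - d (Suc j)\<close>, and steps telescope.\<close>
  have dist: "var_norm M e (\<lambda>x. y (j + k) x - y j x) \<le> ennreal (d j - d (j + k)) \<and> d (j + k) \<le> d j" for j k
  proof (induction k)
    case 0
    have "var_norm M e (\<lambda>x. 0) \<le> 0"
    proof (rule ennreal_le_epsilon)
      show "var_norm M e (\<lambda>x. 0) \<le> 0 + ennreal \<epsilon>" if "0 < \<epsilon>" for \<epsilon>
        using var_norm_le_bound[OF that, of "\<lambda>x. 0"] that by simp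
    qed
    then show ?case by simp
  next
    case (Suc k)
    have "(\<lambda>x. y (j + Suc k) x - y j x) = (\<lambda>x. (y (Suc (j + k)) x - y (j + k) x) + (y (j + k) x - y j x))"
      by auto
    then have "var_norm M e (\<lambda>x. y (j + Suc k) x - y j x)
        \<le> var_norm M e (\<lambda>x. y (Suc (j + k)) x - y (j + k) x) + var_norm M e (\<lambda>x. y (j + k) x - y j x)"
      using var_norm_triangle[of "\<lambda>x. y (Suc (j + k)) x - y (j + k) x" "\<lambda>x. y (j + k) x - y j x"] by simp
    also have "\<dots> \<le> ennreal (d (j + k) / 2) + ennreal (d j - d (j + k))"
      using Suc y by (intro add_mono) auto
    also have "\<dots> = ennreal (d (j + k) / 2 + (d j - d (j + k)))"
      using Suc d(1)[of "j + k"] by (intro ennreal_plus[symmetric]) auto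
    also have "\<dots> \<le> ennreal (d j - d (j + Suc k))"
      using d(2)[of "j + k"] by (intro ennreal_leI) simp
    finally show ?case using Suc d(1)[of "Suc (j + k)"] d(2)[of "j + k"] d(1)[of "j + k"] by simp
  qed
  have dexp: "d j \<le> d 0 * (1/2) ^ j" for j
  proof (induction j)
    case (Suc j)
    then show ?case using d(2)[of j] by simp
  qed simp
  have nn0: "(\<integral>\<^sup>+x. ennreal (norm (y (Suc j) x - y j x)) \<partial>M) \<le> ennreal (2 * d j)" for j
  proof (rule norm_less_integrable(2))
    show "var_norm M e (\<lambda>x. y (Suc j) x - y j x) < ennreal (d j)"
      by (rule le_less_trans[OF y]) (use d(1)[of j] in \<open>simp add: ennreal_less_iff\<close>)
  qed simp
  have nn: "(\<integral>\<^sup>+x. ennreal (norm (y (Suc j) x - y j x)) \<partial>M) \<le> ennreal (2 * d 0 * (1/2) ^ j)" for j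
    by (rule order_trans[OF nn0 ennreal_leI]) (use dexp[of j] in simp)
  have "(\<integral>\<^sup>+x. (\<Sum>j. ennreal (norm (y (Suc j) x - y j x))) \<partial>M)
      = (\<Sum>j. \<integral>\<^sup>+x. ennreal (norm (y (Suc j) x - y j x)) \<partial>M)"
    by (intro nn_integral_suminf) measurable
  also have "\<dots> \<le> (\<Sum>j. ennreal (2 * d 0 * (1/2) ^ j))" using nn by (intro suminf_le) auto
  also have "\<dots> = ennreal (\<Sum>j. 2 * d 0 * (1/2) ^ j)"
    using d(1)[of 0] by (intro suminf_ennreal2 summable_mult summable_geometric) auto
  also have "\<dots> < \<infinity>" by simp
  finally have "AE x in M. (\<Sum>j. ennreal (norm (y (Suc j) x - y j x))) \<noteq> \<infinity>"
    by (intro nn_integral_noteq_infinite) auto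
  then have conv: "AE x in M. convergent (\<lambda>j. y j x)"
  proof eventually_elim
    case (elim x)
    then have "summable (\<lambda>j. norm (y (Suc j) x - y j x))" by (intro summable_suminf_not_top) auto
    then have "summable (\<lambda>j. y (Suc j) x - y j x)" by (rule summable_norm_cancel)
    then have "convergent (\<lambda>n. \<Sum>j<n. (y (Suc j) x - y j x))" by (simp add: summable_iff_convergent)
    then have "convergent (\<lambda>n. y n x - y 0 x)" unfolding sum_lessThan_telescope[of "\<lambda>j. y j x"] .
    from convergent_add[OF this convergent_const[of "y 0 x"]] show ?case by simp
  qed
  define z where "z x = lim (\<lambda>j. y j x)" for x
  have zm: "z \<in> borel_measurable M" unfolding z_def by (rule borel_measurable_lim_metric[OF ym])
  note [measurable] = zm
  have "var_norm M e (\<lambda>x. z x - y j x) \<le> ennreal (d j)" for j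
  proof (rule var_norm_le[OF d(1)])
    have le1: "var_modular M e (\<lambda>x. y (j + k) x - y j x) (d j) \<le> 1" for k
    proof (rule modular_le_1(2))
      show "var_norm M e (\<lambda>x. y (j + k) x - y j x) < ennreal (d j)"
        by (rule le_less_trans[OF conjunct1[OF dist]])
          (use dist[of j k] d(1)[of "j + k"] in \<open>simp add: ennreal_less_iff\<close>)
    qed
    have "var_modular M e (\<lambda>x. z x - y j x) (d j)
        = (\<integral>\<^sup>+x. liminf (\<lambda>k. ennreal ((norm (y (j + k) x - y j x) / d j) powr e x)) \<partial>M)"
      unfolding var_modular_def
    proof (rule nn_integral_cong_AE)
      show "AE x in M. ennreal ((norm (z x - y j x) / d j) powr e x)
          = liminf (\<lambda>k. ennreal ((norm (y (j + k) x - y j x) / d j) powr e x))"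
        using conv
      proof eventually_elim
        case (elim x)
        then have "(\<lambda>k. y k x) \<longlonglongrightarrow> z x" unfolding z_def by (simp add: convergent_LIMSEQ_iff)
        then have "(\<lambda>k. y (j + k) x) \<longlonglongrightarrow> z x" using LIMSEQ_ignore_initial_segment[of _ _ j] by (simp add: add.commute)
        then have "(\<lambda>k. ennreal ((norm (y (j + k) x - y j x) / d j) powr e x))
            \<longlonglongrightarrow> ennreal ((norm (z x - y j x) / d j) powr e x)"
          using d(1)[of j] e_ge_1[of x]
          by (intro tendsto_ennrealI tendsto_powr' tendsto_divide tendsto_norm tendsto_diff tendsto_const) auto
        then show ?case by (intro lim_imp_Liminf[symmetric]) auto
      qed
    qed
    also have "\<dots> \<le> liminf (\<lambda>k. \<integral>\<^sup>+x. ennreal ((norm (y (j + k) x - y j x) / d j) powr e x) \<partial>M)"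
      by (intro nn_integral_liminf) measurable
    also have "\<dots> \<le> 1"
      using le1 unfolding var_modular_def by (intro Liminf_le) (auto intro!: always_eventually)
    finally show "var_modular M e (\<lambda>x. z x - y j x) (d j) \<le> 1" .
  qed
  then show ?thesis using zm by blast
qed

text \<open>Nested balls \<open>(y j, d j)\<close>, as in Baire's theorem.\<close>

lemma uniform_boundedness:
  fixes S :: "nat \<Rightarrow> ('a \<Rightarrow> complex) \<Rightarrow> 'a \<Rightarrow> complex"
  assumes meas: "\<And>n f. f \<in> var_Lp M e \<Longrightarrow> S n f \<in> borel_measurable M"
    and add: "\<And>n f g. f \<in> var_Lp M e \<Longrightarrow> g \<in> var_Lp M e \<Longrightarrow> S n (\<lambda>x. f x + g x) = (\<lambda>x. S n f x + S n g x)"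
    and scale: "\<And>n f c. f \<in> var_Lp M e \<Longrightarrow> S n (\<lambda>x. of_real c * f x) = (\<lambda>x. of_real c * S n f x)"
    and bdd: "\<And>n f. f \<in> var_Lp M e \<Longrightarrow> var_norm M e (S n f) \<le> ennreal (k n) * var_norm M e f"
    and k0: "\<And>n. k n \<ge> 0"
    and pointwise: "\<And>f. f \<in> var_Lp M e \<Longrightarrow> \<exists>B::real. \<forall>n. var_norm M e (S n f) \<le> ennreal B"
  shows "\<exists>C::real. \<forall>f\<in>var_Lp M e. \<forall>n. var_norm M e (S n f) \<le> ennreal C * var_norm M e f"
proof (rule ccontr)
  assume "\<not> ?thesis"
  then have contra: "\<exists>f\<in>var_Lp M e. \<exists>n. ennreal C * var_norm M e f < var_norm M e (S n f)" for C :: real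
    by (meson not_le)
  \<comment> \<open>Unboundedness rescaled: arbitrarily small functions with arbitrarily large
    images. The bound by \<open>k n\<close> excludes a function of norm 0 whose image has positive
    norm.\<close>
  have spike: "\<exists>f\<in>var_Lp M e. \<exists>n. var_norm M e f \<le> ennreal \<delta> \<and> ennreal R < var_norm M e (S n f)"
    if \<delta>: "\<delta> > 0" and R: "R \<ge> 0" for \<delta> R
  proof -
    obtain f n where f: "f \<in> var_Lp M e" and big: "ennreal (R / \<delta>) * var_norm M e f < var_norm M e (S n f)"
      using contra by blast
    define v where "v = enn2real (var_norm M e f)"
    have v: "var_norm M e f = ennreal v" "0 \<le> v" using f by (auto simp: v_def var_Lp_iff)
    have "v \<noteq> 0"
    proof
      assume "v = 0"
      then have "var_norm M e (S n f) \<le> 0" using bdd[OF f, of n] v by simp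
      then show False using big by simp
    qed
    with v have vp: "v > 0" by simp
    define c where "c = \<delta> / v"
    have c: "c > 0" using vp \<delta> by (simp add: c_def)
    have "var_norm M e (\<lambda>x. of_real c * f x) = ennreal c * ennreal v"
      using var_norm_cmult[OF c, of f] v by simp
    also have "\<dots> = ennreal \<delta>" using c vp by (simp add: c_def flip: ennreal_mult)
    finally have "var_norm M e (\<lambda>x. of_real c * f x) = ennreal \<delta>" .
    moreover have "ennreal R < var_norm M e (S n (\<lambda>x. of_real c * f x))"
    proof -
      have "ennreal R = ennreal c * (ennreal (R / \<delta>) * ennreal v)"
        using c R \<delta> vp by (simp add: c_def flip: ennreal_mult)
      also have "\<dots> < ennreal c * var_norm M e (S n f)"
        using big c unfolding v by (intro ennreal_mult_strict_left_mono) auto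
      finally show ?thesis unfolding scale[OF f] var_norm_cmult[OF c] .
    qed
    ultimately show ?thesis using var_Lp_cmult[OF f c] by (auto intro!: bexI exI)
  qed
  define P where "P j s \<longleftrightarrow> fst s \<in> var_Lp M e \<and> 0 < (snd s :: real)" for j :: nat and s
  define Q where "Q j s s' \<longleftrightarrow> var_norm M e (\<lambda>x. fst s' x - fst s x) \<le> ennreal (snd s / 2) \<and> snd s' \<le> snd s / 2 \<and>
      (\<exists>n. \<forall>z\<in>var_Lp M e. var_norm M e (\<lambda>x. z x - fst s' x) \<le> ennreal (snd s') \<longrightarrow> ennreal (real j) \<le> var_norm M e (S n z))"
    for j :: nat and s s' :: "('a \<Rightarrow> complex) \<times> real"
  have "\<exists>s. \<forall>j. P j (s j) \<and> Q j (s j) (s (Suc j))"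
  proof (rule dependent_nat_choice)
    have "(\<lambda>x. 0) \<in> var_Lp M e" by (rule bounded_in_var_Lp[of _ 0]) auto
    then show "\<exists>s. P 0 s" unfolding P_def by (intro exI[of _ "(\<lambda>x. 0, 1)"]) auto
  next
    fix s j assume "P j s"
    then have s: "fst s \<in> var_Lp M e" "0 < snd s" by (auto simp: P_def)
    obtain B where B: "\<And>n. var_norm M e (S n (fst s)) \<le> ennreal B" using pointwise[OF s(1)] by blast
    define B' where "B' = max 0 B"
    have B': "B' \<ge> 0" "var_norm M e (S n (fst s)) \<le> ennreal B'" for n
      using B[of n] by (auto simp: B'_def intro: order_trans ennreal_leI)
    obtain f n where f: "f \<in> var_Lp M e" "var_norm M e f \<le> ennreal (snd s / 2)"
      and big: "ennreal (real j + 1 + B') < var_norm M e (S n f)"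
      using spike[of "snd s / 2" "real j + 1 + B'"] s B' by auto
    define y where "y x = fst s x + f x" for x
    \<comment> \<open>The radius is so small that \<open>S n\<close> moves by at most 1 on the new
      ball.\<close>
    define \<delta> where "\<delta> = min (snd s / 2) (1 / (k n + 1))"
    have \<delta>: "0 < \<delta>" "\<delta> \<le> snd s / 2" "k n * \<delta> \<le> 1"
    proof -
      show "0 < \<delta>" "\<delta> \<le> snd s / 2" using s k0[of n] by (auto simp: \<delta>_def)
      have "k n * \<delta> \<le> k n * (1 / (k n + 1))" using k0[of n] by (intro mult_left_mono) (auto simp: \<delta>_def)
      also have "\<dots> \<le> 1" using k0[of n] by (simp add: field_simps)
      finally show "k n * \<delta> \<le> 1" .
    qed
    have yL: "y \<in> var_Lp M e" unfolding y_def using s f by (intro var_Lp_add) auto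
    have "ennreal (real j) \<le> var_norm M e (S n z)"
      if z: "z \<in> var_Lp M e" and zy: "var_norm M e (\<lambda>x. z x - y x) \<le> ennreal \<delta>" for z
    proof -
      define w where "w x = - fst s x" for x
      define v where "v x = y x - z x" for x
      have w: "w \<in> var_Lp M e" and v: "v \<in> var_Lp M e"
        unfolding w_def v_def using s yL z by (auto intro: var_Lp_uminus var_Lp_diff)
      have "w = (\<lambda>x. - fst s x)" by (simp add: w_def fun_eq_iff)
      then have "S n w = (\<lambda>x. - S n (fst s) x)" using scale[OF s(1), of n "-1"] by simp
      then have Sw: "var_norm M e (S n w) \<le> ennreal B'" using B' by (simp add: var_norm_uminus)
      have "var_norm M e (S n v) \<le> ennreal (k n) * var_norm M e v" by (rule bdd[OF v])
      also have "\<dots> \<le> ennreal (k n) * ennreal \<delta>"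
        using zy var_norm_diff_commute[of z y] unfolding v_def by (intro mult_left_mono) simp_all
      also have "\<dots> \<le> ennreal 1" using \<delta> k0[of n] by (simp flip: ennreal_mult ennreal_1 add: ennreal_leI)
      finally have Sv: "var_norm M e (S n v) \<le> ennreal 1" .
      \<comment> \<open>The spike is \<open>z\<close>, plus the displacement \<open>y - z\<close>,
        minus the old center. The images of the last two have norm at most 1 and \<open>B'\<close>,
        so the image of \<open>z\<close> keeps norm at least \<open>j\<close>.\<close>
      have "f = (\<lambda>x. z x + (v x + w x))" by (auto simp: v_def w_def y_def)
      then have "S n f = (\<lambda>x. S n z x + (S n v x + S n w x))"
        using add[OF z var_Lp_add[OF v w]] add[OF v w] by simp
      then have "var_norm M e (S n f) \<le> var_norm M e (S n z) + (var_norm M e (S n v) + var_norm M e (S n w))"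
        using var_norm_triangle[of "S n z" "\<lambda>x. S n v x + S n w x"] var_norm_triangle[of "S n v" "S n w"]
          meas[OF z, of n] meas[OF v, of n] meas[OF w, of n]
        by (auto intro: order_trans add_left_mono)
      also have "\<dots> \<le> var_norm M e (S n z) + (ennreal 1 + ennreal B')"
        using Sv Sw by (intro add_left_mono add_mono)
      finally have "ennreal (real j + 1 + B') < var_norm M e (S n z) + (ennreal 1 + ennreal B')"
        using big by simp
      also have "ennreal (real j + 1 + B') = ennreal (real j) + (ennreal 1 + ennreal B')"
        using B' by (simp add: ennreal_plus add.assoc)
      finally show ?thesis
        by (meson add_right_mono less_imp_le linorder_not_le)
    qed
    moreover have "var_norm M e (\<lambda>x. y x - fst s x) \<le> ennreal (snd s / 2)" using f by (simp add: y_def)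
    ultimately show "\<exists>s'. P (Suc j) s' \<and> Q j s s'"
      using yL \<delta> unfolding P_def Q_def by (intro exI[of _ "(y, \<delta>)"]) auto
  qed
  then obtain s where s: "\<And>j. P j (s j)" "\<And>j. Q j (s j) (s (Suc j))" by blast
  have "\<exists>z\<in>borel_measurable M. \<forall>j. var_norm M e (\<lambda>x. z x - fst (s j) x) \<le> ennreal (snd (s j))"
    using s unfolding P_def Q_def var_Lp_iff by (intro rapid_Cauchy_limit) auto
  then obtain z where zm: "z \<in> borel_measurable M"
    and z: "\<And>j. var_norm M e (\<lambda>x. z x - fst (s j) x) \<le> ennreal (snd (s j))" by blast
  have "(\<lambda>x. z x - fst (s 0) x) \<in> var_Lp M e"
    using zm s(1)[of 0] le_less_trans[OF z[of 0] ennreal_less_top] by (auto simp: var_Lp_iff P_def)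
  then have zL: "z \<in> var_Lp M e" using var_Lp_add[of "\<lambda>x. z x - fst (s 0) x" "fst (s 0)"] s(1)[of 0] by (simp add: P_def)
  obtain B :: real where B: "\<And>n. var_norm M e (S n z) \<le> ennreal B" using pointwise[OF zL] by blast
  obtain j :: nat where j: "max 0 B < real j" using reals_Archimedean2 by blast
  obtain n where "ennreal (real j) \<le> var_norm M e (S n z)"
    using s(2)[of j] z[of "Suc j"] zL unfolding Q_def by blast
  then have "ennreal (real j) \<le> ennreal B" using B[of n] by simp
  then show False using j by (simp add: ennreal_le_iff2)
qed

end

lemma var_modular_cong_AE:
  assumes "AE x in M. r x = r' x"
  shows "var_modular M r f l = var_modular M r' f l"
  unfolding var_modular_def by (rule nn_integral_cong_AE) (use assms in \<open>eventually_elim, simp\<close>)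

lemma var_norm_cong_AE: "AE x in M. r x = r' x \<Longrightarrow> var_norm M r f = var_norm M r' f"
  unfolding var_norm_def by (simp add: var_modular_cong_AE)

lemma var_Lp_cong_AE: "AE x in M. r x = r' x \<Longrightarrow> var_Lp M r = var_Lp M r'"
  unfolding var_Lp_def by (simp add: var_modular_cong_AE)

section \<open>Norms of indicators, averaging operators and duality\<close>

context exponent_pair
begin

lemma var_exponent_a: "var_exponent M a q"
  using measurable_a a_gt_1 a_le by unfold_locales (auto intro: less_imp_le)

lemma modular_indicator:
  assumes T: "T > 0" and I: "I \<in> sets M"
  shows "var_modular M a (indicator I) (1 / T) = ennreal (mass T I)"
    and "var_modular M b (indicator I) (1 / T) = ennreal (dmass T I)"
proof -
  have *: "ennreal ((norm (indicator I x :: complex) / (1 / T)) powr k) = ennreal (indicator I x * T powr k)" for x k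
    by (simp add: indicator_def)
  show "var_modular M a (indicator I) (1 / T) = ennreal (mass T I)"
    unfolding var_modular_def mass_def ih_def * using I T
    by (intro nn_integral_eq_integral integrable_ih) auto
  show "var_modular M b (indicator I) (1 / T) = ennreal (dmass T I)"
    unfolding var_modular_def dmass_def ih_def * using I T
    by (intro nn_integral_eq_integral integrable_ih) auto
qed

lemma var_norm_indicator_bounds:
  assumes I: "I \<in> sets M"
  shows "ennreal (prob I) \<le> var_norm M a (indicator I)" "var_norm M a (indicator I) \<le> 1"
proof -
  interpret va: var_exponent M a q by (rule var_exponent_a)
  show "var_norm M a (indicator I) \<le> 1"
    using va.var_norm_le_bound[of 1 "indicator I"] by (auto simp: indicator_def)
  show "ennreal (prob I) \<le> var_norm M a (indicator I)"
  proof (rule ccontr)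
    assume "\<not> ?thesis"
    then have less: "var_norm M a (indicator I) < ennreal (prob I)" by simp
    then obtain l where l: "l > 0" "var_modular M a (indicator I) l \<le> 1" "ennreal l < ennreal (prob I)"
      unfolding var_norm_def Inf_less_iff by auto
    then have lI: "l < prob I" by (simp add: ennreal_less_iff)
    also have "\<dots> \<le> 1" by simp
    finally have "1 \<le> 1 / l" using l by simp
    then have "1 / l * prob I \<le> mass (1 / l) I" by (rule mass_ge_prob[OF I])
    moreover have "mass (1 / l) I \<le> 1"
      using modular_indicator(1)[of "1 / l" I] l I by simp
    ultimately have "1 / l * prob I \<le> 1" by linarith
    then show False using lI l(1) by (simp add: field_simps)
  qed
qed

text \<open>Levels a factor 2 below and above the reciprocal norm are used in place of the
  reciprocal norm itself. This avoids asking whether the infimum is attained and costs at most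
  \<open>4 powr q\<close>, the exponents being bounded.\<close>

lemma var_norm_indicator_levels:
  assumes I: "I \<in> sets M" and pos: "prob I > 0"
  obtains l where "0 < l" "var_norm M a (indicator I) = ennreal l"
    "mass (1 / (2 * l)) I \<le> 1" "1 < mass (2 / l) I" "mass (2 / l) I \<le> 4 powr q"
proof -
  interpret va: var_exponent M a q by (rule var_exponent_a)
  define l where "l = enn2real (var_norm M a (indicator I))"
  have fin: "var_norm M a (indicator I) < \<infinity>"
    using var_norm_indicator_bounds(2)[OF I] by (auto simp: less_top[symmetric] top_unique)
  then have l: "var_norm M a (indicator I) = ennreal l" by (simp add: l_def)
  have lp: "0 < l"
  proof -
    have "ennreal (prob I) \<le> ennreal l" using var_norm_indicator_bounds(1)[OF I] l by simp
    then show ?thesis using pos by (simp add: ennreal_le_iff2)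
  qed
  have small: "mass (1 / (2 * l)) I \<le> 1"
  proof -
    have "var_norm M a (indicator I) < ennreal (2 * l)" using l lp by (simp add: ennreal_less_iff)
    then have "var_modular M a (indicator I) (2 * l) \<le> 1" by (rule va.modular_le_1)
    then show ?thesis using modular_indicator(1)[of "1 / (2 * l)" I] I lp by simp
  qed
  have big: "1 < mass (2 / l) I"
  proof (rule ccontr)
    assume "\<not> ?thesis"
    then have "var_modular M a (indicator I) (l / 2) \<le> 1"
      using modular_indicator(1)[of "2 / l" I] I lp by simp
    then have "ennreal l \<le> ennreal (l / 2)" using va.var_norm_le[of "l / 2" "indicator I"] lp l by simp
    then show False using lp by simp
  qed
  have "mass (2 / l) I \<le> 4 powr q * mass (1 / (2 * l)) I"
  proof -
    have "(2 / l) powr a x \<le> 4 powr q * (1 / (2 * l)) powr a x" for x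
    proof -
      have "(2 / l) powr a x = 4 powr a x * (1 / (2 * l)) powr a x"
        using powr_mult[of 4 "1 / (2 * l)" "a x"] by simp
      also have "\<dots> \<le> 4 powr q * (1 / (2 * l)) powr a x" using a_le by (intro mult_right_mono powr_mono) auto
      finally show ?thesis .
    qed
    then have "mass (2 / l) I \<le> ih (\<lambda>x. 4 powr q * (1 / (2 * l)) powr a x) I"
      unfolding mass_def using I lp by (intro ih_mono integrable_mult_right) auto
    then show ?thesis by (simp add: ih_cmult mass_def)
  qed
  also have "\<dots> \<le> 4 powr q * 1" using small by (intro mult_left_mono) auto
  finally show ?thesis using that lp l small big by simp
qed

text \<open>\<open>T\<close> is half the reciprocal norm of the indicator; \<open>S\<close> is then
  forced by \<open>T * S * prob I = 1\<close>, and the hypothesis makes it at most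
  \<open>4 * C\<close> times half the reciprocal dual norm.\<close>

lemma balanced_of_norms:
  assumes I: "I \<in> sets M" and pos: "prob I > 0" and C: "C \<ge> 1"
    and le: "var_norm M a (indicator I) * var_norm M b (indicator I) \<le> ennreal (C * prob I)"
  shows "balanced ((4 * C) powr q) I"
proof -
  interpret d: exponent_pair M b a q by (rule dual)
  obtain l where l: "0 < l" "var_norm M a (indicator I) = ennreal l" "mass (1 / (2 * l)) I \<le> 1"
    using var_norm_indicator_levels[OF I pos] by metis
  obtain k where k: "0 < k" "var_norm M b (indicator I) = ennreal k" "dmass (1 / (2 * k)) I \<le> 1"
    using d.var_norm_indicator_levels[OF I pos] unfolding dual_mass_eq by metis
  have lk: "l * k \<le> C * prob I" using le l k pos C by (simp flip: ennreal_mult)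
  define T S where "T = 1 / (2 * l)" and "S = 2 * l / prob I"
  have q0: "0 \<le> q" using q_gt_1 by simp
  have C4: "1 \<le> (4 * C) powr q" using C q0 by (intro ge_one_powr_ge_zero) auto
  have "S \<le> (4 * C) * (1 / (2 * k))" using lk k pos by (simp add: S_def field_simps)
  then have "S powr b x \<le> (4 * C) powr q * (1 / (2 * k)) powr b x" for x
  proof -
    have "S powr b x \<le> ((4 * C) * (1 / (2 * k))) powr b x"
      using \<open>S \<le> _\<close> l pos b_gt_1[of x] by (intro powr_mono2) (auto simp: S_def)
    also have "\<dots> = (4 * C) powr b x * (1 / (2 * k)) powr b x" by (rule powr_mult)
    also have "\<dots> \<le> (4 * C) powr q * (1 / (2 * k)) powr b x"
      using C b_le by (intro mult_right_mono powr_mono) auto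
    finally show ?thesis .
  qed
  then have "dmass S I \<le> ih (\<lambda>x. (4 * C) powr q * (1 / (2 * k)) powr b x) I"
    unfolding dmass_def using I k l pos
    by (intro ih_mono integrable_mult_right) (auto simp: S_def)
  also have "\<dots> = (4 * C) powr q * dmass (1 / (2 * k)) I" by (simp add: ih_cmult dmass_def)
  also have "\<dots> \<le> (4 * C) powr q * 1" using k by (intro mult_left_mono) auto
  finally have 1: "dmass S I \<le> (4 * C) powr q" by simp
  have 2: "mass T I \<le> (4 * C) powr q" using l C4 by (simp add: T_def)
  have "T > 0" "S > 0" "T * S * prob I = 1" using l pos by (auto simp: T_def S_def)
  then show ?thesis unfolding balanced_def using I pos 1 2 by blast
qed

text \<open>Test the average on the dual extremal function \<open>s powr (b x - 1)\<close> on
  \<open>I\<close>, with \<open>s\<close> twice the reciprocal dual norm: its modular is the dual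
  mass at \<open>s\<close>, which is bounded, and \<open>s\<close> times its integral is the same
  mass, which exceeds 1.\<close>

lemma norms_of_averaging:
  assumes I: "I \<in> sets M" and pos: "prob I > 0" and c: "c \<ge> 0"
    and avg: "\<And>f B. f \<in> borel_measurable M \<Longrightarrow> (\<And>x. 0 \<le> f x) \<Longrightarrow> (\<And>x. f x \<le> B) \<Longrightarrow> (\<And>x. x \<notin> I \<Longrightarrow> f x = 0) \<Longrightarrow>
      var_norm M a (\<lambda>x. of_real (avg f I) * indicator I x) \<le> ennreal c * var_norm M a (\<lambda>x. of_real (f x))"
  shows "var_norm M a (indicator I) * var_norm M b (indicator I) \<le> ennreal (2 * c * 4 powr q * prob I)"
proof -
  interpret va: var_exponent M a q by (rule var_exponent_a)
  interpret d: exponent_pair M b a q by (rule dual)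
  obtain l where l: "0 < l" "var_norm M a (indicator I) = ennreal l"
    using var_norm_indicator_levels[OF I pos] by metis
  obtain k where k: "0 < k" "var_norm M b (indicator I) = ennreal k"
    "1 < dmass (2 / k) I" "dmass (2 / k) I \<le> 4 powr q"
    using d.var_norm_indicator_levels[OF I pos] unfolding dual_mass_eq by metis
  define s where "s = 2 / k"
  have s: "s > 0" using k by (simp add: s_def)
  define f where "f x = indicator I x * s powr (b x - 1)" for x
  have fm[measurable]: "f \<in> borel_measurable M" unfolding f_def using I measurable_b by measurable
  have f0: "0 \<le> f x" for x by (simp add: f_def)
  have fB: "f x \<le> (max 1 s) powr q" for x
  proof -
    have "s powr (b x - 1) \<le> (max 1 s) powr q"
      using s b_gt_1[of x] b_le[of x] by (intro powr_le_max) auto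
    then show ?thesis by (simp add: f_def indicator_def)
  qed
  have fa: "(norm (of_real (f x) :: complex) / 1) powr a x = indicator I x * s powr b x" for x
    by (simp add: f_def indicator_def powr_powr ab mult.commute)
  have "var_modular M a (\<lambda>x. of_real (f x)) 1 = ennreal (dmass s I)"
    unfolding var_modular_def fa dmass_def ih_def using I s
    by (intro nn_integral_eq_integral integrable_ih) auto
  also have "\<dots> \<le> ennreal (4 powr q)" using k by (intro ennreal_leI) (simp add: s_def)
  finally have m1: "var_modular M a (\<lambda>x. of_real (f x)) 1 \<le> ennreal (4 powr q)" .
  have q4: "1 \<le> (4::real) powr q" using q_gt_1 by (intro ge_one_powr_ge_zero) auto
  have "var_modular M a (\<lambda>x. of_real (f x)) (4 powr q) \<le> ennreal (1 / 4 powr q) * var_modular M a (\<lambda>x. of_real (f x)) 1"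
    using q4 by (intro va.modular_scale) auto
  also have "\<dots> \<le> ennreal (1 / 4 powr q) * ennreal (4 powr q)" using m1 by (intro mult_left_mono) auto
  also have "\<dots> = 1" by (simp flip: ennreal_mult)
  finally have nf: "var_norm M a (\<lambda>x. of_real (f x)) \<le> ennreal (4 powr q)"
    by (intro va.var_norm_le) auto
  have "s * ih f I = ih (\<lambda>x. s * f x) I" by (simp add: ih_cmult)
  also have "\<dots> = dmass s I"
  proof -
    have "s * f x = s powr b x" if "x \<in> I" for x
      using that s powr_add[of s 1 "b x - 1"] by (simp add: f_def)
    then show ?thesis unfolding dmass_def by (rule ih_cong)
  qed
  finally have "1 < s * ih f I" using k by (simp add: s_def)
  then have avgf: "1 / (s * prob I) \<le> avg f I"
    using s pos by (simp add: avg_def field_simps)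
  have avgp: "avg f I > 0" using avgf s pos by (meson divide_pos_pos less_le_trans mult_pos_pos zero_less_one)
  have "ennreal (1 / (s * prob I)) * ennreal l \<le> ennreal (avg f I) * ennreal l"
    using avgf by (intro mult_right_mono ennreal_leI) auto
  also have "\<dots> = var_norm M a (\<lambda>x. of_real (avg f I) * indicator I x)"
    using va.var_norm_cmult[OF avgp, of "indicator I"] l by simp
  also have "\<dots> \<le> ennreal c * var_norm M a (\<lambda>x. of_real (f x))"
    by (rule avg[OF fm f0 fB]) (simp add: f_def)
  also have "\<dots> \<le> ennreal c * ennreal (4 powr q)" using nf by (intro mult_left_mono) auto
  finally have "1 / (s * prob I) * l \<le> c * 4 powr q"
    using l c s pos by (simp flip: ennreal_mult)
  then have "k * l \<le> 2 * c * 4 powr q * prob I" using pos k by (simp add: s_def field_simps)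
  then show ?thesis using l k by (simp add: mult.commute flip: ennreal_mult) (simp add: mult_ac ennreal_leI)
qed

text \<open>If the modular \<open>\<rho>\<close> exceeded 1, the extremal \<open>g\<close> would
  contradict the hypothesis. Its normalization needs the variable power
  \<open>\<rho> powr (- 1 / b x)\<close>; because of \<open>1 / a x \<ge> 1 / q\<close> the pairing
  is still at least \<open>K * \<rho> powr (1 / q) > K\<close>, so duality loses no constant.
  Bounded test functions are enough because \<open>h\<close> is bounded.\<close>

lemma modular_le_by_duality:
  assumes hm[measurable]: "h \<in> borel_measurable M" and B: "\<And>x. norm (h x) \<le> B" and K: "K > 0"
    and dual: "\<And>g. g \<in> borel_measurable M \<Longrightarrow> (\<And>x. norm (g x) \<le> (max 1 (B / K)) powr q) \<Longrightarrow>
      (LINT x|M. norm (g x) powr b x) \<le> 1 \<Longrightarrow> norm (LINT x|M. h x * g x) \<le> K"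
  shows "var_modular M a h K \<le> 1"
proof -
  note [measurable] = measurable_a measurable_b
  define u where "u x = (norm (h x) / K) powr a x" for x
  define L where "L = (max 1 (B / K)) powr q"
  have um[measurable]: "u \<in> borel_measurable M" unfolding u_def by measurable
  have pw: "(norm (h x) / K) powr e \<le> L" if "0 \<le> e" "e \<le> q" for x e
  proof -
    have "norm (h x) / K \<le> max 1 (B / K)" using B[of x] K by (simp add: le_max_iff_disj divide_right_mono)
    then have "(norm (h x) / K) powr e \<le> (max 1 (B / K)) powr e" using K that by (intro powr_mono2) auto
    also have "\<dots> \<le> L" unfolding L_def using that by (intro powr_mono) auto
    finally show ?thesis .
  qed
  have a0: "0 \<le> a x" "0 \<le> a x - 1" "a x - 1 \<le> q" for x using a_gt_1[of x] a_le[of x] by auto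
  have uL: "u x \<le> L" for x unfolding u_def using a0 a_le by (intro pw)
  have ui: "integrable M u"
    using uL by (intro integrable_const_bound[where B=L]) (auto simp: u_def)
  define \<rho> where "\<rho> = (LINT x|M. u x)"
  have mod: "var_modular M a h K = ennreal \<rho>"
    unfolding var_modular_def \<rho>_def
    by (subst nn_integral_eq_integral[OF ui, symmetric]) (simp_all add: u_def)
  show ?thesis
  proof (rule ccontr)
    assume "\<not> ?thesis"
    then have \<rho>: "\<rho> > 1" by (simp add: mod)
    define g :: "'a \<Rightarrow> complex" where
      "g x = cnj (sgn (h x)) * of_real ((norm (h x) / K) powr (a x - 1) * \<rho> powr (- 1 / b x))" for x
    have cnj_m: "(\<lambda>x. cnj (k x)) \<in> borel_measurable M" if "k \<in> borel_measurable M" for k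
      using measurable_compose[OF that borel_measurable_continuous_onI[OF continuous_on_cnj[OF continuous_on_id]]] by simp
    have of_real_m: "(\<lambda>x. complex_of_real (k x)) \<in> borel_measurable M" if "k \<in> borel_measurable M" for k
      using measurable_compose[OF that borel_measurable_continuous_onI[OF continuous_on_of_real[OF continuous_on_id]]] by simp
    have gm: "g \<in> borel_measurable M"
      unfolding g_def sgn_div_norm by (intro borel_measurable_times cnj_m of_real_m) measurable
    have r1: "\<rho> powr (- 1 / b x) \<le> 1" for x
      using \<rho> b_gt_1[of x] powr_mono[of "- 1 / b x" 0 \<rho>] by (simp add: divide_nonpos_pos)
    have ng: "norm (g x) \<le> (norm (h x) / K) powr (a x - 1) * \<rho> powr (- 1 / b x)" for x
      by (simp add: g_def norm_mult norm_sgn)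
    have gL: "norm (g x) \<le> (max 1 (B / K)) powr q" for x
    proof -
      have "norm (g x) \<le> (norm (h x) / K) powr (a x - 1) * 1"
        using ng[of x] r1[of x] by (meson mult_left_mono order_trans powr_ge_zero)
      then show ?thesis using pw[OF a0(2,3), of x x] by (simp add: L_def)
    qed
    have gb: "norm (g x) powr b x \<le> u x / \<rho>" for x
    proof -
      have "norm (g x) powr b x \<le> ((norm (h x) / K) powr (a x - 1) * \<rho> powr (- 1 / b x)) powr b x"
        using ng b_gt_1[of x] by (intro powr_mono2) auto
      also have "\<dots> = (norm (h x) / K) powr ((a x - 1) * b x) * \<rho> powr (- 1)"
        unfolding powr_mult powr_powr using b_gt_1[of x] by simp
      also have "(a x - 1) * b x = a x"
        using ab[of x] conj_ab[of x] a_gt_1[of x] b_gt_1[of x] by (simp add: field_simps)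
      finally show ?thesis using \<rho> by (simp add: u_def powr_minus_divide)
    qed
    have ui': "integrable M (\<lambda>x. u x / \<rho>)" using ui by simp
    have gi: "integrable M (\<lambda>x. norm (g x) powr b x)"
    proof (rule Bochner_Integration.integrable_bound[OF ui'])
      have "norm (norm (g x) powr b x) \<le> norm (u x / \<rho>)" for x
        using gb[of x] \<rho> by (simp add: u_def)
      then show "AE x in M. norm (norm (g x) powr b x) \<le> norm (u x / \<rho>)" by (rule AE_I2)
    qed (use gm in measurable)
    have "(LINT x|M. norm (g x) powr b x) \<le> (LINT x|M. u x / \<rho>)"
      using gi ui' gb by (rule integral_mono)
    also have "\<dots> = 1" using \<rho> by (simp add: \<rho>_def)
    finally have le: "norm (LINT x|M. h x * g x) \<le> K" using dual[OF gm gL] by blast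
    have hg: "h x * g x = of_real (K * (u x * \<rho> powr (- 1 / b x)))" for x
    proof (cases "h x = 0")
      case False
      have "h x * cnj (sgn (h x)) = of_real (norm (h x))"
        using False by (simp add: sgn_eq complex_norm_square[symmetric] power2_eq_square)
      then have "h x * g x = of_real (norm (h x) * ((norm (h x) / K) powr (a x - 1) * \<rho> powr (- 1 / b x)))"
        unfolding g_def by (simp only: mult.assoc[symmetric] of_real_mult)
      moreover have "norm (h x) * (norm (h x) / K) powr (a x - 1) = K * u x"
        using False K powr_add[of "norm (h x) / K" 1 "a x - 1"] by (simp add: u_def)
      ultimately show ?thesis by (simp only: mult.assoc[symmetric])
    qed (simp add: u_def)
    have wi: "integrable M (\<lambda>x. u x * \<rho> powr (- 1 / b x))"
    proof (rule Bochner_Integration.integrable_bound[OF ui])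
      show "AE x in M. norm (u x * \<rho> powr (- 1 / b x)) \<le> norm (u x)"
        using r1 by (intro AE_I2) (auto simp: abs_mult u_def intro!: mult_left_le)
    qed simp
    have "(LINT x|M. h x * g x) = of_real (K * (LINT x|M. u x * \<rho> powr (- 1 / b x)))"
      unfolding hg integral_complex_of_real integral_mult_right_zero ..
    then have "\<bar>K * (LINT x|M. u x * \<rho> powr (- 1 / b x))\<bar> \<le> K" using le by (simp only: norm_of_real)
    then have "K * (LINT x|M. u x * \<rho> powr (- 1 / b x)) \<le> K * 1" by linarith
    then have 1: "(LINT x|M. u x * \<rho> powr (- 1 / b x)) \<le> 1" using K by (rule mult_left_le_imp_le)
    have "\<rho> powr (1 / q) = (LINT x|M. u x * \<rho> powr (1 / q - 1))"
      using \<rho> by (simp add: powr_diff \<rho>_def[symmetric])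
    also have "\<dots> \<le> (LINT x|M. u x * \<rho> powr (- 1 / b x))"
    proof (rule integral_mono)
      fix x
      have "1 / q \<le> 1 / a x" using a_gt_1[of x] a_le[of x] by (intro divide_left_mono) auto
      then have "1 / q - 1 \<le> - 1 / b x" using conj_ab[of x] by simp
      then show "u x * \<rho> powr (1 / q - 1) \<le> u x * \<rho> powr (- 1 / b x)"
        using \<rho> by (intro mult_left_mono powr_mono) (auto simp: u_def)
    qed (use ui wi in auto)
    finally have "\<rho> powr (1 / q) \<le> 1" using 1 by simp
    moreover have "1 < \<rho> powr (1 / q)" using \<rho> q_gt_1 by simp
    ultimately show False by simp
  qed
qed

end

section \<open>Arcs of cyclic groups and two-frequency functions\<close>

text \<open>Jordan's inequality, by concavity of the sine.\<close>

lemma sin_ge_linear: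
  assumes "0 \<le> t" "t \<le> 1"
  shows "t \<le> sin (t * (pi / 2))"
proof -
  have "convex_on {0..pi} (\<lambda>x. - sin x)"
  proof (rule f''_ge0_imp_convex)
    show "((\<lambda>x. - sin x) has_real_derivative - cos x) (at x)" for x
      by (auto intro!: derivative_eq_intros)
    show "((\<lambda>x. - cos x) has_real_derivative sin x) (at x)" for x
      by (auto intro!: derivative_eq_intros)
    show "0 \<le> sin x" if "x \<in> {0..pi}" for x using that by (intro sin_ge_zero) auto
  qed auto
  from convex_onD[OF this, of t 0 "pi / 2"] show ?thesis using assms by simp
qed

lemma norm_cis_diff: "norm (cis s - cis t) = 2 * \<bar>sin ((s - t) / 2)\<bar>"
proof -
  have "(norm (cis s - cis t))\<^sup>2 = (cos s - cos t)\<^sup>2 + (sin s - sin t)\<^sup>2"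
    by (simp add: cmod_power2)
  also have "\<dots> = 4 * (sin ((s - t) / 2))\<^sup>2 * ((sin ((s + t) / 2))\<^sup>2 + (cos ((s + t) / 2))\<^sup>2)"
  proof -
    have "sin ((t - s) / 2) = - sin ((s - t) / 2)" by (metis minus_diff_eq minus_divide_left sin_minus)
    then show ?thesis unfolding cos_diff_cos sin_diff_sin by algebra
  qed
  also have "\<dots> = (2 * \<bar>sin ((s - t) / 2)\<bar>)\<^sup>2" by (simp add: power_mult_distrib)
  finally show ?thesis by (rule power2_eq_imp_eq) simp_all
qed

lemma norm_cis_diff_le: "norm (cis s - cis t) \<le> \<bar>s - t\<bar>"
  using abs_sin_x_le_abs_x[of "(s - t) / 2"] unfolding norm_cis_diff by simp

definition unit_root :: "nat \<Rightarrow> nat \<Rightarrow> complex" where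
  "unit_root p a = cis (2 * pi * real a / real p)"

text \<open>Chordal distance of residues placed on the unit circle; it is invariant under cyclic
  shifts and comparable to the cyclic distance divided by \<open>p\<close>.\<close>

definition chord :: "nat \<Rightarrow> nat \<Rightarrow> nat \<Rightarrow> real" where
  "chord p a b = norm (unit_root p a - unit_root p b)"

lemma norm_unit_root [simp]: "norm (unit_root p a) = 1"
  by (simp add: unit_root_def)

lemma unit_root_add: "unit_root p (a + b) = unit_root p a * unit_root p b"
  by (simp add: unit_root_def cis_mult add_divide_distrib distrib_left)

lemma unit_root_period: "p > 0 \<Longrightarrow> unit_root p (a mod p) = unit_root p a"
proof -
  assume p: "p > 0"
  have "unit_root p (p * n) = 1" for n
  proof (induction n)
    case 0 then show ?case by (simp add: unit_root_def)
  next
    case (Suc n)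
    have "unit_root p (p * Suc n) = unit_root p p * unit_root p (p * n)"
      by (simp flip: unit_root_add)
    then show ?case using Suc p by (simp add: unit_root_def)
  qed
  then have "unit_root p (a mod p + p * (a div p)) = unit_root p (a mod p)"
    by (simp only: unit_root_add) simp
  then show ?thesis by simp
qed

lemma chord_commute: "chord p a b = chord p b a"
  by (simp add: chord_def norm_minus_commute)

lemma chord_nonneg [simp]: "0 \<le> chord p a b" by (simp add: chord_def)

lemma chord_triangle: "chord p a c \<le> chord p a b + chord p b c"
  using norm_triangle_ineq[of "unit_root p a - unit_root p b" "unit_root p b - unit_root p c"]
  by (simp add: chord_def)

lemma chord_le_2: "chord p a b \<le> 2"
  unfolding chord_def using norm_triangle_ineq4[of "unit_root p a" "unit_root p b"] by simp

lemma chord_shift: "p > 0 \<Longrightarrow> chord p ((a + s) mod p) ((b + s) mod p) = chord p a b"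
  unfolding chord_def
  by (simp add: unit_root_period unit_root_add left_diff_distrib[symmetric] norm_mult)

lemma chord_le:
  assumes "p > 0"
  shows "chord p a b \<le> 2 * pi * \<bar>real a - real b\<bar> / p"
proof -
  have "chord p a b \<le> \<bar>2 * pi * real a / real p - 2 * pi * real b / real p\<bar>"
    unfolding chord_def unit_root_def by (rule norm_cis_diff_le)
  also have "2 * pi * real a / real p - 2 * pi * real b / real p = (2 * pi / p) * (real a - real b)"
    by (simp add: right_diff_distrib)
  also have "\<bar>\<dots>\<bar> = 2 * pi * \<bar>real a - real b\<bar> / p" by (simp add: abs_mult)
  finally show ?thesis .
qed

lemma chord_ge:
  assumes "a < b" "b < p" and u: "u \<le> real b - real a" "u \<le> real p - (real b - real a)"
  shows "4 * u / p \<le> chord p a b"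
proof -
  define t where "t = (real b - real a) / p"
  have t: "0 \<le> t" "t \<le> 1" "u / p \<le> t" "u / p \<le> 1 - t"
    using assms by (auto simp: t_def field_simps)
  have "chord p b a = 2 * \<bar>sin (pi * t)\<bar>"
    unfolding chord_def unit_root_def norm_cis_diff t_def
    by (simp add: diff_divide_distrib right_diff_distrib)
  moreover have "2 * (u / p) \<le> sin (pi * t)"
  proof (cases "t \<le> 1 / 2")
    case True
    have "2 * t \<le> sin (2 * t * (pi / 2))" using True t by (intro sin_ge_linear) auto
    also have "2 * t * (pi / 2) = pi * t" by simp
    finally show ?thesis using t by linarith
  next
    case False
    have "2 * (1 - t) \<le> sin (2 * (1 - t) * (pi / 2))" using False t by (intro sin_ge_linear) auto
    also have "2 * (1 - t) * (pi / 2) = pi - pi * t" by (simp add: algebra_simps)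
    finally have "2 * (1 - t) \<le> sin (pi * t)" by (simp only: sin_pi_minus)
    then show ?thesis using t(4) by argo
  qed
  ultimately show ?thesis by (simp add: chord_commute)
qed

lemma chord_ge_min:
  assumes "a \<noteq> b" "a < p" "b < p"
  shows "4 / p \<le> chord p a b"
proof (cases "a < b")
  case True
  then show ?thesis using chord_ge[of a b p 1] assms by simp
next
  case False
  then show ?thesis using chord_ge[of b a p 1] assms by (simp add: chord_commute)
qed

text \<open>Two systems of dyadic arcs of the cyclic group, the second one shifted by a third of the group.\<close>

definition arc_shift :: "bool \<Rightarrow> nat \<Rightarrow> nat" where
  "arc_shift j p = (if j then p div 3 else 0)"

definition arc :: "bool \<Rightarrow> nat \<Rightarrow> nat \<Rightarrow> nat \<Rightarrow> nat" where
  "arc j p l a = ((a + arc_shift j p) mod p * 2 ^ l) div p"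

definition depth :: "nat \<Rightarrow> nat" where
  "depth p = (LEAST l. p \<le> 2 ^ l)"

lemma depth: "p \<le> 2 ^ depth p"
  unfolding depth_def by (rule LeastI[of _ p]) (simp add: less_imp_le)

lemma less_depth: "l < depth p \<Longrightarrow> 2 ^ l < p"
  unfolding depth_def using not_less_Least[of l "\<lambda>l. p \<le> 2 ^ l"] by simp

lemma power_depth_le: "p \<ge> 2 \<Longrightarrow> l \<le> depth p \<Longrightarrow> 2 ^ l \<le> 2 * p"
proof -
  assume p: "p \<ge> 2" and l: "l \<le> depth p"
  show ?thesis
  proof (cases l)
    case 0 then show ?thesis using p by simp
  next
    case (Suc l')
    then have "2 ^ l' < p" using l by (intro less_depth) auto
    then show ?thesis using Suc by simp
  qed
qed

lemma arc_0: "p > 0 \<Longrightarrow> arc j p 0 a = 0"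
  by (simp add: arc_def)

lemma arc_Suc: "arc j p (Suc l) c div 2 = arc j p l c"
proof -
  have "(d * 2 ^ Suc l) div p div 2 = (d * 2 ^ l) div p" for d
  proof -
    have "(d * 2 ^ Suc l) div p div 2 = (2 * (d * 2 ^ l)) div (2 * p)"
      unfolding div_mult2_eq[symmetric] by (simp add: mult_ac)
    then show ?thesis by (simp only: div_mult_mult1)
  qed
  then show ?thesis unfolding arc_def .
qed

lemma arc_mono:
  assumes "l \<le> l'" "arc j p l' a = arc j p l' b"
  shows "arc j p l a = arc j p l b"
  using assms
proof (induction l' rule: dec_induct)
  case (step n)
  have "arc j p n a = arc j p n b"
    unfolding arc_Suc[symmetric, of j p n] step.prems ..
  then show ?case by (rule step.IH)
qed

lemma cell_bounds:
  fixes c :: nat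
  assumes "p > 0" "c div p = i"
  shows "i * p \<le> c" "c < i * p + p"
  using div_mult_mod_eq[of c p] mod_less_divisor[OF assms(1), of c] assms(2) by auto

lemma same_cell_close:
  fixes c d :: nat
  assumes "p > 0" "(c * 2 ^ l) div p = (d * 2 ^ l) div p"
  shows "\<bar>real c - real d\<bar> * 2 ^ l \<le> p"
proof -
  define i where "i = (c * 2 ^ l) div p"
  note c = cell_bounds[OF assms(1) i_def[symmetric]]
  have "(d * 2 ^ l) div p = i" using assms(2) by (simp only: i_def)
  note d = cell_bounds[OF assms(1) this]
  have "real (i * p) \<le> real (c * 2 ^ l)" "real (c * 2 ^ l) < real (i * p + p)"
      "real (i * p) \<le> real (d * 2 ^ l)" "real (d * 2 ^ l) < real (i * p + p)"
    using c d by (simp_all only: of_nat_le_iff of_nat_less_iff)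
  then have "real i * p \<le> real c * 2 ^ l" "real c * 2 ^ l < real i * p + p"
      "real i * p \<le> real d * 2 ^ l" "real d * 2 ^ l < real i * p + p"
    by simp_all
  then have "\<bar>real c * 2 ^ l - real d * 2 ^ l\<bar> \<le> p" by linarith
  then show ?thesis by (simp add: left_diff_distrib[symmetric] abs_mult)
qed

lemma chord_le_of_arc:
  assumes p: "p > 0" and "arc j p l a = arc j p l b"
  shows "chord p a b \<le> 2 * pi / 2 ^ l"
proof -
  let ?c = "(a + arc_shift j p) mod p" and ?d = "(b + arc_shift j p) mod p"
  have "\<bar>real ?c - real ?d\<bar> * 2 ^ l \<le> p"
    using assms by (intro same_cell_close) (auto simp: arc_def)
  then have "\<bar>real ?c - real ?d\<bar> / p \<le> 1 / 2 ^ l" using p by (simp add: field_simps)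
  then have "2 * pi * (\<bar>real ?c - real ?d\<bar> / p) \<le> 2 * pi * (1 / 2 ^ l)" by (intro mult_left_mono) auto
  then show ?thesis using chord_le[OF p, of ?c ?d] p by (simp add: chord_shift)
qed

lemma arc_depth_inj:
  assumes "a < p" "b < p" "arc j p (depth p) a = arc j p (depth p) b"
  shows "a = b"
proof -
  let ?c = "(a + arc_shift j p) mod p" and ?d = "(b + arc_shift j p) mod p"
  have p: "p > 0" using assms by simp
  let ?L = "2 ^ depth p :: nat"
  define i where "i = (?c * 2 ^ depth p) div p"
  note c = cell_bounds[OF p i_def[symmetric]]
  have "(?d * 2 ^ depth p) div p = i" using assms(3) unfolding i_def arc_def by (rule sym)
  note d = cell_bounds[OF p this]
  have "i * p \<le> ?c * ?L" "?c * ?L < i * p + p" "i * p \<le> ?d * ?L" "?d * ?L < i * p + p"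
    using c d by simp_all
  then have "?c * ?L < ?d * ?L + ?L" "?d * ?L < ?c * ?L + ?L" using depth[of p] by linarith+
  then have "?c * ?L < Suc ?d * ?L" "?d * ?L < Suc ?c * ?L" by simp_all
  then have "?c < Suc ?d" "?d < Suc ?c" using mult_less_cancel2 by blast+
  then have cd: "?c = ?d" by simp
  have "inj_on (\<lambda>b. (arc_shift j p mod p + b) mod p) {..<p}"
    using bij_betw_add_mod[of "arc_shift j p mod p" p] p by (simp add: bij_betw_def)
  moreover have "(arc_shift j p mod p + a) mod p = (arc_shift j p mod p + b) mod p"
    using cd by (simp add: mod_simps add.commute)
  ultimately show ?thesis using assms by (auto dest: inj_onD)
qed

text \<open>\<open>A i\<close> is the ceiling of \<open>i * p / 2 ^ l\<close>. Intervals of residues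
  are what the two-frequency lemmas require.\<close>

lemma cell_interval:
  fixes p l i :: nat
  assumes "p > 0"
  defines "A \<equiv> \<lambda>i. (i * p + 2 ^ l - 1) div 2 ^ l"
  shows "{c. (c * 2 ^ l) div p = i} = {A i..<A (Suc i)}"
    and "real i * p \<le> real (A i) * 2 ^ l" "real (A i) * 2 ^ l \<le> real i * p + 2 ^ l - 1"
proof -
  have A: "A i \<le> c \<longleftrightarrow> i * p \<le> c * 2 ^ l" for i c
  proof -
    have "A i \<le> c \<longleftrightarrow> i * p + 2 ^ l - 1 < Suc c * 2 ^ l"
      unfolding A_def by (simp only: less_Suc_eq_le[symmetric] div_less_iff_less_mult[of "2 ^ l"] zero_less_power zero_less_numeral)
    also have "\<dots> \<longleftrightarrow> i * p \<le> c * 2 ^ l"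
    proof -
      have "(1::nat) \<le> 2 ^ l" by simp
      then show ?thesis unfolding mult_Suc by linarith
    qed
    finally show ?thesis .
  qed
  have iff: "(c * 2 ^ l) div p = i \<longleftrightarrow> i * p \<le> c * 2 ^ l \<and> \<not> Suc i * p \<le> c * 2 ^ l" for c
  proof
    assume "(c * 2 ^ l) div p = i"
    then show "i * p \<le> c * 2 ^ l \<and> \<not> Suc i * p \<le> c * 2 ^ l"
      using cell_bounds[OF assms(1), of "c * 2 ^ l" i] by simp
  next
    assume "i * p \<le> c * 2 ^ l \<and> \<not> Suc i * p \<le> c * 2 ^ l"
    then show "(c * 2 ^ l) div p = i" by (intro div_nat_eqI) (auto simp: mult.commute)
  qed
  show "{c. (c * 2 ^ l) div p = i} = {A i..<A (Suc i)}"
    unfolding iff A[symmetric] by auto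
  have "i * p \<le> A i * 2 ^ l" using A[of i "A i"] by simp
  then have "real (i * p) \<le> real (A i * 2 ^ l)" by (rule of_nat_mono)
  then show "real i * p \<le> real (A i) * 2 ^ l" by simp
  have "A i * 2 ^ l \<le> i * p + 2 ^ l - 1" unfolding A_def by (rule div_times_less_eq_dividend)
  then have "A i * 2 ^ l + 1 \<le> i * p + 2 ^ l"
    using one_le_power[of "2::nat" l] by linarith
  then have "real (A i * 2 ^ l + 1) \<le> real (i * p + 2 ^ l)" by (rule of_nat_mono)
  then show "real (A i) * 2 ^ l \<le> real i * p + 2 ^ l - 1" by simp
qed

lemma arc_unshift_interval:
  fixes p l i :: nat
  assumes p: "p > 0"
  shows "\<exists>u m. {c\<in>{..<p}. (c * 2 ^ l) div p = i} = {u..<u + m}"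
proof -
  define x y where "x = (i * p + 2 ^ l - 1) div 2 ^ l" and "y = min ((Suc i * p + 2 ^ l - 1) div 2 ^ l) p"
  have cap: "{x..<z} \<inter> {..<p} = {x..<min z p}" for z :: nat by auto
  have "{c\<in>{..<p}. (c * 2 ^ l) div p = i} = {c. (c * 2 ^ l) div p = i} \<inter> {..<p}" by blast
  also have "\<dots> = {x..<y}"
    unfolding cell_interval(1)[OF p] x_def[symmetric] cap y_def ..
  also have "\<dots> = {x..<x + (y - x)}" by (cases "x \<le> y") auto
  finally show ?thesis by blast
qed

text \<open>The number of residues in a cell differs from \<open>p / 2 ^ l\<close> by less than 1.
  Since the cell is nonempty and \<open>2 ^ l \<le> 2 * p\<close> up to the depth, this becomes a
  factor 2 both ways, whatever \<open>p\<close> is.\<close>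

lemma card_arc:
  assumes p: "p \<ge> 2" and l: "l \<le> depth p" and a: "a < p"
  shows "real p \<le> 2 * 2 ^ l * real (card {b\<in>{..<p}. arc j p l b = arc j p l a})"
    and "2 ^ l * real (card {b\<in>{..<p}. arc j p l b = arc j p l a}) \<le> 2 * real p"
proof -
  have p0: "p > 0" using p by simp
  define s where "s = arc_shift j p mod p"
  define S where "S = {b\<in>{..<p}. arc j p l b = arc j p l a}"
  define i where "i = arc j p l a"
  define R where "R = {c\<in>{..<p}. (c * 2 ^ l) div p = i}"
  have sp: "s < p" using p0 by (simp add: s_def)
  note bij = bij_betw_add_mod[OF sp]
  have sh: "(b + arc_shift j p) mod p = (s + b) mod p" for b
    by (simp add: s_def mod_simps add.commute)
  have "bij_betw (\<lambda>b. (s + b) mod p) S R"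
  proof (rule bij_betw_subset[OF bij])
    show "S \<subseteq> {..<p}" by (auto simp: S_def)
    show "(\<lambda>b. (s + b) mod p) ` S = R"
    proof
      show "(\<lambda>b. (s + b) mod p) ` S \<subseteq> R" using p0 by (auto simp: S_def R_def i_def arc_def sh)
      show "R \<subseteq> (\<lambda>b. (s + b) mod p) ` S"
      proof
        fix c assume c: "c \<in> R"
        then have "c \<in> (\<lambda>b. (s + b) mod p) ` {..<p}" using bij by (auto simp: bij_betw_def R_def)
        then obtain b where "b < p" "c = (s + b) mod p" by auto
        then show "c \<in> (\<lambda>b. (s + b) mod p) ` S" using c by (auto simp: S_def R_def i_def arc_def sh)
      qed
    qed
  qed
  then have cardSR: "card S = card R" by (rule bij_betw_same_card)
  have "(a + arc_shift j p) mod p \<in> R" using p0 by (auto simp: R_def i_def arc_def)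
  then have R0: "card R > 0" unfolding R_def by (subst card_gt_0_iff) auto
  have i_less: "i < 2 ^ l"
  proof -
    have "(a + arc_shift j p) mod p * 2 ^ l < p * 2 ^ l" using p0 by simp
    then show ?thesis unfolding i_def arc_def by (simp add: less_mult_imp_div_less mult.commute)
  qed
  have R_eq: "R = {c. (c * 2 ^ l) div p = i}"
  proof -
    have "c < p" if "(c * 2 ^ l) div p = i" for c
    proof (rule ccontr)
      assume "\<not> c < p"
      then have "p * 2 ^ l \<le> c * 2 ^ l" by simp
      then have "(p * 2 ^ l) div p \<le> (c * 2 ^ l) div p" by (rule div_le_mono)
      then show False using that i_less p0 by simp
    qed
    then show ?thesis by (auto simp: R_def)
  qed
  define A where "A i = (i * p + 2 ^ l - 1) div 2 ^ l" for i
  note cell = cell_interval[OF p0, where l=l, folded A_def]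
  have cR: "card R = A (Suc i) - A i" unfolding R_eq cell(1) by simp
  then have cR': "real (card R) = real (A (Suc i)) - real (A i)" using R0 by simp
  have up: "real (card R) * 2 ^ l \<le> real p + 2 ^ l - 1"
    using cell(3)[of "Suc i"] cell(2)[of i] unfolding cR' left_diff_distrib by (simp add: distrib_right)
  have lo: "real p - 2 ^ l + 1 \<le> real (card R) * 2 ^ l"
    using cell(2)[of "Suc i"] cell(3)[of i] unfolding cR' left_diff_distrib by (simp add: distrib_right)
  have "real p \<le> 2 * 2 ^ l * real (card R) \<and> 2 ^ l * real (card R) \<le> 2 * real p"
  proof (cases "2 ^ l \<le> p")
    case True
    then have T: "2 ^ l \<le> real p" by (metis of_nat_le_iff of_nat_numeral of_nat_power)
    have "real p \<le> 2 * (2 ^ l * real (card R))"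
    proof (cases "real p \<le> 2 * 2 ^ l")
      case True
      have "2 ^ l * 1 \<le> 2 ^ l * real (card R)" using R0 by (intro mult_left_mono) auto
      then show ?thesis using True by linarith
    next
      case False
      then show ?thesis using lo by (simp add: mult.commute)
    qed
    then have 1: "real p \<le> 2 * 2 ^ l * real (card R)" by (simp only: mult.assoc)
    have "real (card R) * 2 ^ l \<le> 2 * real p" using up T by linarith
    then have "2 ^ l * real (card R) \<le> 2 * real p" by (simp only: mult.commute)
    with 1 show ?thesis by simp
  next
    case False
    then have "p < 2 ^ l" by simp
    then have F: "real p < 2 ^ l" by (metis of_nat_less_iff of_nat_numeral of_nat_power)
    have "real (card R) * 2 ^ l < 2 * 2 ^ l" using up F by linarith
    then have "card R = 1" using R0 by simp
    then have c1: "real (card R) = 1" by simp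
    have "2 ^ l \<le> 2 * p" using power_depth_le[OF p l] .
    then have "real (2 ^ l) \<le> real (2 * p)" by (rule of_nat_mono)
    then have P: "2 ^ l \<le> 2 * real p" by simp
    have "real p \<le> 2 * 2 ^ l * 1" using F by linarith
    then show ?thesis unfolding c1 using P by linarith
  qed
  then show "real p \<le> 2 * 2 ^ l * real (card {b\<in>{..<p}. arc j p l b = arc j p l a})"
    and "2 ^ l * real (card {b\<in>{..<p}. arc j p l b = arc j p l a}) \<le> 2 * real p"
    using cardSR unfolding S_def by auto
qed

text \<open>\<open>2 ^ l\<close> is not divisible by 3, so \<open>2 ^ l / 3\<close> is at distance
  at least 1/3 from the integers. Rounding \<open>p / 3\<close> down costs the term
  \<open>2 * 2 ^ l / 3\<close>.\<close>

lemma third_far_from_multiples: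
  fixes p l :: nat and m :: int
  shows "(real p - 2 * 2 ^ l) / 3 \<le> \<bar>real (p div 3) * 2 ^ l - real_of_int m * real p\<bar>"
proof -
  define s e where "s = p div 3" and "e = p mod 3"
  have pe: "p = 3 * s + e" "e \<le> 2" by (auto simp: s_def e_def) 
  have "(2 ^ l :: int) mod 3 = 1 \<or> (2 ^ l :: int) mod 3 = 2"
  proof (induction l)
    case (Suc l)
    have "(2 ^ Suc l :: int) mod 3 = (2 * ((2 ^ l) mod 3)) mod 3" by (simp add: mod_mult_right_eq)
    then show ?case using Suc by auto
  qed simp
  then have "2 ^ l \<noteq> 3 * m" by auto
  then have "1 \<le> \<bar>2 ^ l - 3 * m\<bar>" by linarith
  then have "real_of_int 1 \<le> real_of_int \<bar>2 ^ l - 3 * m\<bar>" by (simp only: of_int_le_iff)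
  then have 1: "1 \<le> \<bar>2 ^ l - 3 * real_of_int m\<bar>" by simp
  have "real p * 1 \<le> real p * \<bar>2 ^ l - 3 * real_of_int m\<bar>" using 1 by (intro mult_left_mono) auto
  also have "\<dots> = \<bar>p * (2 ^ l - 3 * real_of_int m)\<bar>" by (simp add: abs_mult)
  also have "p * (2 ^ l - 3 * real_of_int m) = 3 * (real s * 2 ^ l - real_of_int m * real p) + real e * 2 ^ l"
    by (simp add: pe(1) algebra_simps)
  also have "\<bar>\<dots>\<bar> \<le> 3 * \<bar>real s * 2 ^ l - real_of_int m * real p\<bar> + real e * 2 ^ l"
  proof -
    have abs3: "\<bar>3 * z + y\<bar> \<le> 3 * \<bar>z\<bar> + y" if "y \<ge> 0" for y z :: real using that by arith
    show ?thesis by (rule abs3) simp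
  qed
  also have "real e * 2 ^ l \<le> 2 * 2 ^ l" using pe by (intro mult_right_mono) auto
  finally show ?thesis by (simp add: s_def)
qed

lemma cut_between:
  fixes c d :: nat
  assumes "p > 0" "c < d" "(c * 2 ^ l) div p \<noteq> (d * 2 ^ l) div p"
  obtains i :: int where "real c * 2 ^ l \<le> real_of_int i * real p" "real_of_int i * real p \<le> real d * 2 ^ l"
proof -
  define i where "i = (d * 2 ^ l) div p"
  have "(c * 2 ^ l) div p \<le> (d * 2 ^ l) div p" using assms by (intro div_le_mono) auto
  then have "(c * 2 ^ l) div p < i" using assms by (simp add: i_def)
  then have "c * 2 ^ l \<le> i * p"
    using assms(1) by (metis div_less_iff_less_mult less_imp_le)
  moreover have "i * p \<le> d * 2 ^ l" unfolding i_def by (rule div_times_less_eq_dividend)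
  ultimately have "real (c * 2 ^ l) \<le> real (i * p)" "real (i * p) \<le> real (d * 2 ^ l)" by (simp_all only: of_nat_le_iff)
  then show ?thesis using that[of "int i"] by simp
qed

text \<open>
  The one-third trick: the cuts of the two systems of arcs are so far apart that a short arc
  cannot meet cuts of both.
\<close>

lemma chord_ge_of_distinct_arcs:
  assumes a: "a < p" and b: "b < p"
    and F: "arc False p l a \<noteq> arc False p l b" and T: "arc True p l a \<noteq> arc True p l b"
  shows "2 / 3 / 2 ^ l \<le> chord p a b"
proof -
  have *: "2 / 3 / 2 ^ l \<le> chord p a b"
    if ab: "a < b" and b: "b < p" and F: "arc False p l a \<noteq> arc False p l b"
      and T: "arc True p l a \<noteq> arc True p l b" for a b
  proof -
    have p: "p > 0" and a: "a < p" using ab b by auto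
    define s where "s = p div 3"
    have sp: "s < p" using p by (simp add: s_def)
    define g where "g = (real p - 2 * 2 ^ l) / 3"
    have g: "g \<le> \<bar>real s * 2 ^ l - real_of_int m * real p\<bar>" for m :: int
      unfolding g_def s_def by (rule third_far_from_multiples)
    obtain i where i: "real a * 2 ^ l \<le> real_of_int i * real p" "real_of_int i * real p \<le> real b * 2 ^ l"
      using cut_between[OF p ab, of l] F a b by (auto simp: arc_def arc_shift_def)
    have sh: "(x + s) mod p = (if x + s < p then x + s else x + s - p)" if "x < p" for x
      using that sp by (simp add: mod_if)
    have g': "g \<le> \<bar>(real p - real s) * 2 ^ l - real_of_int m * real p\<bar>" for m :: int
    proof -
      have "(real p - real s) * 2 ^ l - real_of_int m * real p = - (real s * 2 ^ l - real_of_int (2 ^ l - m) * real p)"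
        by (simp add: algebra_simps)
      then show ?thesis using g[of "2 ^ l - m"] by (simp only: abs_minus_cancel)
    qed
    \<comment> \<open>Both ways around the cycle from \<open>a\<close> to \<open>b\<close> pass a
      cut of each system; the residue 0 and the residue that the shift sends to 0 count as cuts.
      Cuts of different systems are at least \<open>g / 2 ^ l\<close> apart. The cases tell which of
      the two shifted points wrap around.\<close>
    have direct_wrap: "g \<le> (real b - real a) * 2 ^ l \<and> g \<le> (real p - (real b - real a)) * 2 ^ l"
    proof -
      have T': "((a + s) mod p * 2 ^ l) div p \<noteq> ((b + s) mod p * 2 ^ l) div p"
        using T by (simp add: arc_def arc_shift_def s_def)
      have pow: "(0::real) \<le> 2 ^ l" by simp
      consider "b + s < p" | "a + s < p" "\<not> b + s < p" | "\<not> a + s < p" using ab by linarith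
      then show ?thesis
      proof cases
        case 1
        then have "((a + s) * 2 ^ l) div p \<noteq> ((b + s) * 2 ^ l) div p" using T' sh a b ab by simp
        then obtain k where k: "real (a + s) * 2 ^ l \<le> real_of_int k * real p" "real_of_int k * real p \<le> real (b + s) * 2 ^ l"
          using cut_between[OF p, of "a + s" "b + s" l] ab by auto
        have "\<bar>real s * 2 ^ l - real_of_int (k - i) * real p\<bar> \<le> (real b - real a) * 2 ^ l"
          using i k by (simp add: abs_le_iff algebra_simps)
        moreover have "real s * 2 ^ l \<le> (real p - (real b - real a)) * 2 ^ l"
          using 1 by (intro mult_right_mono) auto
        moreover have "g \<le> real s * 2 ^ l" using g[of 0] by simp
        ultimately show ?thesis using g[of "k - i"] by linarith
      next
        case 2
        then have sh2: "(a + s) mod p = a + s" "(b + s) mod p = b + s - p" using sh a b by auto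
        have lt: "b + s - p < a + s" using b 2 by linarith
        obtain k where k: "real (b + s - p) * 2 ^ l \<le> real_of_int k * real p" "real_of_int k * real p \<le> real (a + s) * 2 ^ l"
          by (rule cut_between[OF p lt not_sym[OF T'[unfolded sh2]]])
        have bsp: "real (b + s - p) = real b + real s - real p" using 2 by simp
        have "real a * 2 ^ l \<le> (real p - real s) * 2 ^ l" "(real p - real s) * 2 ^ l \<le> real b * 2 ^ l"
          using 2 by (intro mult_right_mono; simp)+
        then have "\<bar>(real p - real s) * 2 ^ l - real_of_int i * real p\<bar> \<le> (real b - real a) * 2 ^ l"
          using i by (simp add: abs_le_iff algebra_simps)
        moreover have "(real b + real s - real p) * 2 ^ l \<le> real s * 2 ^ l" "real s * 2 ^ l \<le> real (a + s) * 2 ^ l"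
          using b by (intro mult_right_mono; simp)+
        then have "\<bar>real s * 2 ^ l - real_of_int k * real p\<bar> \<le> (real p - (real b - real a)) * 2 ^ l"
          using k unfolding bsp by (simp only: abs_le_iff distrib_right left_diff_distrib of_nat_add, linarith)
        ultimately show ?thesis using g[of k] g'[of i] by linarith
      next
        case 3
        then have sh3: "(a + s) mod p = a + s - p" "(b + s) mod p = b + s - p" using sh a b ab by auto
        have lt: "a + s - p < b + s - p" using 3 ab by linarith
        obtain k where k: "real (a + s - p) * 2 ^ l \<le> real_of_int k * real p" "real_of_int k * real p \<le> real (b + s - p) * 2 ^ l"
          by (rule cut_between[OF p lt T'[unfolded sh3]])
        have sub: "real (a + s - p) = real a + real s - real p" "real (b + s - p) = real b + real s - real p"
          using 3 ab by auto
        have "\<bar>(real p - real s) * 2 ^ l - real_of_int (i - k) * real p\<bar> \<le> (real b - real a) * 2 ^ l"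
          using i k unfolding sub by (simp add: abs_le_iff algebra_simps)
        moreover have "(real p - real s) * 2 ^ l \<le> (real p - (real b - real a)) * 2 ^ l"
          using 3 b by (intro mult_right_mono) auto
        moreover have "g \<le> (real p - real s) * 2 ^ l" using g'[of 0] sp by simp
        ultimately show ?thesis using g'[of "i - k"] by linarith
      qed
    qed
    \<comment> \<open>For \<open>p < 4 * 2 ^ l\<close> rounding makes \<open>g\<close> too weak, but
      then distinct residues are already far enough apart.\<close>
    define u where "u = real p / (6 * 2 ^ l)"
    have "u \<le> real b - real a \<and> u \<le> real p - (real b - real a)"
    proof (cases "real p < 4 * 2 ^ l")
      case True
      then have "u \<le> 1" unfolding u_def by (simp add: divide_le_eq)
      moreover have "1 \<le> real b - real a" "1 \<le> real p - (real b - real a)" using ab b by linarith+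
      ultimately show ?thesis by linarith
    next
      case False
      have "u * 2 ^ l \<le> g" using False by (simp add: u_def g_def field_simps)
      then have "u * 2 ^ l \<le> (real b - real a) * 2 ^ l" "u * 2 ^ l \<le> (real p - (real b - real a)) * 2 ^ l"
        using direct_wrap by linarith+
      then show ?thesis by simp
    qed
    then have "4 * u / p \<le> chord p a b" using ab b by (intro chord_ge) auto
    then show ?thesis using p by (simp add: u_def)
  qed
  show ?thesis
  proof (cases "a < b")
    case True then show ?thesis using * assms by blast
  next
    case False
    then have "b < a" using F by (metis linorder_neqE_nat)
    then show ?thesis using *[of b a] assms chord_commute by metis
  qed
qed

text \<open>
  Functions \<open>u \<mapsto> A + B * w ^ u\<close> satisfy the recurrence
  \<open>h (u + 2 * d) - (1 + w ^ d) * h (u + d) + w ^ d * h u = 0\<close> for every \<open>d\<close>, so that a value is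
  controlled by two others.
\<close>

lemma two_frequency_remez:
  fixes h :: "nat \<Rightarrow> complex"
  assumes h: "\<And>y. h y = A + B * w ^ y" and w: "norm w = 1"
    and E: "E \<subseteq> {u..<u + m}" "16 * card ({u..<u + m} - E) \<le> m"
    and le: "\<And>y. y \<in> E \<Longrightarrow> norm (h y) \<le> t" and y: "y \<in> {u..<u + m}"
  shows "norm (h y) \<le> 3 * t"
proof (cases "y \<in> E")
  case True
  then show ?thesis using le[OF True] norm_ge_zero[of "h y"] by linarith
next
  case False
  define bad where "bad = {u..<u + m} - E"
  have finbad: "finite bad" by (simp add: bad_def)
  have "bad \<noteq> {}" using y False by (auto simp: bad_def)
  then have "card bad \<ge> 1" using finbad by (simp add: card_gt_0_iff Suc_leI)
  then have m16: "m \<ge> 16" "16 * card bad \<le> m" using E(2) by (auto simp: bad_def)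
  have w0: "w \<noteq> 0" using w by auto
  \<comment> \<open>\<open>4 * r \<le> m - 1\<close> leaves room for \<open>2 * r\<close> steps on
    one side of \<open>y\<close>, and \<open>2 * card bad < r\<close> leaves a \<open>d\<close> for
    which neither \<open>d\<close> nor \<open>2 * d\<close> steps lead to a bad point.\<close>
  define r where "r = (m - 1) div 4"
  have r4: "4 * r \<le> m - 1" unfolding r_def by simp
  have r: "2 * card bad < r" using m16 unfolding r_def by linarith
  text \<open>On one side of \<open>y\<close> there is room for \<open>r\<close> values of the step \<open>d\<close>; \<open>f\<close> is the step map.\<close>
  have step: "\<exists>d\<in>{1..r}. f d \<in> E \<and> f (2 * d) \<in> E"
    if f: "inj_on f {1..2 * r}" "\<And>d. d \<in> {1..2 * r} \<Longrightarrow> f d \<in> {u..<u + m}" for f :: "nat \<Rightarrow> nat"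
  proof (rule ccontr)
    assume "\<not> ?thesis"
    then have "{1..r} \<subseteq> {d\<in>{1..r}. f d \<in> bad} \<union> {d\<in>{1..r}. f (2 * d) \<in> bad}"
      using f(2) by (auto simp: bad_def)
    then have "card {1..r} \<le> card ({d\<in>{1..r}. f d \<in> bad} \<union> {d\<in>{1..r}. f (2 * d) \<in> bad})"
      by (intro card_mono) auto
    also have "\<dots> \<le> card {d\<in>{1..r}. f d \<in> bad} + card {d\<in>{1..r}. f (2 * d) \<in> bad}" by (rule card_Un_le)
    also have "card {d\<in>{1..r}. f d \<in> bad} \<le> card bad"
    proof (rule card_inj_on_le[of f])
      show "inj_on f {d\<in>{1..r}. f d \<in> bad}" using f(1) by (rule inj_on_subset) auto
    qed (use finbad in auto)
    also have "card {d\<in>{1..r}. f (2 * d) \<in> bad} \<le> card bad"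
    proof (rule card_inj_on_le[of "\<lambda>d. f (2 * d)"])
      show "inj_on (\<lambda>d. f (2 * d)) {d\<in>{1..r}. f (2 * d) \<in> bad}"
      proof (rule inj_onI)
        fix d d' assume "d \<in> {d\<in>{1..r}. f (2 * d) \<in> bad}" "d' \<in> {d\<in>{1..r}. f (2 * d) \<in> bad}"
          and eq: "f (2 * d) = f (2 * d')"
        then have "2 * d \<in> {1..2 * r}" "2 * d' \<in> {1..2 * r}" by auto
        then have "2 * d = 2 * d'" using eq f(1) by (auto dest: inj_onD)
        then show "d = d'" by simp
      qed
    qed (use finbad in auto)
    finally show False using r by simp
  qed
  show ?thesis
  proof (cases "y + 2 * r < u + m")
    case True
    obtain d where d: "y + d \<in> E" "y + 2 * d \<in> E"
      using step[of "\<lambda>d. y + d"] True y by (auto simp: inj_on_def)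
    have wd: "norm (w ^ d) = 1" using w by (simp add: norm_power)
    have w2: "w ^ (2 * d) = w ^ d * w ^ d" by (simp only: mult_2 power_add)
    have "w ^ d * h y = (1 + w ^ d) * h (y + d) - h (y + 2 * d)"
      unfolding h power_add w2 by (simp add: algebra_simps)
    then have "norm (h y) = norm ((1 + w ^ d) * h (y + d) - h (y + 2 * d))"
      using wd by (metis mult_1 norm_mult)
    also have "\<dots> \<le> norm (1 + w ^ d) * norm (h (y + d)) + norm (h (y + 2 * d))"
      by (metis norm_mult norm_triangle_ineq4)
    also have "\<dots> \<le> 2 * t + t"
      using le[OF d(1)] le[OF d(2)] norm_triangle_ineq[of 1 "w ^ d"] wd
      by (intro add_mono mult_mono) auto
    finally show ?thesis by simp
  next
    case False
    have room: "u + 2 * r \<le> y" using False y r4 m16 by auto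
    have "\<exists>d\<in>{1..r}. y - d \<in> E \<and> y - 2 * d \<in> E"
      using room y by (intro step) (auto intro!: inj_onI)
    then obtain d where d: "y - d \<in> E" "y - 2 * d \<in> E" "d \<le> r" by auto
    define v where "v = y - 2 * d"
    have yv: "y = v + 2 * d" "y - d = v + d" using d room by (auto simp: v_def)
    have wd: "norm (w ^ d) = 1" using w by (simp add: norm_power)
    have w2: "w ^ (2 * d) = w ^ d * w ^ d" by (simp only: mult_2 power_add)
    have "h y = (1 + w ^ d) * h (v + d) - w ^ d * h v"
      unfolding yv(1) h power_add w2 by (simp add: algebra_simps)
    also have "norm \<dots> \<le> norm (1 + w ^ d) * norm (h (v + d)) + norm (w ^ d) * norm (h v)"
      by (metis norm_mult norm_triangle_ineq4)
    also have "\<dots> \<le> 2 * t + 1 * t"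
      using le[OF d(1)] le[OF d(2)] norm_triangle_ineq[of 1 "w ^ d"] wd
      unfolding yv(2) v_def[symmetric] by (intro add_mono mult_mono) auto
    finally show ?thesis by simp
  qed
qed

text \<open>A single recurrence reproduces the value with coefficients of size about 1. Averaging
  over \<open>R\<close> steps spreads them: a point is hit at most once by \<open>f d\<close> and
  once by \<open>f (2 * d)\<close>, so its coefficient is at most \<open>(2 + 1) / R\<close>, and
  \<open>m \<le> 8 * R\<close> makes this \<open>24 / m\<close>.\<close>

lemma reproducing_from_steps:
  fixes f :: "nat \<Rightarrow> nat" and c1 c2 h :: "nat \<Rightarrow> complex"
  assumes R: "R > 0" "m \<le> 8 * R" and inj: "inj_on f {1..2 * R}" and f: "\<And>d. d \<in> {1..2 * R} \<Longrightarrow> f d \<in> I" and I: "finite I"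
    and c: "\<And>d. norm (c1 d) \<le> 2" "\<And>d. norm (c2 d) \<le> 1"
  obtains r :: "nat \<Rightarrow> complex" where "\<And>z. norm (r z) * real m \<le> 24"
    "\<And>h H. (\<And>d. d \<in> {1..R} \<Longrightarrow> c1 d * h (f d) + c2 d * h (f (2 * d)) = H) \<Longrightarrow> (\<Sum>z\<in>I. r z * h z) = H"
proof -
  define r where "r z = (\<Sum>d\<in>{1..R}. (if f d = z then c1 d else 0) + (if f (2 * d) = z then c2 d else 0)) / of_nat R" for z
  have one: "norm (\<Sum>d\<in>{1..R}. if g d = z then k d else 0) \<le> B"
    if g: "inj_on g {1..R}" and k: "\<And>d. norm (k d :: complex) \<le> B" and B: "B \<ge> 0" for g :: "nat \<Rightarrow> nat" and k B z
  proof -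
    have "card {d\<in>{1..R}. g d = z} \<le> 1"
    proof -
      have "card {d\<in>{1..R}. g d = z} \<le> card {z}"
        by (rule card_inj_on_le[of g]) (auto intro: inj_on_subset[OF g])
      then show ?thesis by simp
    qed
    then have "real (card {d\<in>{1..R}. g d = z}) \<le> 1" by simp
    then have "real (card {d\<in>{1..R}. g d = z}) * B \<le> 1 * B" using B by (intro mult_right_mono)
    moreover have "norm (\<Sum>d\<in>{1..R}. if g d = z then k d else 0) = norm (\<Sum>d\<in>{d\<in>{1..R}. g d = z}. k d)"
      by (simp flip: sum.inter_filter)
    moreover have "\<dots> \<le> real (card {d\<in>{1..R}. g d = z}) * B"
      using k by (intro sum_norm_bound)
    ultimately show ?thesis by linarith
  qed
  have inj2: "inj_on (\<lambda>d. f (2 * d)) {1..R}"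
  proof (rule inj_onI)
    fix d d' assume "d \<in> {1..R}" "d' \<in> {1..R}" and eq: "f (2 * d) = f (2 * d')"
    then have "2 * d \<in> {1..2 * R}" "2 * d' \<in> {1..2 * R}" by auto
    then have "2 * d = 2 * d'" using eq inj by (auto dest: inj_onD)
    then show "d = d'" by simp
  qed
  have inj1: "inj_on f {1..R}" using inj by (rule inj_on_subset) auto
  have "norm (r z) * real m \<le> 24" for z
  proof -
    have "norm (r z) * R = norm (\<Sum>d\<in>{1..R}. (if f d = z then c1 d else 0) + (if f (2 * d) = z then c2 d else 0))"
      using R by (simp add: r_def norm_divide)
    also have "\<dots> \<le> 2 + 1"
      unfolding sum.distrib using one[OF inj1 c(1)] one[OF inj2 c(2)]
      by (intro norm_triangle_mono) auto
    finally have "norm (r z) * R \<le> 3" by simp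
    moreover have "norm (r z) * real m \<le> norm (r z) * (8 * real R)"
      using R by (intro mult_left_mono) (auto simp flip: of_nat_mult)
    ultimately show ?thesis by simp
  qed
  moreover have "(\<Sum>z\<in>I. r z * h z) = H" if eq: "\<And>d. d \<in> {1..R} \<Longrightarrow> c1 d * h (f d) + c2 d * h (f (2 * d)) = H" for h H
  proof -
    have pick: "(\<Sum>z\<in>I. (if k = z then c' else 0) * h z) = c' * h k" if "k \<in> I" for k c'
      using that I by (simp add: if_distrib[of "\<lambda>v. v * _"] cong: if_cong)
    have "(\<Sum>z\<in>I. r z * h z) = (\<Sum>z\<in>I. \<Sum>d\<in>{1..R}. ((if f d = z then c1 d else 0) * h z + (if f (2 * d) = z then c2 d else 0) * h z)) / of_nat R"
      by (simp add: r_def sum_divide_distrib sum_distrib_right distrib_right)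
    also have "\<dots> = (\<Sum>d\<in>{1..R}. \<Sum>z\<in>I. ((if f d = z then c1 d else 0) * h z + (if f (2 * d) = z then c2 d else 0) * h z)) / of_nat R"
      by (subst sum.swap) (rule refl)
    also have "\<dots> = (\<Sum>d\<in>{1..R}. H) / of_nat R"
    proof -
      have "(\<Sum>z\<in>I. ((if f d = z then c1 d else 0) * h z + (if f (2 * d) = z then c2 d else 0) * h z)) = H"
        if d: "d \<in> {1..R}" for d
      proof -
        have "d \<in> {1..2 * R}" "2 * d \<in> {1..2 * R}" using d by auto
        then have "f d \<in> I" "f (2 * d) \<in> I" using f by blast+
        then show ?thesis unfolding sum.distrib using pick eq d by simp
      qed
      then show ?thesis by simp
    qed
    also have "\<dots> = H" using R by simp
    finally show ?thesis .
  qed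
  ultimately show thesis by (rule that) blast
qed

text \<open>The recurrence is solved for the value at \<open>y\<close> and runs towards the side
  with room. \<open>r\<close> depends on \<open>w\<close> and \<open>y\<close> but not on
  \<open>A\<close> and \<open>B\<close>, so it serves all functions with this frequency at once. For
  \<open>m < 16\<close> a point mass is small enough.\<close>

lemma two_frequency_reproducing:
  assumes w: "norm w = 1" and y: "y \<in> {u..<u + m}"
  shows "\<exists>r. (\<forall>z. norm (r z :: complex) * real m \<le> 24) \<and>
    (\<forall>A B. (\<Sum>z\<in>{u..<u + m}. r z * (A + B * w ^ z)) = A + B * w ^ y)"
proof (cases "m < 16")
  case True
  have "(\<Sum>z\<in>{u..<u + m}. (if z = y then 1 else 0) * (A + B * w ^ z)) = A + B * w ^ y" for A B
    using y by (simp add: if_distrib[of "\<lambda>v. v * _"] cong: if_cong)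
  then show ?thesis using True by (intro exI[of _ "\<lambda>z. if z = y then 1 else 0"]) auto
next
  case False
  define R where "R = (m - 1) div 4"
  have R: "R > 0" "m \<le> 8 * R" "4 * R \<le> m - 1" using False unfolding R_def by linarith+
  have w0: "w \<noteq> 0" using w by auto
  have wd: "norm (w ^ d) = 1" for d using w by (simp add: norm_power)
  have w2: "w ^ (2 * d) = w ^ d * w ^ d" for d by (simp only: mult_2 power_add)
  have n1: "norm (1 + w ^ d) \<le> 2" for d using norm_triangle_ineq[of 1 "w ^ d"] wd by simp
  show ?thesis
  proof (cases "y + 2 * R < u + m")
    case True
    obtain r where r: "\<And>z. norm (r z :: complex) * real m \<le> 24"
      "\<And>h H. (\<And>d. d \<in> {1..R} \<Longrightarrow> ((1 + w ^ d) / w ^ d) * h (y + d) + (- 1 / w ^ d) * h (y + 2 * d) = H) \<Longrightarrow>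
        (\<Sum>z\<in>{u..<u + m}. r z * h z) = H"
      by (rule reproducing_from_steps[where R=R and m=m and f="\<lambda>d. y + d" and I="{u..<u + m}"
            and ?c1.0="\<lambda>d. (1 + w ^ d) / w ^ d" and ?c2.0="\<lambda>d. - 1 / w ^ d"])
        (use R(1,2) True y n1 wd in \<open>auto simp: norm_divide inj_on_def\<close>)
    have "(\<Sum>z\<in>{u..<u + m}. r z * (A + B * w ^ z)) = A + B * w ^ y" for A B
    proof (rule r(2))
      show "((1 + w ^ d) / w ^ d) * (A + B * w ^ (y + d)) + (- 1 / w ^ d) * (A + B * w ^ (y + 2 * d)) = A + B * w ^ y" for d
        unfolding power_add w2 using w0 by (simp add: field_simps)
    qed
    then show ?thesis using r(1) by blast
  next
    case False
    have room: "u + 2 * R \<le> y" using False y R by auto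
    obtain r where r: "\<And>z. norm (r z :: complex) * real m \<le> 24"
      "\<And>h H. (\<And>d. d \<in> {1..R} \<Longrightarrow> (1 + w ^ d) * h (y - d) + (- (w ^ d)) * h (y - 2 * d) = H) \<Longrightarrow>
        (\<Sum>z\<in>{u..<u + m}. r z * h z) = H"
      by (rule reproducing_from_steps[where R=R and m=m and f="\<lambda>d. y - d" and I="{u..<u + m}"
            and ?c1.0="\<lambda>d. 1 + w ^ d" and ?c2.0="\<lambda>d. - (w ^ d)"])
        (use R(1,2) room y n1 wd in \<open>auto intro!: inj_onI\<close>)
    have "(\<Sum>z\<in>{u..<u + m}. r z * (A + B * w ^ z)) = A + B * w ^ y" for A B
    proof (rule r(2))
      fix d assume d: "d \<in> {1..R}"
      define v where "v = y - 2 * d"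
      have yv: "y = v + 2 * d" "y - d = v + d" using d room by (auto simp: v_def)
      show "(1 + w ^ d) * (A + B * w ^ (y - d)) + (- (w ^ d)) * (A + B * w ^ (y - 2 * d)) = A + B * w ^ y"
        unfolding v_def[symmetric] yv(2) unfolding yv(1) power_add w2 by (simp add: algebra_simps)
    qed
    then show ?thesis using r(1) by blast
  qed
qed

section \<open>Metric and dyadic structure of the finite quotients\<close>

definition box :: "nat \<Rightarrow> (nat \<Rightarrow> nat set) \<Rightarrow> (nat \<Rightarrow> nat) set" where
  "box N A = {y. (\<forall>i<N. y i \<in> A i) \<and> (\<forall>i\<ge>N. y i = 0)}"

lemma box_Suc: "box (Suc N) A = (\<lambda>(y, a). y(N := a)) ` (box N A \<times> A N)"
proof
  show "box (Suc N) A \<subseteq> (\<lambda>(y, a). y(N := a)) ` (box N A \<times> A N)"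
  proof
    fix y assume y: "y \<in> box (Suc N) A"
    have "y = (y(N := 0))(N := y N)" by simp
    moreover have "y(N := 0) \<in> box N A" "y N \<in> A N" using y by (auto simp: box_def)
    ultimately show "y \<in> (\<lambda>(y, a). y(N := a)) ` (box N A \<times> A N)"
      by (intro image_eqI[of _ _ "(y(N := 0), y N)"]) auto
  qed
qed (auto simp: box_def)

lemma inj_on_box: "inj_on (\<lambda>(y, a). y(N := a)) (box N A \<times> A N)"
proof (rule inj_onI, clarify)
  fix y a y' a' assume y: "y \<in> box N A" "y' \<in> box N A" and eq: "y(N := a) = y'(N := a')"
  have "y i = y' i" for i
    using fun_cong[OF eq, of i] y by (cases "i = N") (auto simp: box_def)
  moreover have "a = a'" using fun_cong[OF eq, of N] by simp
  ultimately show "y = y' \<and> a = a'" by auto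
qed

lemma box_0: "box 0 A = {\<lambda>_. 0}"
  by (auto simp: box_def)

lemma finite_box: "(\<And>i. i < N \<Longrightarrow> finite (A i)) \<Longrightarrow> finite (box N A)"
  by (induction N) (auto simp: box_Suc box_0)

lemma card_box: "card (box N A) = (\<Prod>i<N. card (A i))"
  by (induction N) (auto simp: box_Suc box_0 card_image[OF inj_on_box] card_cartesian_product)

text \<open>Members of a laminar family through a common point form a chain, so one of them is the
  largest.\<close>

lemma Union_chain_mem:
  assumes "finite S" "laminar S" "S \<noteq> {}" "\<And>B. B \<in> S \<Longrightarrow> finite B \<and> x \<in> B"
  shows "\<Union>S \<in> S"
proof -
  obtain B where B: "B \<in> maximal_sets S" using ex_maximal_superset assms(1,3) by (metis ex_in_conv)
  then have BS: "B \<in> S" using maximal_sets_subset by blast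
  have "A \<subseteq> B" if "A \<in> S" for A
  proof -
    have "A \<subseteq> B \<or> B \<subseteq> A \<or> A \<inter> B = {}" using assms(2) that BS unfolding laminar_def by metis
    moreover have "x \<in> A \<inter> B" using assms(4) that BS by blast
    moreover have "B \<subseteq> A \<Longrightarrow> A = B" using B that unfolding maximal_sets_def by blast
    ultimately show ?thesis by blast
  qed
  then have "\<Union>S = B" using BS by blast
  then show ?thesis using BS by simp
qed

section \<open>A metric adapted to generalized intervals\<close>

locale vilenkin =
  fixes p :: "nat \<Rightarrow> nat"
  assumes p_ge_2: "\<And>i. 2 \<le> p i"
begin

lemma p_pos [simp]: "0 < p i" using p_ge_2[of i] by simp

definition m :: "nat \<Rightarrow> nat" where "m = vilenkin_m p"

lemma m_0 [simp]: "m 0 = 1" and m_Suc: "m (Suc k) = m k * p k"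
  by (simp_all add: m_def vilenkin_m_def)

lemma m_pos [simp]: "0 < m k" by (induction k) (auto simp: m_Suc)

lemma m_nonzero [simp]: "m k \<noteq> 0"
  using m_pos[of k] by linarith

lemma m_mono: "k \<le> k' \<Longrightarrow> m k \<le> m k'"
proof (induction k' rule: dec_induct)
  case (step n)
  have "m k * 1 \<le> m n * p n" using step p_ge_2[of n] by (intro mult_mono) auto
  then show ?case by (simp add: m_Suc)
qed simp

definition first_diff :: "(nat \<Rightarrow> nat) \<Rightarrow> (nat \<Rightarrow> nat) \<Rightarrow> nat" where
  "first_diff x y = (LEAST i. x i \<noteq> y i)"

lemma first_diff: "x \<noteq> y \<Longrightarrow> x (first_diff x y) \<noteq> y (first_diff x y)"
  unfolding first_diff_def by (rule LeastI_ex) auto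

lemma eq_below_first_diff: "i < first_diff x y \<Longrightarrow> x i = y i"
  unfolding first_diff_def using not_less_Least by blast

lemma first_diff_eqI:
  assumes "x k \<noteq> y k" "\<And>i. i < k \<Longrightarrow> x i = y i"
  shows "first_diff x y = k"
  unfolding first_diff_def using assms by (intro Least_equality) (auto simp: not_less[symmetric])

lemma first_diff_ge: "x \<noteq> y \<Longrightarrow> (\<And>i. i < k \<Longrightarrow> x i = y i) \<Longrightarrow> k \<le> first_diff x y"
  using first_diff[of x y] by (metis not_less)

text \<open>The chord in the first differing coordinate, scaled by the measure of the common coset.
  Up to constants it is the measure of the smallest block of either system that contains both
  points, by \<open>gdist_le_nu\<close> and \<open>ex_small_block\<close>.\<close>

definition gdist :: "(nat \<Rightarrow> nat) \<Rightarrow> (nat \<Rightarrow> nat) \<Rightarrow> real" where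
  "gdist x y = (if x = y then 0 else
     chord (p (first_diff x y)) (x (first_diff x y)) (y (first_diff x y)) / m (first_diff x y))"

lemma gdist_nonneg: "0 \<le> gdist x y"
  unfolding gdist_def by simp

lemma gdist_le:
  assumes "\<And>i. i < k \<Longrightarrow> x i = y i"
  shows "gdist x y \<le> 2 / m k"
proof (cases "x = y")
  case False
  then have "k \<le> first_diff x y" using first_diff_ge assms by blast
  then have "real (m k) \<le> m (first_diff x y)" using m_mono by simp
  then have "chord (p (first_diff x y)) (x (first_diff x y)) (y (first_diff x y)) / m (first_diff x y) \<le> 2 / m k"
    using chord_le_2 by (intro frac_le) auto
  then show ?thesis using False by (simp add: gdist_def)
qed (simp add: gdist_def)

definition group :: "(nat \<Rightarrow> nat) set" where "group = {x. \<forall>i. x i < p i}"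

lemma gdist_ge:
  assumes "x \<in> group" "y \<in> group" "x \<noteq> y"
  shows "4 / m (Suc (first_diff x y)) \<le> gdist x y"
proof -
  let ?k = "first_diff x y"
  have "4 / p ?k \<le> chord (p ?k) (x ?k) (y ?k)"
    using assms first_diff[of x y] by (intro chord_ge_min) (auto simp: group_def)
  then have "4 / p ?k / m ?k \<le> chord (p ?k) (x ?k) (y ?k) / m ?k" by (intro divide_right_mono) auto
  then show ?thesis using assms by (simp add: gdist_def m_Suc mult.commute)
qed

text \<open>The distance is ultrametric except inside one coordinate, where \<open>chord\<close>
  satisfies the triangle inequality. If \<open>x\<close> and \<open>z\<close> meet again in that
  coordinate, their distance is at most \<open>2 / m (Suc k)\<close>, whereas \<open>x\<close> and
  \<open>y\<close> are at least \<open>4 / m (Suc k)\<close> apart.\<close>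

lemma gdist_triangle:
  assumes x: "x \<in> group" and y: "y \<in> group" and z: "z \<in> group"
  shows "gdist x z \<le> gdist x y + gdist y z"
proof (cases "x = y \<or> y = z \<or> x = z")
  case True
  then show ?thesis using gdist_nonneg by (auto simp: gdist_def)
next
  case False
  let ?k = "first_diff x y" and ?l = "first_diff y z"
  have ne: "x ?k \<noteq> y ?k" "y ?l \<noteq> z ?l" using False first_diff by auto
  consider "?k < ?l" | "?l < ?k" | "?k = ?l" by linarith
  then show ?thesis
  proof cases
    case 1
    then have yz: "y i = z i" if "i \<le> ?k" for i using that eq_below_first_diff[of i y z] by simp
    have "first_diff x z = ?k"
      using ne yz eq_below_first_diff[of _ x y] by (intro first_diff_eqI) auto
    then have "gdist x z = gdist x y" using False yz[of ?k] by (simp add: gdist_def)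
    then show ?thesis using gdist_nonneg by simp
  next
    case 2
    then have xy: "x i = y i" if "i \<le> ?l" for i using that eq_below_first_diff[of i x y] by simp
    have "first_diff x z = ?l"
      using ne xy eq_below_first_diff[of _ y z] by (intro first_diff_eqI) auto
    then have "gdist x z = gdist y z" using False xy[of ?l] by (simp add: gdist_def)
    then show ?thesis using gdist_nonneg by simp
  next
    case 3
    have xz: "x i = z i" if "i < ?k" for i
      using that eq_below_first_diff[of i x y] eq_below_first_diff[of i y z] 3 by simp
    show ?thesis
    proof (cases "x ?k = z ?k")
      case True
      have "gdist x z \<le> 2 / m (Suc ?k)" using xz True by (intro gdist_le) (auto simp: less_Suc_eq)
      also have "\<dots> \<le> 4 / m (Suc ?k)" by (intro divide_right_mono) auto
      also have "\<dots> \<le> gdist x y" using gdist_ge[OF x y] False by simp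
      finally show ?thesis using gdist_nonneg[of y z] by simp
    next
      case F: False
      then have "first_diff x z = ?k" using xz by (intro first_diff_eqI) auto
      then show ?thesis
        using False 3 chord_triangle[of "p ?k" "x ?k" "z ?k" "y ?k"]
        by (simp add: gdist_def divide_right_mono flip: add_divide_distrib)
    qed
  qed
qed

text \<open>The level-\<open>N\<close> quotient of the group is represented by the sequences vanishing from \<open>N\<close> on.\<close>

definition X :: "nat \<Rightarrow> (nat \<Rightarrow> nat) set" where "X N = box N (\<lambda>i. {..<p i})"

lemma X_group: "x \<in> X N \<Longrightarrow> x \<in> group"
  unfolding X_def box_def group_def by (auto, metis not_le p_pos)

lemma X_iff: "x \<in> X N \<longleftrightarrow> x \<in> group \<and> (\<forall>i\<ge>N. x i = 0)"
  using X_group by (auto simp: X_def box_def group_def)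

lemma finite_X [simp]: "finite (X N)" unfolding X_def by (intro finite_box) auto

lemma first_diff_less: "x \<in> X N \<Longrightarrow> y \<in> X N \<Longrightarrow> x \<noteq> y \<Longrightarrow> first_diff x y < N"
  using first_diff[of x y] by (metis X_iff not_le)

section \<open>The two trees of blocks and their sizes\<close>

definition blk :: "bool \<Rightarrow> nat \<Rightarrow> nat \<Rightarrow> (nat \<Rightarrow> nat) \<Rightarrow> (nat \<Rightarrow> nat) set" where
  "blk j k l x = {y \<in> group. (\<forall>i<k. y i = x i) \<and> arc j (p k) l (y k) = arc j (p k) l (x k)}"

definition scales :: "nat \<Rightarrow> (nat \<times> nat) set" where
  "scales N = {(k, l). k < N \<and> l \<le> depth (p k)}"

lemma finite_scales [simp]: "finite (scales N)"
proof -
  have "scales N = (SIGMA k:{..<N}. {..depth (p k)})" by (auto simp: scales_def)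
  then show ?thesis by simp
qed

lemma blk_self: "x \<in> group \<Longrightarrow> x \<in> blk j k l x" by (simp add: blk_def)

lemma blk_cong: "y \<in> blk j k l x \<Longrightarrow> blk j k l y = blk j k l x"
  unfolding blk_def by auto

lemma blk_mono:
  assumes "k < k' \<or> k = k' \<and> l \<le> l'"
  shows "blk j k' l' x \<subseteq> blk j k l x"
  using assms arc_mono[of l l' j "p k"] by (auto simp: blk_def)

lemma blk_0: "blk j 0 0 x = group" by (auto simp: blk_def arc_0)

text \<open>The deepest arcs are single residues, so the last block of one coordinate is the first
  of the next; this joins the levels \<open>(k, l)\<close> into a single scale.\<close>

lemma blk_Suc_0: "x \<in> group \<Longrightarrow> blk j (Suc k) 0 x = blk j k (depth (p k)) x"
  using arc_depth_inj[of _ "p k"] by (auto simp: blk_def arc_0 less_Suc_eq group_def)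

definition coords :: "bool \<Rightarrow> nat \<Rightarrow> nat \<Rightarrow> (nat \<Rightarrow> nat) \<Rightarrow> nat set" where
  "coords j k l x = {b\<in>{..<p k}. arc j (p k) l b = arc j (p k) l (x k)}"

definition B :: "nat \<Rightarrow> bool \<Rightarrow> nat \<Rightarrow> nat \<Rightarrow> (nat \<Rightarrow> nat) \<Rightarrow> (nat \<Rightarrow> nat) set" where
  "B N j k l x = blk j k l x \<inter> X N"

lemma B_box:
  assumes "k < N" "x \<in> group"
  shows "B N j k l x = box N (\<lambda>i. if i < k then {x i} else if i = k then coords j k l x else {..<p i})"
proof (rule set_eqI)
  fix y
  let ?A = "\<lambda>i. if i < k then {x i} else if i = k then coords j k l x else {..<p i}"
  have "y \<in> B N j k l x \<longleftrightarrow> y \<in> X N \<and> (\<forall>i<k. y i = x i) \<and> arc j (p k) l (y k) = arc j (p k) l (x k)"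
    using X_group by (auto simp: B_def blk_def)
  also have "\<dots> \<longleftrightarrow> (\<forall>i\<ge>N. y i = 0) \<and> (\<forall>i<N. y i \<in> ?A i)"
  proof safe
    fix i assume "y \<in> X N" "\<forall>i<k. y i = x i" "arc j (p k) l (y k) = arc j (p k) l (x k)" "i < N"
    then show "y i \<in> ?A i" by (auto simp: X_def box_def coords_def)
  next
    assume y: "\<forall>i\<ge>N. y i = 0" "\<forall>i<N. y i \<in> ?A i"
    have "y i < p i" if "i < N" for i
    proof -
      have "?A i \<subseteq> {..<p i}" using assms(2) by (auto simp: group_def coords_def)
      then show ?thesis using y(2) that by blast
    qed
    then show "y \<in> X N" using y(1) by (auto simp: X_def box_def)
    show "y i = x i" if "i < k" for i using y(2)[rule_format, of i] that assms(1) by simp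
    show "arc j (p k) l (y k) = arc j (p k) l (x k)"
      using y(2)[rule_format, of k] assms(1) by (simp add: coords_def)
  qed (auto simp: X_iff)
  finally show "y \<in> B N j k l x \<longleftrightarrow> y \<in> box N ?A" by (auto simp: box_def)
qed

lemma finite_B [simp]: "finite (B N j k l x)" by (simp add: B_def)

lemma B_subset: "B N j k l x \<subseteq> X N" by (simp add: B_def)

lemma B_self: "x \<in> X N \<Longrightarrow> x \<in> B N j k l x" using X_group blk_self by (auto simp: B_def)

lemma B_cong: "y \<in> B N j k l x \<Longrightarrow> B N j k l y = B N j k l x"
  unfolding B_def using blk_cong by blast

lemma B_mono: "k < k' \<or> k = k' \<and> l \<le> l' \<Longrightarrow> B N j k' l' x \<subseteq> B N j k l x"
  unfolding B_def using blk_mono by blast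

lemma card_B:
  assumes "k < N" "x \<in> group"
  shows "card (B N j k l x) * m (Suc k) = card (coords j k l x) * m N"
proof -
  define A where "A i = (if i < k then {x i} else if i = k then coords j k l x else {..<p i})" for i
  have "(\<Prod>i<N'. card (A i)) * m (Suc k) = card (coords j k l x) * m N'" if "Suc k \<le> N'" for N'
    using that
  proof (induction N' rule: dec_induct)
    case base
    have "(\<Prod>i<k. card (A i)) = 1" by (intro prod.neutral) (auto simp: A_def)
    then show ?case by (simp add: A_def)
  next
    case (step n)
    then show ?case by (simp add: A_def m_Suc mult_ac)
  qed
  then have "(\<Prod>i<N. card (A i)) * m (Suc k) = card (coords j k l x) * m N" using assms by simp
  then show ?thesis unfolding B_box[OF assms] card_box A_def .
qed

text \<open>Haar measure of the cylinder over a subset \<open>Q\<close> of the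
  level-\<open>N\<close> quotient.\<close>

definition nu :: "nat \<Rightarrow> (nat \<Rightarrow> nat) set \<Rightarrow> real" where "nu N Q = card Q / m N"

lemma card_le_of_nu_le: "nu N A \<le> c * nu N A' \<Longrightarrow> real (card A) \<le> c * card A'"
  using m_pos[of N] by (simp add: nu_def field_simps)

lemma nu_B:
  assumes "k < N" "x \<in> group"
  shows "nu N (B N j k l x) = card (coords j k l x) / m (Suc k)"
proof -
  have "real (card (B N j k l x)) * m (Suc k) = card (coords j k l x) * real (m N)"
    using card_B[OF assms, of j l] by (metis of_nat_mult)
  then show ?thesis by (simp add: nu_def field_simps)
qed

lemma nu_B_bounds:
  assumes "(k, l) \<in> scales N" "x \<in> group"
  shows "1 / (2 * 2 ^ l * m k) \<le> nu N (B N j k l x)" "nu N (B N j k l x) \<le> 2 / (2 ^ l * m k)"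
    "1 / m (Suc k) \<le> nu N (B N j k l x)"
proof -
  have k: "k < N" "l \<le> depth (p k)" "x k < p k" using assms by (auto simp: scales_def group_def)
  note c = card_arc[OF p_ge_2 k(2,3), of j, folded coords_def]
  have nu: "nu N (B N j k l x) = card (coords j k l x) / m (Suc k)" using nu_B k assms by blast
  show "1 / (2 * 2 ^ l * m k) \<le> nu N (B N j k l x)" "nu N (B N j k l x) \<le> 2 / (2 ^ l * m k)"
    unfolding nu m_Suc using c by (auto simp: field_simps)
  have "x k \<in> coords j k l x" using k by (simp add: coords_def)
  then have "card (coords j k l x) \<ge> 1" by (simp add: coords_def Suc_le_eq card_gt_0_iff) blast
  then show "1 / m (Suc k) \<le> nu N (B N j k l x)" unfolding nu by (intro divide_right_mono) auto
qed

lemma gdist_le_nu: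
  assumes s: "(k, l) \<in> scales N" and x: "x \<in> X N" and y: "y \<in> B N j k l x"
  shows "gdist x y \<le> 4 * pi * nu N (B N j k l x)"
proof -
  note nu = nu_B_bounds[OF s X_group[OF x], of j]
  have yg: "y \<in> group" "\<And>i. i < k \<Longrightarrow> y i = x i" "arc j (p k) l (y k) = arc j (p k) l (x k)"
    using y by (auto simp: B_def blk_def)
  have nu0: "nu N (B N j k l x) \<ge> 0" by (simp add: nu_def)
  have pi2: "2 \<le> 4 * pi" using pi_gt3 by simp
  show ?thesis
  proof (cases "y k = x k")
    case True
    have "gdist x y \<le> 2 / m (Suc k)" using yg True by (intro gdist_le) (auto simp: less_Suc_eq)
    also have "\<dots> \<le> 2 * nu N (B N j k l x)" using nu(3) by simp
    also have "\<dots> \<le> 4 * pi * nu N (B N j k l x)" using nu0 pi2 by (intro mult_right_mono)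
    finally show ?thesis .
  next
    case False
    then have fd: "first_diff x y = k" using yg by (intro first_diff_eqI) auto
    have "gdist x y = chord (p k) (x k) (y k) / m k" using False fd by (auto simp: gdist_def)
    also have "\<dots> \<le> (2 * pi / 2 ^ l) / m k"
      using chord_le_of_arc[of "p k" j l "x k" "y k"] yg by (intro divide_right_mono) auto
    also have "\<dots> = 4 * pi * (1 / (2 * 2 ^ l * m k))" by simp
    also have "\<dots> \<le> 4 * pi * nu N (B N j k l x)" using nu by (intro mult_left_mono) auto
    finally show ?thesis .
  qed
qed

text \<open>Take the deepest level at which \<open>x\<close> and \<open>y\<close> share an arc in
  one of the systems. One level further they are separated in both, so the one-third trick bounds
  their chord from below by \<open>2 / 3 / 2 ^ Suc l\<close>, a sixth of the factor
  \<open>2 / 2 ^ l\<close> in the bound for the block.\<close>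

lemma ex_small_block:
  assumes x: "x \<in> X N" and y: "y \<in> X N" and ne: "x \<noteq> y"
  obtains j l where "(first_diff x y, l) \<in> scales N" "y \<in> B N j (first_diff x y) l x"
    "nu N (B N j (first_diff x y) l x) \<le> 6 * gdist x y"
proof -
  let ?k = "first_diff x y"
  have k: "?k < N" using first_diff_less assms by blast
  have ab: "x ?k < p ?k" "y ?k < p ?k" "x ?k \<noteq> y ?k"
    using X_group[OF x] X_group[OF y] first_diff[OF ne] by (auto simp: group_def)
  define S where "S = {l. l \<le> depth (p ?k) \<and> (\<exists>j. arc j (p ?k) l (y ?k) = arc j (p ?k) l (x ?k))}"
  have finS: "finite S" by (rule finite_subset[of _ "{..depth (p ?k)}"]) (auto simp: S_def)
  have S0: "0 \<in> S" by (auto simp: S_def arc_0)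
  define l where "l = Max S"
  have lS: "l \<in> S" unfolding l_def using finS S0 by (intro Max_in) auto
  then obtain j where j: "l \<le> depth (p ?k)" "arc j (p ?k) l (y ?k) = arc j (p ?k) l (x ?k)"
    by (auto simp: S_def)
  have "l \<noteq> depth (p ?k)" using arc_depth_inj[of "y ?k" "p ?k" "x ?k" j] ab j by auto
  with j have lL: "Suc l \<le> depth (p ?k)" by simp
  have "Suc l \<notin> S" using Max_ge[OF finS, of "Suc l"] by (auto simp: l_def)
  then have "arc j' (p ?k) (Suc l) (x ?k) \<noteq> arc j' (p ?k) (Suc l) (y ?k)" for j'
    using lL by (auto simp: S_def dest: sym)
  then have ch: "2 / 3 / 2 ^ Suc l \<le> chord (p ?k) (x ?k) (y ?k)"
    using ab by (intro chord_ge_of_distinct_arcs) auto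
  have sc: "(?k, l) \<in> scales N" using k j by (simp add: scales_def)
  have "nu N (B N j ?k l x) \<le> 2 / (2 ^ l * m ?k)" using nu_B_bounds[OF sc X_group[OF x]] by simp
  also have "\<dots> = 6 * ((2 / 3 / 2 ^ Suc l) / m ?k)" by simp
  also have "\<dots> \<le> 6 * (chord (p ?k) (x ?k) (y ?k) / m ?k)"
    using ch by (intro mult_left_mono divide_right_mono) auto
  also have "\<dots> = 6 * gdist x y" using ne by (simp add: gdist_def)
  finally have "nu N (B N j ?k l x) \<le> 6 * gdist x y" .
  moreover have "y \<in> B N j ?k l x"
    using y X_group[OF y] j eq_below_first_diff[of _ x y] by (auto simp: B_def blk_def)
  ultimately show ?thesis using that sc by blast
qed

definition D :: "nat \<Rightarrow> bool \<Rightarrow> (nat \<Rightarrow> nat) set set" where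
  "D N j = {B N j k l x | k l x. (k, l) \<in> scales N \<and> x \<in> X N}"

lemma D_I: "(k, l) \<in> scales N \<Longrightarrow> x \<in> X N \<Longrightarrow> B N j k l x \<in> D N j"
  by (auto simp: D_def)

lemma D_E:
  assumes "Q \<in> D N j"
  obtains k l where "(k, l) \<in> scales N" "\<And>x. x \<in> Q \<Longrightarrow> Q = B N j k l x"
  using assms B_cong unfolding D_def by blast

lemma D_subset: "Q \<in> D N j \<Longrightarrow> Q \<subseteq> X N" unfolding D_def using B_subset by blast

lemma finite_D [simp]: "finite (D N j)"
  by (rule finite_subset[of _ "Pow (X N)"]) (use D_subset in auto)

lemma D_finite: "Q \<in> D N j \<Longrightarrow> finite Q"
  by (rule finite_subset[OF D_subset finite_X])

lemma D_nonempty: "Q \<in> D N j \<Longrightarrow> Q \<noteq> {}" unfolding D_def using B_self by blast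

lemma X_in_D: "0 < N \<Longrightarrow> X N \<in> D N j"
proof -
  assume N: "0 < N"
  have "B N j 0 0 (\<lambda>_. 0) = X N" using X_group by (auto simp: B_def blk_0)
  moreover have "(\<lambda>_. 0) \<in> X N" by (auto simp: X_iff group_def)
  ultimately show ?thesis using D_I[of 0 0 N "\<lambda>_. 0" j] N by (auto simp: scales_def)
qed

lemma singleton_in_D:
  assumes "0 < N" "x \<in> X N"
  shows "{x} \<in> D N j"
proof -
  let ?k = "N - 1"
  have "y = x" if "y \<in> B N j ?k (depth (p ?k)) x" for y
  proof
    fix i
    have y: "y \<in> X N" "\<forall>i<?k. y i = x i" "arc j (p ?k) (depth (p ?k)) (y ?k) = arc j (p ?k) (depth (p ?k)) (x ?k)"
      using that by (auto simp: B_def blk_def)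
    have "y ?k = x ?k"
      using X_group[OF y(1)] X_group[OF assms(2)] by (intro arc_depth_inj[OF _ _ y(3)]) (simp_all add: group_def)
    then show "y i = x i" using y assms by (cases "i < ?k"; cases "i = ?k") (auto simp: X_iff)
  qed
  then have "B N j ?k (depth (p ?k)) x = {x}" using B_self[OF assms(2), of j ?k "depth (p ?k)"] by auto
  then show ?thesis using D_I[of ?k "depth (p ?k)" N x j] assms by (simp add: scales_def)
qed

lemma laminar_D: "laminar (D N j)"
  unfolding laminar_def
proof (intro ballI)
  fix P Q assume P: "P \<in> D N j" and Q: "Q \<in> D N j"
  obtain k l where k: "\<And>x. x \<in> P \<Longrightarrow> P = B N j k l x" using D_E[OF P] by blast
  obtain k' l' where k': "\<And>x. x \<in> Q \<Longrightarrow> Q = B N j k' l' x" using D_E[OF Q] by blast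
  show "P \<subseteq> Q \<or> Q \<subseteq> P \<or> P \<inter> Q = {}"
  proof (cases "P \<inter> Q = {}")
    case False
    then obtain z where z: "z \<in> P" "z \<in> Q" by blast
    have PQ: "P = B N j k l z" "Q = B N j k' l' z" using k[OF z(1)] k'[OF z(2)] .
    show ?thesis
    proof (cases "k < k' \<or> k = k' \<and> l \<le> l'")
      case True
      from B_mono[OF this, of N j z] show ?thesis unfolding PQ by (intro disjI2 disjI1)
    next
      case False
      then have "k' < k \<or> k' = k \<and> l' \<le> l" by linarith
      from B_mono[OF this, of N j z] show ?thesis unfolding PQ by (intro disjI1)
    qed
  qed simp
qed

text \<open>The 8 is the quotient of the bounds \<open>2 / 2 ^ l\<close> and
  \<open>1 / (2 * 2 ^ Suc l)\<close> in \<open>nu_B_bounds\<close>. The next coarser block may be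
  the same set, since halving an arc can leave one half empty; then the search continues upwards,
  across coordinates by \<open>blk_Suc_0\<close>.\<close>

lemma parent_D:
  assumes "Q \<in> D N j" "Q \<noteq> X N"
  shows "\<exists>R\<in>D N j. Q \<subset> R \<and> card R \<le> 8 * card Q"
proof -
  obtain k l x where s: "(k, l) \<in> scales N" "x \<in> X N" "Q = B N j k l x" using assms(1) by (auto simp: D_def)
  have xg: "x \<in> group" using X_group s by blast
  define good where "good k l \<longleftrightarrow> (k, l) \<in> scales N \<longrightarrow> B N j k l x \<noteq> X N \<longrightarrow>
      (\<exists>R\<in>D N j. B N j k l x \<subset> R \<and> card R \<le> 8 * card (B N j k l x))" for k l
  have split: "good k (Suc l)" if gd: "good k l" for k l
    unfolding good_def
  proof (intro impI)
    assume sc: "(k, Suc l) \<in> scales N" and ne: "B N j k (Suc l) x \<noteq> X N"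
    then have sc': "(k, l) \<in> scales N" by (simp add: scales_def)
    show "\<exists>R\<in>D N j. B N j k (Suc l) x \<subset> R \<and> card R \<le> 8 * card (B N j k (Suc l) x)"
    proof (cases "B N j k l x = B N j k (Suc l) x")
      case True
      then show ?thesis using gd sc' ne by (simp add: good_def)
    next
      case False
      have "B N j k (Suc l) x \<subset> B N j k l x" using False B_mono[of k k l "Suc l" N j x] by auto
      moreover have "nu N (B N j k l x) \<le> 8 * nu N (B N j k (Suc l) x)"
      proof -
        have "nu N (B N j k l x) \<le> 2 / (2 ^ l * m k)" using nu_B_bounds(2)[OF sc' xg] .
        also have "\<dots> = 8 * (1 / (2 * 2 ^ Suc l * m k))" by simp
        also have "\<dots> \<le> 8 * nu N (B N j k (Suc l) x)"
          using nu_B_bounds(1)[OF sc xg, of j] by (intro mult_left_mono) auto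
        finally show ?thesis .
      qed
      then have "real (card (B N j k l x)) \<le> real (8 * card (B N j k (Suc l) x))"
        using card_le_of_nu_le by fastforce
      then have "card (B N j k l x) \<le> 8 * card (B N j k (Suc l) x)" by (simp only: of_nat_le_iff)
      ultimately show ?thesis using D_I[OF sc' s(2), of j] by blast
    qed
  qed
  have levels: "good k l" if "good k 0" for k l
    using that by (induction l) (auto intro: split)
  have "good k l" for k l
  proof (induction k arbitrary: l)
    case 0
    show ?case by (rule levels) (use X_group in \<open>auto simp: good_def B_def blk_0\<close>)
  next
    case (Suc k)
    have "B N j (Suc k) 0 x = B N j k (depth (p k)) x" using blk_Suc_0[OF xg] by (simp add: B_def)
    then have "good (Suc k) 0" using Suc[of "depth (p k)"] by (auto simp: good_def scales_def)
    then show ?case by (rule levels)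
  qed
  then show ?thesis using s assms unfolding good_def by blast
qed

section \<open>The maximal function of both trees and enlarged blocks\<close>

definition Mf :: "nat \<Rightarrow> ((nat \<Rightarrow> nat) \<Rightarrow> real) \<Rightarrow> (nat \<Rightarrow> nat) \<Rightarrow> real" where
  "Mf N f x = Max ((\<lambda>(j, k, l). (\<Sum>y\<in>B N j k l x. f y) / card (B N j k l x)) ` (UNIV \<times> scales N))"

lemma scales_nonempty: "0 < N \<Longrightarrow> (0, 0) \<in> scales N" by (simp add: scales_def)

lemma card_B_pos: "x \<in> X N \<Longrightarrow> 0 < card (B N j k l x)"
  using B_self[of x N j k l] by (auto simp: card_gt_0_iff)

lemma Mf_ge:
  assumes "(k, l) \<in> scales N" "x \<in> X N"
  shows "(\<Sum>y\<in>B N j k l x. f y) \<le> card (B N j k l x) * Mf N f x"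
proof -
  have "(\<Sum>y\<in>B N j k l x. f y) / card (B N j k l x) \<le> Mf N f x"
    unfolding Mf_def using assms by (intro Max_ge) (auto intro!: image_eqI[of _ _ "(j, k, l)"])
  then show ?thesis using card_B_pos[OF assms(2), of j k l] by (simp add: pos_divide_le_eq mult.commute)
qed

lemma Mf_attained:
  assumes "0 < N"
  obtains j k l where "(k, l) \<in> scales N" "Mf N f x = (\<Sum>y\<in>B N j k l x. f y) / card (B N j k l x)"
proof -
  have "Mf N f x \<in> (\<lambda>(j, k, l). (\<Sum>y\<in>B N j k l x. f y) / card (B N j k l x)) ` (UNIV \<times> scales N)"
    unfolding Mf_def using scales_nonempty[OF assms] by (intro Max_in) auto
  then show thesis using that by auto
qed

lemma Mf_mono:
  assumes N: "0 < N" and x: "x \<in> X N" and fg: "\<And>y. y \<in> X N \<Longrightarrow> f y \<le> g y"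
  shows "Mf N f x \<le> Mf N g x"
proof -
  obtain j k l where s: "(k, l) \<in> scales N" and eq: "Mf N f x = (\<Sum>y\<in>B N j k l x. f y) / card (B N j k l x)"
    using Mf_attained[OF N] by blast
  have "(\<Sum>y\<in>B N j k l x. f y) \<le> (\<Sum>y\<in>B N j k l x. g y)" using fg B_subset by (intro sum_mono) blast
  also have "\<dots> \<le> card (B N j k l x) * Mf N g x" by (rule Mf_ge[OF s x])
  finally show ?thesis unfolding eq using card_B_pos[OF x, of j k l] by (simp add: pos_divide_le_eq mult.commute)
qed

lemma Mf_one: "0 < N \<Longrightarrow> x \<in> X N \<Longrightarrow> Mf N (\<lambda>_. 1) x = 1"
proof -
  assume N: "0 < N" and x: "x \<in> X N"
  obtain j k l where "Mf N (\<lambda>_. 1) x = (\<Sum>y\<in>B N j k l x. 1) / card (B N j k l x)"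
    using Mf_attained[OF N, where f="\<lambda>_. 1"] by blast
  then show ?thesis using card_B_pos[OF x, of j k l] by (auto split: if_splits)
qed

lemma Mf_ge_0: "0 < N \<Longrightarrow> (\<And>y. y \<in> X N \<Longrightarrow> 0 \<le> f y) \<Longrightarrow> 0 \<le> Mf N f x"
proof -
  assume N: "0 < N" and f: "\<And>y. y \<in> X N \<Longrightarrow> 0 \<le> f y"
  obtain j k l where eq: "Mf N f x = (\<Sum>y\<in>B N j k l x. f y) / card (B N j k l x)"
    using Mf_attained[OF N] by blast
  have "0 \<le> (\<Sum>y\<in>B N j k l x. f y)" using f B_subset by (intro sum_nonneg) blast
  then show ?thesis unfolding eq by simp
qed

text \<open>Each of the two trees contributes 1 to the constant, because its maximal heavy blocks
  are disjoint.\<close>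

lemma Mf_weak:
  assumes N: "0 < N" and f: "\<And>x. x \<in> X N \<Longrightarrow> 0 \<le> f x" and t: "0 < t"
  shows "real (card {x\<in>X N. Mf N f x > t}) * t \<le> 2 * (\<Sum>x\<in>X N. f x)"
proof -
  define S where "S j = {Q\<in>D N j. (\<Sum>y\<in>Q. f y) > t * card Q}" for j
  have SD: "S j \<subseteq> D N j" for j by (auto simp: S_def)
  have finS: "finite (S j)" for j using finite_subset[OF SD] by simp
  have lamS: "laminar (S j)" for j using laminar_subset[OF laminar_D SD] .
  have finm: "finite Q" if "Q \<in> S j" for Q j using that SD D_finite by blast
  have SX: "\<Union>(S j) \<subseteq> X N" for j using SD D_subset by blast
  have finU: "finite (\<Union>(S j))" for j by (rule finite_subset[OF SX finite_X])
  have bound: "real (card (\<Union>(S j))) * t \<le> (\<Sum>x\<in>X N. f x)" for j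
  proof -
    have "real (card (\<Union>(S j))) * t = (\<Sum>x\<in>\<Union>(S j). t)" by simp
    also have "\<dots> = (\<Sum>Q\<in>maximal_sets (S j). \<Sum>x\<in>Q. t)"
      by (rule sum_Union_maximal[OF finS lamS finm, symmetric])
    also have "\<dots> \<le> (\<Sum>Q\<in>maximal_sets (S j). sum f Q)"
    proof (rule sum_mono)
      fix Q assume "Q \<in> maximal_sets (S j)"
      then have "Q \<in> S j" using maximal_sets_subset by blast
      then show "(\<Sum>x\<in>Q. t) \<le> sum f Q" by (simp add: S_def mult.commute)
    qed
    also have "\<dots> = sum f (\<Union>(S j))" by (rule sum_Union_maximal[OF finS lamS finm])
    also have "\<dots> \<le> (\<Sum>x\<in>X N. f x)" using f SX by (intro sum_mono2) auto
    finally show ?thesis .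
  qed
  have "{x\<in>X N. Mf N f x > t} \<subseteq> \<Union>(S True) \<union> \<Union>(S False)"
  proof
    fix x assume x: "x \<in> {x\<in>X N. Mf N f x > t}"
    obtain j k l where s: "(k, l) \<in> scales N" and eq: "Mf N f x = (\<Sum>y\<in>B N j k l x. f y) / card (B N j k l x)"
      using Mf_attained[OF N] by blast
    have xX: "x \<in> X N" using x by simp
    have "t < (\<Sum>y\<in>B N j k l x. f y) / card (B N j k l x)" using x eq by simp
    then have "B N j k l x \<in> S j"
      using D_I[OF s xX] card_B_pos[OF xX, of j k l] by (simp add: S_def pos_less_divide_eq)
    then have "x \<in> \<Union>(S j)" using B_self[OF xX] by blast
    then show "x \<in> \<Union>(S True) \<union> \<Union>(S False)" by (cases j) auto
  qed
  then have "card {x\<in>X N. Mf N f x > t} \<le> card (\<Union>(S True) \<union> \<Union>(S False))"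
    using finU by (intro card_mono) auto
  also have "\<dots> \<le> card (\<Union>(S True)) + card (\<Union>(S False))" by (rule card_Un_le)
  finally have "real (card {x\<in>X N. Mf N f x > t}) * t \<le> (real (card (\<Union>(S True))) + real (card (\<Union>(S False)))) * t"
    using t by (intro mult_right_mono) auto
  then show ?thesis unfolding distrib_right using bound[of True] bound[of False] by linarith
qed

text \<open>The radius uses 3 to exceed the 2 in \<open>gdist_le\<close>: as a block
  \<open>Q\<close> at coordinate \<open>k\<close> has \<open>nu N Q \<ge> 1 / m (Suc k)\<close>, a
  point off \<open>star N Q\<close> that shares the coordinates below \<open>k\<close> with
  \<open>Q\<close> must differ from each point of \<open>Q\<close> in coordinate
  \<open>k\<close>.\<close>

definition star :: "nat \<Rightarrow> (nat \<Rightarrow> nat) set \<Rightarrow> (nat \<Rightarrow> nat) set" where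
  "star N Q = {y \<in> X N. \<exists>x\<in>Q. gdist x y < 3 * nu N Q}"

lemma nu_pos: "Q \<in> D N j \<Longrightarrow> 0 < nu N Q"
  unfolding nu_def using D_finite[of Q N j] D_nonempty[of Q N j] by (simp add: card_gt_0_iff)

lemma gdist_in_D:
  assumes "Q \<in> D N j" "x \<in> Q" "y \<in> Q"
  shows "gdist x y \<le> 4 * pi * nu N Q"
proof -
  obtain k l where s: "(k, l) \<in> scales N" and Q: "Q = B N j k l x" using D_E[OF assms(1)] assms(2) by metis
  have "x \<in> X N" "y \<in> B N j k l x" using assms D_subset[OF assms(1)] Q by auto
  then have "gdist x y \<le> 4 * pi * nu N (B N j k l x)" by (rule gdist_le_nu[OF s])
  then show ?thesis by (simp only: Q[symmetric])
qed

lemma star_superset: "Q \<in> D N j \<Longrightarrow> Q \<subseteq> star N Q"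
  using nu_pos[of Q N j] D_subset[of Q N j] by (force simp: star_def gdist_def)

lemma star_subset: "star N Q \<subseteq> X N" by (auto simp: star_def)

lemma nu_mono: "Q \<subseteq> R \<Longrightarrow> R \<in> D N j \<Longrightarrow> nu N Q \<le> nu N R"
  unfolding nu_def using card_mono[OF D_finite] by (intro divide_right_mono) auto

lemma star_mono: "Q \<subseteq> R \<Longrightarrow> R \<in> D N j \<Longrightarrow> star N Q \<subseteq> star N R"
proof
  fix y assume QR: "Q \<subseteq> R" "R \<in> D N j" and "y \<in> star N Q"
  then obtain x where "y \<in> X N" "x \<in> R" "gdist x y < 3 * nu N Q" by (auto simp: star_def)
  moreover have "3 * nu N Q \<le> 3 * nu N R" using nu_mono[OF QR] by simp
  ultimately show "y \<in> star N R" unfolding star_def by force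
qed

text \<open>\<open>star N Q\<close> lies within \<open>16 + 3 = 19\<close> times
  \<open>nu N Q\<close> of \<open>x0\<close>, as \<open>4 * pi < 16\<close>. By
  \<open>ex_small_block\<close> each of its points other than \<open>x0\<close> is in a block
  through \<open>x0\<close> of measure at most \<open>6 * 19 = 114\<close> times that of
  \<open>Q\<close>. The largest such block of each system suffices, so
  \<open>229 = 2 * 114 + 1\<close>.\<close>

lemma M_star:
  assumes N: "0 < N" and f: "\<And>x. x \<in> X N \<Longrightarrow> 0 \<le> f x" and Q: "Q \<in> D N j0" and x0: "x0 \<in> Q"
  shows "(\<Sum>y\<in>star N Q. f y) \<le> 229 * card Q * Mf N f x0"
proof -
  have x0X: "x0 \<in> X N" using Q x0 D_subset by blast
  have M0: "0 \<le> Mf N f x0" using Mf_ge_0[OF N f] .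
  have cQ: "card Q \<ge> 1" using D_finite[OF Q] x0 by (auto simp: Suc_le_eq card_gt_0_iff)
  define S where "S j = {R\<in>D N j. x0 \<in> R \<and> card R \<le> 114 * card Q}" for j
  have finS: "finite (S j)" for j by (rule finite_subset[OF _ finite_D[of N j]]) (auto simp: S_def)
  have US: "(\<Sum>y\<in>\<Union>(S j). f y) \<le> 114 * card Q * Mf N f x0" for j
  proof (cases "S j = {}")
    case True
    then show ?thesis using M0 by simp
  next
    case False
    have "S j \<subseteq> D N j" by (auto simp: S_def)
    then have "\<Union>(S j) \<in> S j"
      using D_finite by (intro Union_chain_mem[OF finS laminar_subset[OF laminar_D] False]) (auto simp: S_def)
    then have R: "\<Union>(S j) \<in> D N j" "x0 \<in> \<Union>(S j)" "card (\<Union>(S j)) \<le> 114 * card Q" by (auto simp: S_def)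
    obtain k l where s: "(k, l) \<in> scales N" and eq: "\<Union>(S j) = B N j k l x0" using D_E[OF R(1)] R(2) by metis
    have "(\<Sum>y\<in>\<Union>(S j). f y) \<le> card (\<Union>(S j)) * Mf N f x0" unfolding eq by (rule Mf_ge[OF s x0X])
    also have "\<dots> \<le> real (114 * card Q) * Mf N f x0" using R(3) M0 by (intro mult_right_mono of_nat_mono)
    finally show ?thesis by simp
  qed
  have SX: "\<Union>(S j) \<subseteq> X N" for j using D_subset by (auto simp: S_def)
  have "star N Q \<subseteq> {x0} \<union> (\<Union>(S True) \<union> \<Union>(S False))"
  proof
    fix y assume y: "y \<in> star N Q"
    show "y \<in> {x0} \<union> (\<Union>(S True) \<union> \<Union>(S False))"
    proof (cases "y = x0")
      case False
      obtain x where x: "x \<in> Q" "gdist x y < 3 * nu N Q" and yX: "y \<in> X N" using y by (auto simp: star_def)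
      have xX: "x \<in> X N" using x Q D_subset by blast
      have "gdist x0 y \<le> gdist x0 x + gdist x y"
        using X_group x0X xX yX by (intro gdist_triangle) auto
      also have "\<dots> \<le> 4 * pi * nu N Q + 3 * nu N Q" using gdist_in_D[OF Q x0 x(1)] x(2) by simp
      also have "\<dots> \<le> 19 * nu N Q"
        using mult_right_mono[of "4 * pi" 16 "nu N Q"] pi_less_4 nu_pos[OF Q] by simp
      finally have g: "gdist x0 y \<le> 19 * nu N Q" .
      obtain j l where s: "(first_diff x0 y, l) \<in> scales N" "y \<in> B N j (first_diff x0 y) l x0"
          "nu N (B N j (first_diff x0 y) l x0) \<le> 6 * gdist x0 y"
        using ex_small_block[OF x0X yX] False by metis
      have "nu N (B N j (first_diff x0 y) l x0) \<le> 114 * nu N Q" using s(3) g by linarith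
      then have "real (card (B N j (first_diff x0 y) l x0)) \<le> real (114 * card Q)"
        using card_le_of_nu_le by fastforce
      then have "card (B N j (first_diff x0 y) l x0) \<le> 114 * card Q" by (simp only: of_nat_le_iff)
      then have "B N j (first_diff x0 y) l x0 \<in> S j"
        using D_I[OF s(1) x0X] B_self[OF x0X] by (simp add: S_def)
      then show ?thesis using s(2) by (cases j) auto
    qed simp
  qed
  then have "(\<Sum>y\<in>star N Q. f y) \<le> (\<Sum>y\<in>{x0} \<union> (\<Union>(S True) \<union> \<Union>(S False)). f y)"
    using SX x0X f finite_subset[OF SX finite_X] by (intro sum_mono2) auto
  also have "\<dots> \<le> f x0 + ((\<Sum>y\<in>\<Union>(S True). f y) + (\<Sum>y\<in>\<Union>(S False). f y))"
  proof -
    have un: "sum f (A \<union> A') \<le> sum f A + sum f A'" if "A \<subseteq> X N" "A' \<subseteq> X N" for A A'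
    proof -
      have "finite A" "finite A'" using that finite_subset[OF _ finite_X] by auto
      then have "sum f (A \<union> A') + sum f (A \<inter> A') = sum f A + sum f A'" by (rule sum.union_inter)
      moreover have "0 \<le> sum f (A \<inter> A')" using that f by (intro sum_nonneg) auto
      ultimately show ?thesis by linarith
    qed
    have "sum f ({x0} \<union> (\<Union>(S True) \<union> \<Union>(S False))) \<le> sum f {x0} + sum f (\<Union>(S True) \<union> \<Union>(S False))"
      using SX x0X by (intro un) auto
    moreover have "sum f (\<Union>(S True) \<union> \<Union>(S False)) \<le> sum f (\<Union>(S True)) + sum f (\<Union>(S False))"
      using SX by (intro un) auto
    ultimately show ?thesis by simp
  qed
  also have "f x0 \<le> card Q * Mf N f x0"
  proof -
    obtain k l where s: "(k, l) \<in> scales N" and eq: "{x0} = B N True k l x0"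
    proof (rule D_E[OF singleton_in_D[OF N x0X, of True]])
      fix k l assume "(k, l) \<in> scales N" and eq: "\<And>x. x \<in> {x0} \<Longrightarrow> {x0} = B N True k l x"
      then show ?thesis using that eq[OF singletonI] by blast
    qed
    have "f x0 \<le> Mf N f x0" using Mf_ge[OF s x0X, of f True] unfolding eq[symmetric] by simp
    also have "1 * Mf N f x0 \<le> card Q * Mf N f x0" using cQ M0 by (intro mult_right_mono) auto
    finally show ?thesis by simp
  qed
  finally show ?thesis using US[of True] US[of False] by (simp add: algebra_simps)
qed

lemma sum_le_cover:
  fixes h :: "'b \<Rightarrow> real" and u :: "'c \<Rightarrow> 'b \<Rightarrow> real"
  assumes Y: "finite Y" and I: "finite I" and A: "\<And>i. i \<in> I \<Longrightarrow> finite (A i)"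
    and u: "\<And>i y. i \<in> I \<Longrightarrow> y \<in> A i \<Longrightarrow> 0 \<le> u i y"
    and cov: "\<And>y. y \<in> Y \<Longrightarrow> \<exists>i\<in>I. y \<in> A i \<and> h y \<le> u i y"
  shows "(\<Sum>y\<in>Y. h y) \<le> (\<Sum>i\<in>I. \<Sum>y\<in>A i. u i y)"
proof -
  have "(\<Sum>y\<in>Y. h y) \<le> (\<Sum>y\<in>Y. \<Sum>i\<in>I. if y \<in> A i then u i y else 0)"
  proof (rule sum_mono)
    fix y assume "y \<in> Y"
    then obtain i where i: "i \<in> I" "y \<in> A i" "h y \<le> u i y" using cov by blast
    then have "h y \<le> (if y \<in> A i then u i y else 0)" by simp
    also have "\<dots> \<le> (\<Sum>i\<in>I. if y \<in> A i then u i y else 0)"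
      using i I u by (intro member_le_sum) auto
    finally show "h y \<le> (\<Sum>i\<in>I. if y \<in> A i then u i y else 0)" .
  qed
  also have "\<dots> = (\<Sum>i\<in>I. \<Sum>y\<in>Y. if y \<in> A i then u i y else 0)" by (rule sum.swap)
  also have "\<dots> \<le> (\<Sum>i\<in>I. \<Sum>y\<in>A i. u i y)"
  proof (rule sum_mono)
    fix i assume i: "i \<in> I"
    have "(\<Sum>y\<in>Y. if y \<in> A i then u i y else 0) = (\<Sum>y\<in>Y \<inter> A i. u i y)"
      using Y by (simp add: sum.inter_restrict)
    also have "\<dots> \<le> (\<Sum>y\<in>A i. u i y)" using i A u by (intro sum_mono2) auto
    finally show "(\<Sum>y\<in>Y. if y \<in> A i then u i y else 0) \<le> (\<Sum>y\<in>A i. u i y)" .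
  qed
  finally show ?thesis .
qed

lemma first_diff_off_star:
  assumes s: "(k, l) \<in> scales N" and x0: "x0 \<in> X N" and y: "y \<in> X N - star N (B N j k l x0)"
    and eq: "\<And>i. i < k \<Longrightarrow> y i = x0 i"
  shows "first_diff x0 y = k" "x0 \<noteq> y" "y k \<noteq> x0 k"
proof -
  let ?Q = "B N j k l x0"
  have nQ: "1 / m (Suc k) \<le> nu N ?Q" using nu_B_bounds(3)[OF s X_group[OF x0]] .
  show yk: "y k \<noteq> x0 k"
  proof
    assume "y k = x0 k"
    then have "gdist x0 y \<le> 2 / m (Suc k)" using eq by (intro gdist_le) (auto simp: less_Suc_eq)
    also have "\<dots> < 3 * (1 / m (Suc k))" using m_pos[of "Suc k"] by (simp add: field_simps)
    also have "\<dots> \<le> 3 * nu N ?Q" using nQ by (intro mult_left_mono) auto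
    finally have "y \<in> star N ?Q" using B_self[OF x0] y by (auto simp: star_def)
    then show False using y by simp
  qed
  then show "x0 \<noteq> y" by auto
  show "first_diff x0 y = k" using yk eq by (intro first_diff_eqI) auto
qed

text \<open>Dyadic annuli around \<open>x0\<close>: each far point lies in a block through
  \<open>x0\<close> of measure at most 6 times its distance, and the reciprocals of these measures
  are dominated by a geometric series governed by the smallest block. The constant is
  \<open>36 * 2 * 48\<close>, the 2 counting the systems of arcs.\<close>

lemma tail_sum:
  assumes N: "0 < N" and s: "(k, l0) \<in> scales N" and x0: "x0 \<in> X N" and Q: "Q = B N j0 k l0 x0"
    and f: "\<And>x. x \<in> X N \<Longrightarrow> 0 \<le> f x"
  shows "(\<Sum>y\<in>{y\<in>X N - star N Q. \<forall>i<k. y i = x0 i}. f y * (nu N Q / (gdist x0 y)\<^sup>2)) \<le> 3456 * m N * Mf N f x0"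
proof -
  have k: "k < N" using s by (simp add: scales_def)
  have x0Q: "x0 \<in> Q" unfolding Q by (rule B_self[OF x0])
  have nQ: "0 < nu N Q" unfolding Q by (rule nu_pos[OF D_I[OF s x0]])
  have M0: "0 \<le> Mf N f x0" using Mf_ge_0[OF N f] .
  define A where "A i = B N (fst i) k (snd i) x0" for i :: "bool \<times> nat"
  \<comment> \<open>The 6 is \<open>16 / 3\<close> rounded up: a block that reaches beyond distance
    \<open>3 * nu N Q\<close> from \<open>x0\<close> has diameter at most \<open>4 * pi < 16\<close>
    times its measure.\<close>
  define \<Lambda> where "\<Lambda> j = {l\<in>{..depth (p k)}. nu N Q \<le> 6 * nu N (B N j k l x0)}" for j
  define I where "I = (SIGMA j:UNIV. \<Lambda> j)"
  have fin\<Lambda>: "finite (\<Lambda> j)" for j by (simp add: \<Lambda>_def)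
  have finI: "finite I" unfolding I_def using fin\<Lambda> by simp
  have sc: "(k, l) \<in> scales N" if "l \<in> \<Lambda> j" for j l using that k by (auto simp: \<Lambda>_def scales_def)
  have A_X: "A i \<subseteq> X N" for i unfolding A_def by (rule B_subset)
  have Apos: "0 < nu N (A i)" for i unfolding A_def nu_def using card_B_pos[OF x0] by simp
  have "(\<Sum>y\<in>{y\<in>X N - star N Q. \<forall>i<k. y i = x0 i}. f y * (nu N Q / (gdist x0 y)\<^sup>2))
      \<le> (\<Sum>i\<in>I. \<Sum>y\<in>A i. f y * (36 * nu N Q / (nu N (A i))\<^sup>2))"
  proof (rule sum_le_cover)
    fix y assume "y \<in> {y\<in>X N - star N Q. \<forall>i<k. y i = x0 i}"
    then have y: "y \<in> X N - star N (B N j0 k l0 x0)" "\<And>i. i < k \<Longrightarrow> y i = x0 i" by (auto simp: Q)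
    have fd: "first_diff x0 y = k" "x0 \<noteq> y"
      by (rule first_diff_off_star[OF s x0 y(1)], erule y(2))+
    obtain j l where sl: "(k, l) \<in> scales N" and yB: "y \<in> B N j k l x0"
        and small: "nu N (B N j k l x0) \<le> 6 * gdist x0 y"
    proof (rule ex_small_block[OF x0 _ fd(2)])
      show "y \<in> X N" using y(1) by simp
    qed (unfold fd(1), rule that)
    have far: "3 * nu N Q \<le> gdist x0 y"
    proof (rule ccontr)
      assume "\<not> ?thesis"
      then have "y \<in> star N Q" unfolding star_def using y(1) x0Q by (auto intro!: bexI[of _ x0])
      then show False using y(1) by (simp add: Q)
    qed
    have "3 * nu N Q \<le> 4 * pi * nu N (B N j k l x0)" using far gdist_le_nu[OF sl x0 yB] by linarith
    also have "\<dots> \<le> 16 * nu N (B N j k l x0)"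
      using pi_less_4 Apos[of "(j, l)"] by (intro mult_right_mono) (auto simp: A_def)
    finally have "nu N Q \<le> 6 * nu N (B N j k l x0)" using Apos[of "(j, l)"] by (simp add: A_def)
    then have iI: "(j, l) \<in> I" using sl by (auto simp: I_def \<Lambda>_def scales_def)
    have g0: "0 < gdist x0 y" using far nQ by linarith
    have "(nu N (A (j, l)))\<^sup>2 \<le> (6 * gdist x0 y)\<^sup>2"
      using small Apos[of "(j, l)"] by (intro power_mono) (auto simp: A_def)
    then have "1 / (gdist x0 y)\<^sup>2 \<le> 36 / (nu N (A (j, l)))\<^sup>2"
      using g0 Apos[of "(j, l)"] by (simp add: field_simps power_mult_distrib)
    then have "nu N Q * (1 / (gdist x0 y)\<^sup>2) \<le> nu N Q * (36 / (nu N (A (j, l)))\<^sup>2)"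
      using nQ by (intro mult_left_mono) auto
    then have "f y * (nu N Q / (gdist x0 y)\<^sup>2) \<le> f y * (36 * nu N Q / (nu N (A (j, l)))\<^sup>2)"
      using f y by (intro mult_left_mono) (auto simp: mult.commute)
    then show "\<exists>i\<in>I. y \<in> A i \<and> f y * (nu N Q / (gdist x0 y)\<^sup>2) \<le> f y * (36 * nu N Q / (nu N (A i))\<^sup>2)"
      using iI yB by (intro bexI[of _ "(j, l)"] conjI) (simp_all add: A_def)
  next
    fix i y assume "i \<in> I" "y \<in> A i"
    then have "y \<in> X N" using A_X by blast
    then show "0 \<le> f y * (36 * nu N Q / (nu N (A i))\<^sup>2)" using f nQ by simp
  qed (use finI in \<open>auto simp: A_def\<close>)
  also have "\<dots> \<le> (\<Sum>i\<in>I. 36 * nu N Q * m N * Mf N f x0 * (1 / nu N (A i)))"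
  proof (rule sum_mono)
    fix i assume "i \<in> I"
    then have si: "(k, snd i) \<in> scales N" using sc by (auto simp: I_def)
    have "(\<Sum>y\<in>A i. f y * (36 * nu N Q / (nu N (A i))\<^sup>2)) = (\<Sum>y\<in>A i. f y) * (36 * nu N Q / (nu N (A i))\<^sup>2)"
      by (rule sum_distrib_right[symmetric])
    also have "\<dots> \<le> (card (A i) * Mf N f x0) * (36 * nu N Q / (nu N (A i))\<^sup>2)"
      using Mf_ge[OF si x0, of f "fst i"] nQ by (intro mult_right_mono) (auto simp: A_def)
    also have "real (card (A i)) = nu N (A i) * m N" by (simp add: nu_def)
    also have "nu N (A i) * m N * Mf N f x0 * (36 * nu N Q / (nu N (A i))\<^sup>2)
        = 36 * nu N Q * m N * Mf N f x0 * (1 / nu N (A i))"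
      using Apos[of i] by (simp add: power2_eq_square)
    finally show "(\<Sum>y\<in>A i. f y * (36 * nu N Q / (nu N (A i))\<^sup>2)) \<le> 36 * nu N Q * m N * Mf N f x0 * (1 / nu N (A i))" .
  qed
  also have "\<dots> = 36 * nu N Q * m N * Mf N f x0 * (\<Sum>j\<in>UNIV. \<Sum>l\<in>\<Lambda> j. 1 / nu N (A (j, l)))"
    unfolding I_def by (simp add: sum_distrib_left sum.Sigma fin\<Lambda>)
  also have "\<dots> \<le> 36 * nu N Q * m N * Mf N f x0 * (\<Sum>j\<in>(UNIV::bool set). 48 / nu N Q)"
  proof (intro mult_left_mono sum_mono)
    fix j :: bool
    show "(\<Sum>l\<in>\<Lambda> j. 1 / nu N (A (j, l))) \<le> 48 / nu N Q"
    proof (cases "\<Lambda> j = {}")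
      case False
      define L where "L = Max (\<Lambda> j)"
      have L: "L \<in> \<Lambda> j" unfolding L_def using False fin\<Lambda> by (intro Max_in)
      have "(\<Sum>l\<in>\<Lambda> j. 1 / nu N (A (j, l))) \<le> (\<Sum>l\<in>\<Lambda> j. 2 * real (m k) * 2 ^ l)"
      proof (rule sum_mono)
        fix l assume "l \<in> \<Lambda> j"
        have "1 / (2 * 2 ^ l * real (m k)) \<le> nu N (A (j, l))"
          using nu_B_bounds(1)[OF sc[OF \<open>l \<in> \<Lambda> j\<close>] X_group[OF x0]] by (simp add: A_def)
        then have "1 / nu N (A (j, l)) \<le> 1 / (1 / (2 * 2 ^ l * real (m k)))" by (intro divide_left_mono) (auto simp: Apos)
        then show "1 / nu N (A (j, l)) \<le> 2 * real (m k) * 2 ^ l" by (simp add: mult_ac)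
      qed
      also have "\<dots> \<le> (\<Sum>l\<in>{..L}. 2 * real (m k) * 2 ^ l)"
        using fin\<Lambda> by (intro sum_mono2) (auto simp: L_def)
      also have "\<dots> = 2 * real (m k) * (2 ^ Suc L - 1)"
        by (induction L) (auto simp: algebra_simps)
      also have "\<dots> \<le> 4 * (2 ^ L * real (m k))" by (simp add: algebra_simps)
      also have "\<dots> \<le> 4 * (2 / nu N (A (j, L)))"
      proof (intro mult_left_mono)
        have "nu N (A (j, L)) \<le> 2 / (2 ^ L * real (m k))"
          using nu_B_bounds(2)[OF sc[OF L] X_group[OF x0]] by (simp add: A_def)
        then show "2 ^ L * real (m k) \<le> 2 / nu N (A (j, L))" using Apos[of "(j, L)"] by (simp add: field_simps)
      qed simp
      also have "\<dots> \<le> 4 * (12 / nu N Q)"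
      proof (intro mult_left_mono)
        have "nu N Q \<le> 6 * nu N (A (j, L))" using L by (simp add: \<Lambda>_def A_def)
        then show "2 / nu N (A (j, L)) \<le> 12 / nu N Q" using Apos[of "(j, L)"] nQ by (simp add: field_simps)
      qed simp
      finally show ?thesis by simp
    qed (use nQ in simp)
  qed (use nQ M0 in auto)
  also have "\<dots> = 3456 * m N * Mf N f x0" using nQ by (simp add: UNIV_bool)
  finally show ?thesis .
qed

end

section \<open>The Dirichlet kernel\<close>

lemma sum_lessThan_blocks:
  fixes h :: "nat \<Rightarrow> 'a::comm_monoid_add"
  shows "(\<Sum>j<a * b + s. h j) = (\<Sum>i<a. \<Sum>c<b. h (i * b + c)) + (\<Sum>c<s. h (a * b + c))"
proof -
  have shift: "(\<Sum>j<n + s. h j) = (\<Sum>j<n. h j) + (\<Sum>c<s. h (n + c))" for n s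
    by (induction s) (auto simp: add.assoc)
  have "(\<Sum>j<a * b. h j) = (\<Sum>i<a. \<Sum>c<b. h (i * b + c))"
  proof (induction a)
    case (Suc a)
    have "(\<Sum>j<Suc a * b. h j) = (\<Sum>j<a * b + b. h j)" by (simp add: add.commute)
    then show ?case unfolding shift using Suc by simp
  qed simp
  then show ?thesis unfolding shift by simp
qed

lemma sum_geometric_root_of_unity:
  fixes w :: complex
  assumes "w ^ n = 1" "w \<noteq> 1"
  shows "(\<Sum>c<n. w ^ c) = 0"
  using assms by (simp add: geometric_sum)

text \<open>Multiplying the geometric sum by the conjugate of its next term exposes the Cauchy
  kernel \<open>v / (u - v)\<close>, with a second factor made of the constant 1 and one pure power
  of \<open>v\<close>.\<close>

lemma sum_reversed_geometric:
  fixes u v :: complex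
  assumes "norm u = 1" "norm v = 1" "u \<noteq> v"
  shows "cnj ((u * cnj v) ^ a) * (\<Sum>c<a. (u * cnj v) ^ c) = v / (u - v) * (1 - cnj u ^ a * v ^ a)"
proof -
  have uv: "u * cnj u = 1" "v * cnj v = 1" using assms by (simp_all add: complex_norm_square[symmetric])
  define w where "w = u * cnj v"
  have w: "w \<noteq> 1" "w ^ a * cnj w ^ a = 1"
  proof -
    have "w * v = u" using uv by (simp add: w_def mult.assoc mult.commute)
    then show "w \<noteq> 1" using assms by auto
    have "w * cnj w = (u * cnj u) * (v * cnj v)" by (simp add: w_def mult_ac)
    then show "w ^ a * cnj w ^ a = 1" unfolding power_mult_distrib[symmetric] uv by simp
  qed
  have v0: "v \<noteq> 0" using assms by auto
  have "cnj (w ^ a) * (\<Sum>c<a. w ^ c) = (cnj w ^ a * w ^ a - cnj w ^ a) / (w - 1)"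
    using w by (simp add: geometric_sum right_diff_distrib)
  also have "cnj w ^ a * w ^ a = 1" using w by (simp add: mult.commute)
  also have "cnj w ^ a = cnj u ^ a * v ^ a" by (simp add: w_def power_mult_distrib)
  also have "w - 1 = (u - v) / v"
  proof -
    have "(w - 1) * v = u - v" using uv by (simp add: w_def algebra_simps)
    then show ?thesis using v0 by (simp add: field_simps)
  qed
  finally show ?thesis unfolding w_def by simp
qed

context vilenkin
begin

abbreviation "digit \<equiv> vilenkin_digit p"
abbreviation "\<psi> \<equiv> vilenkin_psi p"

lemma m_dvd: "i \<le> k \<Longrightarrow> m i dvd m k"
  by (induction k rule: dec_induct) (auto simp: m_Suc)

lemma phi_eq: "vilenkin_phi p k x = unit_root (p k) (x k)"
  by (simp add: vilenkin_phi_def unit_root_def cis_conv_exp mult_ac)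

lemma digit_le_0: "n < m k \<Longrightarrow> k \<le> i \<Longrightarrow> digit n i = 0"
  using m_mono[of k i] by (simp add: vilenkin_digit_def m_def)

lemma psi_prod: "n < m k \<Longrightarrow> \<psi> n x = (\<Prod>i<k. unit_root (p i) (x i) ^ digit n i)"
proof -
  assume n: "n < m k"
  have "i < k" if "digit n i \<noteq> 0" for i
    using digit_le_0[OF n, of i] that by (meson not_le)
  then show ?thesis
    unfolding vilenkin_psi_def phi_eq by (intro prod.mono_neutral_left) auto
qed

lemma n_less_m: "n < m n"
  unfolding m_def by (rule vilenkin_m_gt[OF p_ge_2])

lemma digit_low:
  assumes "i < k"
  shows "digit (b * m k + s) i = digit s i"
proof -
  obtain r where r: "m k = m (Suc i) * r" using m_dvd[of "Suc i" k] assms unfolding dvd_def by auto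
  have "b * m k + s = s + (b * r * p i) * m i" by (simp add: r m_Suc mult_ac)
  then have "(b * m k + s) div m i = b * r * p i + s div m i"
    using m_pos[of i] by (simp only:) (rule div_mult_self1, simp)
  then show ?thesis by (simp add: vilenkin_digit_def m_def)
qed

lemma digit_high:
  assumes "k \<le> i" "s < m k"
  shows "digit (b * m k + s) i = digit (b * m k) i"
proof -
  obtain r where r: "m i = m k * r" using m_dvd[OF assms(1)] unfolding dvd_def by blast
  have "(b * m k + s) div m i = (b * m k) div m i"
    unfolding r div_mult2_eq using assms by simp
  then show ?thesis by (simp add: vilenkin_digit_def m_def)
qed

text \<open>No carries occur: the nonzero digits of \<open>b * m k\<close> and of \<open>s\<close>
  occupy disjoint positions.\<close>

lemma psi_mult:
  assumes s: "s < m k"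
  shows "\<psi> (b * m k + s) x = \<psi> (b * m k) x * \<psi> s x"
proof -
  let ?M = "b * m k + s"
  have le: "?M < m ?M" "b * m k < m ?M" "s < m ?M"
    using n_less_m[of ?M] by auto
  show ?thesis
    unfolding psi_prod[OF le(1)] psi_prod[OF le(2)] psi_prod[OF le(3)] prod.distrib[symmetric]
  proof (rule prod.cong[OF refl])
    fix i
    show "unit_root (p i) (x i) ^ digit ?M i = unit_root (p i) (x i) ^ digit (b * m k) i * unit_root (p i) (x i) ^ digit s i"
    proof (cases "i < k")
      case True
      have "digit (b * m k) i = 0" using digit_low[OF True, of b 0] by (simp add: vilenkin_digit_def)
      then show ?thesis using digit_low[OF True, of b s] by simp
    next
      case False
      then show ?thesis using digit_high[OF _ s, of i b] digit_le_0[OF s, of i] by simp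
    qed
  qed
qed

lemma psi_digit:
  assumes "c < p k"
  shows "\<psi> (c * m k) x = unit_root (p k) (x k) ^ c"
proof -
  have lt: "c * m k < m (Suc k)" using assms by (simp add: m_Suc mult.commute)
  have "digit (c * m k) i = 0" if "i < k" for i
    using digit_low[OF that, of c 0] by (simp add: vilenkin_digit_def)
  moreover have "digit (c * m k) k = c" using assms m_pos[of k] by (simp add: vilenkin_digit_def m_def[symmetric])
  ultimately show ?thesis unfolding psi_prod[OF lt] by simp
qed

lemma psi_Suc:
  assumes "c < p k"
  shows "\<psi> ((b * p k + c) * m k) x = \<psi> (b * m (Suc k)) x * unit_root (p k) (x k) ^ c"
proof -
  have "(b * p k + c) * m k = b * m (Suc k) + c * m k" by (simp add: m_Suc algebra_simps)
  moreover have "c * m k < m (Suc k)" using assms by (simp add: m_Suc mult.commute)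
  ultimately show ?thesis using psi_mult[of "c * m k" "Suc k" b] psi_digit[OF assms] by simp
qed

lemma norm_psi [simp]: "norm (\<psi> n x) = 1"
  unfolding psi_prod[OF n_less_m] by (simp add: prod_norm[symmetric] norm_power)

lemma psi_cnj [simp]: "\<psi> n x * cnj (\<psi> n x) = 1" "cnj (\<psi> n x) * \<psi> n x = 1"
  by (simp_all add: complex_norm_square[symmetric] mult.commute)

lemma psi_cong: "(\<And>i. i < k \<Longrightarrow> x i = y i) \<Longrightarrow> s < m k \<Longrightarrow> \<psi> s x = \<psi> s y"
  unfolding psi_prod by (intro prod.cong) auto

definition Dir :: "nat \<Rightarrow> (nat \<Rightarrow> nat) \<Rightarrow> (nat \<Rightarrow> nat) \<Rightarrow> complex" where
  "Dir n x y = (\<Sum>j<n. \<psi> j x * cnj (\<psi> j y))"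

text \<open>Coordinates below \<open>k\<close> agree, so characters of index below
  \<open>m k\<close> contribute 1. Each full run of digit \<open>k\<close> sums to 0 over the roots
  of unity, which leaves the incomplete run of \<open>\<alpha>\<close> digits and the
  \<open>s\<close> characters after it.\<close>

lemma Dir_block:
  assumes eq: "\<And>i. i < k \<Longrightarrow> x i = y i" and ne: "x k \<noteq> y k" and x: "x \<in> group" and y: "y \<in> group"
    and \<alpha>: "\<alpha> < p k" and s: "s < m k"
  defines "w \<equiv> unit_root (p k) (x k) * cnj (unit_root (p k) (y k))"
  shows "Dir ((b * p k + \<alpha>) * m k + s) x y =
    \<psi> (b * m (Suc k)) x * cnj (\<psi> (b * m (Suc k)) y) * (of_nat (m k) * (\<Sum>c<\<alpha>. w ^ c) + of_nat s * w ^ \<alpha>)"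
proof -
  define h where "h j = \<psi> j x * cnj (\<psi> j y)" for j
  define E where "E b = h (b * m (Suc k))" for b
  have low: "h (a * m k + s') = h (a * m k)" if "s' < m k" for a s'
  proof -
    have "h (a * m k + s') = h (a * m k) * (\<psi> s' x * cnj (\<psi> s' y))"
      using psi_mult[OF that] by (simp add: h_def mult_ac)
    also have "\<psi> s' x = \<psi> s' y" using eq that by (rule psi_cong)
    finally show ?thesis by simp
  qed
  have high: "h ((b * p k + c) * m k) = E b * w ^ c" if "c < p k" for b c
    using psi_Suc[OF that] by (simp add: h_def E_def w_def power_mult_distrib mult_ac)
  have w1: "w \<noteq> 1"
  proof
    assume "w = 1"
    then have "unit_root (p k) (x k) * (cnj (unit_root (p k) (y k)) * unit_root (p k) (y k)) = unit_root (p k) (y k)"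
      by (simp add: w_def mult_ac)
    then have "unit_root (p k) (x k) = unit_root (p k) (y k)"
      by (simp add: complex_norm_square[symmetric] mult.commute)
    then have "chord (p k) (x k) (y k) = 0" by (simp add: chord_def)
    moreover have "4 / p k \<le> chord (p k) (x k) (y k)"
      using x y ne by (intro chord_ge_min) (auto simp: group_def)
    ultimately show False using p_pos[of k] by (simp add: field_simps)
  qed
  have root: "unit_root (p k) a ^ p k = 1" for a
  proof -
    have "unit_root (p k) a ^ n = unit_root (p k) (n * a)" for n
      by (induction n) (simp_all add: unit_root_add, simp add: unit_root_def)
    then have "unit_root (p k) a ^ p k = unit_root (p k) (p k * a mod p k)"
      unfolding unit_root_period[OF p_pos] .
    then show ?thesis by (simp add: unit_root_def)
  qed
  have wp: "w ^ p k = 1" by (simp add: w_def power_mult_distrib root flip: complex_cnj_power)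
  have "Dir ((b * p k + \<alpha>) * m k + s) x y = (\<Sum>j<(b * p k + \<alpha>) * m k + s. h j)" by (simp add: Dir_def h_def)
  also have "\<dots> = (\<Sum>i<b * p k + \<alpha>. of_nat (m k) * h (i * m k)) + of_nat s * h ((b * p k + \<alpha>) * m k)"
    unfolding sum_lessThan_blocks using low s by simp
  also have "(\<Sum>i<b * p k + \<alpha>. of_nat (m k) * h (i * m k)) =
      (\<Sum>i<b. \<Sum>c<p k. of_nat (m k) * (E i * w ^ c)) + (\<Sum>c<\<alpha>. of_nat (m k) * (E b * w ^ c))"
    unfolding sum_lessThan_blocks using high \<alpha> by simp
  also have "(\<Sum>i<b. \<Sum>c<p k. of_nat (m k) * (E i * w ^ c)) = 0"
    using sum_geometric_root_of_unity[OF wp w1] by (simp add: sum_distrib_left[symmetric])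
  finally show ?thesis
    using high[OF \<alpha>] by (simp add: E_def h_def sum_distrib_left algebra_simps)
qed

lemma Dir_self: "Dir n x x = n"
  by (simp add: Dir_def)

lemma Dir_full:
  assumes x: "x \<in> group" and y: "y \<in> group" and i: "i < N" "x i \<noteq> y i"
  shows "Dir (m N) x y = 0"
proof -
  let ?k = "first_diff x y"
  have ne: "x \<noteq> y" using i by auto
  have k: "Suc ?k \<le> N" using i eq_below_first_diff[of i x y] by (meson Suc_leI le_less_trans not_le)
  obtain b where b: "m N = m (Suc ?k) * b" using m_dvd[OF k] unfolding dvd_def by blast
  have "m N = (b * p ?k + 0) * m ?k + 0" using b by (simp add: m_Suc mult_ac)
  then show ?thesis
    using Dir_block[where k="?k" and x=x and y=y and \<alpha>=0 and s=0 and b=b]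
      eq_below_first_diff[of _ x y] first_diff[OF ne] x y by simp
qed

lemma Parseval_X:
  "(\<Sum>j<m N. (norm (\<Sum>x\<in>X N. f x * cnj (\<psi> j x)))\<^sup>2) = m N * (\<Sum>x\<in>X N. (norm (f x))\<^sup>2)"
proof -
  have D: "Dir (m N) y x = (if y = x then of_nat (m N) else 0)" if "x \<in> X N" "y \<in> X N" for x y
    using that Dir_full[of y x "first_diff y x" N] first_diff[of y x] first_diff_less[of y N x] X_group
    by (auto simp: Dir_self)
  have "complex_of_real (\<Sum>j<m N. (norm (\<Sum>x\<in>X N. f x * cnj (\<psi> j x)))\<^sup>2)
      = (\<Sum>j<m N. (\<Sum>x\<in>X N. f x * cnj (\<psi> j x)) * (\<Sum>y\<in>X N. cnj (f y) * \<psi> j y))"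
    unfolding of_real_sum by (intro sum.cong refl) (simp only: complex_norm_square cnj_sum complex_cnj_mult complex_cnj_cnj)
  also have "\<dots> = (\<Sum>j<m N. \<Sum>x\<in>X N. \<Sum>y\<in>X N. f x * cnj (f y) * (\<psi> j y * cnj (\<psi> j x)))"
    by (simp add: sum_product mult_ac)
  also have "\<dots> = (\<Sum>x\<in>X N. \<Sum>y\<in>X N. \<Sum>j<m N. f x * cnj (f y) * (\<psi> j y * cnj (\<psi> j x)))"
    by (subst sum.swap) (intro sum.cong refl sum.swap)
  also have "\<dots> = (\<Sum>x\<in>X N. \<Sum>y\<in>X N. f x * cnj (f y) * Dir (m N) y x)"
    by (simp add: Dir_def sum_distrib_left)
  also have "\<dots> = (\<Sum>x\<in>X N. \<Sum>y\<in>X N. if y = x then m N * (f x * cnj (f x)) else 0)"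
    by (intro sum.cong refl) (auto simp: D)
  also have "\<dots> = (\<Sum>x\<in>X N. m N * (f x * cnj (f x)))" by simp
  also have "\<dots> = complex_of_real (m N * (\<Sum>x\<in>X N. (norm (f x))\<^sup>2))"
    unfolding of_real_mult of_real_sum complex_norm_square by (simp add: sum_distrib_left)
  finally show ?thesis by (simp only: of_real_eq_iff)
qed

text \<open>Conjugation by the character \<open>\<psi> n\<close> makes the kernel of the partial sum operator close to a Hilbert kernel.\<close>

definition K :: "nat \<Rightarrow> nat \<Rightarrow> (nat \<Rightarrow> nat) \<Rightarrow> (nat \<Rightarrow> nat) \<Rightarrow> complex" where
  "K N n x y = cnj (\<psi> n x) * Dir n x y * \<psi> n y / m N"

lemma cnj_Dir: "cnj (Dir n x y) = Dir n y x"
  by (simp add: Dir_def mult.commute)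

lemma cnj_K: "cnj (K N n x y) = K N n y x"
  by (simp add: K_def cnj_Dir mult_ac)

text \<open>Conjugation removes the character of the digits above \<open>k\<close> and brings digit
  \<open>k\<close> into the form of \<open>sum_reversed_geometric\<close>. The lower digits leave
  only the constant \<open>n mod m k\<close>.\<close>

lemma K_formula:
  assumes eq: "\<And>i. i < k \<Longrightarrow> x i = y i" and ne: "x k \<noteq> y k" and x: "x \<in> group" and y: "y \<in> group"
  defines "u \<equiv> unit_root (p k) (x k)" and "v \<equiv> unit_root (p k) (y k)"
  shows "of_nat (m N) * K N n x y = of_nat (n mod m k) + of_nat (m k) * (v / (u - v) * (1 - cnj u ^ digit n k * v ^ digit n k))"
proof -
  define s where "s = n mod m k"
  define b where "b = n div m (Suc k)"
  define \<alpha> where "\<alpha> = digit n k"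
  have \<alpha>: "\<alpha> < p k" unfolding \<alpha>_def by (rule vilenkin_digit_less, rule p_ge_2)
  have s: "s < m k" unfolding s_def by simp
  have n: "n = (b * p k + \<alpha>) * m k + s"
  proof -
    have "n div m k = b * p k + \<alpha>"
      by (simp add: b_def \<alpha>_def vilenkin_digit_def m_Suc div_mult2_eq flip: m_def)
    then show ?thesis unfolding s_def by (metis div_mult_mod_eq)
  qed
  define w where "w = u * cnj v"
  have nu: "norm u = 1" "norm v = 1" by (simp_all add: u_def v_def)
  have uv: "u \<noteq> v"
  proof
    assume "u = v"
    then have "chord (p k) (x k) (y k) = 0" by (simp add: chord_def u_def v_def)
    moreover have "4 / p k \<le> chord (p k) (x k) (y k)"
      using x y ne by (intro chord_ge_min) (auto simp: group_def)
    ultimately show False using p_pos[of k] by (simp add: field_simps)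
  qed
  have ww: "w ^ \<alpha> * cnj (w ^ \<alpha>) = 1"
    unfolding complex_norm_square[symmetric] by (simp add: w_def nu norm_mult norm_power)
  have psi: "\<psi> n z = \<psi> (b * m (Suc k)) z * unit_root (p k) (z k) ^ \<alpha> * \<psi> s z" for z
    unfolding n using psi_mult[OF s] psi_Suc[OF \<alpha>] by simp
  have sxy: "\<psi> s x = \<psi> s y" using eq s by (rule psi_cong)
  define P where "P = \<psi> (b * m (Suc k)) x"
  define R where "R = \<psi> (b * m (Suc k)) y"
  define S where "S = \<psi> s y"
  have one: "cnj P * P = 1" "cnj R * R = 1" "cnj S * S = 1" by (simp_all add: P_def R_def S_def)
  have "of_nat (m N) * K N n x y = cnj (\<psi> n x) * Dir n x y * \<psi> n y" by (simp add: K_def)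
  also have "Dir n x y = P * cnj R * (of_nat (m k) * (\<Sum>c<\<alpha>. w ^ c) + of_nat s * w ^ \<alpha>)"
    using Dir_block[OF eq ne x y \<alpha> s, of b] unfolding n[symmetric] by (simp add: P_def R_def w_def u_def v_def)
  also have "cnj (\<psi> n x) * (P * cnj R * (of_nat (m k) * (\<Sum>c<\<alpha>. w ^ c) + of_nat s * w ^ \<alpha>)) * \<psi> n y
      = (cnj P * P) * (cnj R * R) * (cnj S * S) * (cnj (w ^ \<alpha>) * (of_nat (m k) * (\<Sum>c<\<alpha>. w ^ c) + of_nat s * w ^ \<alpha>))"
    unfolding psi by (simp add: P_def[symmetric] R_def[symmetric] S_def[symmetric] sxy
      u_def[symmetric] v_def[symmetric] w_def power_mult_distrib mult_ac)
  also have "\<dots> = of_nat (m k) * (cnj (w ^ \<alpha>) * (\<Sum>c<\<alpha>. w ^ c)) + of_nat s * (w ^ \<alpha> * cnj (w ^ \<alpha>))"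
    unfolding one by (simp add: algebra_simps)
  also have "\<dots> = of_nat s + of_nat (m k) * (v / (u - v) * (1 - cnj u ^ \<alpha> * v ^ \<alpha>))"
    unfolding ww unfolding w_def sum_reversed_geometric[OF nu uv] by simp
  finally show ?thesis by (simp add: s_def \<alpha>_def)
qed

text \<open>Up to the unimodular factors this is Bessel's inequality. The squared norm of
  \<open>v\<close> pairs its coefficients \<open>d\<close> with the coefficients \<open>c\<close> of
  \<open>g\<close>; the inequality of arithmetic and geometric mean, weighted by \<open>P\<close>,
  splits the pairing so that half of the squared norm is absorbed.\<close>

lemma K_L2:
  assumes n: "n \<le> m N"
  shows "(\<Sum>x\<in>X N. (norm (\<Sum>y\<in>X N. K N n x y * f y))\<^sup>2) \<le> (\<Sum>y\<in>X N. (norm (f y))\<^sup>2)"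
proof -
  define g where "g y = \<psi> n y * f y" for y
  define c where "c j = (\<Sum>y\<in>X N. g y * cnj (\<psi> j y))" for j
  define v where "v x = (\<Sum>j<n. \<psi> j x * c j)" for x
  define d where "d j = (\<Sum>x\<in>X N. v x * cnj (\<psi> j x))" for j
  define P where "P = real (m N)"
  have P: "0 < P" by (simp add: P_def)
  have c: "(\<Sum>j<m N. (norm (c j))\<^sup>2) = P * (\<Sum>y\<in>X N. (norm (f y))\<^sup>2)"
    unfolding c_def Parseval_X by (simp add: g_def norm_mult P_def)
  have d: "(\<Sum>j<m N. (norm (d j))\<^sup>2) = P * (\<Sum>x\<in>X N. (norm (v x))\<^sup>2)"
    unfolding d_def Parseval_X by (simp add: P_def)
  have K: "norm (\<Sum>y\<in>X N. K N n x y * f y) = norm (v x) / P" for x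
  proof -
    have "(\<Sum>y\<in>X N. K N n x y * f y) = cnj (\<psi> n x) * (\<Sum>y\<in>X N. Dir n x y * g y) / m N"
      by (simp add: K_def g_def sum_distrib_left sum_divide_distrib mult_ac)
    also have "(\<Sum>y\<in>X N. Dir n x y * g y) = (\<Sum>y\<in>X N. \<Sum>j<n. \<psi> j x * (g y * cnj (\<psi> j y)))"
      by (simp add: Dir_def sum_distrib_left sum_distrib_right mult_ac)
    also have "\<dots> = v x" unfolding v_def c_def sum_distrib_left by (rule sum.swap)
    finally show ?thesis by (simp add: norm_mult norm_divide P_def)
  qed
  have "complex_of_real (\<Sum>x\<in>X N. (norm (v x))\<^sup>2) = (\<Sum>x\<in>X N. v x * cnj (v x))"
    unfolding of_real_sum by (intro sum.cong refl complex_norm_square)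
  also have "\<dots> = (\<Sum>x\<in>X N. \<Sum>j<n. cnj (c j) * (v x * cnj (\<psi> j x)))"
    by (intro sum.cong refl) (simp add: v_def[of _, THEN arg_cong[where f=cnj]] sum_distrib_left mult_ac)
  also have "\<dots> = (\<Sum>j<n. cnj (c j) * d j)"
    unfolding d_def sum_distrib_left by (rule sum.swap)
  finally have eq: "complex_of_real (\<Sum>x\<in>X N. (norm (v x))\<^sup>2) = (\<Sum>j<n. cnj (c j) * d j)" .
  have v0: "0 \<le> (\<Sum>x\<in>X N. (norm (v x))\<^sup>2)" by (intro sum_nonneg) auto
  have "(\<Sum>x\<in>X N. (norm (v x))\<^sup>2) = norm (complex_of_real (\<Sum>x\<in>X N. (norm (v x))\<^sup>2))"
    unfolding norm_of_real using v0 by simp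
  also have "\<dots> = norm (\<Sum>j<n. cnj (c j) * d j)" unfolding eq ..
  also have "\<dots> \<le> (\<Sum>j<n. norm (c j) * norm (d j))" by (rule sum_norm_le) (simp add: norm_mult)
  also have "\<dots> \<le> (\<Sum>j<n. (P * (norm (c j))\<^sup>2 + (norm (d j))\<^sup>2 / P) / 2)"
  proof (rule sum_mono)
    fix j
    have "0 \<le> (P * norm (c j) - norm (d j))\<^sup>2 / P" using P by simp
    also have "\<dots> = P * (norm (c j))\<^sup>2 + (norm (d j))\<^sup>2 / P - 2 * (norm (c j) * norm (d j))"
      using P by (simp add: power2_eq_square field_simps)
    finally show "norm (c j) * norm (d j) \<le> (P * (norm (c j))\<^sup>2 + (norm (d j))\<^sup>2 / P) / 2" by simp
  qed
  also have "\<dots> \<le> (\<Sum>j<m N. (P * (norm (c j))\<^sup>2 + (norm (d j))\<^sup>2 / P) / 2)"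
    using n P by (intro sum_mono2) auto
  also have "\<dots> = (P * (\<Sum>j<m N. (norm (c j))\<^sup>2) + (\<Sum>j<m N. (norm (d j))\<^sup>2) / P) / 2"
    by (simp add: sum_divide_distrib[symmetric] sum.distrib sum_distrib_left)
  also have "\<dots> = (P\<^sup>2 * (\<Sum>y\<in>X N. (norm (f y))\<^sup>2) + (\<Sum>x\<in>X N. (norm (v x))\<^sup>2)) / 2"
    unfolding c d using P by (simp add: power2_eq_square)
  finally have "(\<Sum>x\<in>X N. (norm (v x))\<^sup>2) \<le> P\<^sup>2 * (\<Sum>y\<in>X N. (norm (f y))\<^sup>2)" by simp
  then have "(\<Sum>x\<in>X N. (norm (v x))\<^sup>2) / P\<^sup>2 \<le> (\<Sum>y\<in>X N. (norm (f y))\<^sup>2)"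
    using P by (simp add: pos_divide_le_eq mult.commute)
  then show ?thesis unfolding K power_divide sum_divide_distrib .
qed

lemma norm_K_le:
  assumes x: "x \<in> group" and y: "y \<in> group" and ne: "x \<noteq> y"
  shows "norm (K N n x y) * gdist x y * m N \<le> 4"
proof -
  let ?k = "first_diff x y"
  define u v where "u = unit_root (p ?k) (x ?k)" and "v = unit_root (p ?k) (y ?k)"
  have ch: "norm (u - v) = chord (p ?k) (x ?k) (y ?k)" by (simp add: chord_def u_def v_def)
  have "0 < 4 / real (p ?k)" by simp
  also have "\<dots> \<le> chord (p ?k) (x ?k) (y ?k)"
    using x y first_diff[OF ne] by (intro chord_ge_min) (auto simp: group_def)
  finally have pos: "0 < norm (u - v)" unfolding ch .
  have uv: "norm u = 1" "norm v = 1" by (simp_all add: u_def v_def)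
  have "norm (1 - cnj u ^ digit n ?k * v ^ digit n ?k) \<le> 1 + 1"
    by (rule order_trans[OF norm_triangle_ineq4]) (simp add: norm_mult norm_power uv)
  then have two: "norm (v / (u - v) * (1 - cnj u ^ digit n ?k * v ^ digit n ?k)) \<le> 2 / norm (u - v)"
    unfolding norm_mult norm_divide uv using pos by (simp add: divide_right_mono)
  have "norm (K N n x y) * m N = norm (of_nat (m N) * K N n x y)" by (simp add: norm_mult)
  also have "\<dots> = norm (of_nat (n mod m ?k) + of_nat (m ?k) * (v / (u - v) * (1 - cnj u ^ digit n ?k * v ^ digit n ?k)))"
    unfolding u_def v_def
    by (subst K_formula[where k="?k"]) (use x y first_diff[OF ne] eq_below_first_diff[of _ x y] in auto)
  also have "\<dots> \<le> real (n mod m ?k) + real (m ?k) * (2 / norm (u - v))"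
    
    by (intro order_trans[OF norm_triangle_ineq] add_mono) (simp_all only: norm_mult[of "of_nat (m _)"] norm_of_nat order_refl mult_left_mono[OF two] of_nat_0_le_iff)
  also have "\<dots> \<le> real (m ?k) * (2 / norm (u - v)) + real (m ?k) * (2 / norm (u - v))"
  proof (rule add_right_mono)
    have "real (n mod m ?k) \<le> real (m ?k) * 1" by (simp add: less_imp_le)
    also have "\<dots> \<le> real (m ?k) * (2 / norm (u - v))"
      using pos chord_le_2[of "p ?k" "x ?k" "y ?k"] ch by (intro mult_left_mono) auto
    finally show "real (n mod m ?k) \<le> real (m ?k) * (2 / norm (u - v))" .
  qed
  finally have "norm (K N n x y) * m N \<le> 4 * m ?k / norm (u - v)" by simp
  then have "norm (K N n x y) * m N * gdist x y \<le> 4 * m ?k / norm (u - v) * gdist x y"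
    by (intro mult_right_mono gdist_nonneg)
  also have "\<dots> = 4" using pos ne by (simp add: gdist_def ch)
  finally show ?thesis by (simp add: mult_ac)
qed

section \<open>The kernel on a block as a two-frequency function of one coordinate\<close>

lemma coords_interval: "x \<in> group \<Longrightarrow> \<exists>u n. coords False k l x = {u..<u + n}"
proof -
  assume "x \<in> group"
  obtain i where i: "i = arc False (p k) l (x k)" by blast
  have "coords False k l x = {c\<in>{..<p k}. (c * 2 ^ l) div p k = i}"
    unfolding coords_def i[symmetric] by (auto simp: arc_def arc_shift_def)
  then show ?thesis using arc_unshift_interval[of "p k" l i] by simp
qed

lemma finite_coords: "finite (coords j k l x)"
  by (auto simp: coords_def)

text \<open>All residues of the arc have fibers of equal size in the block, which transfers
  one-dimensional statements about coordinate \<open>k\<close> to the block.\<close>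

lemma card_B_fiber:
  assumes s: "(k, l) \<in> scales N" and x: "x \<in> X N" and c: "c \<in> coords j k l x"
  shows "card {z\<in>B N j k l x. z k = c} * card (coords j k l x) = card (B N j k l x)"
proof -
  have k: "k < N" using s by (simp add: scales_def)
  define z where "z = x(k := c)"
  have zX: "z \<in> X N" using x c k by (auto simp: z_def X_iff group_def coords_def)
  let ?A = "B N j k (depth (p k)) z"
  have eq: "coords j k (depth (p k)) z = {c}"
  proof -
    have "c < p k" using c by (simp add: coords_def)
    then show ?thesis using arc_depth_inj[of _ "p k" c j] by (auto simp: coords_def z_def)
  qed
  have "{z\<in>B N j k l x. z k = c} = ?A"
  proof (rule set_eqI)
    fix y
    have "y \<in> ?A \<longleftrightarrow> y \<in> X N \<and> (\<forall>i<k. y i = x i) \<and> y k \<in> coords j k (depth (p k)) z"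
      using X_group[of y N] by (auto simp: B_def blk_def coords_def z_def group_def)
    then have "y \<in> ?A \<longleftrightarrow> y \<in> X N \<and> (\<forall>i<k. y i = x i) \<and> y k = c" unfolding eq by simp
    moreover have "y \<in> B N j k l x \<longleftrightarrow> y \<in> X N \<and> (\<forall>i<k. y i = x i) \<and> y k \<in> coords j k l x"
      using X_group[of y N] by (auto simp: B_def blk_def coords_def group_def)
    ultimately show "y \<in> {z\<in>B N j k l x. z k = c} \<longleftrightarrow> y \<in> ?A" using c by auto
  qed
  moreover have "card ?A * m (Suc k) = m N"
    using card_B[OF k X_group[OF zX], of j "depth (p k)"] eq by simp
  moreover have "card (B N j k l x) * m (Suc k) = card (coords j k l x) * m N"
    using card_B[OF k X_group[OF x]] .
  ultimately have "(card {z\<in>B N j k l x. z k = c} * card (coords j k l x)) * m (Suc k) = card (B N j k l x) * m (Suc k)"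
    by (metis mult.assoc mult.commute)
  then show ?thesis using m_pos[of "Suc k"] by simp
qed

lemma B_coord: "z \<in> B N j k l x \<Longrightarrow> z k \<in> coords j k l x"
  by (auto simp: B_def blk_def coords_def group_def)

lemma sum_B_coord:
  fixes F :: "nat \<Rightarrow> complex"
  assumes s: "(k, l) \<in> scales N" and x: "x \<in> X N"
  shows "of_nat (card (coords j k l x)) * (\<Sum>z\<in>B N j k l x. F (z k)) = of_nat (card (B N j k l x)) * (\<Sum>c\<in>coords j k l x. F c)"
proof -
  let ?B = "B N j k l x" and ?C = "coords j k l x"
  have "(\<Sum>z\<in>?B. F (z k)) = (\<Sum>c\<in>?C. \<Sum>z\<in>{z\<in>?B. z k = c}. F (z k))"
    using B_coord by (intro sum.group[symmetric] finite_coords) auto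
  also have "\<dots> = (\<Sum>c\<in>?C. of_nat (card {z\<in>?B. z k = c}) * F c)" by simp
  finally have "of_nat (card ?C) * (\<Sum>z\<in>?B. F (z k)) =
      (\<Sum>c\<in>?C. of_nat (card {z\<in>?B. z k = c} * card ?C) * F c)"
    by (simp add: sum_distrib_left mult_ac)
  also have "\<dots> = (\<Sum>c\<in>?C. of_nat (card ?B) * F c)"
    by (intro sum.cong refl) (simp only: card_B_fiber[OF s x])
  finally show ?thesis by (simp add: sum_distrib_left)
qed

lemma gdist_off_star:
  assumes Q: "Q \<in> D N j" and x: "x \<in> X N - star N Q" and y: "y \<in> Q"
  shows "3 * nu N Q \<le> gdist y x"
  using assms unfolding star_def by (auto simp: not_less)

text \<open>If \<open>x\<close> leaves the coset of \<open>x0\<close> before coordinate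
  \<open>k\<close>, the kernel is constant on \<open>Q\<close>. Otherwise only the Cauchy factor is
  frozen, at \<open>v0\<close>, while the power of \<open>v (y k)\<close> is kept exactly as
  \<open>w ^ y k\<close>; the error is the distance of \<open>v (y k)\<close> and \<open>v0\<close>
  over a product of two distances to \<open>u\<close>. \<open>w\<close> is the same for all
  \<open>x\<close>, being determined by \<open>n\<close> and \<open>k\<close>.\<close>

lemma K_near_exponential:
  assumes s: "(k, l) \<in> scales N" and x0: "x0 \<in> X N" and Q: "Q = B N j k l x0"
  shows "\<exists>w. norm w = 1 \<and> (\<forall>x\<in>X N - star N Q. \<exists>A B'. \<forall>y\<in>Q.
    norm (of_nat (m N) * K N n x y - (A + B' * w ^ y k)) \<le>
      (if \<forall>i<k. x i = x0 i then 224 * (nu N Q / (gdist x0 x)\<^sup>2) else 0))"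
proof -
  define a where "a = digit n k"
  define w where "w = unit_root (p k) 1 ^ a"
  have QD: "Q \<in> D N j" unfolding Q by (rule D_I[OF s x0])
  have x0Q: "x0 \<in> Q" unfolding Q by (rule B_self[OF x0])
  have nQ: "0 < nu N Q" by (rule nu_pos[OF QD])
  have w: "norm w = 1" by (simp add: w_def norm_power)
  have wpow: "unit_root (p k) c ^ a = w ^ c" for c
  proof -
    have "unit_root (p k) 1 ^ c = unit_root (p k) c" for c
      by (induction c) (simp add: unit_root_def, metis Suc_eq_plus1 power_Suc2 unit_root_add)
    then show ?thesis unfolding w_def by (metis power_commutes power_mult mult.commute)
  qed
  have Qm: "y \<in> group" "\<And>i. i < k \<Longrightarrow> y i = x0 i" if "y \<in> Q" for y
    using that by (auto simp: Q B_def blk_def)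
  show ?thesis
  proof (rule exI[of _ w], intro conjI w ballI)
    fix x assume x: "x \<in> X N - star N Q"
    then have xg: "x \<in> group" using X_group by blast
    show "\<exists>A B'. \<forall>y\<in>Q. norm (of_nat (m N) * K N n x y - (A + B' * w ^ y k)) \<le>
        (if \<forall>i<k. x i = x0 i then 224 * (nu N Q / (gdist x0 x)\<^sup>2) else 0)"
    proof (cases "\<forall>i<k. x i = x0 i")
      case False
      then have ne: "x \<noteq> x0" by auto
      let ?k' = "first_diff x x0"
      have k': "?k' < k" using False eq_below_first_diff[of _ x x0] by (meson less_le_trans not_le)
      have "of_nat (m N) * K N n x y = of_nat (m N) * K N n x x0" if y: "y \<in> Q" for y
      proof -
        have yx: "y i = x0 i" if "i \<le> ?k'" for i using Qm(2)[OF y] k' that by simp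
        have "x ?k' \<noteq> y ?k'" using first_diff[OF ne] yx by simp
        moreover have "x i = y i" if "i < ?k'" for i using eq_below_first_diff[OF that] yx[of i] that by simp
        ultimately show ?thesis
          using K_formula[where k="?k'" and x=x and y=y and N=N and n=n] K_formula[where k="?k'" and x=x and y=x0 and N=N and n=n]
            first_diff[OF ne] eq_below_first_diff[of _ x x0] xg Qm(1)[OF y] X_group[OF x0] yx[of ?k'] by simp
      qed
      then show ?thesis using False by (rule_tac exI[of _ "of_nat (m N) * K N n x x0"], rule_tac exI[of _ 0]) auto
    next
      case True
      define u where "u = unit_root (p k) (x k)"
      define v where "v c = unit_root (p k) c" for c
      define v0 where "v0 = v (x0 k)"
      define s where "s = complex_of_nat (n mod m k)"
      have un: "norm u = 1" "norm (v c) = 1" for c by (simp_all add: u_def v_def)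
      have fd: "first_diff y x = k" "y \<noteq> x" "x k \<noteq> y k" if y: "y \<in> Q" for y
      proof -
        have yX: "y \<in> X N" and eq: "B N j k l y = Q" using y Q B_subset B_cong by blast+
        have xs: "x \<in> X N - star N (B N j k l y)" using x eq by simp
        have lo: "x i = y i" if "i < k" for i using True Qm(2)[OF y that] that by simp
        show "first_diff y x = k" "y \<noteq> x" "x k \<noteq> y k"
          by (rule first_diff_off_star[OF assms(1) yX xs], erule lo)+
      qed
      have Kf: "of_nat (m N) * K N n x y = s + of_nat (m k) * (v (y k) / (u - v (y k)) * (1 - cnj u ^ a * v (y k) ^ a))"
        if y: "y \<in> Q" for y
        unfolding u_def v_def s_def a_def
        by (rule K_formula) (use fd[OF y] True Qm[OF y] xg in auto)
      have ch: "norm (u - v (y k)) = m k * gdist y x" if y: "y \<in> Q" for y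
        using fd[OF y] by (simp add: gdist_def u_def v_def chord_def norm_minus_commute)
      have chy: "norm (v (y k) - v0) \<le> m k * gdist x0 y" if y: "y \<in> Q" for y
      proof (cases "y k = x0 k")
        case True
        then show ?thesis using gdist_nonneg by (simp add: v0_def)
      next
        case False
        then have "first_diff x0 y = k" using Qm(2)[OF y] by (intro first_diff_eqI) auto
        then show ?thesis using False by (auto simp: gdist_def v_def v0_def chord_def norm_minus_commute)
      qed
      define A where "A = s + of_nat (m k) * (v0 / (u - v0))"
      define B' where "B' = - of_nat (m k) * (v0 / (u - v0)) * cnj u ^ a"
      have "norm (of_nat (m N) * K N n x y - (A + B' * w ^ y k)) \<le> 224 * (nu N Q / (gdist x0 x)\<^sup>2)" if y: "y \<in> Q" for y
      proof -
        define G where "G = 1 - cnj u ^ a * v (y k) ^ a"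
        have Gn: "norm G \<le> 2"
        proof -
          have "norm G \<le> 1 + 1" unfolding G_def
            by (rule order_trans[OF norm_triangle_ineq4]) (simp add: norm_mult norm_power un)
          then show ?thesis by simp
        qed
        have far: "3 * nu N Q \<le> gdist y x" "3 * nu N Q \<le> gdist x0 x"
          using gdist_off_star[OF QD x] y x0Q by auto
        have pos: "0 < gdist y x" "0 < gdist x0 x" using far nQ by auto
        have ne: "u - v (y k) \<noteq> 0" "u - v0 \<noteq> 0"
          using ch[OF y] ch[OF x0Q] pos m_pos[of k] unfolding v0_def by (metis mult_pos_pos norm_zero of_nat_0_less_iff less_irrefl)+
        have "w ^ y k = v (y k) ^ a" by (simp add: v_def wpow)
        then have "of_nat (m N) * K N n x y - (A + B' * w ^ y k) =
            of_nat (m k) * (v (y k) / (u - v (y k)) * G) - of_nat (m k) * (v0 / (u - v0) * G)"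
          unfolding Kf[OF y] A_def B'_def G_def by (simp add: algebra_simps)
        also have "\<dots> = of_nat (m k) * G * (u * (v (y k) - v0) / ((u - v (y k)) * (u - v0)))"
        proof -
          have "v (y k) / (u - v (y k)) - v0 / (u - v0) = u * (v (y k) - v0) / ((u - v (y k)) * (u - v0))"
            using ne by (simp add: diff_frac_eq algebra_simps)
          moreover have "c * (a * G) - c * (b * G) = c * G * (a - b)" for a b c :: complex by (simp add: algebra_simps)
          ultimately show ?thesis by (simp only:)
        qed
        also have "norm \<dots> = m k * norm G * (norm (v (y k) - v0) / (norm (u - v (y k)) * norm (u - v0)))"
          by (simp add: norm_mult norm_divide un)
        also have "\<dots> = m k * norm G * (norm (v (y k) - v0) / ((m k * gdist y x) * (m k * gdist x0 x)))"
          using ch[OF y] ch[OF x0Q] by (simp add: v0_def)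
        \<comment> \<open>\<open>224 = 2 * 16 * 7\<close>: the bound 2 for \<open>G\<close>, the
          diameter \<open>16 * nu N Q\<close>, and
          \<open>gdist x0 x \<le> (16 / 3 + 1) * gdist y x\<close> rounded to 7.\<close>
        also have "\<dots> \<le> m k * 2 * ((m k * (16 * nu N Q)) / ((m k * (gdist x0 x / 7)) * (m k * gdist x0 x)))"
        proof -
          have g: "gdist x0 y \<le> 16 * nu N Q"
          proof -
            have "gdist x0 y \<le> 4 * pi * nu N Q" by (rule gdist_in_D[OF QD x0Q y])
            also have "\<dots> \<le> 16 * nu N Q" using pi_less_4 nQ by (intro mult_right_mono) auto
            finally show ?thesis .
          qed
          have "gdist x0 x \<le> gdist x0 y + gdist y x"
            using gdist_triangle[OF _ _ xg] Qm(1) x0Q y by blast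
          then have "gdist x0 x / 7 \<le> gdist y x" using far g by simp
          moreover have "norm (v (y k) - v0) \<le> m k * (16 * nu N Q)"
            by (rule order_trans[OF chy[OF y]]) (use g in \<open>intro mult_left_mono\<close>, auto)
          ultimately show ?thesis using Gn pos nQ
            by (intro mult_mono frac_le) (auto intro!: mult_left_mono mult_right_mono)
        qed
        also have "\<dots> = 224 * (nu N Q / (gdist x0 x)\<^sup>2)"
          using pos m_pos[of k] by (simp add: power2_eq_square field_simps)
        finally show ?thesis .
      qed
      then show ?thesis using True by auto
    qed
  qed
qed

definition off_star_bound :: "nat \<Rightarrow> nat \<Rightarrow> (nat \<Rightarrow> nat) set \<Rightarrow> (nat \<Rightarrow> nat) \<Rightarrow> (nat \<Rightarrow> nat) \<Rightarrow> real" where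
  "off_star_bound N k Q x0 x = (if \<forall>i<k. x i = x0 i then 224 * (nu N Q / (gdist x0 x)\<^sup>2) else 0)"

lemma off_star_bound_nonneg: "Q \<in> D N j \<Longrightarrow> 0 \<le> off_star_bound N k Q x0 x"
  using nu_pos[of Q N j] by (auto simp: off_star_bound_def)

lemma sum_off_star_bound:
  assumes N: "0 < N" and s: "(k, l) \<in> scales N" and x0: "x0 \<in> X N" and Q: "Q = B N j k l x0"
    and f: "\<And>x. x \<in> X N \<Longrightarrow> 0 \<le> f x"
  shows "(\<Sum>x\<in>X N - star N Q. f x * off_star_bound N k Q x0 x) \<le> 774144 * m N * Mf N f x0"
proof -
  have "(\<Sum>x\<in>X N - star N Q. f x * off_star_bound N k Q x0 x)
      = (\<Sum>x\<in>{x\<in>X N - star N Q. \<forall>i<k. x i = x0 i}. 224 * (f x * (nu N Q / (gdist x0 x)\<^sup>2)))"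
    unfolding off_star_bound_def by (rule sum.mono_neutral_cong_right) auto
  also have "\<dots> = 224 * (\<Sum>x\<in>{x\<in>X N - star N Q. \<forall>i<k. x i = x0 i}. f x * (nu N Q / (gdist x0 x)\<^sup>2))"
    by (rule sum_distrib_left[symmetric])
  also have "\<dots> \<le> 224 * (3456 * m N * Mf N f x0)"
    using tail_sum[OF N s x0 Q f] by (intro mult_left_mono) auto
  finally show ?thesis by simp
qed

text \<open>\<open>\<rho>\<close> spreads the one-dimensional reproducing kernel evenly over the
  fibers, hence the factor \<open>c / card Q\<close>. It is exact on the two-frequency part; of the
  error there remain one copy from \<open>y\<close> and 24 from the sum over \<open>z\<close>, and
  \<open>25 * 774144 = 19353600\<close>.\<close>

lemma K_cancellation:
  assumes N: "0 < N" and QD: "Q \<in> D N False"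
  shows "\<exists>\<rho>. (\<forall>y\<in>Q. \<forall>z\<in>Q. norm (\<rho> y z) * card Q \<le> 24) \<and>
    (\<forall>y\<in>Q. (\<Sum>x\<in>X N - star N Q. norm (K N n x y - (\<Sum>z\<in>Q. K N n x z * \<rho> y z))) \<le> 19353600)"
proof -
  obtain x0 where x0Q: "x0 \<in> Q" using D_nonempty[OF QD] by blast
  obtain k l where s: "(k, l) \<in> scales N" and Q: "Q = B N False k l x0" using D_E[OF QD] x0Q by metis
  have x0: "x0 \<in> X N" using x0Q D_subset[OF QD] by blast
  define C where "C = coords False k l x0"
  obtain u c where C: "C = {u..<u + c}" using coords_interval[OF X_group[OF x0]] unfolding C_def by blast
  have cC: "card C = c" by (simp add: C)
  have yC: "y k \<in> {u..<u + c}" if "y \<in> Q" for y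
    using B_coord that unfolding Q C[symmetric] C_def by blast
  have c0: "0 < c" using yC[OF x0Q] by auto
  have q0: "0 < card Q" using x0Q D_finite[OF QD] by (auto simp: card_gt_0_iff)
  have P0: "0 < real (m N)" by simp
  obtain w where w: "norm w = 1" and ex: "\<forall>x\<in>X N - star N Q. \<exists>A B'. \<forall>y\<in>Q.
      norm (of_nat (m N) * K N n x y - (A + B' * w ^ y k)) \<le> off_star_bound N k Q x0 x"
    using K_near_exponential[OF s x0 Q, of n] unfolding off_star_bound_def by blast
  have "\<forall>y\<in>Q. \<exists>r. (\<forall>z. norm (r z :: complex) * real c \<le> 24) \<and>
      (\<forall>A B. (\<Sum>z\<in>{u..<u + c}. r z * (A + B * w ^ z)) = A + B * w ^ y k)"
    using two_frequency_reproducing[OF w] yC by blast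
  from bchoice[OF this] obtain r :: "(nat \<Rightarrow> nat) \<Rightarrow> nat \<Rightarrow> complex" where
    r: "\<forall>y\<in>Q. (\<forall>z. norm (r y z) * real c \<le> 24) \<and>
      (\<forall>A B. (\<Sum>z\<in>{u..<u + c}. r y z * (A + B * w ^ z)) = A + B * w ^ y k)" ..
  define \<rho> where "\<rho> y z = r y (z k) * c / card Q" for y z :: "nat \<Rightarrow> nat"
  have \<rho>: "norm (\<rho> y z) * card Q \<le> 24" if "y \<in> Q" for y z
    using r[rule_format, OF that] q0 by (simp add: \<rho>_def norm_mult norm_divide)
  show ?thesis
  proof (intro exI[of _ \<rho>] conjI ballI)
    fix y assume y: "y \<in> Q"
    have pt: "norm (K N n x y - (\<Sum>z\<in>Q. K N n x z * \<rho> y z)) \<le> 25 / m N * off_star_bound N k Q x0 x"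
      if x: "x \<in> X N - star N Q" for x
    proof -
      obtain A B' where AB: "\<And>y. y \<in> Q \<Longrightarrow>
          norm (of_nat (m N) * K N n x y - (A + B' * w ^ y k)) \<le> off_star_bound N k Q x0 x"
        using ex[rule_format, OF x] by blast
      define e where "e y = of_nat (m N) * K N n x y - (A + B' * w ^ y k)" for y
      have e: "norm (e y) \<le> off_star_bound N k Q x0 x" if "y \<in> Q" for y using AB[OF that] by (simp add: e_def)
      have Ke: "of_nat (m N) * K N n x y = (A + B' * w ^ y k) + e y" for y by (simp add: e_def)
      have rep: "(\<Sum>z\<in>Q. (A + B' * w ^ z k) * \<rho> y z) = A + B' * w ^ y k"
      proof -
        have "of_nat c * (\<Sum>z\<in>Q. r y (z k) * (A + B' * w ^ z k)) = of_nat (card Q) * (\<Sum>z\<in>{u..<u + c}. r y z * (A + B' * w ^ z))"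
          using sum_B_coord[OF s x0, of False "\<lambda>a. r y a * (A + B' * w ^ a)"] by (simp add: Q[symmetric] C_def[symmetric] cC C[symmetric])
        also have "(\<Sum>z\<in>{u..<u + c}. r y z * (A + B' * w ^ z)) = A + B' * w ^ y k" using r y by blast
        finally have "of_nat c * (\<Sum>z\<in>Q. r y (z k) * (A + B' * w ^ z k)) / of_nat (card Q) = A + B' * w ^ y k"
          using q0 by simp
        then show ?thesis by (simp add: \<rho>_def sum_distrib_left sum_divide_distrib mult_ac)
      qed
      have "of_nat (m N) * (K N n x y - (\<Sum>z\<in>Q. K N n x z * \<rho> y z))
          = of_nat (m N) * K N n x y - (\<Sum>z\<in>Q. of_nat (m N) * K N n x z * \<rho> y z)"
        by (simp add: right_diff_distrib sum_distrib_left mult_ac)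
      also have "\<dots> = e y - (\<Sum>z\<in>Q. e z * \<rho> y z)"
        unfolding Ke using rep by (simp add: distrib_right sum.distrib)
      finally have eq: "of_nat (m N) * (K N n x y - (\<Sum>z\<in>Q. K N n x z * \<rho> y z)) = e y - (\<Sum>z\<in>Q. e z * \<rho> y z)" .
      have "norm (\<Sum>z\<in>Q. e z * \<rho> y z) \<le> (\<Sum>z\<in>Q. off_star_bound N k Q x0 x * (24 / card Q))"
      proof (rule sum_norm_le)
        fix z assume z: "z \<in> Q"
        show "norm (e z * \<rho> y z) \<le> off_star_bound N k Q x0 x * (24 / card Q)"
          unfolding norm_mult using e[OF z] \<rho>[OF y, of z] q0 off_star_bound_nonneg[OF QD]
          by (intro mult_mono) (auto simp: field_simps)
      qed
      also have "\<dots> = 24 * off_star_bound N k Q x0 x" using q0 by simp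
      finally have "norm (e y - (\<Sum>z\<in>Q. e z * \<rho> y z)) \<le> 25 * off_star_bound N k Q x0 x"
        using e[OF y] norm_triangle_ineq4[of "e y" "\<Sum>z\<in>Q. e z * \<rho> y z"] by linarith
      then have "m N * norm (K N n x y - (\<Sum>z\<in>Q. K N n x z * \<rho> y z)) \<le> 25 * off_star_bound N k Q x0 x"
        unfolding eq[symmetric] norm_mult by simp
      then show ?thesis using P0 by (simp add: field_simps)
    qed
    have "(\<Sum>x\<in>X N - star N Q. norm (K N n x y - (\<Sum>z\<in>Q. K N n x z * \<rho> y z)))
        \<le> (\<Sum>x\<in>X N - star N Q. 25 / m N * off_star_bound N k Q x0 x)"
      by (intro sum_mono pt)
    also have "\<dots> = 25 / m N * (\<Sum>x\<in>X N - star N Q. 1 * off_star_bound N k Q x0 x)"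
      by (simp add: sum_distrib_left)
    also have "\<dots> \<le> 25 / m N * (774144 * m N * Mf N (\<lambda>_. 1) x0)"
      by (intro mult_left_mono sum_off_star_bound[OF N s x0 Q]) auto
    also have "\<dots> = 19353600" using P0 Mf_one[OF N x0] by simp
    finally show "(\<Sum>x\<in>X N - star N Q. norm (K N n x y - (\<Sum>z\<in>Q. K N n x z * \<rho> y z))) \<le> 19353600" .
  qed (rule \<rho>)
qed

text \<open>By \<open>cnj_K\<close> the approximation in the second variable also holds in the
  first, so on \<open>Q\<close> the far part is within \<open>774144 * t\<close> of a function
  \<open>a + b * cnj w ^ x k\<close>. Equal fibers carry the sixteenth over to the arc, and
  \<open>two_frequency_remez\<close> gives \<open>3 * 774145 + 774144 < 4000000\<close>.\<close>

lemma K_far_part_remez: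
  assumes N: "0 < N" and QD: "Q \<in> D N False" and x0Q: "x0 \<in> Q" and E: "E \<subseteq> Q" "16 * card (Q - E) \<le> card Q"
    and t: "Mf N (\<lambda>x. norm (f x)) x0 \<le> t"
    and le: "\<And>x. x \<in> E \<Longrightarrow> norm (\<Sum>y\<in>X N - star N Q. K N n x y * f y) \<le> t" and x: "x \<in> Q"
  shows "norm (\<Sum>y\<in>X N - star N Q. K N n x y * f y) \<le> 4000000 * t"
proof -
  obtain k l where s: "(k, l) \<in> scales N" and Q: "Q = B N False k l x0" using D_E[OF QD] x0Q by metis
  have x0: "x0 \<in> X N" using x0Q D_subset[OF QD] by blast
  define C where "C = coords False k l x0"
  obtain u c where C: "C = {u..<u + c}" using coords_interval[OF X_group[OF x0]] unfolding C_def by blast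
  have cC: "card C = c" by (simp add: C)
  have yC: "y k \<in> {u..<u + c}" if "y \<in> Q" for y
    using B_coord that unfolding Q C[symmetric] C_def by blast
  have q0: "0 < card Q" using x0Q D_finite[OF QD] by (auto simp: card_gt_0_iff)
  have P0: "0 < real (m N)" by simp
  have t0: "0 \<le> t" using Mf_ge_0[OF N, of "\<lambda>x. norm (f x)" x0] t by simp
  obtain w where w: "norm w = 1" and ex: "\<forall>y\<in>X N - star N Q. \<exists>A B'. \<forall>x\<in>Q.
      norm (of_nat (m N) * K N n y x - (A + B' * w ^ x k)) \<le> off_star_bound N k Q x0 y"
    using K_near_exponential[OF s x0 Q, of n] unfolding off_star_bound_def by blast
  from bchoice[OF ex] obtain A where "\<forall>y\<in>X N - star N Q. \<exists>B'. \<forall>x\<in>Q.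
      norm (of_nat (m N) * K N n y x - (A y + B' * w ^ x k)) \<le> off_star_bound N k Q x0 y" ..
  from bchoice[OF this] obtain B' where AB: "\<forall>y\<in>X N - star N Q. \<forall>x\<in>Q.
      norm (of_nat (m N) * K N n y x - (A y + B' y * w ^ x k)) \<le> off_star_bound N k Q x0 y" ..
  define T where "T x = (\<Sum>y\<in>X N - star N Q. K N n x y * f y)" for x
  define a where "a = (\<Sum>y\<in>X N - star N Q. cnj (A y) * f y) / m N"
  define b where "b = (\<Sum>y\<in>X N - star N Q. cnj (B' y) * f y) / m N"
  define h where "h i = a + b * cnj w ^ i" for i :: nat
  have near: "norm (T x - h (x k)) \<le> 774144 * t" if x: "x \<in> Q" for x
  proof -
    have "h (x k) = (\<Sum>y\<in>X N - star N Q. cnj (A y) * f y / m N + cnj (B' y) * f y / m N * cnj w ^ x k)"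
      by (simp only: h_def a_def b_def sum_divide_distrib sum_distrib_right sum.distrib)
    then have "T x - h (x k) = (\<Sum>y\<in>X N - star N Q. (K N n x y - cnj (A y + B' y * w ^ x k) / m N) * f y)"
      by (simp only: T_def sum_subtractf[symmetric]) (intro sum.cong refl, simp add: algebra_simps add_divide_distrib)
    then have "norm (T x - h (x k)) = norm (\<Sum>y\<in>X N - star N Q. (K N n x y - cnj (A y + B' y * w ^ x k) / m N) * f y)"
      by (simp only:)
    also have "\<dots> \<le> (\<Sum>y\<in>X N - star N Q. norm (f y) * off_star_bound N k Q x0 y / m N)"
    proof (rule sum_norm_le)
      fix y assume y: "y \<in> X N - star N Q"
      have "K N n x y - cnj (A y + B' y * w ^ x k) / m N = cnj (of_nat (m N) * K N n y x - (A y + B' y * w ^ x k)) / m N"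
        using P0 by (simp add: cnj_K diff_divide_distrib)
      then have "norm (K N n x y - cnj (A y + B' y * w ^ x k) / m N) \<le> off_star_bound N k Q x0 y / m N"
        using AB[rule_format, OF y x] by (simp only: norm_divide complex_mod_cnj norm_of_nat) (simp add: divide_right_mono)
      from mult_left_mono[OF this norm_ge_zero[of "f y"]]
      show "norm ((K N n x y - cnj (A y + B' y * w ^ x k) / m N) * f y) \<le> norm (f y) * off_star_bound N k Q x0 y / m N"
        by (simp add: norm_mult mult.commute)
    qed
    also have "\<dots> = (\<Sum>y\<in>X N - star N Q. norm (f y) * off_star_bound N k Q x0 y) / m N"
      by (rule sum_divide_distrib[symmetric])
    also have "\<dots> \<le> 774144 * m N * Mf N (\<lambda>x. norm (f x)) x0 / m N"
      by (intro divide_right_mono sum_off_star_bound[OF N s x0 Q]) auto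
    also have "\<dots> = 774144 * Mf N (\<lambda>x. norm (f x)) x0" using P0 by simp
    also have "\<dots> \<le> 774144 * t" using t by simp
    finally show ?thesis .
  qed
  define E' where "E' = (\<lambda>x. x k) ` E"
  have E'C: "E' \<subseteq> {u..<u + c}" using yC E by (auto simp: E'_def)
  have "card ({u..<u + c} - E') * card Q \<le> card (Q - E) * c"
  proof -
    let ?R = "{u..<u + c} - E'"
    have finQ: "finite Q" by (rule D_finite[OF QD])
    have fib: "card {z\<in>Q. z k = i} * c = card Q" if "i \<in> ?R" for i
      using card_B_fiber[OF s x0, of i False] that by (simp add: Q[symmetric] C_def[symmetric] cC C)
    have "(\<Sum>i\<in>?R. card {z\<in>Q. z k = i}) = card (\<Union>i\<in>?R. {z\<in>Q. z k = i})"
      using finQ by (intro card_UN_disjoint[symmetric]) auto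
    also have "\<dots> \<le> card (Q - E)" using finQ by (intro card_mono) (auto simp: E'_def)
    finally have "(\<Sum>i\<in>?R. card {z\<in>Q. z k = i}) * c \<le> card (Q - E) * c" by simp
    then show ?thesis unfolding sum_distrib_right using fib by simp
  qed
  then have "16 * (card ({u..<u + c} - E') * card Q) \<le> 16 * card (Q - E) * c" by simp
  also have "\<dots> \<le> card Q * c" using E(2) by (intro mult_right_mono) auto
  finally have small: "16 * card ({u..<u + c} - E') \<le> c" using q0 by (simp add: mult.assoc[symmetric] mult.commute[of _ "card Q"])
  have leE: "norm (h i) \<le> 774145 * t" if i: "i \<in> E'" for i
  proof -
    obtain z where z: "z \<in> E" "i = z k" using i by (auto simp: E'_def)
    have "norm (h i) \<le> norm (T z) + norm (T z - h i)" using norm_triangle_ineq4[of "T z" "T z - h i"] by simp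
    then show ?thesis using near[of z] le[OF z(1)] z E by (auto simp: T_def)
  qed
  have "norm (h (x k)) \<le> 3 * (774145 * t)"
    by (rule two_frequency_remez[OF h_def _ E'C small leE yC[OF x]]) (simp_all add: w)
  then have "norm (T x) \<le> 4000000 * t"
    using near[OF x] norm_triangle_sub[of "T x" "h (x k)"] t0 by linarith
  then show ?thesis by (simp add: T_def)
qed

text \<open>The recursion runs on the unshifted tree, whose arcs are intervals of residues as the
  two-frequency lemmas require; arcs of the shifted tree may wrap around 0, and that tree enters
  through \<open>Mf\<close> only. The constant is \<open>19353600\<close> rounded up.\<close>

lemma cz_space_K:
  assumes N: "0 < N" and n: "n \<le> m N"
  shows "cz_space (X N) (D N False) (star N) (K N n) (Mf N) 20000000"
proof
  fix Q assume Q: "Q \<in> D N False"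
  show "real (card (star N Q)) \<le> 20000000 * real (card Q)"
  proof -
    obtain x0 where x0: "x0 \<in> Q" using D_nonempty[OF Q] by blast
    then have "x0 \<in> X N" using D_subset[OF Q] by blast
    then show ?thesis using M_star[OF N _ Q x0, of "\<lambda>_. 1"] Mf_one[OF N] by simp
  qed
  obtain \<rho> where \<rho>: "\<forall>y\<in>Q. \<forall>z\<in>Q. norm (\<rho> y z) * card Q \<le> 24"
      "\<forall>y\<in>Q. (\<Sum>x\<in>X N - star N Q. norm (K N n x y - (\<Sum>z\<in>Q. K N n x z * \<rho> y z))) \<le> 19353600"
    using K_cancellation[OF N Q, of n] by blast
  show "\<exists>\<rho>. (\<forall>y\<in>Q. \<forall>z\<in>Q. norm (\<rho> y z) * card Q \<le> 20000000) \<and>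
      (\<forall>y\<in>Q. (\<Sum>x\<in>X N - star N Q. norm (K N n x y - (\<Sum>z\<in>Q. K N n x z * \<rho> y z))) \<le> 20000000)"
  proof (intro exI[of _ \<rho>] conjI ballI)
    show "norm (\<rho> y z) * real (card Q) \<le> 20000000" if "y \<in> Q" "z \<in> Q" for y z
      using \<rho>(1)[rule_format, OF that] by simp
    show "(\<Sum>x\<in>X N - star N Q. norm (K N n x y - (\<Sum>z\<in>Q. K N n x z * \<rho> y z))) \<le> 20000000" if "y \<in> Q" for y
      using \<rho>(2)[rule_format, OF that] by simp
  qed
next
  fix Q x y assume Q: "Q \<in> D N False" and x: "x \<in> Q" and y: "y \<in> X N - star N Q"
  have far: "3 * nu N Q \<le> gdist x y" by (rule gdist_off_star[OF Q y x])
  have pos: "0 < nu N Q" by (rule nu_pos[OF Q])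
  have "x \<noteq> y" using far pos by (auto simp: gdist_def)
  then have "norm (K N n x y) * gdist x y * m N \<le> 4"
    using x y D_subset[OF Q] X_group by (intro norm_K_le) auto
  moreover have "norm (K N n x y) * (3 * nu N Q) * m N \<le> norm (K N n x y) * gdist x y * m N"
    using far by (intro mult_right_mono mult_left_mono) auto
  ultimately show "norm (K N n x y) * real (card Q) \<le> 20000000" by (simp add: nu_def)
next
  fix f Q x assume f: "\<And>x. x \<in> X N \<Longrightarrow> 0 \<le> (f x :: real)" and Q: "Q \<in> D N False" and x: "x \<in> Q"
  have "229 * real (card Q) * Mf N f x \<le> 20000000 * real (card Q) * Mf N f x"
    using Mf_ge_0[OF N, of f x] f by (intro mult_right_mono) auto
  then show "sum f (star N Q) \<le> 20000000 * real (card Q) * Mf N f x" using M_star[OF N _ Q x, of f] f by simp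
next
  fix f t assume f: "\<And>x. x \<in> X N \<Longrightarrow> 0 \<le> (f x :: real)" and t: "0 < (t::real)"
  have "0 \<le> sum f (X N)" using f by (rule sum_nonneg)
  then show "real (card {x\<in>X N. t < Mf N f x}) * t \<le> 20000000 * sum f (X N)"
    using Mf_weak[OF N _ t, of f] f by fastforce
next
  fix Q x0 f E and t :: real
  assume "Q \<in> D N False" "x0 \<in> Q" "E \<subseteq> Q" "16 * card (Q - E) \<le> card Q"
    and t: "Mf N (\<lambda>x. norm (f x)) x0 \<le> t"
    and "\<And>x. x \<in> E \<Longrightarrow> norm (\<Sum>y\<in>X N - star N Q. K N n x y * f y) \<le> t"
  note * = K_far_part_remez[OF N this]
  have "0 \<le> t" using Mf_ge_0[OF N, of "\<lambda>x. norm (f x)" x0] t by simp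
  then show "\<forall>x\<in>Q. norm (\<Sum>y\<in>X N - star N Q. K N n x y * f y) \<le> 20000000 * t"
    using * by (intro ballI order_trans[OF *]) auto
qed (use N D_subset D_nonempty X_in_D singleton_in_D laminar_D parent_D star_superset star_subset star_mono K_L2[OF n] Mf_mono in \<open>simp_all\<close>)

lemma partial_sum_form_bound:
  assumes N: "0 < N" and n: "n \<le> m N"
  shows "norm (\<Sum>x\<in>X N. (\<Sum>y\<in>X N. Dir n x y * f y) * g x) \<le>
    cz_space.form_const 20000000 * m N * (\<Sum>x\<in>X N. Mf N (\<lambda>x. norm (f x)) x * Mf N (\<lambda>x. norm (g x)) x)"
proof -
  interpret cz_space "X N" "D N False" "star N" "K N n" "Mf N" 20000000 by (rule cz_space_K[OF N n])
  define f' where "f' y = cnj (\<psi> n y) * f y" for y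
  define g' where "g' x = \<psi> n x * g x" for x
  have fg: "norm (f' x) = norm (f x)" "norm (g' x) = norm (g x)" for x by (simp_all add: f'_def g'_def norm_mult)
  have "of_nat (m N) * (\<Sum>x\<in>X N. (\<Sum>y\<in>X N. K N n x y * f' y) * g' x) = (\<Sum>x\<in>X N. (\<Sum>y\<in>X N. Dir n x y * f y) * g x)"
  proof -
    have "of_nat (m N) * (K N n x y * f' y * g' x) = Dir n x y * f y * g x" for x y
    proof -
      have "of_nat (m N) * (K N n x y * f' y * g' x) =
          (of_nat (m N) / of_nat (m N)) * (cnj (\<psi> n x) * \<psi> n x) * (cnj (\<psi> n y) * \<psi> n y) * (Dir n x y * f y * g x)"
        by (simp only: K_def f'_def g'_def times_divide_eq_left times_divide_eq_right mult_ac)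
      then show ?thesis using m_pos[of N] by simp
    qed
    then show ?thesis by (simp add: sum_distrib_left sum_distrib_right)
  qed
  then have "norm (\<Sum>x\<in>X N. (\<Sum>y\<in>X N. Dir n x y * f y) * g x) = norm (of_nat (m N) * (\<Sum>x\<in>X N. (\<Sum>y\<in>X N. K N n x y * f' y) * g' x))"
    by (simp only:)
  also have "\<dots> = m N * norm (\<Sum>x\<in>X N. (\<Sum>y\<in>X N. K N n x y * f' y) * g' x)"
    by (simp only: norm_mult norm_of_nat)
  also have "\<dots> \<le> m N * (form_const * (\<Sum>x\<in>X N. Mf N (\<lambda>x. norm (f x)) x * Mf N (\<lambda>x. norm (g x)) x))"
    using form_bound[of f' g'] unfolding fg by (intro mult_left_mono) auto
  finally show ?thesis by (simp add: mult_ac)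
qed

section \<open>From the finite quotients to the group\<close>

abbreviation "haar \<equiv> vilenkin_measure p"

lemma space_haar: "space haar = group"
  using mem_vilenkin_group_iff[of _ p] by (auto simp: group_def)

lemma prob_space_haar: "prob_space haar"
  by (rule prob_space_vilenkin_measure, rule p_ge_2)

sublocale haar: prob_space haar by (rule prob_space_haar)

definition proj :: "nat \<Rightarrow> (nat \<Rightarrow> nat) \<Rightarrow> nat \<Rightarrow> nat" where
  "proj N x = (\<lambda>i. if i < N then x i else 0)"

lemma proj_X: "x \<in> group \<Longrightarrow> proj N x \<in> X N"
  by (auto simp: proj_def X_iff group_def)

lemma proj_id: "x \<in> X N \<Longrightarrow> proj N x = x"
  by (auto simp: proj_def X_iff not_less)

definition pre :: "nat \<Rightarrow> (nat \<Rightarrow> nat) set \<Rightarrow> (nat \<Rightarrow> nat) set" where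
  "pre N S = {x \<in> group. proj N x \<in> S}"

lemma pre_cyl:
  assumes y: "y \<in> X N"
  shows "pre N {y} \<in> sets haar" "measure haar (pre N {y}) = 1 / m N"
proof -
  let ?U = "\<lambda>i. uniform_count_measure {..<p i}"
  interpret product_prob_space ?U UNIV
    by (intro product_prob_spaceI prob_space_uniform_component p_ge_2)
  have "pre N {y} = prod_emb UNIV ?U {..<N} (\<Pi>\<^sub>E i\<in>{..<N}. {y i})"
    using y by (auto simp: pre_def prod_emb_def PiE_iff space_PiM space_uniform_count_measure group_def
      proj_def X_iff fun_eq_iff not_less)
  note eq = this
  have yU: "{y i} \<in> sets (?U i)" for i
    using y by (auto simp: sets_uniform_count_measure X_iff group_def)
  show "pre N {y} \<in> sets haar"
    unfolding eq vilenkin_measure_def using yU by (intro sets_PiM_I) auto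
  have "emeasure haar (pre N {y}) = (\<Prod>i<N. emeasure (?U i) {y i})"
    unfolding eq vilenkin_measure_def using yU by (intro emeasure_PiM_emb) auto
  also have "\<dots> = (\<Prod>i<N. ennreal (1 / p i))"
    using y by (intro prod.cong refl, subst emeasure_uniform_count_measure) (auto simp: X_iff group_def ennreal_of_nat_eq_real_of_nat)
  also have "\<dots> = ennreal (\<Prod>i<N. 1 / p i)" by (simp add: prod_ennreal)
  also have "(\<Prod>i<N. 1 / real (p i)) = 1 / m N"
    by (simp add: m_def vilenkin_m_def prod_dividef)
  finally show "measure haar (pre N {y}) = 1 / m N" by (simp add: measure_def)
qed

lemma sum_indicator_pre:
  fixes h :: "(nat \<Rightarrow> nat) \<Rightarrow> 'b::real_vector"
  assumes "x \<in> group"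
  shows "h (proj N x) = (\<Sum>y\<in>X N. indicat_real (pre N {y}) x *\<^sub>R h y)"
proof -
  have "(\<Sum>y\<in>X N. indicat_real (pre N {y}) x *\<^sub>R h y) = (\<Sum>y\<in>X N. if y = proj N x then h y else 0)"
    using assms by (intro sum.cong refl) (auto simp: pre_def indicator_def)
  then show ?thesis using proj_X[OF assms] by simp
qed

lemma measurable_cyl:
  fixes h :: "(nat \<Rightarrow> nat) \<Rightarrow> 'b::{second_countable_topology, real_normed_vector}"
  shows "(\<lambda>x. h (proj N x)) \<in> borel_measurable haar"
proof -
  have "(\<lambda>x. \<Sum>y\<in>X N. indicat_real (pre N {y}) x *\<^sub>R h y) \<in> borel_measurable haar"
    using pre_cyl(1) by (intro borel_measurable_sum borel_measurable_scaleR borel_measurable_indicator) auto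
  moreover have "h (proj N x) = (\<Sum>y\<in>X N. indicat_real (pre N {y}) x *\<^sub>R h y)" if "x \<in> space haar" for x
    using that unfolding space_haar by (rule sum_indicator_pre)
  ultimately show ?thesis by (subst measurable_cong) auto
qed

lemma integral_mult_cyl:
  fixes h f :: "(nat \<Rightarrow> nat) \<Rightarrow> 'b::{second_countable_topology, real_normed_algebra, banach}"
  assumes "integrable haar f"
  shows "(LINT x|haar. f x * h (proj N x)) = (\<Sum>y\<in>X N. (LINT x|haar. indicat_real (pre N {y}) x *\<^sub>R f x) * h y)"
    "integrable haar (\<lambda>x. f x * h (proj N x))"
proof -
  have i: "integrable haar (\<lambda>x. (indicat_real (pre N {y}) x *\<^sub>R f x) * h y)" if "y \<in> X N" for y
    using pre_cyl(1)[OF that] assms by (intro integrable_mult_left integrable_mult_indicator) auto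
  have eq: "f x * h (proj N x) = (\<Sum>y\<in>X N. (indicat_real (pre N {y}) x *\<^sub>R f x) * h y)" if "x \<in> space haar" for x
    using that unfolding space_haar by (subst sum_indicator_pre) (auto simp: sum_distrib_left)
  have "(LINT x|haar. f x * h (proj N x)) = (LINT x|haar. (\<Sum>y\<in>X N. (indicat_real (pre N {y}) x *\<^sub>R f x) * h y))"
    by (intro Bochner_Integration.integral_cong refl eq)
  also have "\<dots> = (\<Sum>y\<in>X N. LINT x|haar. (indicat_real (pre N {y}) x *\<^sub>R f x) * h y)"
    by (rule Bochner_Integration.integral_sum, rule i)
  also have "\<dots> = (\<Sum>y\<in>X N. (LINT x|haar. indicat_real (pre N {y}) x *\<^sub>R f x) * h y)"
    using pre_cyl(1) assms by (intro sum.cong refl Bochner_Integration.integral_mult_left integrable_mult_indicator) auto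
  finally show "(LINT x|haar. f x * h (proj N x)) = (\<Sum>y\<in>X N. (LINT x|haar. indicat_real (pre N {y}) x *\<^sub>R f x) * h y)" .
  have "integrable haar (\<lambda>x. \<Sum>y\<in>X N. (indicat_real (pre N {y}) x *\<^sub>R f x) * h y)"
    by (intro Bochner_Integration.integrable_sum i)
  then show "integrable haar (\<lambda>x. f x * h (proj N x))"
    by (rule Bochner_Integration.integrable_cong[THEN iffD1, rotated -1]) (simp_all add: eq)
qed

lemma integral_cyl:
  fixes h :: "(nat \<Rightarrow> nat) \<Rightarrow> 'b::{second_countable_topology, real_normed_algebra_1, banach}"
  shows "(LINT x|haar. h (proj N x)) = (\<Sum>y\<in>X N. h y) /\<^sub>R m N" "integrable haar (\<lambda>x. h (proj N x))"
proof -
  have "(LINT x|haar. indicat_real (pre N {y}) x *\<^sub>R (1::'b)) = (1 / m N) *\<^sub>R 1" if "y \<in> X N" for y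
    using pre_cyl[OF that] by (subst integral_scaleR_left) (auto intro!: integrable_real_indicator simp: haar.emeasure_eq_measure)
  then show "(LINT x|haar. h (proj N x)) = (\<Sum>y\<in>X N. h y) /\<^sub>R m N"
    using integral_mult_cyl(1)[of "\<lambda>_. 1" h N] by (simp add: scaleR_sum_right divide_inverse)
  show "integrable haar (\<lambda>x. h (proj N x))" using integral_mult_cyl(2)[of "\<lambda>_. 1" h N] by simp
qed

lemma pre_sets: "S \<subseteq> X N \<Longrightarrow> pre N S \<in> sets haar"
proof -
  assume S: "S \<subseteq> X N"
  have "pre N S = (\<Union>y\<in>S. pre N {y})" by (auto simp: pre_def)
  then show ?thesis using S finite_subset[OF S] pre_cyl(1) by (auto intro!: sets.finite_UN)
qed

lemma ih_pre:
  assumes "integrable haar f" "S \<subseteq> X N"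
  shows "haar.ih f (pre N S) = (\<Sum>y\<in>S. haar.ih f (pre N {y}))"
proof -
  have "haar.ih f (pre N S) = haar.ih f (\<Union>((\<lambda>y. pre N {y}) ` S))"
    by (rule arg_cong[where f="haar.ih f"]) (auto simp: pre_def)
  also have "\<dots> = (\<Sum>A\<in>(\<lambda>y. pre N {y}) ` S. haar.ih f A)"
    using assms finite_subset[OF assms(2)] pre_cyl(1) by (intro haar.ih_Union) (auto simp: pre_def)
  also have "\<dots> = (\<Sum>y\<in>S. haar.ih f (pre N {y}))"
  proof (rule sum.reindex_cong[OF _ refl refl], rule inj_onI)
    fix y z assume "y \<in> S" "z \<in> S" and eq: "pre N {y} = pre N {z}"
    have "y \<in> pre N {y}" using assms(2) proj_id X_group \<open>y \<in> S\<close> by (auto simp: pre_def)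
    then have "y \<in> pre N {z}" unfolding eq .
    then show "y = z" using \<open>y \<in> S\<close> assms(2) proj_id by (auto simp: pre_def)
  qed
  finally show ?thesis .
qed

lemma prob_pre: "S \<subseteq> X N \<Longrightarrow> measure haar (pre N S) = card S / m N"
proof -
  assume S: "S \<subseteq> X N"
  have "measure haar (pre N S) = haar.ih (\<lambda>_. 1) (pre N S)" using haar.ih_const[OF pre_sets[OF S], of 1] by simp
  also have "\<dots> = (\<Sum>y\<in>S. haar.ih (\<lambda>_. 1) (pre N {y}))" by (rule ih_pre[OF _ S]) simp
  also have "\<dots> = (\<Sum>y\<in>S. 1 / m N)"
    using S pre_cyl by (intro sum.cong refl) (subst haar.ih_const, auto)
  finally show ?thesis by simp
qed

lemma pre_X: "pre N (X N) = group" using proj_X by (auto simp: pre_def)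

lemma pre_mono: "S \<subseteq> S' \<Longrightarrow> pre N S \<subseteq> pre N S'" by (auto simp: pre_def)

lemma pre_strict_mono:
  assumes "S \<subset> S'" "S' \<subseteq> X N"
  shows "pre N S \<subset> pre N S'"
proof -
  obtain y where y: "y \<in> S'" "y \<notin> S" using assms by blast
  then have "y \<in> X N" using assms by blast
  then have "y \<in> pre N S'" "y \<notin> pre N S" using y proj_id X_group by (auto simp: pre_def)
  then show ?thesis using pre_mono[of S S' N] assms by blast
qed

lemma pre_B:
  assumes "k < N" "x \<in> group"
  shows "pre N (B N j k l x) = blk j k l x"
  using assms proj_X by (auto simp: pre_def B_def blk_def proj_def group_def)

definition cells :: "nat \<Rightarrow> bool \<Rightarrow> (nat \<Rightarrow> nat) set set" where "cells N j = pre N ` D N j"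

text \<open>The shift may carry an arc across 0, so in general only a cyclic interval results; the
  translations in the definition of generalized intervals allow for this.\<close>

lemma coords_cyclic:
  assumes x: "x \<in> group"
  shows "\<exists>v n. v < p k \<and> 1 \<le> n \<and> n \<le> p k \<and> coords j k l x = (\<lambda>t. (v + t) mod p k) ` {..<n}"
proof -
  define s where "s = arc_shift j (p k)"
  have s: "s < p k" using p_ge_2[of k] by (simp add: s_def arc_shift_def)
  define i where "i = arc j (p k) l (x k)"
  define J where "J = {c\<in>{..<p k}. (c * 2 ^ l) div p k = i}"
  obtain u n where J: "J = {u..<u + n}" using arc_unshift_interval[of "p k" l i] unfolding J_def by auto
  have iff: "b \<in> coords j k l x \<longleftrightarrow> b < p k \<and> (b + s) mod p k \<in> J" for b
    by (auto simp: coords_def J_def i_def arc_def s_def)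
  have "x k \<in> coords j k l x" using x by (simp add: coords_def group_def)
  then have "J \<noteq> {}" using iff by auto
  then have n: "1 \<le> n" by (simp add: J)
  have "u + n - 1 \<in> J" using n by (simp add: J)
  then have "u + n - 1 < p k" by (simp add: J_def)
  then have un: "u + n \<le> p k" using n by linarith
  define v where "v = (u + (p k - s)) mod p k"
  have vs: "(v + t + s) mod p k = (u + t) mod p k" for t
  proof -
    have "(v + t + s) mod p k = (u + (p k - s) + (t + s)) mod p k"
      unfolding v_def by (simp add: mod_add_left_eq add.assoc)
    also have "u + (p k - s) + (t + s) = (u + t) + p k" using s by simp
    finally show ?thesis by simp
  qed
  have "coords j k l x = (\<lambda>t. (v + t) mod p k) ` {..<n}"
  proof (intro equalityI subsetI)
    fix b assume "b \<in> coords j k l x"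
    then have b: "b < p k" "(b + s) mod p k \<in> J" using iff by auto
    define t where "t = (b + s) mod p k - u"
    have t: "t < n" "u + t = (b + s) mod p k" using b(2) by (auto simp: J t_def)
    have "(v + t) mod p k = (u + t + (p k - s)) mod p k"
      unfolding v_def by (simp add: mod_simps add_ac)
    also have "\<dots> = (b + s + (p k - s)) mod p k" unfolding t(2) by (simp add: mod_add_left_eq)
    also have "\<dots> = b" using s b(1) by simp
    finally show "b \<in> (\<lambda>t. (v + t) mod p k) ` {..<n}" using t(1) by (intro image_eqI[of _ _ t]) auto
  next
    fix b assume "b \<in> (\<lambda>t. (v + t) mod p k) ` {..<n}"
    then obtain t where t: "t < n" "b = (v + t) mod p k" by auto
    have "(b + s) mod p k = (v + t + s) mod p k" unfolding t(2) by (simp add: mod_add_left_eq)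
    also have "\<dots> = u + t" unfolding vs using t un by simp
    finally show "b \<in> coords j k l x" unfolding iff using t by (simp add: J)
  qed
  moreover have "v < p k" by (simp add: v_def)
  moreover have "n \<le> p k" using un by simp
  ultimately show ?thesis using n by blast
qed

lemma blk_gen_interval:
  assumes x: "x \<in> group"
  shows "blk j k l x \<in> gen_intervals p"
proof -
  obtain v n where v: "v < p k" and n: "1 \<le> n" "n \<le> p k" and C: "coords j k l x = (\<lambda>t. (v + t) mod p k) ` {..<n}"
    using coords_cyclic[OF x] by metis
  define x' where "x' i = (if i < k then x i else if i = k then v else 0)" for i
  have x': "x' \<in> group" using x v by (auto simp: x'_def group_def)
  have in_coords: "z k \<in> coords j k l x \<longleftrightarrow> arc j (p k) l (z k) = arc j (p k) l (x k)" if "z \<in> group" for z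
    using that by (auto simp: coords_def group_def)
  have "blk j k l x = vilenkin_add p x' ` {y \<in> group. (\<forall>i<k. y i = 0) \<and> y k < n}"
  proof (intro equalityI subsetI)
    fix z assume "z \<in> blk j k l x"
    then have z: "z \<in> group" "\<forall>i<k. z i = x i" "z k \<in> coords j k l x" using in_coords by (auto simp: blk_def)
    then obtain t where t: "t < n" "z k = (v + t) mod p k" unfolding C by auto
    define y where "y i = (if i < k then 0 else if i = k then t else z i)" for i
    have "z i = vilenkin_add p x' y i" for i
      using z t x by (auto simp: vilenkin_add_def x'_def y_def group_def)
    then have "z = vilenkin_add p x' y" by auto
    moreover have "y \<in> group" using z t n by (auto simp: y_def group_def)
    ultimately show "z \<in> vilenkin_add p x' ` {y \<in> group. (\<forall>i<k. y i = 0) \<and> y k < n}"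
      using t by (intro image_eqI[of _ _ y]) (auto simp: y_def)
  next
    fix z assume "z \<in> vilenkin_add p x' ` {y \<in> group. (\<forall>i<k. y i = 0) \<and> y k < n}"
    then obtain y where y: "y \<in> group" "\<forall>i<k. y i = 0" "y k < n" "z = vilenkin_add p x' y" by blast
    have zg: "z \<in> group" by (auto simp: y(4) vilenkin_add_def group_def)
    moreover have "z i = x i" if "i < k" for i
      using y x that by (simp add: vilenkin_add_def x'_def group_def)
    moreover have "z k \<in> coords j k l x"
      unfolding C using y by (intro image_eqI[of _ _ "y k"]) (auto simp: vilenkin_add_def x'_def)
    ultimately show "z \<in> blk j k l x" using in_coords[OF zg] by (auto simp: blk_def)
  qed
  then show ?thesis
    unfolding gen_intervals_def space_haar using x' n by blast
qed

lemma cells_gen_intervals: "cells N j \<subseteq> gen_intervals p"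
proof
  fix I assume "I \<in> cells N j"
  then obtain k l x where "(k, l) \<in> scales N" "x \<in> X N" "I = pre N (B N j k l x)" by (auto simp: cells_def D_def)
  then show "I \<in> gen_intervals p"
    using pre_B[of k N x j l] X_group blk_gen_interval by (auto simp: scales_def)
qed

lemma cells_mem: "I \<in> cells N j \<Longrightarrow> I \<in> sets haar \<and> 0 < measure haar I"
proof -
  assume "I \<in> cells N j"
  then obtain Q where Q: "Q \<in> D N j" "I = pre N Q" by (auto simp: cells_def)
  then show ?thesis
    using pre_sets[OF D_subset[OF Q(1)]] prob_pre[OF D_subset[OF Q(1)]] D_finite[OF Q(1)] D_nonempty[OF Q(1)]
    by (simp add: card_gt_0_iff)
qed

lemma cells_structure:
  assumes N: "0 < N"
  shows "finite (cells N j)" "laminar (cells N j)" "space haar \<in> cells N j"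
    "\<And>I. I \<in> cells N j \<Longrightarrow> I \<noteq> space haar \<Longrightarrow> \<exists>R\<in>cells N j. I \<subset> R \<and> measure haar R \<le> 8 * measure haar I"
proof -
  show "finite (cells N j)" by (simp add: cells_def)
  show "space haar \<in> cells N j" using X_in_D[OF N] pre_X by (auto simp: cells_def space_haar)
  show "laminar (cells N j)"
    unfolding laminar_def cells_def
  proof (intro ballI, elim imageE)
    fix I I' P Q assume PQ: "P \<in> D N j" "Q \<in> D N j" and I: "I = pre N P" "I' = pre N Q"
    have "P \<subseteq> Q \<or> Q \<subseteq> P \<or> P \<inter> Q = {}" using laminar_D PQ unfolding laminar_def by blast
    moreover have "pre N P \<inter> pre N Q = {}" if "P \<inter> Q = {}" using that by (auto simp: pre_def)
    ultimately show "I \<subseteq> I' \<or> I' \<subseteq> I \<or> I \<inter> I' = {}" unfolding I using pre_mono by metis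
  qed
  fix I assume "I \<in> cells N j" "I \<noteq> space haar"
  then obtain Q where Q: "Q \<in> D N j" "I = pre N Q" by (auto simp: cells_def)
  have "Q \<noteq> X N" using Q \<open>I \<noteq> space haar\<close> by (auto simp: pre_X space_haar)
  then obtain R where R: "R \<in> D N j" "Q \<subset> R" "card R \<le> 8 * card Q" using parent_D[OF Q(1)] by blast
  have "measure haar (pre N R) \<le> 8 * measure haar (pre N Q)"
    using R(3) by (simp add: prob_pre[OF D_subset[OF R(1)]] prob_pre[OF D_subset[OF Q(1)]] divide_right_mono flip: of_nat_mult)
  then show "\<exists>R\<in>cells N j. I \<subset> R \<and> measure haar R \<le> 8 * measure haar I"
    unfolding Q(2) using R pre_strict_mono[OF R(2) D_subset[OF R(1)]] by (intro bexI[of _ "pre N R"]) (auto simp: cells_def)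
qed

lemma psi_proj: "j < m N \<Longrightarrow> \<psi> j (proj N x) = \<psi> j x"
  by (rule psi_cong) (auto simp: proj_def)

lemma measurable_psi: "\<psi> j \<in> borel_measurable haar"
  using measurable_cyl[of "\<psi> j" j] unfolding psi_proj[OF n_less_m] .

lemma measurable_partial_sum: "vilenkin_partial_sum p n f \<in> borel_measurable haar"
  using measurable_psi unfolding vilenkin_partial_sum_def by (intro borel_measurable_sum borel_measurable_times) auto

lemma norm_partial_sum_le: "norm (vilenkin_partial_sum p n f x) \<le> (\<Sum>j<n. norm (vilenkin_coeff p f j))"
  unfolding vilenkin_partial_sum_def by (rule sum_norm_le) (simp add: norm_mult)

lemma partial_sum_scale:
  "vilenkin_partial_sum p n (\<lambda>x. of_real c * f x) = (\<lambda>x. of_real c * vilenkin_partial_sum p n f x)"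
proof -
  have "vilenkin_coeff p (\<lambda>x. of_real c * f x) j = of_real c * vilenkin_coeff p f j" for j
    unfolding vilenkin_coeff_def mult.assoc by (rule integral_mult_right_zero)
  then show ?thesis by (simp add: vilenkin_partial_sum_def fun_eq_iff sum_distrib_left mult.assoc)
qed

definition cyl_integral :: "nat \<Rightarrow> ((nat \<Rightarrow> nat) \<Rightarrow> complex) \<Rightarrow> (nat \<Rightarrow> nat) \<Rightarrow> complex" where
  "cyl_integral N f y = (LINT x|haar. indicat_real (pre N {y}) x *\<^sub>R f x)"

lemma norm_cyl_integral_le: "norm (cyl_integral N f y) \<le> haar.ih (\<lambda>x. norm (f x)) (pre N {y})"
  unfolding cyl_integral_def haar.ih_def
  by (rule order_trans[OF integral_norm_bound]) simp

lemma coeff_eq: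
  assumes "integrable haar f" "j < m N"
  shows "vilenkin_coeff p f j = (\<Sum>y\<in>X N. cyl_integral N f y * cnj (\<psi> j y))"
proof -
  have "vilenkin_coeff p f j = (LINT x|haar. f x * cnj (\<psi> j (proj N x)))"
    unfolding vilenkin_coeff_def psi_proj[OF assms(2)] ..
  also have "\<dots> = (\<Sum>y\<in>X N. cyl_integral N f y * cnj (\<psi> j y))"
    unfolding cyl_integral_def by (rule integral_mult_cyl[OF assms(1)])
  finally show ?thesis .
qed

text \<open>Characters of index below \<open>m N\<close> are constant on the cylinders of level
  \<open>N\<close>, so \<open>f\<close> enters only through its integrals over these.\<close>

lemma partial_sum_eq:
  assumes f: "integrable haar f" and n: "n \<le> m N"
  shows "vilenkin_partial_sum p n f x = (\<Sum>y\<in>X N. Dir n (proj N x) y * cyl_integral N f y)"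
proof -
  have "vilenkin_partial_sum p n f x = (\<Sum>j<n. \<Sum>y\<in>X N. (\<psi> j (proj N x) * cnj (\<psi> j y)) * cyl_integral N f y)"
    unfolding vilenkin_partial_sum_def using n
    by (intro sum.cong refl)
      (simp add: coeff_eq[OF f, of _ N] psi_proj sum_distrib_left sum_distrib_right mult_ac less_le_trans[of _ n "m N"])
  also have "\<dots> = (\<Sum>y\<in>X N. Dir n (proj N x) y * cyl_integral N f y)"
    unfolding Dir_def sum_distrib_right by (rule sum.swap)
  finally show ?thesis .
qed

lemma partial_sum_form:
  assumes f: "integrable haar f" and g: "integrable haar g" and n: "n \<le> m N"
  shows "(LINT x|haar. vilenkin_partial_sum p n f x * g x) =
    (\<Sum>x\<in>X N. (\<Sum>y\<in>X N. Dir n x y * cyl_integral N f y) * cyl_integral N g x)"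
proof -
  have "(LINT x|haar. vilenkin_partial_sum p n f x * g x)
      = (LINT x|haar. g x * (\<lambda>x. \<Sum>y\<in>X N. Dir n x y * cyl_integral N f y) (proj N x))"
    by (simp add: partial_sum_eq[OF f n] mult.commute)
  also have "\<dots> = (\<Sum>x\<in>X N. cyl_integral N g x * (\<Sum>y\<in>X N. Dir n x y * cyl_integral N f y))"
    unfolding cyl_integral_def by (rule integral_mult_cyl[OF g])
  finally show ?thesis by (simp add: mult.commute)
qed

end

section \<open>Boundedness of the partial sums from the condition\<close>

locale vilenkin_exponent = vilenkin p + exponent_pair "vilenkin_measure p" a b q
  for p :: "nat \<Rightarrow> nat" and a b :: "(nat \<Rightarrow> nat) \<Rightarrow> real" and q :: real
begin

lemma tree_cells:
  assumes N: "0 < N" and bal: "\<And>I. I \<in> gen_intervals p \<Longrightarrow> I \<in> sets haar \<Longrightarrow> 0 < measure haar I \<Longrightarrow> balanced C I"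
  shows "tree C (cells N j)"
  unfolding tree_def using cells_structure[where j=j, OF N] cells_mem[of _ N j] cells_gen_intervals[of N j] bal by blast

lemma maxfun_nonneg: "finite \<D> \<Longrightarrow> 0 \<le> maxfun \<D> f x"
  unfolding maxfun_def by (intro Max_ge) auto

lemma Mf_le_maxfun:
  assumes N: "0 < N" and f: "integrable haar f" and x: "x \<in> group"
  shows "m N * Mf N (\<lambda>y. haar.ih f (pre N {y})) (proj N x) \<le> maxfun (cells N True) f x + maxfun (cells N False) f x"
proof -
  obtain j k l where s: "(k, l) \<in> scales N"
    and eq: "Mf N (\<lambda>y. haar.ih f (pre N {y})) (proj N x) =
      (\<Sum>y\<in>B N j k l (proj N x). haar.ih f (pre N {y})) / card (B N j k l (proj N x))"
    using Mf_attained[OF N] by blast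
  define Q where "Q = B N j k l (proj N x)"
  have xX: "proj N x \<in> X N" using proj_X[OF x] .
  have QX: "Q \<subseteq> X N" unfolding Q_def by (rule B_subset)
  have QT: "pre N Q \<in> cells N j" "x \<in> pre N Q"
    using D_I[OF s xX] B_self[OF xX] x by (auto simp: cells_def Q_def pre_def)
  have c0: "0 < card Q" unfolding Q_def using card_B_pos[OF xX] .
  have "m N * Mf N (\<lambda>y. haar.ih f (pre N {y})) (proj N x) = avg f (pre N Q)"
    unfolding eq avg_def Q_def[symmetric] ih_pre[OF f QX, symmetric] prob_pre[OF QX] using c0 by simp
  also have "\<dots> \<le> maxfun (cells N j) f x"
    unfolding maxfun_def using QT cells_structure(1)[OF N, of j] by (intro Max_ge) auto
  also have "\<dots> \<le> maxfun (cells N True) f x + maxfun (cells N False) f x"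
    using maxfun_nonneg[OF cells_structure(1)[OF N]] by (cases j) auto
  finally show ?thesis .
qed

end

context exponent_pair
begin

lemma integrable_of_powr:
  fixes f :: "'a \<Rightarrow> complex"
  assumes f: "f \<in> borel_measurable M" and i: "integrable M (\<lambda>x. norm (f x) powr a x)"
  shows "integrable M f"
proof -
  have le: "norm (f x) \<le> norm (norm (f x) powr a x + 1)" for x
    using young[of "norm (f x)" 1 x] by simp
  have "integrable M (\<lambda>x. norm (f x) powr a x + 1)" using i by simp
  then show ?thesis by (rule Bochner_Integration.integrable_bound[OF _ f AE_I2[OF le]])
qed

end

context vilenkin_exponent
begin

definition bilinear_const :: "real \<Rightarrow> real" where
  "bilinear_const C = max 1 (\<bar>cz_space.form_const 20000000\<bar> * (8 * maximal_const C))"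

text \<open>Scaled by \<open>m N\<close>, the discrete maximal functions are at most the sum of
  \<open>maxfun\<close> over both trees. Each of the four products is split by Young at the point,
  which reduces everything to \<open>maximal_modular\<close> for \<open>a\<close> and, with the
  exponents exchanged, for \<open>b\<close>; four functions, each counted twice, give the 8.\<close>

lemma partial_sum_bilinear_le:
  assumes C: "1 \<le> C"
    and bal: "\<And>I. I \<in> gen_intervals p \<Longrightarrow> I \<in> sets haar \<Longrightarrow> 0 < measure haar I \<Longrightarrow> balanced C I"
    and f: "f \<in> borel_measurable haar" "integrable haar (\<lambda>x. norm (f x) powr a x)"
      "(LINT x|haar. norm (f x) powr a x) \<le> 1"
    and g: "g \<in> borel_measurable haar" "integrable haar (\<lambda>x. norm (g x) powr b x)"
      "(LINT x|haar. norm (g x) powr b x) \<le> 1"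
  shows "norm (LINT x|haar. vilenkin_partial_sum p n f x * g x) \<le> bilinear_const C"
proof -
  interpret d: exponent_pair haar b a q by (rule dual)
  define N where "N = Suc n"
  have N: "0 < N" and n: "n \<le> m N" using n_less_m[of N] by (simp_all add: N_def)
  have tree: "tree C (cells N j)" for j using tree_cells[OF N bal] .
  have d_tree: "d.tree C (cells N j)" for j
    using tree[of j] unfolding d.tree_def tree_def balanced_dual .
  define U where "U j = maxfun (cells N j) (\<lambda>x. norm (f x))" for j
  define V where "V j = maxfun (cells N j) (\<lambda>x. norm (g x))" for j
  have U0: "0 \<le> U j x" and V0: "0 \<le> V j x" for j x
    using maxfun_nonneg[OF cells_structure(1)[OF N]] by (auto simp: U_def V_def)
  have Ui: "integrable haar (\<lambda>x. U j x powr a x)" "(LINT x|haar. U j x powr a x) \<le> maximal_const C" for j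
    unfolding U_def using f by (intro maximal_modular[OF C tree]; simp)+
  have Vi: "integrable haar (\<lambda>x. V j x powr b x)" "(LINT x|haar. V j x powr b x) \<le> maximal_const C" for j
    unfolding V_def using g by (intro d.maximal_modular[OF C d_tree]; simp)+
  have fi: "integrable haar f" by (rule integrable_of_powr[OF f(1,2)])
  have gi: "integrable haar g" by (rule d.integrable_of_powr[OF g(1,2)])
  define A where "A = Mf N (\<lambda>y. prob_space.ih haar (\<lambda>x. norm (f x)) (pre N {y}))"
  define B' where "B' = Mf N (\<lambda>y. prob_space.ih haar (\<lambda>x. norm (g x)) (pre N {y}))"
  define W where "W x = 2 * (U True x powr a x + U False x powr a x + V True x powr b x + V False x powr b x)" for x
  have Wi: "integrable haar W" unfolding W_def using Ui(1) Vi(1) by (intro integrable_mult_right integrable_add) auto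
  have WI: "(LINT x|haar. W x) \<le> 8 * maximal_const C"
    unfolding W_def using Ui(1) Vi(1) Ui(2)[of True] Ui(2)[of False] Vi(2)[of True] Vi(2)[of False] by simp
  have A0: "0 \<le> A x" and B0: "0 \<le> B' x" for x
    unfolding A_def B'_def using haar.ih_nonneg by (auto intro!: Mf_ge_0[OF N])
  have pw: "(m N)\<^sup>2 * (A (proj N x) * B' (proj N x)) \<le> W x" if x: "x \<in> space haar" for x
  proof -
    have xg: "x \<in> group" using x by (simp add: space_haar)
    have "m N * A (proj N x) \<le> U True x + U False x"
      unfolding A_def U_def using fi by (intro Mf_le_maxfun[OF N _ xg]) auto
    moreover have "m N * B' (proj N x) \<le> V True x + V False x"
      unfolding B'_def V_def using gi by (intro Mf_le_maxfun[OF N _ xg]) auto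
    ultimately have "(m N * A (proj N x)) * (m N * B' (proj N x)) \<le> (U True x + U False x) * (V True x + V False x)"
      using A0 B0 U0 by (intro mult_mono) (auto intro!: add_nonneg_nonneg)
    also have "\<dots> = U True x * V True x + U True x * V False x + (U False x * V True x + U False x * V False x)"
      by (simp add: algebra_simps)
    also have "\<dots> \<le> (U True x powr a x + V True x powr b x) + (U True x powr a x + V False x powr b x)
        + ((U False x powr a x + V True x powr b x) + (U False x powr a x + V False x powr b x))"
      by (intro add_mono young U0 V0)
    also have "\<dots> = W x" by (simp add: W_def)
    finally show ?thesis by (simp add: power2_eq_square mult_ac)
  qed
  have "(m N)\<^sup>2 * (LINT x|haar. A (proj N x) * B' (proj N x)) = (LINT x|haar. (m N)\<^sup>2 * (A (proj N x) * B' (proj N x)))"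
    by simp
  also have "\<dots> \<le> (LINT x|haar. W x)"
    using integral_cyl(2)[of "\<lambda>x. A x * B' x" N] pw by (intro integral_mono Wi integrable_mult_right)
  finally have AB: "(m N)\<^sup>2 * (LINT x|haar. A (proj N x) * B' (proj N x)) \<le> 8 * maximal_const C" using WI by linarith
  have eqAB: "(m N)\<^sup>2 * (LINT x|haar. A (proj N x) * B' (proj N x)) = m N * (\<Sum>x\<in>X N. A x * B' x)"
    using integral_cyl(1)[of "\<lambda>x. A x * B' x" N] by (simp add: power2_eq_square field_simps)
  have M: "Mf N (\<lambda>y. norm (cyl_integral N h y)) x \<le> Mf N (\<lambda>y. prob_space.ih haar (\<lambda>x. norm (h x)) (pre N {y})) x"
    "0 \<le> Mf N (\<lambda>y. norm (cyl_integral N h y)) x" if "x \<in> X N" for h x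
    using norm_cyl_integral_le that by (auto intro!: Mf_mono[OF N] Mf_ge_0[OF N])
  have "norm (LINT x|haar. vilenkin_partial_sum p n f x * g x)
      \<le> cz_space.form_const 20000000 * m N *
        (\<Sum>x\<in>X N. Mf N (\<lambda>x. norm (cyl_integral N f x)) x * Mf N (\<lambda>x. norm (cyl_integral N g x)) x)"
    unfolding partial_sum_form[OF fi gi n] by (rule partial_sum_form_bound[OF N n])
  also have "\<dots> \<le> \<bar>cz_space.form_const 20000000\<bar> * (m N *
        (\<Sum>x\<in>X N. Mf N (\<lambda>x. norm (cyl_integral N f x)) x * Mf N (\<lambda>x. norm (cyl_integral N g x)) x))"
    unfolding mult.assoc using M(2) by (intro mult_right_mono mult_nonneg_nonneg sum_nonneg) auto
  also have "\<dots> \<le> \<bar>cz_space.form_const 20000000\<bar> * (m N * (\<Sum>x\<in>X N. A x * B' x))"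
    unfolding A_def B'_def using M A0 by (intro mult_left_mono sum_mono mult_mono) (auto simp: A_def)
  also have "\<dots> \<le> \<bar>cz_space.form_const 20000000\<bar> * (8 * maximal_const C)"
    using AB unfolding eqAB by (intro mult_left_mono) auto
  finally show ?thesis unfolding bilinear_const_def by simp
qed

text \<open>The bilinear bound concerns modulars and is not homogeneous, so \<open>f\<close> is
  first divided by a level \<open>l\<close> above its norm.\<close>

lemma partial_sum_bounded:
  assumes C: "1 \<le> C"
    and bal: "\<And>I. I \<in> gen_intervals p \<Longrightarrow> I \<in> sets haar \<Longrightarrow> 0 < measure haar I \<Longrightarrow> balanced C I"
    and f: "f \<in> var_Lp haar a"
  shows "var_norm haar a (vilenkin_partial_sum p n f) \<le> ennreal (bilinear_const C) * var_norm haar a f"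
proof -
  interpret d: exponent_pair haar b a q by (rule dual)
  interpret v: var_exponent haar a q by (rule var_exponent_a)
  have fm: "f \<in> borel_measurable haar" and fin: "var_norm haar a f < \<infinity>" using f by (simp_all add: v.var_Lp_iff)
  have K: "1 \<le> bilinear_const C" by (simp add: bilinear_const_def)
  show ?thesis
  proof (rule v.le_var_norm_of_less[OF _ _ fin])
    fix l assume l: "0 < l" and less: "var_norm haar a f < ennreal l"
    define f1 where "f1 x = of_real (1 / l) * f x" for x
    have f1m: "f1 \<in> borel_measurable haar" unfolding f1_def using fm by measurable
    have n1: "norm (f1 x) = norm (f x) / l" for x using l by (simp add: f1_def norm_mult norm_divide)
    have mod: "(\<integral>\<^sup>+x. ennreal (norm (f1 x) powr a x) \<partial>haar) \<le> 1"
      using v.modular_le_1(2)[OF less] by (simp add: var_modular_def n1)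
    have mm: "(\<lambda>x. norm (f1 x) powr a x) \<in> borel_measurable haar"
      using f1m measurable_a by measurable
    have i1: "integrable haar (\<lambda>x. norm (f1 x) powr a x)"
      using mod mm by (intro integrableI_nonneg) (auto intro: le_less_trans)
    have L1: "(LINT x|haar. norm (f1 x) powr a x) \<le> 1"
    proof -
      have "ennreal (LINT x|haar. norm (f1 x) powr a x) \<le> ennreal 1"
        using mod nn_integral_eq_integral[OF i1] by simp
      then show ?thesis by (subst (asm) ennreal_le_iff) auto
    qed
    define h where "h = vilenkin_partial_sum p n f1"
    have "var_modular haar a h (bilinear_const C) \<le> 1"
    proof (rule modular_le_by_duality)
      show "h \<in> borel_measurable haar" unfolding h_def by (rule measurable_partial_sum)
      show "norm (h x) \<le> (\<Sum>j<n. norm (vilenkin_coeff p f1 j))" for x unfolding h_def by (rule norm_partial_sum_le)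
      fix g :: "(nat \<Rightarrow> nat) \<Rightarrow> complex" assume g: "g \<in> borel_measurable haar" "\<And>x. norm (g x) \<le> max 1 ((\<Sum>j<n. norm (vilenkin_coeff p f1 j)) / bilinear_const C) powr q"
        "(LINT x|haar. norm (g x) powr b x) \<le> 1"
      define G where "G = max 1 ((\<Sum>j<n. norm (vilenkin_coeff p f1 j)) / bilinear_const C) powr q"
      have gm: "(\<lambda>x. norm (g x) powr b x) \<in> borel_measurable haar"
        using g(1) measurable_b by measurable
      have "norm (g x) powr b x \<le> max 1 G powr q" for x
      proof -
        have "norm (g x) powr b x \<le> max 1 (norm (g x)) powr q"
          using b_gt_1[of x] b_le[of x] by (intro powr_le_max) auto
        also have "\<dots> \<le> max 1 G powr q"
          using g(2)[of x] q_gt_1 by (intro powr_mono2) (auto simp: G_def)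
        finally show ?thesis .
      qed
      then have gi: "integrable haar (\<lambda>x. norm (g x) powr b x)"
        by (intro haar.integrable_const_bound[of _ "max 1 G powr q"] gm) auto
      show "norm (LINT x|haar. h x * g x) \<le> bilinear_const C"
        unfolding h_def by (rule partial_sum_bilinear_le[OF C bal f1m i1 L1 g(1) gi g(3)])
    qed (use K in simp)
    moreover have "vilenkin_partial_sum p n f = (\<lambda>x. of_real l * h x)"
      using l partial_sum_scale[of n "1 / l" f] by (simp add: h_def f1_def[abs_def])
    ultimately have "var_modular haar a (vilenkin_partial_sum p n f) (l * bilinear_const C) \<le> 1"
      using v.modular_cmult[OF l, of h "bilinear_const C"] by simp
    then have "var_norm haar a (vilenkin_partial_sum p n f) \<le> ennreal (l * bilinear_const C)"
      using l K by (intro v.var_norm_le) auto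
    then show "var_norm haar a (vilenkin_partial_sum p n f) \<le> ennreal (bilinear_const C * l)"
      by (simp add: mult.commute)
  qed (use K in simp)
qed

end

section \<open>Necessity of the condition\<close>

lemma half_le_cos: "\<bar>t\<bar> \<le> pi / 3 \<Longrightarrow> 1 / 2 \<le> cos t"
  using cos_monotone_0_pi_le[of "\<bar>t\<bar>" "pi / 3"] by (simp add: cos_60)

context vilenkin
begin

lemma Dir_low:
  assumes eq: "\<And>i. i < k \<Longrightarrow> x i = y i" and \<alpha>: "\<alpha> \<le> p k"
  shows "Dir (\<alpha> * m k) x y = of_nat (m k) * (\<Sum>c<\<alpha>. (unit_root (p k) (x k) * cnj (unit_root (p k) (y k))) ^ c)"
proof -
  define h where "h j = \<psi> j x * cnj (\<psi> j y)" for j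
  have "Dir (\<alpha> * m k) x y = (\<Sum>j<\<alpha> * m k + 0. h j)" by (simp add: Dir_def h_def)
  also have "\<dots> = (\<Sum>i<\<alpha>. \<Sum>s<m k. h (i * m k + s))" unfolding sum_lessThan_blocks by simp
  also have "\<dots> = (\<Sum>i<\<alpha>. of_nat (m k) * (unit_root (p k) (x k) * cnj (unit_root (p k) (y k))) ^ i)"
  proof (intro sum.cong refl)
    fix i assume "i \<in> {..<\<alpha>}"
    then have i: "i < p k" using \<alpha> by simp
    have "h (i * m k + s) = (unit_root (p k) (x k) * cnj (unit_root (p k) (y k))) ^ i" if s: "s < m k" for s
    proof -
      have "h (i * m k + s) = \<psi> (i * m k) x * cnj (\<psi> (i * m k) y) * (\<psi> s x * cnj (\<psi> s y))"
        using psi_mult[OF s] by (simp add: h_def mult_ac)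
      also have "\<psi> s x = \<psi> s y" using eq s by (rule psi_cong)
      finally show ?thesis using psi_digit[OF i] by (simp add: power_mult_distrib)
    qed
    then show "(\<Sum>s<m k. h (i * m k + s)) = of_nat (m k) * (unit_root (p k) (x k) * cnj (unit_root (p k) (y k))) ^ i"
      by simp
  qed
  finally show ?thesis by (simp add: sum_distrib_left)
qed

lemma partial_sum_kernel:
  assumes "integrable haar f"
  shows "vilenkin_partial_sum p n f x = (LINT y|haar. f y * Dir n x y)" "integrable haar (\<lambda>y. f y * Dir n x y)"
proof -
  have i: "integrable haar (\<lambda>y. f y * cnj (\<psi> j y) * \<psi> j x)" for j
    using integral_mult_cyl(2)[OF assms, of "\<lambda>y. cnj (\<psi> j y) * \<psi> j x" j]
    unfolding psi_proj[OF n_less_m] by (simp add: mult.assoc)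
  have eq: "f y * Dir n x y = (\<Sum>j<n. f y * cnj (\<psi> j y) * \<psi> j x)" for y
    by (simp add: Dir_def sum_distrib_left mult_ac)
  show "integrable haar (\<lambda>y. f y * Dir n x y)" unfolding eq using i by (intro Bochner_Integration.integrable_sum)
  show "vilenkin_partial_sum p n f x = (LINT y|haar. f y * Dir n x y)"
    unfolding eq vilenkin_partial_sum_def vilenkin_coeff_def using i by (subst Bochner_Integration.integral_sum) auto
qed

lemma gen_intervalE:
  assumes "I \<in> gen_intervals p"
  obtains k v j x where "x \<in> group" "v < p k" "1 \<le> j" "j \<le> p k"
    "I = {z \<in> group. (\<forall>i<k. z i = x i) \<and> z k \<in> (\<lambda>t. (v + t) mod p k) ` {..<j}}"
    "I \<in> sets haar" "measure haar I = j / m (Suc k)"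
proof -
  obtain x k j where x: "x \<in> group" and j: "1 \<le> j" "j \<le> p k"
    and I: "I = vilenkin_add p x ` {y \<in> group. (\<forall>i<k. y i = 0) \<and> y k < j}"
    using assms by (auto simp: gen_intervals_def space_haar)
  define C where "C = (\<lambda>t. (x k + t) mod p k) ` {..<j}"
  have xk: "x k < p k" using x by (simp add: group_def)
  have CP: "C \<subseteq> {..<p k}" by (auto simp: C_def)
  have inj: "inj_on (\<lambda>t. (x k + t) mod p k) {..<j}"
    using bij_betw_add_mod[OF xk] j(2) by (auto simp: bij_betw_def intro: inj_on_subset)
  have cC: "card C = j" unfolding C_def by (simp add: card_image[OF inj])
  have eq: "I = {z \<in> group. (\<forall>i<k. z i = x i) \<and> z k \<in> C}"
  proof (intro equalityI subsetI)
    fix z assume "z \<in> I"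
    then obtain y where y: "y \<in> group" "\<forall>i<k. y i = 0" "y k < j" "z = vilenkin_add p x y" unfolding I by blast
    then show "z \<in> {z \<in> group. (\<forall>i<k. z i = x i) \<and> z k \<in> C}"
      using x by (auto simp: vilenkin_add_def group_def C_def)
  next
    fix z assume z: "z \<in> {z \<in> group. (\<forall>i<k. z i = x i) \<and> z k \<in> C}"
    then obtain t where t: "t < j" "z k = (x k + t) mod p k" by (auto simp: C_def)
    have "\<exists>b<p i. (x i + b) mod p i = z i" for i
    proof -
      have "z i \<in> {..<p i}" "x i < p i" using z x by (auto simp: group_def)
      then have "z i \<in> (\<lambda>b. (x i + b) mod p i) ` {..<p i}"
        using bij_betw_imp_surj_on[OF bij_betw_add_mod[of "x i" "p i"]] by simp
      then show ?thesis by auto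
    qed
    then obtain b where b: "\<And>i. b i < p i" "\<And>i. (x i + b i) mod p i = z i" by metis
    define y where "y i = (if i < k then 0 else if i = k then t else b i)" for i
    have "y \<in> group" using b t j by (auto simp: y_def group_def)
    moreover have "z = vilenkin_add p x y"
      using z x t b by (auto simp: y_def vilenkin_add_def group_def fun_eq_iff)
    ultimately show "z \<in> I" unfolding I using t by (intro image_eqI[of _ _ y]) (auto simp: y_def)
  qed
  define S where "S = box (Suc k) (\<lambda>i. if i < k then {x i} else C)"
  have SX: "S \<subseteq> X (Suc k)"
    unfolding S_def X_def box_def using x CP by (force simp: group_def less_Suc_eq split: if_splits)
  have "I = pre (Suc k) S"
    unfolding eq pre_def S_def box_def by (auto simp: proj_def less_Suc_eq)
  moreover have "card S = j" unfolding S_def card_box by (simp add: cC)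
  ultimately have "I \<in> sets haar" "measure haar I = j / m (Suc k)"
    using pre_sets[OF SX] prob_pre[OF SX] by auto
  then show ?thesis by (rule that[OF x xk j eq[unfolded C_def]])
qed

lemma gen_interval_mem:
  assumes "I \<in> gen_intervals p"
  shows "I \<in> sets haar" "0 < measure haar I"
proof -
  show "I \<in> sets haar" by (rule gen_intervalE[OF assms])
  show "0 < measure haar I"
  proof (rule gen_intervalE[OF assms])
    fix k j assume "1 \<le> j" "measure haar I = real j / real (m (Suc k))"
    then show ?thesis by simp
  qed
qed

text \<open>For \<open>n = \<alpha> * m k\<close> only the first \<open>\<alpha>\<close> powers of
  one root of unity occur, and on the interval their phases stay within \<open>pi / 3\<close>, so
  the kernel has real part at least \<open>m k * (\<alpha> / 2)\<close> there. Since
  \<open>p k \<le> 12 * j * \<alpha>\<close>, this is the reciprocal measure up to the factor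
  \<open>12 * 2 = 24\<close>.\<close>

lemma partial_sum_ge_average:
  assumes I: "I \<in> gen_intervals p"
  shows "\<exists>n. \<forall>f. integrable haar f \<longrightarrow> (\<forall>y. 0 \<le> f y) \<longrightarrow> (\<forall>y. y \<notin> I \<longrightarrow> f y = 0) \<longrightarrow>
    (\<forall>x\<in>I. (LINT y|haar. f y) / measure haar I \<le> 24 * Re (vilenkin_partial_sum p n (\<lambda>y. of_real (f y)) x))"
proof -
  obtain k v j x where x: "x \<in> group" and v: "v < p k" and j: "1 \<le> j" "j \<le> p k"
    and Ieq: "I = {z \<in> group. (\<forall>i<k. z i = x i) \<and> z k \<in> (\<lambda>t. (v + t) mod p k) ` {..<j}}"
    and \<mu>: "measure haar I = j / m (Suc k)"
    by (rule gen_intervalE[OF I], rule that)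
  \<comment> \<open>The 6 makes \<open>2 * pi * j * \<alpha> / p k\<close> at most
    \<open>pi / 3\<close>. When \<open>p k < 6 * j\<close> the maximum leaves the single power 0,
    whose phase is 0.\<close>
  define \<alpha> where "\<alpha> = max 1 (p k div (6 * j))"
  have \<alpha>p: "\<alpha> \<le> p k" using p_ge_2[of k] by (auto simp: \<alpha>_def)
  have \<alpha>_ge: "p k \<le> 12 * j * \<alpha>"
  proof (cases "p k < 6 * j")
    case True
    then show ?thesis by (simp add: \<alpha>_def)
  next
    case False
    define d where "d = p k div (6 * j)"
    have d: "1 \<le> d" using False j by (simp add: d_def Suc_le_eq div_greater_zero_iff)
    have "p k \<le> 6 * j * (d + 1)" unfolding d_def using j dividend_less_times_div[of "6 * j" "p k"] by simp
    also have "\<dots> \<le> 6 * j * (2 * d)" using d by (intro mult_left_mono) auto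
    also have "\<dots> = 12 * j * d" by simp
    also have "d = \<alpha>" using d by (simp add: \<alpha>_def d_def)
    finally show ?thesis .
  qed
  have ReD: "m k * (\<alpha> / 2) \<le> Re (Dir (\<alpha> * m k) y z)" if y: "y \<in> I" and z: "z \<in> I" for y z
  proof -
    obtain t t' where t: "t < j" "y k = (v + t) mod p k" and t': "t' < j" "z k = (v + t') mod p k"
      using y z unfolding Ieq by blast
    define \<theta> where "\<theta> = 2 * pi * (real t - real t') / p k"
    have "unit_root (p k) (y k) * cnj (unit_root (p k) (z k)) = cis \<theta>"
      unfolding t t' unit_root_period[OF p_pos]
      by (simp add: unit_root_def cis_cnj cis_mult \<theta>_def diff_divide_distrib add_divide_distrib algebra_simps)
    then have "Dir (\<alpha> * m k) y z = of_nat (m k) * sum ((^) (cis \<theta>)) {..<\<alpha>}"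
      using Dir_low[of k y z \<alpha>] y z \<alpha>p by (simp add: Ieq)
    also have "sum ((^) (cis \<theta>)) {..<\<alpha>} = (\<Sum>c<\<alpha>. cis (c * \<theta>))"
      by (intro sum.cong refl Complex.DeMoivre)
    finally have D: "Dir (\<alpha> * m k) y z = of_nat (m k) * (\<Sum>c<\<alpha>. cis (c * \<theta>))" .
    have "1 / 2 \<le> cos (c * \<theta>)" if c: "c < \<alpha>" for c
    proof (cases "c = 0")
      case False
      then have "\<alpha> = p k div (6 * j)" using c by (auto simp: \<alpha>_def max_def split: if_splits)
      then have "c * (6 * j) \<le> p k div (6 * j) * (6 * j)" using c by (intro mult_right_mono) auto
      also have "\<dots> \<le> p k" by (rule div_times_less_eq_dividend)
      finally have "real (c * (6 * j)) \<le> real (p k)" by (rule of_nat_mono)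
      then have cj: "real c * real j \<le> p k / 6" by simp
      have "\<bar>c * (2 * pi * d / p k)\<bar> = 2 * pi * (c * \<bar>d\<bar>) / p k" for d :: real by (simp add: abs_mult mult_ac)
      then have "\<bar>c * \<theta>\<bar> = 2 * pi * (c * \<bar>real t - real t'\<bar>) / p k" unfolding \<theta>_def .
      also have "\<dots> \<le> 2 * pi * (real c * real j) / p k"
      proof (intro divide_right_mono mult_left_mono)
        show "\<bar>real t - real t'\<bar> \<le> j" using t(1) t'(1) by linarith
      qed auto
      also have "\<dots> \<le> 2 * pi * (p k / 6) / p k"
        using cj by (intro divide_right_mono mult_left_mono) auto
      also have "\<dots> = pi / 3" using p_pos[of k] by simp
      finally show ?thesis by (rule half_le_cos)
    qed simp
    then have "(\<Sum>c<\<alpha>. 1 / 2) \<le> (\<Sum>c<\<alpha>. cos (c * \<theta>))" by (intro sum_mono) auto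
    then show ?thesis unfolding D by (simp add: mult_left_mono)
  qed
  show ?thesis
  proof (intro exI[of _ "\<alpha> * m k"] allI impI ballI)
    fix f y assume f0: "integrable haar f" "\<forall>y. 0 \<le> f y" "\<forall>y. y \<notin> I \<longrightarrow> f y = (0::real)" and y: "y \<in> I"
    then have f: "integrable haar f" "\<And>y. 0 \<le> f y" "\<And>y. y \<notin> I \<Longrightarrow> f y = 0" by auto
    have fc: "integrable haar (\<lambda>y. complex_of_real (f y))" using f(1) by simp
    note S = partial_sum_kernel[OF fc, of "\<alpha> * m k" y]
    have "m k * (\<alpha> / 2) * (LINT z|haar. f z) = (LINT z|haar. m k * (\<alpha> / 2) * f z)" by simp
    also have "\<dots> \<le> (LINT z|haar. Re (of_real (f z) * Dir (\<alpha> * m k) y z))"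
    proof (rule integral_mono)
      fix z
      show "m k * (\<alpha> / 2) * f z \<le> Re (of_real (f z) * Dir (\<alpha> * m k) y z)"
      proof (cases "z \<in> I")
        case True
        then show ?thesis using mult_right_mono[OF ReD[OF y True] f(2)[of z]] by (simp add: mult.commute)
      qed (simp add: f(3))
    qed (use f(1) integrable_Re[OF S(2)] in simp_all)
    also have "\<dots> = Re (vilenkin_partial_sum p (\<alpha> * m k) (\<lambda>y. of_real (f y)) y)"
      unfolding S(1) using S(2) by (rule integral_Re)
    finally have le: "m k * (\<alpha> / 2) * (LINT z|haar. f z) \<le> Re (vilenkin_partial_sum p (\<alpha> * m k) (\<lambda>y. of_real (f y)) y)" .
    have "(LINT z|haar. f z) / measure haar I = real (m k) * (real (p k) / real j) * (LINT z|haar. f z)"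
      unfolding \<mu> by (simp add: m_Suc)
    also have "\<dots> \<le> real (m k) * (12 * real \<alpha>) * (LINT z|haar. f z)"
    proof (intro mult_right_mono mult_left_mono)
      have "real (p k) \<le> 12 * real \<alpha> * real j" using of_nat_mono[OF \<alpha>_ge, where 'a=real] by (simp add: mult_ac)
      then show "real (p k) / real j \<le> 12 * real \<alpha>" using j by (simp add: pos_divide_le_eq)
    qed (use f(2) in auto)
    also have "\<dots> = 24 * (m k * (\<alpha> / 2) * (LINT z|haar. f z))" by simp
    also have "\<dots> \<le> 24 * Re (vilenkin_partial_sum p (\<alpha> * m k) (\<lambda>y. of_real (f y)) y)" using le by (intro mult_left_mono) auto
    finally show "(LINT y|haar. f y) / measure haar I \<le> 24 * Re (vilenkin_partial_sum p (\<alpha> * m k) (\<lambda>y. of_real (f y)) y)" .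
  qed
qed

end

context vilenkin_exponent
begin

lemma norm_product_le_of_bounded:
  assumes C: "0 \<le> C" and bdd: "\<And>n f. f \<in> var_Lp haar a \<Longrightarrow> var_norm haar a (vilenkin_partial_sum p n f) \<le> ennreal C * var_norm haar a f"
    and I: "I \<in> gen_intervals p"
  shows "var_norm haar a (indicator I) * var_norm haar b (indicator I) \<le> ennreal (2 * (24 * C) * 4 powr q * measure haar I)"
proof -
  interpret v: var_exponent haar a q by (rule var_exponent_a)
  note Im = gen_interval_mem(1)[OF I] and Ip = gen_interval_mem(2)[OF I]
  obtain n where n: "\<forall>f. integrable haar f \<longrightarrow> (\<forall>y. 0 \<le> f y) \<longrightarrow> (\<forall>y. y \<notin> I \<longrightarrow> f y = 0) \<longrightarrow>
      (\<forall>x\<in>I. (LINT y|haar. f y) / measure haar I \<le> 24 * Re (vilenkin_partial_sum p n (\<lambda>y. of_real (f y)) x))"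
    using partial_sum_ge_average[OF I] ..
  show ?thesis
  proof (rule norms_of_averaging[OF Im Ip])
    fix f :: "(nat \<Rightarrow> nat) \<Rightarrow> real" and B' :: real
    assume f: "f \<in> borel_measurable haar" "\<And>x. 0 \<le> f x" "\<And>x. f x \<le> B'" "\<And>x. x \<notin> I \<Longrightarrow> f x = 0"
    have fi: "integrable haar f" using f by (intro haar.integrable_const_bound[of _ B']) auto
    have avg: "avg f I = (LINT y|haar. f y) / measure haar I"
    proof -
      have "indicator I x * f x = f x" for x using f(4)[of x] by (cases "x \<in> I") auto
      then show ?thesis unfolding avg_def haar.ih_def by (simp only:)
    qed
    define F where "F x = complex_of_real (f x)" for x
    have FL: "F \<in> var_Lp haar a"
      unfolding F_def using f by (intro v.bounded_in_var_Lp[of _ B']) auto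
    have "norm (complex_of_real (avg f I) * indicator I x) \<le> norm (of_real 24 * vilenkin_partial_sum p n F x)" for x
    proof (cases "x \<in> I")
      case True
      have "0 \<le> avg f I" unfolding avg using f(2) Ip by (intro divide_nonneg_pos integral_nonneg) auto
      then have "norm (complex_of_real (avg f I) * indicator I x) = avg f I" using True by simp
      also have "\<dots> \<le> 24 * Re (vilenkin_partial_sum p n F x)"
        unfolding avg F_def using n fi f(2,4) True by simp
      also have "\<dots> \<le> 24 * norm (vilenkin_partial_sum p n F x)" using complex_Re_le_cmod by (intro mult_left_mono) auto
      finally show ?thesis by (simp add: norm_mult)
    qed simp
    then have "var_norm haar a (\<lambda>x. of_real (avg f I) * indicator I x) \<le> var_norm haar a (\<lambda>x. of_real 24 * vilenkin_partial_sum p n F x)"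
      by (intro v.var_norm_mono AE_I2)
    also have "\<dots> \<le> ennreal 24 * var_norm haar a (vilenkin_partial_sum p n F)" by (rule v.var_norm_cmult_le) simp
    also have "\<dots> \<le> ennreal 24 * (ennreal C * var_norm haar a F)" by (intro mult_left_mono bdd FL) auto
    also have "\<dots> = ennreal (24 * C) * var_norm haar a F" using C by (simp add: ennreal_mult mult.assoc)
    finally show "var_norm haar a (\<lambda>x. of_real (avg f I) * indicator I x) \<le> ennreal (24 * C) * var_norm haar a (\<lambda>x. of_real (f x))"
      unfolding F_def .
  qed (use C in simp)
qed

end

context vilenkin
begin

section \<open>Convergence\<close>

lemma proj_proj: "N \<le> N' \<Longrightarrow> proj N (proj N' x) = proj N x"
  by (auto simp: proj_def)

lemma pre_refine: "N \<le> N' \<Longrightarrow> S \<subseteq> X N \<Longrightarrow> pre N S = pre N' {y \<in> X N'. proj N y \<in> S}"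
  using proj_X proj_proj by (auto simp: pre_def)

text \<open>These sets form a sigma-algebra that contains the generators of the product
  sigma-algebra; this yields density of cylinder functions.\<close>

definition cyl_approximable :: "(nat \<Rightarrow> nat) set \<Rightarrow> bool" where
  "cyl_approximable A \<longleftrightarrow> A \<in> sets haar \<and> (\<forall>\<delta>>0. \<exists>N. \<exists>S\<subseteq>X N. measure haar (sym_diff A (pre N S)) \<le> \<delta>)"

lemma cyl_approximable_Compl:
  assumes "cyl_approximable A"
  shows "cyl_approximable (space haar - A)"
  unfolding cyl_approximable_def
proof (intro conjI allI impI)
  show "space haar - A \<in> sets haar" using assms by (auto simp: cyl_approximable_def)
  fix \<delta> :: real assume "0 < \<delta>"
  then obtain N S where S: "S \<subseteq> X N" "measure haar (sym_diff A (pre N S)) \<le> \<delta>"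
    using assms by (auto simp: cyl_approximable_def)
  have "A \<subseteq> group" using assms sets.sets_into_space[of A haar] by (simp add: cyl_approximable_def space_haar)
  then have "sym_diff (space haar - A) (pre N (X N - S)) = sym_diff A (pre N S)"
    using proj_X by (auto simp: pre_def space_haar)
  then show "\<exists>N. \<exists>S\<subseteq>X N. measure haar (sym_diff (space haar - A) (pre N S)) \<le> \<delta>"
    using S by (metis Diff_subset)
qed

lemma cyl_approximable_Un:
  assumes A: "cyl_approximable A" and A': "cyl_approximable A'"
  shows "cyl_approximable (A \<union> A')"
  unfolding cyl_approximable_def
proof (intro conjI allI impI)
  show "A \<union> A' \<in> sets haar" using assms by (auto simp: cyl_approximable_def)
  fix \<delta> :: real assume d: "0 < \<delta>"
  obtain N S where S: "S \<subseteq> X N" "measure haar (sym_diff A (pre N S)) \<le> \<delta> / 2"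
    using A d by (auto simp: cyl_approximable_def dest!: spec[of _ "\<delta> / 2"])
  obtain N' S' where S': "S' \<subseteq> X N'" "measure haar (sym_diff A' (pre N' S')) \<le> \<delta> / 2"
    using A' d by (auto simp: cyl_approximable_def dest!: spec[of _ "\<delta> / 2"])
  define L where "L = max N N'"
  define R where "R = {y \<in> X L. proj N y \<in> S} \<union> {y \<in> X L. proj N' y \<in> S'}"
  have pR: "pre L R = pre N S \<union> pre N' S'"
    using pre_refine[OF _ S(1), of L] pre_refine[OF _ S'(1), of L] by (auto simp: R_def L_def pre_def)
  have meas: "A \<in> sets haar" "A' \<in> sets haar" "pre N S \<in> sets haar" "pre N' S' \<in> sets haar"
    using A A' S S' pre_sets by (auto simp: cyl_approximable_def)
  have "measure haar (sym_diff (A \<union> A') (pre L R)) \<le> measure haar (sym_diff A (pre N S) \<union> sym_diff A' (pre N' S'))"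
    using meas unfolding pR by (intro haar.finite_measure_mono) auto
  also have "\<dots> \<le> measure haar (sym_diff A (pre N S)) + measure haar (sym_diff A' (pre N' S'))"
    using meas by (intro measure_Un_le) auto
  also have "\<dots> \<le> \<delta>" using S S' by simp
  finally show "\<exists>N. \<exists>S\<subseteq>X N. measure haar (sym_diff (A \<union> A') (pre N S)) \<le> \<delta>"
    by (intro exI[of _ L] exI[of _ R]) (auto simp: R_def)
qed

lemma cyl_approximable_pre: "S \<subseteq> X N \<Longrightarrow> cyl_approximable (pre N S)"
  unfolding cyl_approximable_def using pre_sets
  by (auto intro!: exI[of _ N] exI[of _ S])

lemma cyl_approximable_UN:
  assumes A: "\<And>i::nat. cyl_approximable (A i)"
  shows "cyl_approximable (\<Union>i. A i)"
  unfolding cyl_approximable_def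
proof (intro conjI allI impI)
  have Am: "A i \<in> sets haar" for i using A by (auto simp: cyl_approximable_def)
  then show Um: "(\<Union>i. A i) \<in> sets haar" by auto
  define U where "U n = (\<Union>i\<le>n. A i)" for n
  have Ua: "cyl_approximable (U n)" for n
  proof (induction n)
    case 0
    then show ?case using A[of 0] by (simp add: U_def)
  next
    case (Suc n)
    have "U (Suc n) = A (Suc n) \<union> U n" by (simp add: U_def atMost_Suc)
    then show ?case using cyl_approximable_Un[OF A Suc] by simp
  qed
  have Unm: "U n \<in> sets haar" for n using Ua by (auto simp: cyl_approximable_def)
  have UU: "(\<Union>n. U n) = (\<Union>i. A i)" by (auto simp: U_def)
  have "incseq U" unfolding incseq_def U_def by (intro allI impI UN_mono) auto
  then have "(\<lambda>n. measure haar (U n)) \<longlonglongrightarrow> measure haar (\<Union>i. A i)"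
    using haar.finite_Lim_measure_incseq[of U] Unm by (simp add: UU image_subset_iff)
  fix \<delta> :: real assume d: "0 < \<delta>"
  have "eventually (\<lambda>n. dist (measure haar (U n)) (measure haar (\<Union>i. A i)) < \<delta> / 2) sequentially"
    using tendstoD[OF \<open>(\<lambda>n. measure haar (U n)) \<longlonglongrightarrow> measure haar (\<Union>i. A i)\<close>, of "\<delta> / 2"] d by simp
  then obtain n where n: "dist (measure haar (U n)) (measure haar (\<Union>i. A i)) < \<delta> / 2"
    by (auto simp: eventually_sequentially)
  have Usub: "U n \<subseteq> (\<Union>i. A i)" by (auto simp: U_def)
  have near: "measure haar ((\<Union>i. A i) - U n) \<le> \<delta> / 2"
    using n unfolding haar.finite_measure_Diff[OF Um Unm Usub] dist_real_def by linarith
  obtain N S where S: "S \<subseteq> X N" "measure haar (sym_diff (U n) (pre N S)) \<le> \<delta> / 2"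
    using Ua[of n] d by (auto simp: cyl_approximable_def dest!: spec[of _ "\<delta> / 2"])
  have pm: "pre N S \<in> sets haar" by (rule pre_sets[OF S(1)])
  have "measure haar (sym_diff (\<Union>i. A i) (pre N S)) \<le> measure haar (((\<Union>i. A i) - U n) \<union> sym_diff (U n) (pre N S))"
    using Um Unm pm Usub by (intro haar.finite_measure_mono) auto
  also have "\<dots> \<le> measure haar ((\<Union>i. A i) - U n) + measure haar (sym_diff (U n) (pre N S))"
    using Um Unm pm by (intro measure_Un_le) auto
  also have "\<dots> \<le> \<delta>" using near S(2) by simp
  finally show "\<exists>N. \<exists>S\<subseteq>X N. measure haar (sym_diff (\<Union>i. A i) (pre N S)) \<le> \<delta>" using S(1) by blast
qed

lemma cyl_approximable: "A \<in> sets haar \<Longrightarrow> cyl_approximable A"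
proof -
  let ?U = "\<lambda>i. uniform_count_measure {..<p i}"
  have sp: "(\<Pi>\<^sub>E i\<in>UNIV. space (?U i)) = group"
    by (auto simp: space_uniform_count_measure group_def)
  assume "A \<in> sets haar"
  then have "A \<in> sigma_sets group {{f \<in> group. f i \<in> E} | i E. i \<in> UNIV \<and> E \<in> sets (?U i)}"
    unfolding vilenkin_measure_def sets_PiM_single sp .
  then show ?thesis
  proof (induction rule: sigma_sets.induct)
    case (Basic A)
    then obtain i E where A: "A = {f \<in> group. f i \<in> E}" by blast
    have "A = pre (Suc i) {y \<in> X (Suc i). y i \<in> E}" unfolding A using proj_X by (auto simp: pre_def proj_def)
    then show ?case using cyl_approximable_pre[of "{y \<in> X (Suc i). y i \<in> E}" "Suc i"] by auto
  next
    case Empty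
    have "pre 0 {} = {}" by (simp add: pre_def)
    then show ?case using cyl_approximable_pre[of "{}" 0] by simp
  next
    case (Compl A)
    then show ?case using cyl_approximable_Compl by (simp add: space_haar)
  next
    case (Union A)
    then show ?case by (intro cyl_approximable_UN)
  qed
qed

lemma cyl_dense_L1:
  fixes f :: "(nat \<Rightarrow> nat) \<Rightarrow> complex"
  assumes "integrable haar f"
  shows "\<forall>\<delta>>0. \<exists>N h. (LINT x|haar. norm (f x - h (proj N x))) \<le> \<delta>"
  using assms
proof (induction rule: integrable_induct)
  case (base A c)
  show ?case
  proof (intro allI impI)
    fix \<delta> :: real assume d: "0 < \<delta>"
    define e where "e = \<delta> / (norm c + 1)"
    have e: "0 < e" using d by (simp add: e_def add_nonneg_pos)
    obtain N S where S: "S \<subseteq> X N" "measure haar (sym_diff A (pre N S)) \<le> e"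
      using cyl_approximable[OF base(1)] e unfolding cyl_approximable_def by blast
    define h where "h y = indicat_real S y *\<^sub>R c" for y
    have Am: "A \<in> sets haar" "pre N S \<in> sets haar" using base(1) pre_sets[OF S(1)] by auto
    have "norm (indicat_real A x *\<^sub>R c - h (proj N x)) = norm c * indicat_real (sym_diff A (pre N S)) x" if "x \<in> space haar" for x
      using that by (auto simp: h_def pre_def space_haar indicator_def)
    then have "(LINT x|haar. norm (indicat_real A x *\<^sub>R c - h (proj N x))) = (LINT x|haar. norm c * indicat_real (sym_diff A (pre N S)) x)"
      by (intro Bochner_Integration.integral_cong refl)
    also have "\<dots> = norm c * measure haar (sym_diff A (pre N S))" using Am by simp
    also have "\<dots> \<le> norm c * e" using S(2) by (intro mult_left_mono) auto
    also have "\<dots> \<le> (norm c + 1) * e" using e by (intro mult_right_mono) auto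
    also have "\<dots> = \<delta>" unfolding e_def using norm_ge_zero[of c] by (simp add: add_nonneg_eq_0_iff)
    finally show "\<exists>N h. (LINT x|haar. norm (indicat_real A x *\<^sub>R c - h (proj N x))) \<le> \<delta>" by blast
  qed
next
  case (add f g)
  show ?case
  proof (intro allI impI)
    fix \<delta> :: real assume "0 < \<delta>"
    then have d: "0 < \<delta> / 2" by simp
    obtain N h where h: "(LINT x|haar. norm (f x - h (proj N x))) \<le> \<delta> / 2" using add.IH(1) d by blast
    obtain N' h' where h': "(LINT x|haar. norm (g x - h' (proj N' x))) \<le> \<delta> / 2" using add.IH(2) d by blast
    define L where "L = max N N'"
    define H where "H y = h (proj N y) + h' (proj N' y)" for y
    have H: "H (proj L x) = h (proj N x) + h' (proj N' x)" for x by (simp add: H_def L_def proj_proj)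
    have i: "integrable haar (\<lambda>x. f x - h (proj N x))" "integrable haar (\<lambda>x. g x - h' (proj N' x))"
      using add integral_cyl(2)[of h N] integral_cyl(2)[of h' N'] by auto
    have i3: "integrable haar (\<lambda>x. f x + g x - H (proj L x))"
      using add integral_cyl(2)[of H L] by auto
    have "(LINT x|haar. norm (f x + g x - H (proj L x))) \<le> (LINT x|haar. norm (f x - h (proj N x)) + norm (g x - h' (proj N' x)))"
    proof (rule integral_mono)
      show "norm (f x + g x - H (proj L x)) \<le> norm (f x - h (proj N x)) + norm (g x - h' (proj N' x))" for x
        using norm_triangle_ineq[of "f x - h (proj N x)" "g x - h' (proj N' x)"] by (simp add: H algebra_simps)
    qed (use i i3 in auto)
    also have "\<dots> \<le> \<delta>" using i h h' by simp
    finally show "\<exists>N h. (LINT x|haar. norm (f x + g x - h (proj N x))) \<le> \<delta>" by blast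
  qed
next
  case (lim f s)
  show ?case
  proof (intro allI impI)
    fix \<delta> :: real assume "0 < \<delta>"
    then have d: "0 < \<delta> / 2" by simp
    have "(\<lambda>i. LINT x|haar. norm (f x - s i x)) \<longlonglongrightarrow> (LINT x|haar. 0)"
    proof (rule integral_dominated_convergence)
      show "integrable haar (\<lambda>x. 3 * norm (f x))" using lim by auto
      show "AE x in haar. (\<lambda>i. norm (f x - s i x)) \<longlonglongrightarrow> 0"
      proof (rule AE_I2)
        fix x assume "x \<in> space haar"
        then have "(\<lambda>i. s i x) \<longlonglongrightarrow> f x" using lim by blast
        then have "(\<lambda>i. norm (f x - s i x)) \<longlonglongrightarrow> norm (f x - f x)" by (intro tendsto_intros)
        then show "(\<lambda>i. norm (f x - s i x)) \<longlonglongrightarrow> 0" by simp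
      qed
      show "AE x in haar. norm (norm (f x - s i x)) \<le> 3 * norm (f x)" for i
      proof (rule AE_I2)
        fix x assume "x \<in> space haar"
        then have "norm (s i x) \<le> 2 * norm (f x)" using lim by blast
        then show "norm (norm (f x - s i x)) \<le> 3 * norm (f x)"
          using norm_triangle_ineq4[of "f x" "s i x"] by simp
      qed
    qed (use lim in auto)
    then have "eventually (\<lambda>i. (LINT x|haar. norm (f x - s i x)) < \<delta> / 2) sequentially"
      using d by (intro order_tendstoD) auto
    then obtain i where i: "(LINT x|haar. norm (f x - s i x)) < \<delta> / 2" by (auto simp: eventually_sequentially)
    obtain N h where h: "(LINT x|haar. norm (s i x - h (proj N x))) \<le> \<delta> / 2" using lim.IH[of i] d by blast
    have ii: "integrable haar (\<lambda>x. f x - s i x)" "integrable haar (\<lambda>x. s i x - h (proj N x))" "integrable haar (\<lambda>x. f x - h (proj N x))"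
      using lim integral_cyl(2)[of h N] by auto
    have "(LINT x|haar. norm (f x - h (proj N x))) \<le> (LINT x|haar. norm (f x - s i x) + norm (s i x - h (proj N x)))"
    proof (rule integral_mono)
      show "norm (f x - h (proj N x)) \<le> norm (f x - s i x) + norm (s i x - h (proj N x))" for x
        using norm_triangle_ineq[of "f x - s i x" "s i x - h (proj N x)"] by simp
    qed (use ii in auto)
    also have "\<dots> \<le> \<delta>" using ii i h by simp
    finally show "\<exists>N h. (LINT x|haar. norm (f x - h (proj N x))) \<le> \<delta>" by blast
  qed
qed

text \<open>Composing the approximation with the nearest-point map onto the ball of radius
  \<open>B'\<close> fixes the values of \<open>f\<close>, does not increase distances, and provides
  the uniform bound that \<open>var_norm_le_L1\<close> asks for.\<close>

lemma cyl_dense_L1_bounded: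
  fixes f :: "(nat \<Rightarrow> nat) \<Rightarrow> complex"
  assumes f: "f \<in> borel_measurable haar" and B': "\<And>x. norm (f x) \<le> B'" and d: "0 < \<delta>"
  shows "\<exists>N h. (\<forall>y. norm (h y) \<le> B') \<and> (LINT x|haar. norm (f x - h (proj N x))) \<le> \<delta>"
proof -
  have fi: "integrable haar f" using f B' by (intro haar.integrable_const_bound[of _ B']) auto
  obtain N h where h: "(LINT x|haar. norm (f x - h (proj N x))) \<le> \<delta>" using cyl_dense_L1[OF fi] d by blast
  have B0: "0 \<le> B'" using norm_ge_zero[of "f undefined"] B'[of undefined] by linarith
  define P where "P = closest_point (cball (0::complex) B')"
  have Pn: "norm (P z) \<le> B'" for z
    using closest_point_in_set[of "cball (0::complex) B'" z] B0 by (simp add: P_def)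
  have Pf: "P (f x) = f x" for x unfolding P_def using B' by (intro closest_point_self) simp
  have le: "norm (f x - P (h (proj N x))) \<le> norm (f x - h (proj N x))" for x
    using closest_point_lipschitz[of "cball (0::complex) B'" "f x" "h (proj N x)"] B0 Pf[of x]
    by (simp add: P_def dist_norm)
  have "(LINT x|haar. norm (f x - (\<lambda>y. P (h y)) (proj N x))) \<le> (LINT x|haar. norm (f x - h (proj N x)))"
  proof (rule integral_mono)
    show "integrable haar (\<lambda>x. norm (f x - (\<lambda>y. P (h y)) (proj N x)))"
      by (intro integrable_norm Bochner_Integration.integrable_diff fi integral_cyl(2))
    show "integrable haar (\<lambda>x. norm (f x - h (proj N x)))"
      by (intro integrable_norm Bochner_Integration.integrable_diff fi integral_cyl(2))
  qed (rule le)
  also have "\<dots> \<le> \<delta>" by (rule h)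
  finally show ?thesis using Pn by (intro exI[of _ N] exI[of _ "\<lambda>y. P (h y)"] conjI allI)
qed

text \<open>At \<open>n = m N\<close> the Dirichlet kernel is a multiple of a point mass on the
  quotient. The coefficients from \<open>m N\<close> on vanish by energy: Parseval at the levels
  \<open>N\<close> and \<open>L\<close> gives the same value.\<close>

lemma partial_sum_cyl:
  assumes n: "m N \<le> n" and x: "x \<in> group"
  shows "vilenkin_partial_sum p n (\<lambda>x. h (proj N x)) x = h (proj N x)"
proof -
  let ?f = "\<lambda>x. h (proj N x)"
  have fi: "integrable haar ?f" by (rule integral_cyl)
  have cyl: "cyl_integral L (\<lambda>x. H (proj L x)) y = H y / m L" if y: "y \<in> X L" for L H y
  proof -
    have "cyl_integral L (\<lambda>x. H (proj L x)) y = (LINT x|haar. (1::complex) * (if proj L x = y then H y else 0))"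
      unfolding cyl_integral_def by (intro Bochner_Integration.integral_cong refl) (auto simp: pre_def space_haar)
    also have "\<dots> = (\<Sum>z\<in>X L. if z = y then H y else 0) /\<^sub>R m L"
      using integral_cyl(1)[of "\<lambda>z. if z = y then H y else 0" L] by simp
    also have "\<dots> = H y / m L" using y by (simp add: scaleR_conv_of_real divide_inverse mult.commute)
    finally show ?thesis .
  qed
  have base: "vilenkin_partial_sum p (m N) ?f x = h (proj N x)"
  proof -
    have D: "Dir (m N) (proj N x) y = (if y = proj N x then of_nat (m N) else 0)" if "y \<in> X N" for y
      using that proj_X[OF x, of N] Dir_full[of "proj N x" y "first_diff (proj N x) y" N] first_diff[of "proj N x" y]
        first_diff_less[of "proj N x" N y] X_group by (auto simp: Dir_self)
    have "vilenkin_partial_sum p (m N) ?f x = (\<Sum>y\<in>X N. if y = proj N x then h y else 0)"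
      unfolding partial_sum_eq[OF fi order_refl] by (intro sum.cong refl) (simp add: D cyl)
    then show ?thesis using proj_X[OF x] by simp
  qed
  define L where "L = max N n"
  have NL: "N \<le> L" "m N \<le> m L" using m_mono by (auto simp: L_def)
  have nL: "n \<le> m L" using n_less_m[of L] by (simp add: L_def)
  have pars: "(\<Sum>j<m L'. (norm (vilenkin_coeff p ?f j))\<^sup>2) = (LINT x|haar. (norm (?f x))\<^sup>2)" if L': "N \<le> L'" for L'
  proof -
    define H where "H y = h (proj N y)" for y
    have HL: "?f = (\<lambda>x. H (proj L' x))" using L' by (simp add: H_def proj_proj)
    have "(norm (vilenkin_coeff p ?f j))\<^sup>2 = (norm (\<Sum>y\<in>X L'. H y * cnj (\<psi> j y)))\<^sup>2 / (m L')\<^sup>2" if "j < m L'" for j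
    proof -
      have "vilenkin_coeff p ?f j = (\<Sum>y\<in>X L'. H y * cnj (\<psi> j y)) / m L'"
        unfolding coeff_eq[OF fi that] unfolding HL by (simp add: cyl sum_divide_distrib)
      then show ?thesis by (simp only: norm_divide power_divide norm_of_nat of_nat_power)
    qed
    then have "(\<Sum>j<m L'. (norm (vilenkin_coeff p ?f j))\<^sup>2) = (\<Sum>j<m L'. (norm (\<Sum>y\<in>X L'. H y * cnj (\<psi> j y)))\<^sup>2 / (m L')\<^sup>2)"
      by (intro sum.cong refl) (simp only: lessThan_iff)
    also have "\<dots> = (\<Sum>j<m L'. (norm (\<Sum>y\<in>X L'. H y * cnj (\<psi> j y)))\<^sup>2) / (m L')\<^sup>2"
      by (rule sum_divide_distrib[symmetric])
    also have "\<dots> = (\<Sum>y\<in>X L'. (norm (H y))\<^sup>2) / m L'" unfolding Parseval_X by (simp add: power2_eq_square)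
    also have "\<dots> = (LINT x|haar. (norm (?f x))\<^sup>2)"
      using integral_cyl(1)[of "\<lambda>y. (norm (H y))\<^sup>2" L'] by (simp add: fun_cong[OF HL] divide_inverse mult.commute)
    finally show ?thesis .
  qed
  have zero: "vilenkin_coeff p ?f j = 0" if j: "m N \<le> j" "j < m L" for j
  proof -
    have "(\<Sum>j<m L. (norm (vilenkin_coeff p ?f j))\<^sup>2) = (\<Sum>j<m N. (norm (vilenkin_coeff p ?f j))\<^sup>2) + (\<Sum>j\<in>{m N..<m L}. (norm (vilenkin_coeff p ?f j))\<^sup>2)"
      using NL(2) by (subst sum.union_disjoint[symmetric]) (auto intro!: sum.cong)
    then have "(\<Sum>j\<in>{m N..<m L}. (norm (vilenkin_coeff p ?f j))\<^sup>2) = 0" using pars[of N] pars[OF NL(1)] by simp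
    then show ?thesis using j by (subst (asm) sum_nonneg_eq_0_iff) auto
  qed
  have "vilenkin_partial_sum p n ?f x = vilenkin_partial_sum p (m N) ?f x"
    unfolding vilenkin_partial_sum_def using n nL zero by (intro sum.mono_neutral_right) auto
  then show ?thesis using base by simp
qed

lemma integrable_mult_psi: "integrable haar f \<Longrightarrow> integrable haar (\<lambda>x. f x * cnj (\<psi> j x))"
  using integral_mult_cyl(2)[of f "\<lambda>y. cnj (\<psi> j y)" j] unfolding psi_proj[OF n_less_m] .

lemma partial_sum_add:
  assumes "integrable haar f" "integrable haar g"
  shows "vilenkin_partial_sum p n (\<lambda>x. f x + g x) = (\<lambda>x. vilenkin_partial_sum p n f x + vilenkin_partial_sum p n g x)"
proof -
  have "vilenkin_coeff p (\<lambda>x. f x + g x) j = vilenkin_coeff p f j + vilenkin_coeff p g j" for j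
    unfolding vilenkin_coeff_def distrib_right using assms by (intro Bochner_Integration.integral_add integrable_mult_psi)
  then show ?thesis by (simp add: vilenkin_partial_sum_def fun_eq_iff distrib_right sum.distrib)
qed

end

section \<open>Boundedness against convergence, and the equivalences\<close>

context vilenkin_exponent
begin

text \<open>Coefficients are at most the \<open>L\<^sup>1\<close> norm, which gives a bound growing
  with \<open>n\<close>. Uniform boundedness needs this continuity of each single partial
  sum.\<close>

lemma partial_sum_crude_bound:
  assumes f: "f \<in> var_Lp haar a"
  shows "var_norm haar a (vilenkin_partial_sum p n f) \<le> ennreal (2 * real n + 1) * var_norm haar a f"
proof -
  interpret v: var_exponent haar a q by (rule var_exponent_a)
  have fin: "var_norm haar a f < \<infinity>" and fm: "f \<in> borel_measurable haar" using f by (simp_all add: v.var_Lp_iff)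
  show ?thesis
  proof (rule v.le_var_norm_of_less[OF _ _ fin])
    fix l assume l: "0 < l" and less: "var_norm haar a f < ennreal l"
    have fi: "integrable haar f" by (rule v.norm_less_integrable(1)[OF fm less])
    have "ennreal (LINT x|haar. norm (f x)) \<le> ennreal (2 * l)"
      using v.norm_less_integrable(2)[OF fm less] nn_integral_eq_integral[OF integrable_norm[OF fi]] by simp
    then have L1: "(LINT x|haar. norm (f x)) \<le> 2 * l" using l by (subst (asm) ennreal_le_iff) auto
    have "norm (vilenkin_coeff p f j) \<le> 2 * l" for j
    proof -
      have "norm (vilenkin_coeff p f j) \<le> (LINT x|haar. norm (f x * cnj (\<psi> j x)))"
        unfolding vilenkin_coeff_def by (rule integral_norm_bound)
      also have "\<dots> = (LINT x|haar. norm (f x))" by (simp add: norm_mult)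
      finally show ?thesis using L1 by simp
    qed
    then have "(\<Sum>j<n. norm (vilenkin_coeff p f j)) \<le> (\<Sum>j<n. 2 * l)" by (intro sum_mono)
    then have pw: "norm (vilenkin_partial_sum p n f x) \<le> (2 * real n + 1) * l" for x
      using norm_partial_sum_le[of n f x] l by (simp add: algebra_simps)
    show "var_norm haar a (vilenkin_partial_sum p n f) \<le> ennreal ((2 * real n + 1) * l)"
    proof (rule v.var_norm_le_bound)
      show "0 < (2 * real n + 1) * l" using l by (intro mult_pos_pos) auto
    qed (use pw in auto)
  qed simp
qed

text \<open>Truncate first: a bounded function and a cylinder function with the same bound are close
  in norm as soon as they are close in \<open>L\<^sup>1\<close>. \<open>\<delta>\<close> is the
  smallness that \<open>var_norm_le_L1\<close> demands.\<close>

lemma cyl_dense: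
  assumes f: "f \<in> var_Lp haar a" and e: "0 < \<epsilon>"
  shows "\<exists>N h. var_norm haar a (\<lambda>x. f x - h (proj N x)) \<le> ennreal \<epsilon>"
proof -
  interpret v: var_exponent haar a q by (rule var_exponent_a)
  have e2: "0 < \<epsilon> / 2" using e by simp
  have fm: "f \<in> borel_measurable haar" using f by (simp add: v.var_Lp_iff)
  obtain B' :: nat where B': "var_norm haar a (\<lambda>x. f x - (if norm (f x) \<le> B' then f x else 0)) \<le> ennreal (\<epsilon> / 2)"
    using v.truncation_dense[OF f e2] by blast
  define g where "g x = (if norm (f x) \<le> real B' then f x else 0)" for x
  have gm: "g \<in> borel_measurable haar" unfolding g_def using fm by measurable
  have gB: "norm (g x) \<le> real B'" for x by (simp add: g_def)
  define \<delta> where "\<delta> = (\<epsilon> / 2) / (max 1 (2 * real B' / (\<epsilon> / 2))) powr q"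
  have d: "0 < \<delta>" using e by (simp add: \<delta>_def)
  obtain N h where h: "\<forall>y. norm (h y) \<le> real B'" "(LINT x|haar. norm (g x - h (proj N x))) \<le> \<delta>"
    using cyl_dense_L1_bounded[OF gm gB d] by blast
  have hm: "(\<lambda>x. h (proj N x)) \<in> borel_measurable haar" by (rule measurable_cyl)
  have gi: "integrable haar g" using gm gB by (intro haar.integrable_const_bound[of _ "real B'"]) auto
  have "var_norm haar a (\<lambda>x. g x - h (proj N x)) \<le> ennreal (\<epsilon> / 2)"
  proof (rule v.var_norm_le_L1[OF _ _ e2])
    show "(\<lambda>x. g x - h (proj N x)) \<in> borel_measurable haar" using gm hm by measurable
    show "norm (g x - h (proj N x)) \<le> 2 * real B'" for x
      using norm_triangle_ineq4[of "g x" "h (proj N x)"] gB[of x] h(1)[rule_format, of "proj N x"] by linarith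
    have "integrable haar (\<lambda>x. norm (g x - h (proj N x)))"
      by (intro integrable_norm Bochner_Integration.integrable_diff gi integral_cyl(2))
    then show "(\<integral>\<^sup>+x. ennreal (norm (g x - h (proj N x))) \<partial>haar) \<le> ennreal ((\<epsilon> / 2) / (max 1 (2 * real B' / (\<epsilon> / 2))) powr q)"
      unfolding \<delta>_def[symmetric] using h(2) by (subst nn_integral_eq_integral) (auto intro: ennreal_leI)
  qed
  then have "var_norm haar a (\<lambda>x. (f x - g x) + (g x - h (proj N x))) \<le> ennreal (\<epsilon> / 2) + ennreal (\<epsilon> / 2)"
    using B' fm gm hm by (intro order_trans[OF v.var_norm_triangle] add_mono) (auto simp: g_def)
  also have "\<dots> = ennreal \<epsilon>" using e by (simp flip: ennreal_plus)
  finally show ?thesis by (intro exI[of _ N] exI[of _ h]) simp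
qed

text \<open>From \<open>m N\<close> on, the cylinder approximation is reproduced exactly, so at most
  \<open>C + 1\<close> times the approximation error remains.\<close>

lemma converges_of_bounded:
  assumes C: "0 \<le> C" and bdd: "\<And>n f. f \<in> var_Lp haar a \<Longrightarrow> var_norm haar a (vilenkin_partial_sum p n f) \<le> ennreal C * var_norm haar a f"
    and f: "f \<in> var_Lp haar a"
  shows "(\<lambda>n. var_norm haar a (\<lambda>x. vilenkin_partial_sum p n f x - f x)) \<longlonglongrightarrow> 0"
proof (rule order_tendstoI)
  interpret v: var_exponent haar a q by (rule var_exponent_a)
  fix u :: ennreal assume "0 < u"
  then obtain e' where e': "0 < e'" "e' < u" using dense by blast
  then obtain e where e: "e' = ennreal e" "0 < e" by (cases e') auto
  define \<epsilon> where "\<epsilon> = e / (C + 1)"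
  have \<epsilon>: "0 < \<epsilon>" using e C by (simp add: \<epsilon>_def)
  obtain N h where h: "var_norm haar a (\<lambda>x. f x - h (proj N x)) \<le> ennreal \<epsilon>" using cyl_dense[OF f \<epsilon>] by blast
  define d where "d x = f x - h (proj N x)" for x
  have fm: "f \<in> borel_measurable haar" using f by (simp add: v.var_Lp_iff)
  have hm: "(\<lambda>x. h (proj N x)) \<in> borel_measurable haar" by (rule measurable_cyl)
  have dm: "d \<in> borel_measurable haar" unfolding d_def using fm hm by measurable
  have dn: "var_norm haar a d \<le> ennreal \<epsilon>" using h unfolding d_def .
  then have dL: "d \<in> var_Lp haar a" using dm by (auto simp: v.var_Lp_iff intro: le_less_trans)
  have "var_norm haar a (\<lambda>x. vilenkin_partial_sum p n f x - f x) \<le> e'" if n: "m N \<le> n" for n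
  proof -
    have "vilenkin_partial_sum p n f = (\<lambda>x. vilenkin_partial_sum p n d x + vilenkin_partial_sum p n (\<lambda>x. h (proj N x)) x)"
      using partial_sum_add[OF v.var_Lp_integrable[OF dL] integral_cyl(2)[of h N], of n] by (simp add: d_def)
    then have eq: "vilenkin_partial_sum p n f x - f x = vilenkin_partial_sum p n d x + - d x" if "x \<in> space haar" for x
      using partial_sum_cyl[OF n, of x h] that by (simp add: space_haar d_def)
    have "var_norm haar a (\<lambda>x. vilenkin_partial_sum p n f x - f x) \<le> var_norm haar a (\<lambda>x. vilenkin_partial_sum p n d x + - d x)"
      by (intro v.var_norm_mono AE_I2) (simp only: eq order_refl)
    also have "\<dots> \<le> var_norm haar a (vilenkin_partial_sum p n d) + var_norm haar a (\<lambda>x. - d x)"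
      using dm by (intro v.var_norm_triangle measurable_partial_sum) auto
    also have "\<dots> \<le> ennreal C * ennreal \<epsilon> + ennreal \<epsilon>"
      unfolding v.var_norm_uminus using dn by (intro add_mono order_trans[OF bdd[OF dL]] mult_left_mono) auto
    also have "\<dots> = ennreal (C * \<epsilon> + \<epsilon>)" using C \<epsilon> by (simp flip: ennreal_mult ennreal_plus)
    also have "C * \<epsilon> + \<epsilon> = (C + 1) * \<epsilon>" by (simp add: distrib_right)
    also have "\<dots> = e" using C by (simp add: \<epsilon>_def)
    finally show ?thesis by (simp add: e)
  qed
  then have "var_norm haar a (\<lambda>x. vilenkin_partial_sum p n f x - f x) < u" if "m N \<le> n" for n
    using that e'(2) le_less_trans by blast
  then show "\<forall>\<^sub>F n in sequentially. var_norm haar a (\<lambda>x. vilenkin_partial_sum p n f x - f x) < u"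
    unfolding eventually_sequentially by blast
qed simp

text \<open>Convergence bounds all but finitely many partial sums of a given \<open>f\<close>, and
  the crude bound the others; this is the hypothesis \<open>pointwise\<close> of
  \<open>uniform_boundedness\<close>.\<close>

lemma bounded_of_converges:
  assumes conv: "\<And>f. f \<in> var_Lp haar a \<Longrightarrow> (\<lambda>n. var_norm haar a (\<lambda>x. vilenkin_partial_sum p n f x - f x)) \<longlonglongrightarrow> 0"
  shows "\<exists>C::real. \<forall>f\<in>var_Lp haar a. \<forall>n. var_norm haar a (vilenkin_partial_sum p n f) \<le> ennreal C * var_norm haar a f"
proof -
  interpret v: var_exponent haar a q by (rule var_exponent_a)
  show ?thesis
  proof (rule v.uniform_boundedness[where k="\<lambda>n. 2 * real n + 1"])
    fix f assume f: "f \<in> var_Lp haar a"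
    then have fm: "f \<in> borel_measurable haar" and "var_norm haar a f < \<infinity>" by (simp_all add: v.var_Lp_iff)
    then obtain F where F: "var_norm haar a f = ennreal F" "0 \<le> F" by (cases "var_norm haar a f") auto
    obtain n0 where n0: "\<And>n. n0 \<le> n \<Longrightarrow> var_norm haar a (\<lambda>x. vilenkin_partial_sum p n f x - f x) < 1"
      using order_tendstoD(2)[OF conv[OF f], of 1] by (auto simp: eventually_sequentially)
    have "var_norm haar a (vilenkin_partial_sum p n f) \<le> ennreal (1 + (2 * real n0 + 1) * F)" for n
    proof (cases "n0 \<le> n")
      case True
      have "var_norm haar a (\<lambda>x. (vilenkin_partial_sum p n f x - f x) + f x) \<le> var_norm haar a (\<lambda>x. vilenkin_partial_sum p n f x - f x) + var_norm haar a f"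
        using fm measurable_partial_sum[of n f] by (intro v.var_norm_triangle) auto
      also have "\<dots> \<le> 1 + ennreal F" using n0[OF True] F by (intro add_mono) auto
      also have "\<dots> = ennreal (1 + F)" using F by simp
      also have "\<dots> \<le> ennreal (1 + (2 * real n0 + 1) * F)"
        using F(2) by (intro ennreal_leI) (simp add: distrib_right)
      finally show ?thesis by simp
    next
      case False
      have "var_norm haar a (vilenkin_partial_sum p n f) \<le> ennreal (2 * real n + 1) * ennreal F"
        using partial_sum_crude_bound[OF f, of n] F by simp
      also have "\<dots> = ennreal ((2 * real n + 1) * F)" using F by (simp add: ennreal_mult)
      also have "\<dots> \<le> ennreal (1 + (2 * real n0 + 1) * F)"
      proof (rule ennreal_leI)
        have "(2 * real n + 1) * F \<le> (2 * real n0 + 1) * F" using False F by (intro mult_right_mono) auto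
        then show "(2 * real n + 1) * F \<le> 1 + (2 * real n0 + 1) * F" by simp
      qed
      finally show ?thesis .
    qed
    then show "\<exists>B'::real. \<forall>n. var_norm haar a (vilenkin_partial_sum p n f) \<le> ennreal B'" by blast
  next
    show "var_norm haar a (vilenkin_partial_sum p n f) \<le> ennreal (2 * real n + 1) * var_norm haar a f"
      if "f \<in> var_Lp haar a" for n f using that by (rule partial_sum_crude_bound)
  qed (auto intro: measurable_partial_sum simp: partial_sum_scale partial_sum_add v.var_Lp_integrable)
qed

lemma class_A_condition_iff:
  assumes I: "I \<in> sets haar" "0 < measure haar I"
  shows "1 / emeasure haar I * var_norm haar a (indicator I) * var_norm haar b (indicator I) \<le> ennreal C \<longleftrightarrow>
    var_norm haar a (indicator I) * var_norm haar b (indicator I) \<le> ennreal (C * measure haar I)"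
    (is "1 / ?e * ?u * ?v \<le> _ \<longleftrightarrow> _")
proof -
  let ?\<mu> = "measure haar I"
  have e: "?e = ennreal ?\<mu>" by (rule haar.emeasure_eq_measure)
  have inv: "1 / ?e = ennreal (1 / ?\<mu>)"
    unfolding e using divide_ennreal[of 1 ?\<mu>] I by simp
  have one: "ennreal ?\<mu> * ennreal (1 / ?\<mu>) = 1" "ennreal (1 / ?\<mu>) * ennreal ?\<mu> = 1"
    using I by (simp_all flip: ennreal_mult)
  show ?thesis
  proof
    assume "1 / ?e * ?u * ?v \<le> ennreal C"
    then have "ennreal ?\<mu> * (ennreal (1 / ?\<mu>) * (?u * ?v)) \<le> ennreal ?\<mu> * ennreal C"
      unfolding inv by (intro mult_left_mono) (simp_all add: mult.assoc)
    then show "?u * ?v \<le> ennreal (C * ?\<mu>)"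
      unfolding mult.assoc[symmetric] one by (simp add: ennreal_mult'' mult.commute)
  next
    assume "?u * ?v \<le> ennreal (C * ?\<mu>)"
    then have "ennreal (1 / ?\<mu>) * (?u * ?v) \<le> ennreal (1 / ?\<mu>) * (ennreal ?\<mu> * ennreal C)"
      by (intro mult_left_mono) (simp_all add: ennreal_mult'' mult.commute)
    then show "1 / ?e * ?u * ?v \<le> ennreal C" unfolding inv mult.assoc[symmetric] one by simp
  qed
qed

definition norm_condition :: "real \<Rightarrow> bool" where
  "norm_condition C \<longleftrightarrow> (\<forall>I\<in>gen_intervals p.
     1 / emeasure haar I * var_norm haar a (indicator I) * var_norm haar b (indicator I) \<le> ennreal C)"

definition partial_sums_bounded :: "real \<Rightarrow> bool" where
  "partial_sums_bounded C \<longleftrightarrow> (\<forall>f\<in>var_Lp haar a. \<forall>n.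
     var_norm haar a (vilenkin_partial_sum p n f) \<le> ennreal C * var_norm haar a f)"

lemma bounded_of_norm_condition:
  assumes "norm_condition C"
  shows "\<exists>C'. partial_sums_bounded C'"
proof -
  define C1 where "C1 = max 1 C"
  have "1 powr q \<le> (4 * C1) powr q" using q_gt_1 by (intro powr_mono2) (auto simp: C1_def)
  then have C2: "1 \<le> (4 * C1) powr q" by simp
  have "balanced ((4 * C1) powr q) I" if I: "I \<in> gen_intervals p" for I
  proof (rule balanced_of_norms)
    note mem = gen_interval_mem[OF I]
    show "I \<in> sets haar" "0 < measure haar I" by (rule mem)+
    have "var_norm haar a (indicator I) * var_norm haar b (indicator I) \<le> ennreal (C * measure haar I)"
      using assms I class_A_condition_iff[OF mem] unfolding norm_condition_def by blast
    also have "\<dots> \<le> ennreal (C1 * measure haar I)"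
      by (intro ennreal_leI mult_right_mono) (auto simp: C1_def)
    finally show "var_norm haar a (indicator I) * var_norm haar b (indicator I) \<le> ennreal (C1 * measure haar I)" .
  qed (simp add: C1_def)
  then show ?thesis unfolding partial_sums_bounded_def using partial_sum_bounded[OF C2] by blast
qed

text \<open>\<open>ennreal\<close> sends a negative \<open>C\<close> to 0, so \<open>max 0 C\<close>
  gives the same bound.\<close>

lemma nonneg_bound:
  assumes "partial_sums_bounded C"
  shows "f \<in> var_Lp haar a \<Longrightarrow> var_norm haar a (vilenkin_partial_sum p n f) \<le> ennreal (max 0 C) * var_norm haar a f"
  using assms unfolding partial_sums_bounded_def by (metis ennreal_neg max.absorb1 max.absorb2 ennreal_0 linear)

lemma norm_condition_of_bounded:
  assumes "partial_sums_bounded C"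
  shows "\<exists>C'. norm_condition C'"
proof -
  have "norm_condition (2 * (24 * max 0 C) * 4 powr q)"
    unfolding norm_condition_def
  proof
    fix I assume I: "I \<in> gen_intervals p"
    show "1 / emeasure haar I * var_norm haar a (indicator I) * var_norm haar b (indicator I) \<le> ennreal (2 * (24 * max 0 C) * 4 powr q)"
      unfolding class_A_condition_iff[OF gen_interval_mem[OF I]]
      by (rule norm_product_le_of_bounded[OF _ nonneg_bound[OF assms] I]) simp_all
  qed
  then show ?thesis by blast
qed

theorem equivalences:
  "(\<exists>C. norm_condition C) \<longleftrightarrow> (\<exists>C. partial_sums_bounded C)"
  "(\<exists>C. norm_condition C) \<longleftrightarrow> (\<forall>f\<in>var_Lp haar a.
     (\<lambda>n. var_norm haar a (\<lambda>x. vilenkin_partial_sum p n f x - f x)) \<longlonglongrightarrow> 0)"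
proof -
  show 1: "(\<exists>C. norm_condition C) \<longleftrightarrow> (\<exists>C. partial_sums_bounded C)"
    using bounded_of_norm_condition norm_condition_of_bounded by blast
  show "(\<exists>C. norm_condition C) \<longleftrightarrow> (\<forall>f\<in>var_Lp haar a.
     (\<lambda>n. var_norm haar a (\<lambda>x. vilenkin_partial_sum p n f x - f x)) \<longlonglongrightarrow> 0)"
    unfolding 1
  proof
    assume "\<exists>C. partial_sums_bounded C"
    then obtain C where C: "partial_sums_bounded C" ..
    show "\<forall>f\<in>var_Lp haar a. (\<lambda>n. var_norm haar a (\<lambda>x. vilenkin_partial_sum p n f x - f x)) \<longlonglongrightarrow> 0"
      by (intro ballI converges_of_bounded[OF _ nonneg_bound[OF C]]) simp_all
  next
    assume "\<forall>f\<in>var_Lp haar a. (\<lambda>n. var_norm haar a (\<lambda>x. vilenkin_partial_sum p n f x - f x)) \<longlonglongrightarrow> 0"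
    then show "\<exists>C. partial_sums_bounded C" unfolding partial_sums_bounded_def by (intro bounded_of_converges) blast
  qed
qed

end

theorem theorem1p10:
  fixes p :: "nat \<Rightarrow> nat" and r :: "(nat \<Rightarrow> nat) \<Rightarrow> real"
  assumes "\<And>i. p i \<ge> 2"
    and "r \<in> borel_measurable (vilenkin_measure p)"
    and "\<And>x. x \<in> vilenkin_group p \<Longrightarrow> r x \<ge> 1"
    and "1 < exponent_inf (vilenkin_measure p) r"
    and "exponent_sup (vilenkin_measure p) r < \<infinity>"
  shows
    "(class_A p r \<longleftrightarrow>
       (\<exists>C::real. \<forall>f\<in>var_Lp (vilenkin_measure p) r.
          (SUP n. var_norm (vilenkin_measure p) r (vilenkin_partial_sum p n f))
            \<le> ennreal C * var_norm (vilenkin_measure p) r f))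
     \<and>
     (class_A p r \<longleftrightarrow>
       (\<forall>f\<in>var_Lp (vilenkin_measure p) r.
          (\<lambda>n. var_norm (vilenkin_measure p) r (\<lambda>x. vilenkin_partial_sum p n f x - f x))
            \<longlonglongrightarrow> 0))"
proof -
  let ?M = "vilenkin_measure p"
  obtain \<alpha> where \<alpha>': "1 < ereal \<alpha>" "ereal \<alpha> < exponent_inf ?M r"
    using ereal_dense2[OF assms(4)] by blast
  then have \<alpha>: "1 < \<alpha>" "ereal \<alpha> < exponent_inf ?M r" by (simp_all add: one_ereal_def)
  obtain \<beta> :: real where \<beta>: "exponent_sup ?M r \<le> ereal \<beta>"
    using assms(5) by (cases "exponent_sup ?M r") auto
  have AE_\<alpha>: "AE x in ?M. \<alpha> \<le> r x"
  proof -
    from esssup_AE[of "\<lambda>x. - ereal (r x)" ?M] show ?thesis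
    proof eventually_elim
      case (elim x)
      have "esssup ?M (\<lambda>x. - ereal (r x)) < - ereal \<alpha>"
        using \<alpha>(2) unfolding exponent_inf_def by (simp only: ereal_less_uminus_reorder)
      with elim have "- ereal (r x) < - ereal \<alpha>" by (rule le_less_trans)
      then show ?case by simp
    qed
  qed
  have AE_\<beta>: "AE x in ?M. r x \<le> \<beta>"
    using esssup_AE[of "\<lambda>x. ereal (r x)" ?M]
  proof eventually_elim
    case (elim x)
    then have "ereal (r x) \<le> ereal \<beta>" using \<beta> unfolding exponent_sup_def by (rule order_trans)
    then show ?case by simp
  qed
  \<comment> \<open>Truncation to the interval from \<open>\<alpha>\<close> to
    \<open>max \<alpha> \<beta>\<close> gives an exponent that has the bounds at every point and
    equals \<open>r\<close> almost everywhere, hence has the same modulars and norms. The maximum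
    makes the interval nonempty without comparing \<open>\<alpha>\<close> and
    \<open>\<beta>\<close>.\<close>
  define a where "a x = max \<alpha> (min (max \<alpha> \<beta>) (r x))" for x
  define b where "b x = a x / (a x - 1)" for x
  define q where "q = max (max \<alpha> \<beta>) (\<alpha> / (\<alpha> - 1))"
  have a: "\<alpha> \<le> a x" "1 < a x" "a x \<le> max \<alpha> \<beta>" for x using \<alpha>(1) by (auto simp: a_def)
  have b: "b x = 1 + 1 / (a x - 1)" for x using a(2)[of x] by (simp add: b_def field_simps)
  have am: "a \<in> borel_measurable ?M" unfolding a_def using assms(2) by measurable
  interpret vilenkin_exponent p a b q
  proof (intro vilenkin_exponent.intro exponent_pair.intro exponent_pair_axioms.intro)
    show "vilenkin p" by standard (rule assms(1))
    show "prob_space ?M" by (rule prob_space_vilenkin_measure, rule assms(1))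
    show "a \<in> borel_measurable ?M" by (rule am)
    show "b \<in> borel_measurable ?M" unfolding b_def using am by measurable
    show "1 < a x" for x by (rule a)
    show "a x \<le> q" for x using a(3)[of x] by (simp add: q_def)
    show "1 < b x" for x unfolding b using a(2)[of x] by simp
    show "b x \<le> q" for x
    proof -
      have "b x \<le> 1 + 1 / (\<alpha> - 1)" unfolding b using a(1)[of x] \<alpha>(1) by (intro add_left_mono divide_left_mono) auto
      also have "\<dots> = \<alpha> / (\<alpha> - 1)" using \<alpha>(1) by (simp add: field_simps)
      finally show ?thesis by (simp add: q_def)
    qed
    show "1 / a x + 1 / b x = 1" for x using a(2)[of x] by (simp add: b_def field_simps)
  qed
  have ra: "AE x in ?M. r x = a x" using AE_\<alpha> AE_\<beta> by eventually_elim (auto simp: a_def)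
  have rb: "AE x in ?M. conj_exponent r x = b x" using ra by eventually_elim (simp add: conj_exponent_def b_def)
  note cong = var_norm_cong_AE[OF ra] var_norm_cong_AE[OF rb] var_Lp_cong_AE[OF ra]
  have "class_A p r \<longleftrightarrow> (\<exists>C. norm_condition C)"
    unfolding class_A_def norm_condition_def cong ..
  moreover have "(\<exists>C::real. \<forall>f\<in>var_Lp ?M r. (SUP n. var_norm ?M r (vilenkin_partial_sum p n f)) \<le> ennreal C * var_norm ?M r f)
      \<longleftrightarrow> (\<exists>C. partial_sums_bounded C)"
    unfolding partial_sums_bounded_def cong SUP_le_iff by simp
  ultimately show ?thesis using equivalences unfolding cong by simp
qed

end
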